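(* Let $(\beta,h)\in(0,\infty)\times\mathbb{R}$, and suppose there exist $2\le K\in\mathbb{N}$ and $k_1>0$ such that $\mathbb{P}\bigl[\liminf_{N\to\infty}\widetilde{\Omega}_{\mathrm{meta}}(N)\bigr]=1$. Let the index $i\in\{2,\dots,K\}$ satisfy the non-degeneracy condition (with some $k_2\in(0,\infty)$), and let $\mathcal{A}_N,\mathcal{B}_N$ be the associated sets, all as defined in the context. Set $$\alpha_N:=\frac{\beta^2}{2N^2}\sum_{1\le i<j\le N}\mathrm{Var}_{\mathcal{G}}[J_{ij}].$$ (i) For $t\in\mathbb{N}_0$, $\mathbb{P}$-a.s., $$\lim_{N\to\infty}\mathbb{P}_{\mathcal{G}}\Biggl[e^{-t-\alpha_N}\le\frac{\mathrm{E}^N_{\nu_{\mathcal{A}_N,\mathcal{B}_N}}[\tau^N_{\mathcal{B}_N}]}{\widetilde{\mathrm{E}}^N_{\tilde\nu_{\mathcal{A}_N,\mathcal{B}_N}}[\tilde\tau^N_{\mathcal{B}_N}]}\le e^{t+2\alpha_N}\Biggr]\ge1-4\,e^{-t^2/(2\beta k_J)^2}.$$ (ii) For any $q\ge1$ and $c\in(0,\infty)$ let $$\Omega_{q,c}(N):=\Biggl\{\omega:\ e^{-\alpha_N}\Bigl(1-\tfrac{c}{\sqrt N}\Bigr)\le\frac{\mathbb{E}_{\mathcal{G}}\Bigl[\mathrm{E}^N_{\nu_{\mathcal{A}_N,\mathcal{B}_N}}[\tau^N_{\mathcal{B}_N}]^q\Bigr]^{1/q}(\omega)}{\widetilde{\mathrm{E}}^N_{\tilde\nu_{\mathcal{A}_N,\mathcal{B}_N}}[\tilde\tau^N_{\mathcal{B}_N}](\omega)}\le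 e^{4q\alpha_N}\Bigl(1+\tfrac{c}{\sqrt N}\Bigr)\Biggr\}.$$ Then for any $q\ge1$ there exists $c_1\in(0,\infty)$ such that $$\mathbb{P}\Bigl[\liminf_{N\to\infty}\Omega_{q,c_1}(N)\Bigr]=1.$$
   Context: Setting. Let $(\Omega,\mathcal{F},\mathbb{P})$ be a probability space, $\mathcal{G}\subset\mathcal{F}$ a sub-$\sigma$-algebra, and $J=(J_{ij})_{1\le i<j<\infty}$ a triangular array of real random variables that are conditionally independent given $\mathcal{G}$ and uniformly bounded: there is $k_J\in(0,\infty)$ with $|J_{ij}|\le k_J$ $\mathbb{P}$-a.s. for all $i<j$. $\mathbb{P}_{\mathcal{G}}$ is a regular conditional distribution of $J$ given $\mathcal{G}$, with expectation $\mathbb{E}_{\mathcal{G}}$ and variance $\mathrm{Var}_{\mathcal{G}}$. Quenched model. For $2\le N\in\mathbb{N}$, $\mathcal{S}_N:=\{-1,1\}^N$, $\beta\in(0,\infty)$, $h\in\mathbb{R}$, $$H_N(\sigma):=-\frac1N\sum_{1\le i<j\le N}J_{ij}\sigma_i\sigma_j-h\sum_{i=1}^N\sigma_i,\qquad \mu_N(\sigma):=Z_N^{-1}e^{-\beta H_N(\sigma)},$$ with $Z_N$ the normalizing constant. $(\Sigma_N(t))_{t\in\mathbb{N}_0}$ is the discrete-time Markov chain on $\mathcal{S}_N$ with transition probabilities $p_N(\sigma,\sigma')=\frac1N\exp(-\beta[H_N(\sigma')-H_N(\sigma)]_+)$ if $\sigma\sim\sigma'$ (i.e. $\sigma'$ is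 obtained from $\sigma$ by flipping one spin), $p_N(\sigma,\sigma)=1-\sum_{\eta\ne\sigma}p_N(\sigma,\eta)$, and $0$ otherwise; it is reversible w.r.t. $\mu_N$. $\mathrm{P}^N_\nu,\mathrm{E}^N_\nu$ are its law and expectation with initial distribution $\nu$ ($\mathrm{P}^N_\sigma$ if $\nu=\delta_\sigma$), and $\tau^N_{\mathcal{A}}:=\inf\{t\in\mathbb{N}:\Sigma_N(t)\in\mathcal{A}\}$ (with $t\ge1$) is the first return time to $\mathcal{A}$. For non-empty disjoint $\mathcal{A},\mathcal{B}\subset\mathcal{S}_N$, the last-exit biased distribution on $\mathcal{A}$ is $$\nu_{\mathcal{A},\mathcal{B}}(\sigma)=\frac{\mu_N(\sigma)\mathrm{P}^N_\sigma[\tau^N_{\mathcal{B}}<\tau^N_{\mathcal{A}}]}{\sum_{\sigma'\in\mathcal{A}}\mu_N(\sigma')\mathrm{P}^N_{\sigma'}[\tau^N_{\mathcal{B}}<\tau^N_{\mathcal{A}}]},\qquad\sigma\in\mathcal{A}.$$ Annealed model. $\widetilde H_N(\sigma):=\mathbb{E}_{\mathcal{G}}[H_N(\sigma)]$, i.e. $J_{ij}$ is replaced by $\mathbb{E}_{\mathcal{G}}[J_{ij}]$. $\tilde\mu_N(\sigma):=\widetilde Z_N^{-1}e^{-\beta\widetilde H_N(\sigma)}$ with $\widetilde Z_N$ the normalizing constant. $(\widetilde\Sigma_N(t))_{t\in\mathbb{N}_0}$ is the discrete-time Markov chain on $\mathcal{S}_N$ with transition probabilities $\tilde p_N(\sigma,\sigma')=\frac1N\exp(-\beta[\widetilde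 H_N(\sigma')-\widetilde H_N(\sigma)]_+)$ if $\sigma\sim\sigma'$, $\tilde p_N(\sigma,\sigma)=1-\sum_{\eta\ne\sigma}\tilde p_N(\sigma,\eta)$, and $0$ otherwise; it is reversible w.r.t. $\tilde\mu_N$. $\widetilde{\mathrm{P}}^N_\nu,\widetilde{\mathrm{E}}^N_\nu$ are its law and expectation with initial distribution $\nu$ ($\widetilde{\mathrm{P}}^N_\sigma$ if $\nu=\delta_\sigma$), and $\tilde\tau^N_{\mathcal{A}}:=\inf\{t\in\mathbb{N}:\widetilde\Sigma_N(t)\in\mathcal{A}\}$ (with $t\ge1$) is its first return time to $\mathcal{A}$. For non-empty disjoint $\mathcal{A},\mathcal{B}\subset\mathcal{S}_N$, the annealed last-exit biased distribution on $\mathcal{A}$ is $$\tilde\nu_{\mathcal{A},\mathcal{B}}(\sigma)=\frac{\tilde\mu_N(\sigma)\widetilde{\mathrm{P}}^N_\sigma[\tilde\tau^N_{\mathcal{B}}<\tilde\tau^N_{\mathcal{A}}]}{\sum_{\sigma'\in\mathcal{A}}\tilde\mu_N(\sigma')\widetilde{\mathrm{P}}^N_{\sigma'}[\tilde\tau^N_{\mathcal{B}}<\tilde\tau^N_{\mathcal{A}}]},\qquad\sigma\in\mathcal{A}.$$ Metastability. For $\rho_N>0$ and mutually disjoint $\mathcal{M}_{1,N},\dots,\mathcal{M}_{K,N}\subset\mathcal{S}_N$, $\mathcal{M}_N:=\bigcup_{\ell=1}^K\mathcal{M}_{\ell,N}$, the chain $(\Sigma_N(t))$ is $\rho_N$-metastable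 w.r.t. $\{\mathcal{M}_{1,N},\dots,\mathcal{M}_{K,N}\}$ when $$K\,\frac{\max_{j}\mathrm{P}^N_{\mu_N|\mathcal{M}_{j,N}}\bigl[\tau^N_{\mathcal{M}_N\setminus\mathcal{M}_{j,N}}<\tau^N_{\mathcal{M}_{j,N}}\bigr]}{\min_{\mathcal{X}\subset\mathcal{S}_N\setminus\mathcal{M}_N}\mathrm{P}^N_{\mu_N|\mathcal{X}}\bigl[\tau^N_{\mathcal{M}_N}<\tau^N_{\mathcal{X}}\bigr]}\le\rho_N\ll1,$$ where the minimum is over non-empty $\mathcal{X}$ and $\mu_N|\mathcal{X}$ is $\mu_N$ conditioned on $\mathcal{X}$; for the annealed chain use $\tilde\mu_N,\widetilde{\mathrm{P}}^N$. $\widetilde{\Omega}_{\mathrm{meta}}(N)$ (depending on $K,k_1$) is the event that the annealed chain is $e^{-k_1N}$-metastable w.r.t. some non-empty mutually disjoint sets $\{\mathcal{M}_{1,N},\dots,\mathcal{M}_{K,N}\}(\omega)$; on this event such sets are fixed, labelled so that $\tilde\mu_N[\mathcal{M}_{1,N}]\ge\dots\ge\tilde\mu_N[\mathcal{M}_{K,N}]$. The event and the sets are $\mathcal{G}$-measurable. $\liminf_NE_N=\bigcup_n\bigcap_{N\ge n}E_N$ for events $E_N$. Metastable partition. On $\widetilde{\Omega}_{\mathrm{meta}}(N)$, $\{\mathcal{S}_{1,N},\dots,\mathcal{S}_{K,N}\}$ is a ($\mathcal{G}$-measurable) partition of $\mathcal{S}_N$ with $\mathcal{M}_{\ell,N}\subseteq\mathcal{S}_{\ell,N}\subset\mathcal{V}_{\ell,N}$,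 where the local valley is $$\mathcal{V}_{\ell,N}:=\mathcal{M}_{\ell,N}\cup\Bigl\{\sigma\in\mathcal{M}_N^c:\widetilde{\mathrm{P}}^N_\sigma\bigl[\tilde\tau^N_{\mathcal{M}_{\ell,N}}<\tilde\tau^N_{\mathcal{M}_N\setminus\mathcal{M}_{\ell,N}}\bigr]\ge\max_{j\ne\ell}\widetilde{\mathrm{P}}^N_\sigma\bigl[\tilde\tau^N_{\mathcal{M}_{j,N}}<\tilde\tau^N_{\mathcal{M}_N\setminus\mathcal{M}_{j,N}}\bigr]\Bigr\}.$$ Non-degeneracy and the sets $\mathcal{A}_N,\mathcal{B}_N$. Fix $i\in\{2,\dots,K\}$ such that there is $k_2\in(0,\infty)$ with, $\mathbb{P}$-a.s. (on $\widetilde{\Omega}_{\mathrm{meta}}(N)$), $\tilde\mu_N[\mathcal{S}_{j,N}]\le e^{-k_2N}\tilde\mu_N[\mathcal{S}_{i,N}]$ for all $j\in\{i+1,\dots,K\}$ and all $N$ (void if $i=K$). On $\widetilde{\Omega}_{\mathrm{meta}}(N)$ set $\mathcal{A}_N:=\mathcal{M}_{i,N}$ and $\mathcal{B}_N:=\bigcup_{j=1}^{i-1}\mathcal{M}_{j,N}$. These quantities are defined only on $\widetilde{\Omega}_{\mathrm{meta}}(N)$, which under the hypothesis occurs $\mathbb{P}$-a.s. for all sufficiently large $N$.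
   Formalization: In (i) the limit as N tends to infinity need not exist (the conditional variances, hence alpha_N, may oscillate in N); the lower bound is stated and proved for the liminf, which equals the limit whenever the limit exists. *)

theory Defs
  imports "HOL-Probability.Probability"
begin

section \<open>Finite-state Markov chains in discrete time\<close>

text \<open>
  The law of the chain on a finite state space \<open>S\<close> with initial distribution \<open>\<nu>\<close> and transition
  probabilities \<open>p\<close>, as a measure on the path space \<open>S\<^sup>\<nat>\<close>, is the Ionescu-Tulcea limit of the
  kernels below; \<open>markov_law_cylinder\<close> gives its finite-dimensional distributions.
\<close>

definition markov_kernel ::
    "'s set \<Rightarrow> ('s \<Rightarrow> 's \<Rightarrow> real) \<Rightarrow> ('s \<Rightarrow> real) \<Rightarrow> nat \<Rightarrow> (nat \<Rightarrow> 's) \<Rightarrow> 's measure" where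
  "markov_kernel S p \<nu> n w =
     point_measure S (\<lambda>s. ennreal (if n = 0 then \<nu> s else p (w (n - 1)) s))"

definition markov_law ::
    "'s set \<Rightarrow> ('s \<Rightarrow> 's \<Rightarrow> real) \<Rightarrow> ('s \<Rightarrow> real) \<Rightarrow> (nat \<Rightarrow> 's) measure" where
  "markov_law S p \<nu> =
     projective_family.lim UNIV
       (Ionescu_Tulcea.CI (markov_kernel S p \<nu>) (\<lambda>_. count_space S)) (\<lambda>_. count_space S)"

locale finite_markov_chain =
  fixes S :: "'s set" and p :: "'s \<Rightarrow> 's \<Rightarrow> real" and \<nu> :: "'s \<Rightarrow> real"
  assumes finite_S: "finite S"
    and p_nonneg: "\<And>s s'. s \<in> S \<Longrightarrow> s' \<in> S \<Longrightarrow> 0 \<le> p s s'"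
    and p_sum: "\<And>s. s \<in> S \<Longrightarrow> (\<Sum>s'\<in>S. p s s') = 1"
    and \<nu>_nonneg: "\<And>s. s \<in> S \<Longrightarrow> 0 \<le> \<nu> s"
    and \<nu>_sum: "(\<Sum>s\<in>S. \<nu> s) = 1"
begin

lemma prob_space_point:
  assumes "\<And>s. s \<in> S \<Longrightarrow> 0 \<le> f s" "(\<Sum>s\<in>S. f s) = 1"
  shows "prob_space (point_measure S (\<lambda>s. ennreal (f s)))"
proof (rule prob_spaceI)
  have "(\<Sum>s\<in>S. ennreal (f s)) = ennreal (\<Sum>s\<in>S. f s)"
    using assms(1) by (intro sum_ennreal) auto
  then show "emeasure (point_measure S (\<lambda>s. ennreal (f s)))
      (space (point_measure S (\<lambda>s. ennreal (f s)))) = 1"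
    using finite_S assms(2) by (simp add: emeasure_point_measure_finite space_point_measure)
qed

lemma prob_space_markov_kernel:
  assumes "w \<in> space (PiM {0..<n} (\<lambda>_. count_space S))"
  shows "prob_space (markov_kernel S p \<nu> n w)"
proof -
  have w: "n \<noteq> 0 \<Longrightarrow> w (n - 1) \<in> S"
    using assms by (auto simp: space_PiM PiE_iff)
  show ?thesis
    unfolding markov_kernel_def
    using w by (cases "n = 0") (auto intro!: prob_space_point simp: p_nonneg p_sum \<nu>_nonneg \<nu>_sum)
qed

lemma measurable_markov_kernel:
  "markov_kernel S p \<nu> n \<in>
     measurable (PiM {0..<n} (\<lambda>_. count_space S)) (subprob_algebra (count_space S))"
proof (cases n)
  case 0
  have "prob_space (point_measure S (\<lambda>s. ennreal (\<nu> s)))"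
    by (intro prob_space_point) (auto simp: \<nu>_nonneg \<nu>_sum)
  then have "point_measure S (\<lambda>s. ennreal (\<nu> s)) \<in> space (subprob_algebra (count_space S))"
    by (auto simp: space_subprob_algebra sets_point_measure intro: prob_space_imp_subprob_space)
  with 0 show ?thesis
    by (simp add: markov_kernel_def[abs_def])
next
  case (Suc m)
  have "(\<lambda>s. point_measure S (\<lambda>s'. ennreal (p s s'))) \<in>
      measurable (count_space S) (subprob_algebra (count_space S))"
    by (auto simp: space_subprob_algebra sets_point_measure
        intro!: prob_space_imp_subprob_space prob_space_point p_nonneg p_sum)
  moreover have "(\<lambda>w. w m) \<in> measurable (PiM {0..<n} (\<lambda>_. count_space S)) (count_space S)"
    using Suc by (intro measurable_component_singleton) auto
  ultimately have "(\<lambda>w. point_measure S (\<lambda>s'. ennreal (p (w m) s'))) \<in>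
      measurable (PiM {0..<n} (\<lambda>_. count_space S)) (subprob_algebra (count_space S))"
    by (rule measurable_compose[rotated])
  then show ?thesis
    by (simp add: markov_kernel_def[abs_def] Suc)
qed

sublocale Ionescu_Tulcea "markov_kernel S p \<nu>" "\<lambda>_. count_space S"
  by (rule Ionescu_Tulcea.intro) (fact measurable_markov_kernel prob_space_markov_kernel)+

lemma markov_law_eq: "markov_law S p \<nu> = PF.lim"
  by (simp add: markov_law_def)

lemma sets_singleton_path:
  fixes n :: nat
  assumes "\<And>k. k < n \<Longrightarrow> s k \<in> S"
  shows "{restrict s {0..<n}} \<in> sets (PiM {0..<n} (\<lambda>_. count_space S))"
proof -
  have "{restrict s {0..<n}} = PiE {0..<n} (\<lambda>k. {s k})"
    by (auto simp: PiE_iff fun_eq_iff extensional_def restrict_def)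
  also have "\<dots> \<in> sets (PiM {0..<n} (\<lambda>_. count_space S))"
    using assms by (intro sets_PiM_I_finite) auto
  finally show ?thesis .
qed

lemma emeasure_kernel_singleton:
  assumes "s \<in> S"
  shows "emeasure (markov_kernel S p \<nu> n w) {s} = ennreal (if n = 0 then \<nu> s else p (w (n - 1)) s)"
  using assms finite_S by (simp add: markov_kernel_def emeasure_point_measure_finite2)

lemma emeasure_eP_path:
  assumes s: "\<And>k. k \<le> m \<Longrightarrow> s k \<in> S" and x: "x \<in> space (PiM {0..<m} (\<lambda>_. count_space S))"
  shows "emeasure (eP m x) {restrict s {0..<Suc m}} =
     ennreal (if m = 0 then \<nu> (s 0) else p (s (m - 1)) (s m)) * indicator {restrict s {0..<m}} x"
proof -
  have X: "{restrict s {0..<Suc m}} \<in> sets (PiM {0..<Suc m} (\<lambda>_. count_space S))"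
    using s by (intro sets_singleton_path) auto
  have ext: "x k = undefined" if "\<not> k < m" for k
    using x that by (auto simp: space_PiM PiE_iff extensional_def)
  have upd: "x(m := y) = restrict s {0..<Suc m} \<longleftrightarrow> y = s m \<and> x = restrict s {0..<m}" for y
  proof
    assume eq: "x(m := y) = restrict s {0..<Suc m}"
    have "y = s m"
      using fun_cong[OF eq, of m] by simp
    moreover have "x k = restrict s {0..<m} k" for k
      using fun_cong[OF eq, of k] ext[of k] by (cases "k < m") auto
    ultimately show "y = s m \<and> x = restrict s {0..<m}" by auto
  next
    assume "y = s m \<and> x = restrict s {0..<m}"
    then show "x(m := y) = restrict s {0..<Suc m}"
      by (auto simp: fun_eq_iff)
  qed
  have "emeasure (eP m x) {restrict s {0..<Suc m}} =
      emeasure (markov_kernel S p \<nu> m x)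
        ((\<lambda>y. x(m := y)) -` {restrict s {0..<Suc m}} \<inter> space (count_space S))"
    by (rule emeasure_eP[OF x X])
  also have "(\<lambda>y. x(m := y)) -` {restrict s {0..<Suc m}} \<inter> space (count_space S) =
      (if x = restrict s {0..<m} then {s m} else {})"
    using s[of m] by (simp add: set_eq_iff upd del: restrict_fun_upd) auto
  finally have *: "emeasure (eP m x) {restrict s {0..<Suc m}} =
      emeasure (markov_kernel S p \<nu> m x) (if x = restrict s {0..<m} then {s m} else {})" .
  show ?thesis
  proof (cases "x = restrict s {0..<m}")
    case True
    have "m \<noteq> 0 \<Longrightarrow> x (m - 1) = s (m - 1)"
      by (simp add: True)
    moreover have "emeasure (eP m x) {restrict s {0..<Suc m}} = emeasure (markov_kernel S p \<nu> m x) {s m}"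
      using * True by (simp only: if_True simp_thms)
    ultimately show ?thesis
      unfolding emeasure_kernel_singleton[OF s[OF order_refl]]
      using True by (cases "m = 0") (simp_all only: indicator_simps singleton_iff simp_thms if_True if_False mult_1_right)
  next
    case False
    then have "emeasure (eP m x) {restrict s {0..<Suc m}} = 0"
      unfolding * by simp
    then show ?thesis
      using False by (simp only: indicator_simps singleton_iff simp_thms mult_zero_right)
  qed
qed

lemma emeasure_C_path:
  assumes "\<And>k. k \<le> n \<Longrightarrow> s k \<in> S"
  shows "emeasure (C 0 (Suc n) (\<lambda>_. undefined)) {restrict s {0..<Suc n}} =
           ennreal (\<nu> (s 0) * (\<Prod>k<n. p (s k) (s (Suc k))))"
proof -
  have u: "(\<lambda>_. undefined) \<in> space (PiM {0..<0::nat} (\<lambda>_. count_space S))"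
    by (simp add: space_PiM)
  have step: "emeasure (C 0 (Suc m) (\<lambda>_. undefined)) {restrict s {0..<Suc m}} =
      ennreal (if m = 0 then \<nu> (s 0) else p (s (m - 1)) (s m)) *
        emeasure (C 0 m (\<lambda>_. undefined)) {restrict s {0..<m}}"
    if s: "\<And>k. k \<le> m \<Longrightarrow> s k \<in> S" for m
  proof -
    let ?C = "C 0 m (\<lambda>_. undefined)"
    have sp: "space ?C = space (PiM {0..<m} (\<lambda>_. count_space S))"
      using space_C[OF u, of m] by simp
    have st: "sets ?C = sets (PiM {0..<m} (\<lambda>_. count_space S))"
      using sets_C[OF u, of m] by simp
    have ne: "space ?C \<noteq> {}"
      by (rule prob_space.not_empty[OF prob_space_C[OF u]])
    have X: "{restrict s {0..<Suc m}} \<in> sets (PiM {0..<Suc m} (\<lambda>_. count_space S))"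
      using s by (intro sets_singleton_path) auto
    have X': "{restrict s {0..<m}} \<in> sets ?C"
      unfolding st using s by (intro sets_singleton_path) auto
    have eP: "eP m \<in> measurable ?C (subprob_algebra (PiM {0..<Suc m} (\<lambda>_. count_space S)))"
      using measurable_eP[of m] measurable_cong_sets[OF st refl] by blast
    have "emeasure (C 0 (Suc m) (\<lambda>_. undefined)) {restrict s {0..<Suc m}} =
        (\<integral>\<^sup>+ x. emeasure (eP m x) {restrict s {0..<Suc m}} \<partial>?C)"
      using emeasure_bind[OF ne eP X] by simp
    also have "\<dots> = (\<integral>\<^sup>+ x. ennreal (if m = 0 then \<nu> (s 0) else p (s (m - 1)) (s m)) *
        indicator {restrict s {0..<m}} x \<partial>?C)"
      by (intro nn_integral_cong emeasure_eP_path s) (simp_all add: sp)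
    also have "\<dots> = ennreal (if m = 0 then \<nu> (s 0) else p (s (m - 1)) (s m)) *
        emeasure ?C {restrict s {0..<m}}"
      by (rule nn_integral_cmult_indicator[OF X'])
    finally show ?thesis .
  qed
  show ?thesis
    using assms
  proof (induction n)
    case 0
    have "emeasure (C 0 0 (\<lambda>_. undefined)) {restrict s {0..<0}} = 1"
      by (simp add: sets_PiM_empty restrict_def)
    then show ?case
      using step[of 0] 0 by (simp only: le_0_eq if_True simp_thms mult_1_right lessThan_0 prod.empty)
  next
    case (Suc n)
    have IH: "emeasure (C 0 (Suc n) (\<lambda>_. undefined)) {restrict s {0..<Suc n}} =
        ennreal (\<nu> (s 0) * (\<Prod>k<n. p (s k) (s (Suc k))))"
      by (rule Suc.IH) (simp add: Suc.prems)
    have "0 \<le> p (s n) (s (Suc n))" "0 \<le> \<nu> (s 0) * (\<Prod>k<n. p (s k) (s (Suc k)))"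
      using Suc.prems by (auto intro!: mult_nonneg_nonneg prod_nonneg p_nonneg \<nu>_nonneg)
    note nonneg = this
    have "emeasure (C 0 (Suc (Suc n)) (\<lambda>_. undefined)) {restrict s {0..<Suc (Suc n)}} =
        ennreal (p (s n) (s (Suc n))) * ennreal (\<nu> (s 0) * (\<Prod>k<n. p (s k) (s (Suc k))))"
      using step[of "Suc n", OF Suc.prems] unfolding IH
      by (simp only: nat.distinct if_False diff_Suc_1)
    also have "\<dots> = ennreal (p (s n) (s (Suc n)) * (\<nu> (s 0) * (\<Prod>k<n. p (s k) (s (Suc k)))))"
      by (rule ennreal_mult[OF nonneg, symmetric])
    also have "\<dots> = ennreal (\<nu> (s 0) * (\<Prod>k<Suc n. p (s k) (s (Suc k))))"
      by (simp add: mult_ac)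
    finally show ?case .
  qed
qed

lemma markov_law_cylinder:
  assumes "\<And>k. k \<le> n \<Longrightarrow> s k \<in> S"
  shows "emeasure (markov_law S p \<nu>) {w \<in> space (markov_law S p \<nu>). \<forall>k\<le>n. w k = s k} =
           ennreal (\<nu> (s 0) * (\<Prod>k<n. p (s k) (s (Suc k))))"
proof -
  let ?X = "{restrict s {0..<Suc n}}"
  have X: "?X \<in> sets (PiM {0..<Suc n} (\<lambda>_. count_space S))"
    using assms by (intro sets_singleton_path) auto
  have "restrict w {0..<Suc n} = restrict s {0..<Suc n} \<longleftrightarrow> (\<forall>k\<le>n. w k = s k)" for w
  proof
    assume eq: "restrict w {0..<Suc n} = restrict s {0..<Suc n}"
    show "\<forall>k\<le>n. w k = s k"
    proof (intro allI impI)
      fix k assume "k \<le> n"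
      then show "w k = s k" using fun_cong[OF eq, of k] by (simp add: less_Suc_eq_le)
    qed
  qed (auto intro!: restrict_ext)
  then have *: "{w \<in> space (markov_law S p \<nu>). \<forall>k\<le>n. w k = s k} = PF.emb UNIV {0..<Suc n} ?X"
    unfolding markov_law_eq prod_emb_def PF.space_lim space_PiM by blast
  have sets_into: "?X \<subseteq> PiE {0..<Suc n} (\<lambda>_. space (count_space S))"
    using sets.sets_into_space[OF X] by (simp add: space_PiM)
  have "emeasure (markov_law S p \<nu>) (PF.emb UNIV {0..<Suc n} ?X) = emeasure (CI {0..<Suc n}) ?X"
    unfolding markov_law_eq by (rule lim[OF finite_atLeastLessThan X])
  also have "\<dots> = emeasure (C 0 (Suc n) (\<lambda>_. undefined)) ?X"
    using emeasure_CI[of "{0..<Suc n}" "Suc n" ?X] X prod_emb_id[OF sets_into]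
    by (simp del: C.simps)
  also have "\<dots> = ennreal (\<nu> (s 0) * (\<Prod>k<n. p (s k) (s (Suc k))))"
    using assms by (rule emeasure_C_path)
  finally show ?thesis
    unfolding * .
qed

end

section \<open>Configurations, Gibbs measure and Metropolis dynamics\<close>

definition spins :: "nat \<Rightarrow> (nat \<Rightarrow> real) set" where
  "spins N = PiE {1..N} (\<lambda>_. {-1, 1})"

text \<open>
  The couplings are a family indexed by \<open>couplings\<close>; \<open>c (i, j)\<close> is the entry \<open>J\<^sub>i\<^sub>j\<close> of the
  triangular array.
\<close>

definition couplings :: "(nat \<times> nat) set" where
  "couplings = {(i, j). 1 \<le> i \<and> i < j}"

definition couplings_upto :: "nat \<Rightarrow> (nat \<times> nat) set" where
  "couplings_upto N = {(i, j). 1 \<le> i \<and> i < j \<and> j \<le> N}"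

definition hamiltonian :: "nat \<Rightarrow> real \<Rightarrow> (nat \<times> nat \<Rightarrow> real) \<Rightarrow> (nat \<Rightarrow> real) \<Rightarrow> real" where
  "hamiltonian N h c \<sigma> =
     - (1 / real N) * (\<Sum>(i, j)\<in>couplings_upto N. c (i, j) * \<sigma> i * \<sigma> j) - h * (\<Sum>i\<in>{1..N}. \<sigma> i)"

text \<open>
  Everything up to metastability depends on the model only through its Hamiltonian
  \<open>H :: (nat \<Rightarrow> real) \<Rightarrow> real\<close>, so that the quenched and the annealed model are two instances of
  the same definitions.
\<close>

definition gibbs :: "nat \<Rightarrow> real \<Rightarrow> ((nat \<Rightarrow> real) \<Rightarrow> real) \<Rightarrow> (nat \<Rightarrow> real) \<Rightarrow> real" where
  "gibbs N \<beta> H \<sigma> = exp (- \<beta> * H \<sigma>) / (\<Sum>\<eta>\<in>spins N. exp (- \<beta> * H \<eta>))"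

definition gibbs_mass :: "nat \<Rightarrow> real \<Rightarrow> ((nat \<Rightarrow> real) \<Rightarrow> real) \<Rightarrow> (nat \<Rightarrow> real) set \<Rightarrow> real" where
  "gibbs_mass N \<beta> H X = (\<Sum>\<sigma>\<in>X. gibbs N \<beta> H \<sigma>)"

definition neighbour :: "nat \<Rightarrow> (nat \<Rightarrow> real) \<Rightarrow> (nat \<Rightarrow> real) \<Rightarrow> bool" where
  "neighbour N \<sigma> \<sigma>' \<longleftrightarrow> (\<exists>i\<in>{1..N}. \<sigma>' = \<sigma>(i := - \<sigma> i))"

definition flip_prob ::
    "nat \<Rightarrow> real \<Rightarrow> ((nat \<Rightarrow> real) \<Rightarrow> real) \<Rightarrow> (nat \<Rightarrow> real) \<Rightarrow> (nat \<Rightarrow> real) \<Rightarrow> real" where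
  "flip_prob N \<beta> H \<sigma> \<sigma>' =
     (if neighbour N \<sigma> \<sigma>' then 1 / real N * exp (- \<beta> * max (H \<sigma>' - H \<sigma>) 0) else 0)"

definition trans_prob ::
    "nat \<Rightarrow> real \<Rightarrow> ((nat \<Rightarrow> real) \<Rightarrow> real) \<Rightarrow> (nat \<Rightarrow> real) \<Rightarrow> (nat \<Rightarrow> real) \<Rightarrow> real" where
  "trans_prob N \<beta> H \<sigma> \<sigma>' =
     (if \<sigma>' = \<sigma> then 1 - (\<Sum>\<eta>\<in>spins N - {\<sigma>}. flip_prob N \<beta> H \<sigma> \<eta>) else flip_prob N \<beta> H \<sigma> \<sigma>')"

definition chain_law ::
    "nat \<Rightarrow> real \<Rightarrow> ((nat \<Rightarrow> real) \<Rightarrow> real) \<Rightarrow> ((nat \<Rightarrow> real) \<Rightarrow> real) \<Rightarrow> (nat \<Rightarrow> nat \<Rightarrow> real) measure" where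
  "chain_law N \<beta> H \<nu> = markov_law (spins N) (trans_prob N \<beta> H) \<nu>"

text \<open>\<open>trans_prob\<close> is stochastic, hence \<open>chain_law\<close> is the law of a Markov chain.\<close>

lemma finite_spins: "finite (spins N)"
  unfolding spins_def by (rule finite_PiE) auto

lemma finite_markov_chain_trans_prob:
  assumes "1 \<le> N" "0 \<le> \<beta>"
    and "\<And>\<sigma>. \<sigma> \<in> spins N \<Longrightarrow> 0 \<le> \<nu> \<sigma>" "(\<Sum>\<sigma>\<in>spins N. \<nu> \<sigma>) = 1"
  shows "finite_markov_chain (spins N) (trans_prob N \<beta> H) \<nu>"
proof
  have flip0: "0 \<le> flip_prob N \<beta> H \<sigma> \<eta>" for \<sigma> \<eta>
    by (simp add: flip_prob_def)
  have flip1: "flip_prob N \<beta> H \<sigma> \<eta> \<le> (if neighbour N \<sigma> \<eta> then 1 / real N else 0)" for \<sigma> \<eta>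
  proof -
    have "exp (- \<beta> * max (H \<eta> - H \<sigma>) 0) \<le> 1"
      using mult_nonneg_nonneg[OF assms(2), of "max (H \<eta> - H \<sigma>) 0"] by simp
    then have "1 / real N * exp (- \<beta> * max (H \<eta> - H \<sigma>) 0) \<le> 1 / real N * 1"
      by (rule mult_left_mono) simp
    then show ?thesis
      unfolding flip_prob_def by simp
  qed
  fix \<sigma> assume \<sigma>: "\<sigma> \<in> spins N"
  let ?nb = "{\<eta> \<in> spins N - {\<sigma>}. neighbour N \<sigma> \<eta>}"
  have "card ?nb \<le> card ((\<lambda>i. \<sigma>(i := - \<sigma> i)) ` {1..N})"
    by (rule card_mono) (auto simp: neighbour_def)
  also have "\<dots> \<le> card {1..N}"
    by (rule card_image_le) simp
  finally have card: "card ?nb \<le> N" by simp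
  have "(\<Sum>\<eta>\<in>spins N - {\<sigma>}. flip_prob N \<beta> H \<sigma> \<eta>)
      \<le> (\<Sum>\<eta>\<in>spins N - {\<sigma>}. if neighbour N \<sigma> \<eta> then 1 / real N else 0)"
    by (rule sum_mono) (rule flip1)
  also have "\<dots> = (\<Sum>\<eta>\<in>?nb. 1 / real N)"
    by (rule sum.inter_filter[symmetric]) (simp add: finite_spins)
  also have "\<dots> = real (card ?nb) / real N"
    by simp
  also have "\<dots> \<le> 1"
    using card assms(1) by simp
  finally have le: "(\<Sum>\<eta>\<in>spins N - {\<sigma>}. flip_prob N \<beta> H \<sigma> \<eta>) \<le> 1" .
  show "0 \<le> trans_prob N \<beta> H \<sigma> \<sigma>'" for \<sigma>'
    using le flip0[of \<sigma> \<sigma>'] by (simp add: trans_prob_def)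
  show "(\<Sum>\<sigma>'\<in>spins N. trans_prob N \<beta> H \<sigma> \<sigma>') = 1"
  proof -
    have "(\<Sum>\<eta>\<in>spins N - {\<sigma>}. trans_prob N \<beta> H \<sigma> \<eta>) =
        (\<Sum>\<eta>\<in>spins N - {\<sigma>}. flip_prob N \<beta> H \<sigma> \<eta>)"
      by (rule sum.cong) (auto simp: trans_prob_def)
    then show ?thesis
      unfolding sum.remove[OF finite_spins \<sigma>, of "trans_prob N \<beta> H \<sigma>"]
      by (simp add: trans_prob_def)
  qed
next
  show "finite (spins N)" by (rule finite_spins)
  show "\<And>\<sigma>. \<sigma> \<in> spins N \<Longrightarrow> 0 \<le> \<nu> \<sigma>" "(\<Sum>\<sigma>\<in>spins N. \<nu> \<sigma>) = 1"
    by (fact assms)+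
qed

definition return_time :: "'s set \<Rightarrow> (nat \<Rightarrow> 's) \<Rightarrow> enat" where
  "return_time A w = Inf {enat t | t. 1 \<le> t \<and> w t \<in> A}"

text \<open>\<open>prob_before N \<beta> H \<nu> B A\<close> is the probability of \<open>\<tau>\<^sub>B < \<tau>\<^sub>A\<close> when starting from \<open>\<nu>\<close>.\<close>

definition prob_before ::
    "nat \<Rightarrow> real \<Rightarrow> ((nat \<Rightarrow> real) \<Rightarrow> real) \<Rightarrow> ((nat \<Rightarrow> real) \<Rightarrow> real) \<Rightarrow>
     (nat \<Rightarrow> real) set \<Rightarrow> (nat \<Rightarrow> real) set \<Rightarrow> real" where
  "prob_before N \<beta> H \<nu> B A =
     measure (chain_law N \<beta> H \<nu>)
       {w \<in> space (chain_law N \<beta> H \<nu>). return_time B w < return_time A w}"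

text \<open>
  The mean is computed in the extended reals; it is finite for every non-empty \<open>B\<close> because the
  chain is irreducible on a finite state space, so that \<open>enn2real\<close> loses nothing.
\<close>

definition mean_return_time ::
    "nat \<Rightarrow> real \<Rightarrow> ((nat \<Rightarrow> real) \<Rightarrow> real) \<Rightarrow> ((nat \<Rightarrow> real) \<Rightarrow> real) \<Rightarrow> (nat \<Rightarrow> real) set \<Rightarrow> real" where
  "mean_return_time N \<beta> H \<nu> B =
     enn2real (\<integral>\<^sup>+ w. ennreal_of_enat (return_time B w) \<partial>chain_law N \<beta> H \<nu>)"

definition dirac :: "'s \<Rightarrow> 's \<Rightarrow> real" where
  "dirac \<sigma> = indicator {\<sigma>}"

definition gibbs_cond ::
    "nat \<Rightarrow> real \<Rightarrow> ((nat \<Rightarrow> real) \<Rightarrow> real) \<Rightarrow> (nat \<Rightarrow> real) set \<Rightarrow> (nat \<Rightarrow> real) \<Rightarrow> real" where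
  "gibbs_cond N \<beta> H X \<sigma> = (if \<sigma> \<in> X then gibbs N \<beta> H \<sigma> / gibbs_mass N \<beta> H X else 0)"

definition last_exit ::
    "nat \<Rightarrow> real \<Rightarrow> ((nat \<Rightarrow> real) \<Rightarrow> real) \<Rightarrow> (nat \<Rightarrow> real) set \<Rightarrow> (nat \<Rightarrow> real) set \<Rightarrow>
     (nat \<Rightarrow> real) \<Rightarrow> real" where
  "last_exit N \<beta> H A B \<sigma> =
     (if \<sigma> \<in> A
      then gibbs N \<beta> H \<sigma> * prob_before N \<beta> H (dirac \<sigma>) B A /
             (\<Sum>\<sigma>'\<in>A. gibbs N \<beta> H \<sigma>' * prob_before N \<beta> H (dirac \<sigma>') B A)
      else 0)"

definition mean_crossover ::
    "nat \<Rightarrow> real \<Rightarrow> ((nat \<Rightarrow> real) \<Rightarrow> real) \<Rightarrow> (nat \<Rightarrow> real) set \<Rightarrow> (nat \<Rightarrow> real) set \<Rightarrow> real" where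
  "mean_crossover N \<beta> H A B = mean_return_time N \<beta> H (last_exit N \<beta> H A B) B"

section \<open>Metastability\<close>

text \<open>
  The minimum in the definition of metastability is over the non-empty subsets of the complement
  of the union of the metastable sets; for it to be meaningful, that complement has to be
  non-empty.
\<close>

definition metastable ::
    "nat \<Rightarrow> real \<Rightarrow> ((nat \<Rightarrow> real) \<Rightarrow> real) \<Rightarrow> real \<Rightarrow> nat \<Rightarrow> (nat \<Rightarrow> (nat \<Rightarrow> real) set) \<Rightarrow> bool" where
  "metastable N \<beta> H \<rho> K \<M> \<longleftrightarrow>
     (\<forall>l\<in>{1..K}. \<M> l \<noteq> {} \<and> \<M> l \<subseteq> spins N) \<and>
     disjoint_family_on \<M> {1..K} \<and>
     (\<Union>l\<in>{1..K}. \<M> l) \<noteq> spins N \<and>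
     (let U = (\<Union>l\<in>{1..K}. \<M> l) in
       real K *
         Max ((\<lambda>j. prob_before N \<beta> H (gibbs_cond N \<beta> H (\<M> j)) (U - \<M> j) (\<M> j)) ` {1..K}) /
         Min ((\<lambda>X. prob_before N \<beta> H (gibbs_cond N \<beta> H X) U X) ` (Pow (spins N - U) - {{}}))
       \<le> \<rho>)"

definition valley ::
    "nat \<Rightarrow> real \<Rightarrow> ((nat \<Rightarrow> real) \<Rightarrow> real) \<Rightarrow> nat \<Rightarrow> (nat \<Rightarrow> (nat \<Rightarrow> real) set) \<Rightarrow> nat \<Rightarrow>
     (nat \<Rightarrow> real) set" where
  "valley N \<beta> H K \<M> l =
     (let U = (\<Union>j\<in>{1..K}. \<M> j) in
       \<M> l \<union> {\<sigma> \<in> spins N - U.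
         prob_before N \<beta> H (dirac \<sigma>) (\<M> l) (U - \<M> l) \<ge>
           Max ((\<lambda>j. prob_before N \<beta> H (dirac \<sigma>) (\<M> j) (U - \<M> j)) ` ({1..K} - {l}))})"

section \<open>Conditioning on the sub-sigma-algebra\<close>

definition cond_indep_given ::
    "'a measure \<Rightarrow> 'a measure \<Rightarrow> 'i set \<Rightarrow> ('i \<Rightarrow> 'a \<Rightarrow> real) \<Rightarrow> bool" where
  "cond_indep_given M G I X \<longleftrightarrow>
     (\<forall>F A. finite F \<longrightarrow> F \<subseteq> I \<longrightarrow> (\<forall>p\<in>F. A p \<in> sets borel) \<longrightarrow>
       (AE \<omega> in M.
         real_cond_exp M G (indicator {\<xi> \<in> space M. \<forall>p\<in>F. X p \<xi> \<in> A p}) \<omega> =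
         (\<Prod>p\<in>F. real_cond_exp M G (indicator {\<xi> \<in> space M. X p \<xi> \<in> A p}) \<omega>)))"

definition regular_cond_dist ::
    "'a measure \<Rightarrow> 'a measure \<Rightarrow> 'i set \<Rightarrow> ('i \<Rightarrow> 'a \<Rightarrow> real) \<Rightarrow> ('a \<Rightarrow> ('i \<Rightarrow> real) measure) \<Rightarrow> bool" where
  "regular_cond_dist M G I X \<kappa> \<longleftrightarrow>
     \<kappa> \<in> measurable G (prob_algebra (PiM I (\<lambda>_. borel))) \<and>
     (\<forall>A\<in>sets (PiM I (\<lambda>_. borel)). AE \<omega> in M.
       measure (\<kappa> \<omega>) A =
         real_cond_exp M G (indicator {\<xi> \<in> space M. (\<lambda>p\<in>I. X p \<xi>) \<in> A}) \<omega>)"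

text \<open>
  Below, \<open>\<kappa> \<omega>\<close> is the regular conditional distribution of the couplings at \<open>\<omega>\<close>: the conditional
  expectation of \<open>f (J, \<omega>)\<close>, with \<open>f\<close> depending on \<open>\<omega>\<close> in a measurable way with respect to the
  conditioning sigma-algebra, is the integral of \<open>f (c, \<omega>)\<close> over \<open>c\<close> with respect to \<open>\<kappa> \<omega>\<close>.
\<close>

definition annealed_ham ::
    "nat \<Rightarrow> real \<Rightarrow> (nat \<times> nat \<Rightarrow> real) measure \<Rightarrow> (nat \<Rightarrow> real) \<Rightarrow> real" where
  "annealed_ham N h D \<sigma> = (\<integral>c. hamiltonian N h c \<sigma> \<partial>D)"

definition cond_variance :: "(nat \<times> nat \<Rightarrow> real) measure \<Rightarrow> nat \<times> nat \<Rightarrow> real" where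
  "cond_variance D p = (\<integral>c. (c p - (\<integral>c'. c' p \<partial>D))\<^sup>2 \<partial>D)"

definition alpha :: "real \<Rightarrow> (nat \<times> nat \<Rightarrow> real) measure \<Rightarrow> nat \<Rightarrow> real" where
  "alpha \<beta> D N = \<beta>\<^sup>2 / (2 * (real N)\<^sup>2) * (\<Sum>p\<in>couplings_upto N. cond_variance D p)"

definition meta_event ::
    "'a measure \<Rightarrow> ('a \<Rightarrow> (nat \<times> nat \<Rightarrow> real) measure) \<Rightarrow> real \<Rightarrow> real \<Rightarrow> nat \<Rightarrow> real \<Rightarrow> nat \<Rightarrow> 'a set" where
  "meta_event M \<kappa> \<beta> h K k1 N =
     {\<omega> \<in> space M. \<exists>\<M>. metastable N \<beta> (annealed_ham N h (\<kappa> \<omega>)) (exp (- k1 * real N)) K \<M>}"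

definition liminf_event :: "(nat \<Rightarrow> 'a set) \<Rightarrow> 'a set" where
  "liminf_event E = (\<Union>n. \<Inter>N\<in>{n..}. E N)"

end

theory Submission
  imports Defs "HOL-Real_Asymp.Real_Asymp"
begin

text \<open>
  The ratio of the two mean crossover times splits into a ratio of weights and a ratio of
  capacities, which can be estimated separately. For a reversible chain started from the last-exit biased
  distribution, the mean hitting time of \<open>B\<close> equals \<open>(\<Sum>\<sigma>. w \<sigma> * h \<sigma>) / cap A B\<close>, where \<open>w\<close> is the unnormalised Boltzmann weight, \<open>h\<close> is
  the equilibrium potential (the probability to hit \<open>A\<close> before \<open>B\<close>) and \<open>cap\<close> is the capacity. The
  partition function cancels, so that only weights \<open>exp (- \<beta> * H \<sigma>)\<close> and edge conductances
  \<open>exp (- \<beta> * max (H \<sigma>) (H \<eta>)) / N\<close> occur, and both react in an explicit way to a change of the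
  couplings.

  \<^emph>\<open>The numerator is the weight of the valley \<open>S\<^sub>i\<close>, up to an exponentially small error.\<close>
  In the annealed chain there is \<open>m > 0\<close> such that every subset \<open>X\<close> of a valley \<open>S\<^sub>j\<close> away from \<open>M\<^sub>j\<close>
  has a capacity to \<open>M\<^sub>j\<close> of at least \<open>m / K\<close> times the weight of \<open>X\<close>, while the capacity between \<open>A\<close>
  and \<open>B\<close> is at most \<open>exp (- k1 * N) * m\<close> times the weight of \<open>A\<close>. Applied to the superlevel sets
  of \<open>h\<close> (in \<open>S\<^sub>j\<close> with \<open>j < i\<close>) or of \<open>1 - h\<close> (in \<open>S\<^sub>i\<close>), this shows that they carry almost no
  weight. Both facts are inequalities between weights and capacities, so they survive the passage to
  any Hamiltonian that is uniformly within \<open>O (sqrt N)\<close> of the annealed one. With conditional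
  probability exponentially close to one the quenched Hamiltonian is of this kind
  (\<open>equil_mass_metastable\<close>, \<open>prob_not_near_annealed\<close>).

  \<^emph>\<open>The means of the logarithms.\<close> The Dirichlet principle with the annealed potential as a test
  function bounds the quenched capacity from above, and the Cauchy-Schwarz inequality (Thomson's
  principle for the annealed harmonic flow) bounds it from below (\<open>capacity_upper\<close>,
  \<open>capacity_lower\<close>). In both cases the ratio of the capacities is at most an average, with respect to
  a probability distribution on edges that depends only on the annealed model, of ratios of
  conductances. The average over the disorder of the \<open>s\<close>-th power of such a ratio is
  at most \<open>exp (s\<^sup>2 * \<alpha> + O (1 / sqrt N))\<close>. By Jensen's inequality the mean
  logarithm of the capacity moves by at most \<open>\<alpha>\<close>, up to \<open>O (1 / sqrt N)\<close>. The mean logarithm of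
  the weight of the valley moves upwards by
  at most \<open>\<alpha>\<close>, up to the same error, and, by convexity, not downwards.
  This produces the asymmetric factors \<open>exp (- \<alpha>)\<close> and \<open>exp (2 * \<alpha>)\<close>.

  \<^emph>\<open>The fluctuations.\<close> Both logarithms change by at most \<open>2 * \<beta> * kJ / N\<close> when one coupling is
  changed. McDiarmid's inequality over at most \<open>N\<^sup>2 / 2\<close> couplings gives Gaussian tails; four one-sided
  tails at distance about \<open>t / 2\<close> yield the first claim (\<open>crossover_ratio_concentration\<close>). For the
  second claim, the \<open>q\<close>-th moment is bounded from above by the Cauchy-Schwarz inequality and the
  \<open>2 * q\<close>-th moments of the two factors, each \<open>exp (4 * q\<^sup>2 * \<alpha>)\<close> up to \<open>O (1 / sqrt N)\<close>, and from
  below by Jensen's inequality (\<open>crossover_moment_bounds\<close>).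

  It remains to see that almost every conditional law of the couplings makes them independent and
  bounded (\<open>kernel_disorder\<close>), and that the event of the second claim is measurable.
\<close>

section \<open>Potential theory of finite reversible chains\<close>

definition kill :: "('s \<Rightarrow> 's \<Rightarrow> real) \<Rightarrow> 's set \<Rightarrow> ('s \<Rightarrow> real) \<Rightarrow> 's \<Rightarrow> real" where
  "kill p C f x = (\<Sum>y\<in>C. p x y * f y)"

text \<open>
  The Green operator of the chain killed outside \<open>C\<close>, as a Neumann series. Each partial sum is a
  polynomial in the transition probabilities, which makes measurability in a parameter immediate.
\<close>

definition green :: "('s \<Rightarrow> 's \<Rightarrow> real) \<Rightarrow> 's set \<Rightarrow> ('s \<Rightarrow> real) \<Rightarrow> 's \<Rightarrow> real" where
  "green p C f x = (\<Sum>n. (kill p C ^^ n) f x)"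

text \<open>
  The equilibrium potential: the probability to reach \<open>A\<close> before \<open>B\<close>, counting time \<open>0\<close>.
\<close>

definition equil :: "'s set \<Rightarrow> ('s \<Rightarrow> 's \<Rightarrow> real) \<Rightarrow> 's set \<Rightarrow> 's set \<Rightarrow> 's \<Rightarrow> real" where
  "equil S p A B x =
     (if x \<in> A then 1 else if x \<in> B then 0 else green p (S - (A \<union> B)) (\<lambda>y. \<Sum>z\<in>A. p y z) x)"

definition mean_hit :: "'s set \<Rightarrow> ('s \<Rightarrow> 's \<Rightarrow> real) \<Rightarrow> 's set \<Rightarrow> 's \<Rightarrow> real" where
  "mean_hit S p B x = (if x \<in> B then 0 else green p (S - B) (\<lambda>_. 1) x)"

definition dform ::
    "'s set \<Rightarrow> ('s \<Rightarrow> 's \<Rightarrow> real) \<Rightarrow> ('s \<Rightarrow> real) \<Rightarrow> ('s \<Rightarrow> real) \<Rightarrow> ('s \<Rightarrow> real) \<Rightarrow> real" where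
  "dform S p w f g = (\<Sum>x\<in>S. \<Sum>y\<in>S. w x * p x y * (f x - f y) * (g x - g y)) / 2"

definition capacity ::
    "'s set \<Rightarrow> ('s \<Rightarrow> 's \<Rightarrow> real) \<Rightarrow> ('s \<Rightarrow> real) \<Rightarrow> 's set \<Rightarrow> 's set \<Rightarrow> real" where
  "capacity S p w A B = dform S p w (equil S p A B) (equil S p A B)"

text \<open>
  Irreducibility is stated through exits: no proper non-empty subset is closed. This is the form in
  which the maximum principle uses it.
\<close>

locale reversible_chain =
  fixes S :: "'s set" and p :: "'s \<Rightarrow> 's \<Rightarrow> real" and w :: "'s \<Rightarrow> real"
  assumes fin [simp]: "finite S"
    and p_nonneg: "\<And>x y. x \<in> S \<Longrightarrow> y \<in> S \<Longrightarrow> 0 \<le> p x y"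
    and p_sum: "\<And>x. x \<in> S \<Longrightarrow> (\<Sum>y\<in>S. p x y) = 1"
    and w_pos: "\<And>x. x \<in> S \<Longrightarrow> 0 < w x"
    and rev: "\<And>x y. x \<in> S \<Longrightarrow> y \<in> S \<Longrightarrow> w x * p x y = w y * p y x"
    and exit: "\<And>X. X \<subseteq> S \<Longrightarrow> X \<noteq> {} \<Longrightarrow> X \<noteq> S \<Longrightarrow> \<exists>x\<in>X. \<exists>y\<in>S - X. 0 < p x y"
begin

abbreviation "avg f x \<equiv> (\<Sum>y\<in>S. p x y * f y)"
abbreviation "equi A B \<equiv> equil S p A B"
abbreviation "cap A B \<equiv> capacity S p w A B"
abbreviation "E f g \<equiv> dform S p w f g"

lemma fin_sub: "X \<subseteq> S \<Longrightarrow> finite X"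
  by (rule finite_subset) auto

text \<open>
  At a positive maximum the value is an average of values that are not larger, so the set of interior
  maximisers cannot be left by a step of positive probability, which contradicts irreducibility.
\<close>

lemma maximum_principle:
  assumes C: "C \<subseteq> S" "C \<noteq> S"
    and sub: "\<And>x. x \<in> C \<Longrightarrow> u x \<le> avg u x"
    and bdry: "\<And>x. x \<in> S - C \<Longrightarrow> u x \<le> 0"
    and x: "x \<in> S"
  shows "u x \<le> 0"
proof (rule ccontr)
  assume pos: "\<not> u x \<le> 0"
  define m where "m = Max (u ` S)"
  have um: "u y \<le> m" if "y \<in> S" for y
    unfolding m_def using that by (intro Max_ge) auto
  have mpos: "0 < m" using um[OF x] pos by linarith
  define Y where "Y = {y \<in> C. u y = m}"
  have "m \<in> u ` S" unfolding m_def using x by (intro Max_in) auto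
  then obtain z where z: "z \<in> S" "u z = m" by auto
  then have "z \<in> C" using bdry[of z] mpos by (cases "z \<in> C") auto
  then have "Y \<noteq> {}" using z by (auto simp: Y_def)
  moreover have "Y \<subseteq> S" "Y \<noteq> S" using C by (auto simp: Y_def)
  ultimately obtain a b where a: "a \<in> Y" and b: "b \<in> S - Y" and ab: "0 < p a b"
    using exit by blast
  have ub: "u b < m"
  proof (cases "b \<in> C")
    case True then show ?thesis using b um[of b] by (auto simp: Y_def order.strict_iff_order)
  next
    case False then show ?thesis using bdry[of b] b mpos by auto
  qed
  have aS: "a \<in> S" "a \<in> C" "u a = m" using a C by (auto simp: Y_def)
  have "m \<le> avg u a" using sub[OF aS(2)] aS(3) by simp
  also have "\<dots> < (\<Sum>y\<in>S. p a y * m)"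
    using b ab ub um p_nonneg[OF aS(1)]
    by (intro sum_strict_mono_ex1) (auto intro!: mult_left_mono bexI[of _ b])
  also have "\<dots> = m" using p_sum[OF aS(1)] by (simp add: sum_distrib_right[symmetric])
  finally show False by simp
qed

lemma harmonic_zero:
  assumes C: "C \<subseteq> S" "C \<noteq> S"
    and har: "\<And>x. x \<in> C \<Longrightarrow> u x = avg u x"
    and bdry: "\<And>x. x \<in> S - C \<Longrightarrow> u x = 0"
    and x: "x \<in> S"
  shows "u x = 0"
proof -
  have "u x \<le> 0" by (rule maximum_principle[OF C]) (use har bdry x in auto)
  moreover have "- u x \<le> 0"
    by (rule maximum_principle[OF C, of "\<lambda>x. - u x"])
      (use har bdry x in \<open>auto simp: sum_negf\<close>)
  ultimately show ?thesis by simp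
qed

lemma harmonic_unique:
  assumes C: "C \<subseteq> S" "C \<noteq> S"
    and u: "\<And>x. x \<in> C \<Longrightarrow> u x = avg u x" and v: "\<And>x. x \<in> C \<Longrightarrow> v x = avg v x"
    and bdry: "\<And>x. x \<in> S - C \<Longrightarrow> u x = v x" and x: "x \<in> S"
  shows "u x = v x"
proof -
  have "u x - v x = 0"
  proof (rule harmonic_zero[OF C, of "\<lambda>x. u x - v x"])
    fix x assume "x \<in> C"
    then show "u x - v x = avg (\<lambda>x. u x - v x) x"
      using u[of x] v[of x] by (simp add: right_diff_distrib sum_subtractf)
  qed (use bdry x in auto)
  then show ?thesis by simp
qed

lemma kill_mono:
  assumes "C \<subseteq> S" "x \<in> S" "\<And>y. y \<in> C \<Longrightarrow> f y \<le> g y"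
  shows "kill p C f x \<le> kill p C g x"
  unfolding kill_def using assms p_nonneg by (intro sum_mono mult_left_mono) auto

lemma kill_pow_mono:
  assumes C: "C \<subseteq> S" and x: "x \<in> S" and fg: "\<And>y. y \<in> S \<Longrightarrow> f y \<le> g y"
  shows "(kill p C ^^ n) f x \<le> (kill p C ^^ n) g x"
  using x
proof (induction n arbitrary: x)
  case 0 then show ?case using fg by simp
next
  case (Suc n)
  have "kill p C ((kill p C ^^ n) f) x \<le> kill p C ((kill p C ^^ n) g) x"
    using C Suc by (intro kill_mono) auto
  then show ?case by simp
qed

lemma kill_scale: "kill p C (\<lambda>y. c * f y) = (\<lambda>x. c * kill p C f x)"
  unfolding kill_def by (auto simp: sum_distrib_left algebra_simps)

lemma kill_pow_scale: "(kill p C ^^ n) (\<lambda>y. c * f y) = (\<lambda>x. c * (kill p C ^^ n) f x)"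
  by (induction n) (auto simp: kill_scale)

lemma kill_one_le:
  assumes "C \<subseteq> S" "x \<in> S"
  shows "kill p C (\<lambda>_. 1) x \<le> 1"
proof -
  have "kill p C (\<lambda>_. 1) x \<le> (\<Sum>y\<in>S. p x y)"
    unfolding kill_def using assms p_nonneg by (simp, intro sum_mono2) auto
  then show ?thesis using p_sum assms by simp
qed

lemma kill_pow_nonneg:
  assumes C: "C \<subseteq> S" and x: "x \<in> S" and f: "\<And>y. y \<in> S \<Longrightarrow> 0 \<le> f y"
  shows "0 \<le> (kill p C ^^ n) f x"
  using x
proof (induction n arbitrary: x)
  case 0 then show ?case using f by simp
next
  case (Suc n)
  have "0 \<le> kill p C ((kill p C ^^ n) f) x"
    unfolding kill_def[of p C "(kill p C ^^ n) f"]
    using C Suc p_nonneg by (intro sum_nonneg mult_nonneg_nonneg) auto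
  then show ?case by simp
qed

lemma survival_antimono:
  assumes C: "C \<subseteq> S" and x: "x \<in> S"
  shows "(kill p C ^^ Suc n) (\<lambda>_. 1) x \<le> (kill p C ^^ n) (\<lambda>_. 1) x"
proof -
  have "(kill p C ^^ n) (kill p C (\<lambda>_. 1)) x \<le> (kill p C ^^ n) (\<lambda>_. 1) x"
    by (rule kill_pow_mono[OF C x]) (rule kill_one_le[OF C])
  then show ?thesis by (simp add: funpow_swap1)
qed

text \<open>
  The limit of the survival probabilities is a fixed point of the killed transition operator, and the
  maximum principle leaves only the zero function.
\<close>

lemma survival_tendsto:
  assumes C: "C \<subseteq> S" "C \<noteq> S" and x: "x \<in> S"
  shows "(\<lambda>n. (kill p C ^^ n) (\<lambda>_. 1) x) \<longlonglongrightarrow> 0"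
proof -
  define r where "r n x = (kill p C ^^ n) (\<lambda>_. 1) x" for n x
  have r0: "0 \<le> r n y" if "y \<in> S" for n y
    unfolding r_def using C that by (intro kill_pow_nonneg) auto
  have dec: "decseq (\<lambda>n. r n y)" if "y \<in> S" for y
    unfolding r_def using survival_antimono[OF C(1) that] by (intro decseq_SucI)
  define L where "L y = lim (\<lambda>n. r n y)" for y
  have lim: "(\<lambda>n. r n y) \<longlonglongrightarrow> L y" if y: "y \<in> S" for y
  proof -
    obtain l where "(\<lambda>n. r n y) \<longlonglongrightarrow> l"
      by (rule decseq_convergent[OF dec[OF y], of 0]) (use r0 y in auto)
    then show ?thesis unfolding L_def by (simp add: limI)
  qed
  have Leq: "L y = kill p C L y" if y: "y \<in> S" for y
  proof (rule LIMSEQ_unique)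
    show "(\<lambda>n. r (Suc n) y) \<longlonglongrightarrow> L y" using lim[OF y] by (rule LIMSEQ_Suc)
    have "(\<lambda>n. kill p C (r n) y) \<longlonglongrightarrow> kill p C L y"
      unfolding kill_def using C lim by (intro tendsto_intros) auto
    then show "(\<lambda>n. r (Suc n) y) \<longlonglongrightarrow> kill p C L y"
      by (simp add: r_def[abs_def])
  qed
  have LC: "L y \<le> 0" if "y \<in> C" for y
  proof -
    have "(if y \<in> C then L y else 0) \<le> 0"
    proof (rule maximum_principle[OF C])
      fix x assume xC: "x \<in> C"
      have "(\<Sum>y\<in>S. p x y * (if y \<in> C then L y else 0)) = kill p C L x"
        unfolding kill_def using C by (intro sum.mono_neutral_cong_right) auto
      then show "(if x \<in> C then L x else 0) \<le> avg (\<lambda>y. if y \<in> C then L y else 0) x"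
        using xC C Leq[of x] by auto
    qed (use that C in auto)
    then show ?thesis using that by simp
  qed
  have "L x \<le> 0"
    unfolding Leq[OF x] kill_def using LC p_nonneg x C
    by (intro sum_nonpos mult_nonneg_nonpos) auto
  moreover have "0 \<le> L x" using lim[OF x] r0[OF x] by (auto intro: LIMSEQ_le_const)
  ultimately have "L x = 0" by simp
  with lim[OF x] show ?thesis by (simp add: r_def)
qed

text \<open>
  Once the survival probability has dropped below one half everywhere, at time \<open>m\<close> say, any further
  \<open>m\<close> steps halve it again; summed up, the partial sums are at most \<open>2 * m\<close>.
\<close>

lemma survival_summable:
  assumes C: "C \<subseteq> S" "C \<noteq> S" and x: "x \<in> S"
  shows "summable (\<lambda>n. (kill p C ^^ n) (\<lambda>_. 1) x)"
proof -
  define r where "r n x = (kill p C ^^ n) (\<lambda>_. 1) x" for n x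
  have r0: "0 \<le> r n y" if "y \<in> S" for n y
    unfolding r_def using C that by (intro kill_pow_nonneg) auto
  have "\<forall>\<^sub>F n in sequentially. \<forall>y\<in>S. r n y < 1/2"
  proof (rule eventually_ball_finite)
    show "\<forall>y\<in>S. \<forall>\<^sub>F n in sequentially. r n y < 1/2"
      unfolding r_def using survival_tendsto[OF C] by (auto intro!: order_tendstoD(2)[of _ 0])
  qed auto
  then obtain m where m: "\<And>y. y \<in> S \<Longrightarrow> r m y \<le> 1/2"
    unfolding eventually_sequentially by (meson less_imp_le order_refl)
  have half: "r (m + k) x \<le> 1/2 * r k x" for k
  proof -
    have "r (m + k) x = (kill p C ^^ k) (r m) x"
      unfolding r_def[abs_def] by (simp add: add.commute funpow_add)
    also have "\<dots> \<le> (kill p C ^^ k) (\<lambda>y. 1/2 * 1) x"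
      by (rule kill_pow_mono[OF C(1) x]) (use m in simp)
    also have "\<dots> = 1/2 * r k x" unfolding r_def kill_pow_scale by simp
    finally show ?thesis .
  qed
  have r1: "r n x \<le> 1" for n
  proof (induction n)
    case (Suc n) then show ?case using survival_antimono[OF C(1) x, of n] by (simp add: r_def)
  qed (simp add: r_def)
  have "(\<Sum>n<k. r n x) \<le> 2 * real m" for k
  proof -
    have "(\<Sum>n<k. r n x) \<le> (\<Sum>n<m+k. r n x)"
      using r0[OF x] by (intro sum_mono2) auto
    also have "\<dots> = (\<Sum>n<m. r n x) + (\<Sum>n<k. r (m + n) x)"
      by (induction k) (simp_all add: add.assoc)
    also have "\<dots> \<le> (\<Sum>n<m. 1) + (\<Sum>n<k. 1/2 * r n x)"
      using r1 half by (intro add_mono sum_mono) auto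
    also have "\<dots> = real m + 1/2 * (\<Sum>n<k. r n x)" by (simp add: sum_distrib_left)
    finally show ?thesis by simp
  qed
  then have "summable (\<lambda>n. r n x)"
    using r0[OF x] by (intro summableI_nonneg_bounded[where x="2 * real m"]) auto
  then show ?thesis by (simp add: r_def)
qed

lemma green_summable:
  assumes C: "C \<subseteq> S" "C \<noteq> S" and x: "x \<in> S" and f: "\<And>y. y \<in> S \<Longrightarrow> 0 \<le> f y \<and> f y \<le> 1"
  shows "summable (\<lambda>n. (kill p C ^^ n) f x)"
proof (rule summable_comparison_test'[OF survival_summable[OF C x]])
  fix n :: nat
  have "0 \<le> (kill p C ^^ n) f x" by (rule kill_pow_nonneg[OF C(1) x]) (use f in auto)
  moreover have "(kill p C ^^ n) f x \<le> (kill p C ^^ n) (\<lambda>_. 1) x"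
    by (rule kill_pow_mono[OF C(1) x]) (use f in auto)
  ultimately show "norm ((kill p C ^^ n) f x) \<le> (kill p C ^^ n) (\<lambda>_. 1) x" by simp
qed

lemma green_eq:
  assumes C: "C \<subseteq> S" "C \<noteq> S" and x: "x \<in> S" and f: "\<And>y. y \<in> S \<Longrightarrow> 0 \<le> f y \<and> f y \<le> 1"
  shows "green p C f x = f x + kill p C (green p C f) x"
proof -
  have "green p C f x = f x + (\<Sum>n. (kill p C ^^ Suc n) f x)"
    unfolding green_def using suminf_split_head[OF green_summable[OF assms]] by simp
  also have "(\<Sum>n. (kill p C ^^ Suc n) f x) = (\<Sum>n. \<Sum>y\<in>C. p x y * (kill p C ^^ n) f y)"
    by (simp add: kill_def)
  also have "\<dots> = (\<Sum>y\<in>C. \<Sum>n. p x y * (kill p C ^^ n) f y)"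
    using C by (intro suminf_sum summable_mult green_summable[OF C _ f]) auto
  also have "\<dots> = kill p C (green p C f) x"
    unfolding kill_def[of p C "green p C f"] green_def
    using C by (intro sum.cong refl suminf_mult green_summable[OF C _ f]) auto
  finally show ?thesis .
qed

lemma sum_le_one: "A \<subseteq> S \<Longrightarrow> x \<in> S \<Longrightarrow> 0 \<le> (\<Sum>y\<in>A. p x y) \<and> (\<Sum>y\<in>A. p x y) \<le> 1"
  using sum_mono2[of S A "p x"] p_sum[of x] p_nonneg by (auto intro!: sum_nonneg)

lemma equil_A [simp]: "x \<in> A \<Longrightarrow> equi A B x = 1"
  by (simp add: equil_def)

lemma equil_B: "x \<in> B \<Longrightarrow> A \<inter> B = {} \<Longrightarrow> equi A B x = 0"
  by (auto simp: equil_def)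

lemma equil_harmonic:
  assumes AB: "A \<subseteq> S" "B \<subseteq> S" "A \<union> B \<noteq> {}" "A \<inter> B = {}" and x: "x \<in> S - (A \<union> B)"
  shows "equi A B x = avg (equi A B) x"
proof -
  let ?C = "S - (A \<union> B)"
  have C: "?C \<subseteq> S" "?C \<noteq> S" using AB by auto
  have "equi A B x = (\<Sum>z\<in>A. p x z) + kill p ?C (green p ?C (\<lambda>y. \<Sum>z\<in>A. p y z)) x"
    using x green_eq[OF C, of x "\<lambda>y. \<Sum>z\<in>A. p y z"] sum_le_one[OF AB(1)]
    by (simp add: equil_def)
  also have "(\<Sum>z\<in>A. p x z) = (\<Sum>z\<in>A. p x z * equi A B z)" by simp
  also have "kill p ?C (green p ?C (\<lambda>y. \<Sum>z\<in>A. p y z)) x = (\<Sum>z\<in>?C. p x z * equi A B z)"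
    unfolding kill_def by (intro sum.cong) (auto simp: equil_def)
  also have "(\<Sum>z\<in>A. p x z * equi A B z) + (\<Sum>z\<in>?C. p x z * equi A B z) =
     (\<Sum>z\<in>A \<union> ?C. p x z * equi A B z)"
    using AB fin_sub by (intro sum.union_disjoint[symmetric]) auto
  also have "\<dots> = avg (equi A B) x"
    using AB by (intro sum.mono_neutral_left) (auto simp: equil_B)
  finally show ?thesis .
qed

lemma equil_swap:
  assumes AB: "A \<subseteq> S" "B \<subseteq> S" "A \<union> B \<noteq> {}" "A \<inter> B = {}" and x: "x \<in> S"
  shows "equi B A x = 1 - equi A B x"
proof -
  let ?C = "S - (A \<union> B)"
  have C: "?C \<subseteq> S" "?C \<noteq> S" using AB by auto
  show ?thesis
  proof (rule harmonic_unique[OF C])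
    fix x assume x: "x \<in> ?C"
    then show "equi B A x = avg (equi B A) x"
      using AB by (intro equil_harmonic) auto
    show "1 - equi A B x = avg (\<lambda>x. 1 - equi A B x) x"
      using x AB equil_harmonic[of A B x] p_sum[of x] by (simp add: right_diff_distrib sum_subtractf)
  qed (use AB x in \<open>auto simp: equil_B Int_commute\<close>)
qed

lemma equil_nonneg:
  assumes AB: "A \<subseteq> S" "B \<subseteq> S" "A \<union> B \<noteq> {}" "A \<inter> B = {}" and x: "x \<in> S"
  shows "0 \<le> equi A B x"
proof -
  let ?C = "S - (A \<union> B)"
  have C: "?C \<subseteq> S" "?C \<noteq> S" using AB by auto
  have "- equi A B x \<le> 0"
  proof (rule maximum_principle[OF C])
    fix x assume x: "x \<in> ?C"
    then show "- equi A B x \<le> avg (\<lambda>x. - equi A B x) x"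
      using AB equil_harmonic[of A B x] by (simp add: sum_negf)
  qed (use AB x in \<open>auto simp: equil_B\<close>)
  then show ?thesis by simp
qed

lemma equil_le_one:
  assumes AB: "A \<subseteq> S" "B \<subseteq> S" "A \<union> B \<noteq> {}" "A \<inter> B = {}" and x: "x \<in> S"
  shows "equi A B x \<le> 1"
  using equil_swap[OF assms] equil_nonneg[of B A x] AB x by (auto simp: Un_commute Int_commute)

lemma mean_hit_eq:
  assumes B: "B \<subseteq> S" "B \<noteq> {}" and x: "x \<in> S - B"
  shows "mean_hit S p B x = 1 + avg (mean_hit S p B) x"
proof -
  have C: "S - B \<subseteq> S" "S - B \<noteq> S" using B by auto
  have "mean_hit S p B x = 1 + kill p (S - B) (green p (S - B) (\<lambda>_. 1)) x"
    using x green_eq[OF C, of x "\<lambda>_. 1"] by (simp add: mean_hit_def)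
  also have "kill p (S - B) (green p (S - B) (\<lambda>_. 1)) x = avg (mean_hit S p B) x"
    unfolding kill_def using B by (intro sum.mono_neutral_cong_left) (auto simp: mean_hit_def)
  finally show ?thesis .
qed

lemma mean_hit_nonneg:
  assumes B: "B \<subseteq> S" "B \<noteq> {}" and x: "x \<in> S"
  shows "0 \<le> mean_hit S p B x"
proof -
  have C: "S - B \<subseteq> S" "S - B \<noteq> S" using B by auto
  show ?thesis unfolding mean_hit_def green_def
    using x by (auto intro!: suminf_nonneg green_summable[OF C] kill_pow_nonneg[OF C(1)])
qed

text \<open>
  Summation by parts; reversibility makes the two halves of the double sum equal up to sign.
\<close>

lemma dform_green:
  "E f g = (\<Sum>x\<in>S. w x * (f x - avg f x) * g x)"
proof -
  have swap: "(\<Sum>x\<in>S. \<Sum>y\<in>S. w x * p x y * (f x - f y) * g y) =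
      - (\<Sum>x\<in>S. \<Sum>y\<in>S. w x * p x y * (f x - f y) * g x)"
  proof -
    have "(\<Sum>x\<in>S. \<Sum>y\<in>S. w x * p x y * (f x - f y) * g y) =
        (\<Sum>y\<in>S. \<Sum>x\<in>S. w x * p x y * (f x - f y) * g y)" by (rule sum.swap)
    also have "\<dots> = (\<Sum>y\<in>S. \<Sum>x\<in>S. - (w y * p y x * (f y - f x) * g y))"
    proof (intro sum.cong refl)
      fix x y assume "y \<in> S" "x \<in> S"
      then have "w x * p x y = w y * p y x" by (rule rev[symmetric])
      then show "w x * p x y * (f x - f y) * g y = - (w y * p y x * (f y - f x) * g y)"
        by (simp add: algebra_simps)
    qed
    finally show ?thesis by (simp add: sum_negf)
  qed
  have "E f g = ((\<Sum>x\<in>S. \<Sum>y\<in>S. w x * p x y * (f x - f y) * g x) -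
      (\<Sum>x\<in>S. \<Sum>y\<in>S. w x * p x y * (f x - f y) * g y)) / 2"
    unfolding dform_def by (simp add: right_diff_distrib sum_subtractf)
  also have "\<dots> = (\<Sum>x\<in>S. \<Sum>y\<in>S. w x * p x y * (f x - f y) * g x)"
    unfolding swap by simp
  also have "\<dots> = (\<Sum>x\<in>S. w x * (f x - avg f x) * g x)"
  proof (intro sum.cong refl)
    fix x assume x: "x \<in> S"
    have "(\<Sum>y\<in>S. w x * p x y * (f x - f y) * g x) = w x * g x * (\<Sum>y\<in>S. p x y * f x - p x y * f y)"
      by (simp add: sum_distrib_left algebra_simps)
    also have "(\<Sum>y\<in>S. p x y * f x - p x y * f y) = f x - avg f x"
      using p_sum[OF x] by (simp add: sum_subtractf sum_distrib_right[symmetric])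
    finally show "(\<Sum>y\<in>S. w x * p x y * (f x - f y) * g x) = w x * (f x - avg f x) * g x"
      by (simp add: algebra_simps)
  qed
  finally show ?thesis .
qed

lemma dform_commute: "E f g = E g f"
  unfolding dform_def by (simp add: mult.commute mult.left_commute)

lemma dform_nonneg: "0 \<le> E f f"
proof -
  have "0 \<le> w x * p x y * (f x - f y) * (f x - f y)" if "x \<in> S" "y \<in> S" for x y
    using w_pos[OF that(1)] p_nonneg[OF that] by (auto simp: mult.assoc)
  then show ?thesis unfolding dform_def by (auto intro!: sum_nonneg divide_nonneg_nonneg)
qed

lemma equil_dform:
  assumes AB: "A \<subseteq> S" "B \<subseteq> S" "A \<union> B \<noteq> {}" "A \<inter> B = {}"
    and u: "\<And>x. x \<in> B \<Longrightarrow> u x = 0"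
  shows "E (equi A B) u = (\<Sum>x\<in>A. w x * (1 - avg (equi A B) x) * u x)"
proof -
  have "E (equi A B) u = (\<Sum>x\<in>A. w x * (equi A B x - avg (equi A B) x) * u x)"
    unfolding dform_green
  proof (rule sum.mono_neutral_right)
    show "\<forall>x\<in>S - A. w x * (equi A B x - avg (equi A B) x) * u x = 0"
    proof
      fix x assume "x \<in> S - A"
      then show "w x * (equi A B x - avg (equi A B) x) * u x = 0"
        using u[of x] equil_harmonic[OF AB, of x] by (cases "x \<in> B") auto
    qed
  qed (use AB in auto)
  then show ?thesis by simp
qed

text \<open>
  The potential is harmonic off \<open>A \<union> B\<close>, so its Dirichlet product with any function vanishing on \<open>B\<close>
  sees only the values on \<open>A\<close>. All capacity estimates below are instances of this identity.
\<close>

lemma equil_dform_const: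
  assumes AB: "A \<subseteq> S" "B \<subseteq> S" "A \<union> B \<noteq> {}" "A \<inter> B = {}"
    and u: "\<And>x. x \<in> B \<Longrightarrow> u x = 0" and c: "\<And>x. x \<in> A \<Longrightarrow> u x = c"
  shows "E (equi A B) u = c * cap A B"
proof -
  have "E (equi A B) u = (\<Sum>x\<in>A. w x * (1 - avg (equi A B) x) * c)"
    by (subst equil_dform[OF AB u]) (auto simp: c intro!: sum.cong)
  moreover have "cap A B = (\<Sum>x\<in>A. w x * (1 - avg (equi A B) x) * 1)"
    unfolding capacity_def by (subst equil_dform[OF AB]) (auto simp: equil_B AB)
  ultimately show ?thesis by (simp add: sum_distrib_left mult.commute)
qed

lemma capacity_sum:
  assumes AB: "A \<subseteq> S" "B \<subseteq> S" "A \<union> B \<noteq> {}" "A \<inter> B = {}"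
  shows "cap A B = (\<Sum>x\<in>A. w x * (1 - avg (equi A B) x))"
  unfolding capacity_def by (subst equil_dform[OF AB]) (auto simp: equil_B AB)

lemma dform_diff_left: "E (\<lambda>x. f x - g x) h = E f h - E g h"
  unfolding dform_def
  by (simp add: diff_divide_distrib[symmetric] sum_subtractf[symmetric] algebra_simps)

lemma dform_diff_right: "E h (\<lambda>x. f x - g x) = E h f - E h g"
  using dform_diff_left dform_commute by metis

lemma dirichlet_principle:
  assumes AB: "A \<subseteq> S" "B \<subseteq> S" "A \<union> B \<noteq> {}" "A \<inter> B = {}"
    and u: "\<And>x. x \<in> B \<Longrightarrow> u x = 0" "\<And>x. x \<in> A \<Longrightarrow> u x = 1"
  shows "cap A B \<le> E u u"
proof -
  let ?h = "equi A B"
  have 1: "E ?h u = cap A B" using equil_dform_const[OF AB u] by simp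
  have "0 \<le> E (\<lambda>x. u x - ?h x) (\<lambda>x. u x - ?h x)" by (rule dform_nonneg)
  also have "\<dots> = E u u - 2 * E ?h u + E ?h ?h"
    unfolding dform_diff_left dform_diff_right using dform_commute[of u ?h] by simp
  finally show ?thesis using 1 by (simp add: capacity_def)
qed

lemma capacity_pos:
  assumes AB: "A \<subseteq> S" "B \<subseteq> S" "A \<noteq> {}" "B \<noteq> {}" "A \<inter> B = {}"
  shows "0 < cap A B"
proof (rule ccontr)
  let ?h = "equi A B"
  assume "\<not> 0 < cap A B"
  then have z: "E ?h ?h = 0" using dform_nonneg[of ?h] unfolding capacity_def by simp
  let ?t = "\<lambda>x y. w x * p x y * (?h x - ?h y) * (?h x - ?h y)"
  have t0: "0 \<le> ?t x y" if "x \<in> S" "y \<in> S" for x y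
    using w_pos[OF that(1)] p_nonneg[OF that] by (auto simp: mult.assoc)
  have tz: "?t x y = 0" if "x \<in> S" "y \<in> S" for x y
  proof -
    have "(\<Sum>x\<in>S. \<Sum>y\<in>S. ?t x y) = 0" using z by (simp add: dform_def)
    then have "(\<Sum>y\<in>S. ?t x y) = 0"
      using that t0 by (subst (asm) sum_nonneg_eq_0_iff) (auto intro!: sum_nonneg)
    then show ?thesis using that t0 by (subst (asm) sum_nonneg_eq_0_iff) auto
  qed
  let ?X = "{x \<in> S. ?h x = 1}"
  have "?X \<noteq> {}" using AB by auto
  moreover have "?X \<noteq> S"
  proof -
    obtain b where "b \<in> B" using AB by auto
    then have "b \<in> S - ?X" using AB equil_B[of b B A] by auto
    then show ?thesis by auto
  qed
  ultimately
  obtain a b where "a \<in> ?X" "b \<in> S - ?X" "0 < p a b" using exit[of ?X] by auto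
  then show False using tz[of a b] w_pos[of a] by auto
qed

lemma capacity_commute:
  assumes AB: "A \<subseteq> S" "B \<subseteq> S" "A \<union> B \<noteq> {}" "A \<inter> B = {}"
  shows "cap B A = cap A B"
  unfolding capacity_def dform_def
  by (intro arg_cong2[of _ _ _ _ "(/)"] sum.cong refl) (simp add: equil_swap[OF AB] algebra_simps)

lemma capacity_mono:
  assumes AB: "A \<subseteq> S" "B \<subseteq> S" "A \<union> B \<noteq> {}" "A \<inter> B' = {}" and "B \<subseteq> B'" "B' \<subseteq> S"
  shows "cap A B \<le> cap A B'"
proof -
  have "cap A B \<le> E (equi A B') (equi A B')"
    using assms by (intro dirichlet_principle) (auto simp: equil_B subset_iff)
  then show ?thesis by (simp add: capacity_def)
qed

text \<open>
  Truncation at height \<open>t\<close> replaces one gradient of the potential by the gradient of the truncated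
  function; the product form then only sees the value \<open>t\<close> on \<open>A\<close>.
\<close>

lemma dform_min_le:
  assumes AB: "A \<subseteq> S" "B \<subseteq> S" "A \<union> B \<noteq> {}" "A \<inter> B = {}" and t: "0 \<le> t" "t \<le> 1"
  shows "E (\<lambda>x. min (equi A B x) t) (\<lambda>x. min (equi A B x) t) \<le> t * cap A B"
proof -
  let ?h = "equi A B" let ?m = "\<lambda>x. min (equi A B x) t"
  have "E ?m ?m \<le> E ?h ?m"
    unfolding dform_def
  proof (intro divide_right_mono sum_mono)
    fix x y assume xy: "x \<in> S" "y \<in> S"
    have "(?m x - ?m y) * (?m x - ?m y) \<le> (?h x - ?h y) * (?m x - ?m y)"
    proof (cases "?h x \<le> ?h y")
      case True
      then show ?thesis by (intro mult_right_mono_neg) auto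
    next
      case False
      then show ?thesis by (intro mult_right_mono) auto
    qed
    then show "w x * p x y * (?m x - ?m y) * (?m x - ?m y) \<le> w x * p x y * (?h x - ?h y) * (?m x - ?m y)"
      using w_pos[OF xy(1)] p_nonneg[OF xy] by (simp add: mult.assoc mult_left_mono)
  qed auto
  also have "\<dots> = t * cap A B"
    using t by (intro equil_dform_const[OF AB]) (auto simp: equil_B AB)
  finally show ?thesis .
qed

text \<open>
  The truncated and rescaled potential is a test function for the capacity of a superlevel set.
  Together with a lower bound of the capacity by the weight, this bounds the weight of the set.
\<close>

lemma capacity_level_set:
  assumes AB: "A \<subseteq> S" "B \<subseteq> S" "A \<union> B \<noteq> {}" "A \<inter> B = {}" and t: "0 < t" "t \<le> 1"
    and X: "X \<subseteq> S" "X \<noteq> {}" "\<And>x. x \<in> X \<Longrightarrow> t \<le> equi A B x"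
    and D: "D \<subseteq> B"
  shows "cap X D \<le> cap A B / t"
proof -
  let ?m = "\<lambda>x. min (equi A B x) t"
  have XB: "X \<inter> B = {}" using X(3) t AB by (force simp: equil_B)
  have "cap X D \<le> E (\<lambda>x. ?m x / t) (\<lambda>x. ?m x / t)"
  proof (rule dirichlet_principle)
    show "?m x / t = 0" if "x \<in> D" for x using that D AB t by (auto simp: equil_B subset_iff)
    show "?m x / t = 1" if "x \<in> X" for x using X(3)[OF that] t by simp
  qed (use X D AB XB in auto)
  also have "\<dots> = E ?m ?m / t\<^sup>2"
    unfolding dform_def
    by (simp add: diff_divide_distrib[symmetric] sum_divide_distrib power2_eq_square field_simps)
  also have "\<dots> \<le> t * cap A B / t\<^sup>2"
    using dform_min_le[OF AB] t by (intro divide_right_mono) auto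
  also have "\<dots> = cap A B / t" using t by (simp add: power2_eq_square)
  finally show ?thesis .
qed

text \<open>
  The symmetric form of the Dirichlet product of the potential of \<open>A\<close> and the mean hitting time of
  \<open>B\<close>, evaluated by parts in either argument: the potential has Laplacian concentrated on \<open>A\<close>, the
  mean hitting time has Laplacian one off \<open>B\<close>.
\<close>

lemma mean_hit_formula:
  assumes AB: "A \<subseteq> S" "B \<subseteq> S" "B \<noteq> {}" "A \<inter> B = {}"
  shows "(\<Sum>x\<in>A. w x * (1 - avg (equi A B) x) * mean_hit S p B x) = (\<Sum>x\<in>S. w x * equi A B x)"
proof -
  let ?T = "mean_hit S p B"
  have TB: "?T x = 0" if "x \<in> B" for x using that by (simp add: mean_hit_def)
  have "(\<Sum>x\<in>A. w x * (1 - avg (equi A B) x) * ?T x) = E (equi A B) ?T"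
    using AB TB by (subst equil_dform) auto
  also have "\<dots> = E ?T (equi A B)" by (rule dform_commute)
  also have "\<dots> = (\<Sum>x\<in>S. w x * (?T x - avg ?T x) * equi A B x)" by (rule dform_green)
  also have "\<dots> = (\<Sum>x\<in>S. w x * equi A B x)"
  proof (intro sum.cong refl)
    fix x assume x: "x \<in> S"
    show "w x * (?T x - avg ?T x) * equi A B x = w x * equi A B x"
    proof (cases "x \<in> B")
      case True then show ?thesis using AB by (simp add: equil_B)
    next
      case False then show ?thesis using mean_hit_eq[of B x] AB x by simp
    qed
  qed
  finally show ?thesis .
qed

end

section \<open>Comparison of two chains and metastable valleys\<close>

text \<open>
  The relative energy that the harmonic flow from \<open>A\<close> to \<open>B\<close> dissipates on each oriented edge; a
  probability distribution on pairs of states.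
\<close>

definition flow_weight ::
    "'s set \<Rightarrow> ('s \<Rightarrow> 's \<Rightarrow> real) \<Rightarrow> ('s \<Rightarrow> real) \<Rightarrow> 's set \<Rightarrow> 's set \<Rightarrow> 's \<times> 's \<Rightarrow> real" where
  "flow_weight S p w A B = (\<lambda>(x, y). w x * p x y * (equil S p A B x - equil S p A B y)\<^sup>2
      / (2 * capacity S p w A B))"

context reversible_chain
begin

lemma flow_weight_nonneg:
  assumes "x \<in> S" "y \<in> S"
  shows "0 \<le> flow_weight S p w A B (x, y)"
  using w_pos[OF assms(1)] p_nonneg[OF assms] dform_nonneg unfolding flow_weight_def capacity_def
  by auto

lemma flow_weight_sum:
  assumes AB: "A \<subseteq> S" "B \<subseteq> S" "A \<noteq> {}" "B \<noteq> {}" "A \<inter> B = {}"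
  shows "(\<Sum>e\<in>S \<times> S. flow_weight S p w A B e) = 1"
proof -
  have "(\<Sum>e\<in>S \<times> S. flow_weight S p w A B e) =
      (\<Sum>x\<in>S. \<Sum>y\<in>S. w x * p x y * (equi A B x - equi A B y)\<^sup>2 / (2 * cap A B))"
    unfolding flow_weight_def by (simp add: sum.cartesian_product)
  also have "\<dots> = cap A B / cap A B"
    unfolding sum_divide_distrib[symmetric] capacity_def dform_def
    by (simp add: power2_eq_square mult.assoc)
  finally show ?thesis using capacity_pos[OF AB] by simp
qed

lemma valley_equil_sum:
  assumes I: "finite I" "I \<noteq> {}"
    and M: "\<And>l. l \<in> I \<Longrightarrow> M l \<noteq> {} \<and> M l \<subseteq> S" and disj: "disjoint_family_on M I"
    and x: "x \<in> S"
  defines "U \<equiv> \<Union>l\<in>I. M l"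
  shows "(\<Sum>l\<in>I. equi (M l) (U - M l) x) = 1"
proof (rule harmonic_unique[where u="\<lambda>x. \<Sum>l\<in>I. equi (M l) (U - M l) x" and v="\<lambda>_. 1" and C="S - U"])
  have U: "U \<subseteq> S" "U \<noteq> {}" using M I by (auto simp: U_def)
  have AB: "M l \<subseteq> S" "U - M l \<subseteq> S" "M l \<union> (U - M l) \<noteq> {}" "M l \<inter> (U - M l) = {}" if "l \<in> I" for l
    using M that U by auto
  have MU: "M l \<union> (U - M l) = U" if "l \<in> I" for l using that by (auto simp: U_def)
  show "S - U \<subseteq> S" "S - U \<noteq> S" using U by auto
  show "(\<Sum>l\<in>I. equi (M l) (U - M l) x) = avg (\<lambda>x. \<Sum>l\<in>I. equi (M l) (U - M l) x) x"
    if x: "x \<in> S - U" for x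
  proof -
    have "(\<Sum>l\<in>I. equi (M l) (U - M l) x) = (\<Sum>l\<in>I. avg (equi (M l) (U - M l)) x)"
      using equil_harmonic[OF AB] MU x by (intro sum.cong) auto
    also have "\<dots> = avg (\<lambda>x. \<Sum>l\<in>I. equi (M l) (U - M l) x) x"
      unfolding sum_distrib_left by (rule sum.swap)
    finally show ?thesis .
  qed
  show "1 = avg (\<lambda>_. 1) x" if "x \<in> S - U" for x using p_sum that by simp
  show "(\<Sum>l\<in>I. equi (M l) (U - M l) x) = 1" if x: "x \<in> S - (S - U)" for x
  proof -
    obtain j where j: "j \<in> I" "x \<in> M j" using x by (auto simp: U_def)
    have "x \<notin> M l" if "l \<in> I" "l \<noteq> j" for l
      using disjoint_family_onD[OF disj that(1) j(1) that(2)] j(2) by auto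
    then have "(\<Sum>l\<in>I. equi (M l) (U - M l) x) = (\<Sum>l\<in>I. if l = j then 1 else 0)"
      using j by (intro sum.cong refl) (auto simp: U_def equil_def)
    also have "\<dots> = 1" using I j by simp
    finally show ?thesis .
  qed
qed (rule x)

text \<open>
  A set \<open>X\<close> inside the valley of \<open>M j\<close> sends at least the share \<open>1 / card I\<close> of its equilibrium
  charge to \<open>M j\<close>, because from each of its points \<open>M j\<close> is the most likely metastable set to be hit
  first. The total charge sent to \<open>M j\<close> is at most the capacity of \<open>X\<close> and \<open>M j\<close> alone.
\<close>

lemma valley_capacity:
  assumes I: "finite I" "I \<noteq> {}"
    and M: "\<And>l. l \<in> I \<Longrightarrow> M l \<noteq> {} \<and> M l \<subseteq> S" and disj: "disjoint_family_on M I"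
    and U: "U = (\<Union>l\<in>I. M l)"
    and X: "X \<subseteq> S - U" and j: "j \<in> I"
    and valley: "\<And>x l. x \<in> X \<Longrightarrow> l \<in> I - {j} \<Longrightarrow> equi (M l) (U - M l) x \<le> equi (M j) (U - M j) x"
  shows "cap X U \<le> real (card I) * cap X (M j)"
proof -
  define k where "k = equi X U"
  define h where "h = equi X (M j)"
  define g where "g = equi (M j) (U - M j)"
  have US: "U \<subseteq> S" "U \<noteq> {}" "M j \<subseteq> U" using M I j by (auto simp: U)
  have kAB: "X \<subseteq> S" "U \<subseteq> S" "X \<union> U \<noteq> {}" "X \<inter> U = {}" using X US by auto
  have hAB: "X \<subseteq> S" "M j \<subseteq> S" "X \<union> M j \<noteq> {}" "X \<inter> M j = {}" using X US M[OF j] by auto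
  have gAB: "M j \<subseteq> S" "U - M j \<subseteq> S" "M j \<union> (U - M j) \<noteq> {}" "M j \<inter> (U - M j) = {}"
    using US M[OF j] by auto
  have gU: "M j \<union> (U - M j) = U" using US by auto
  have kU: "k x = 0" if "x \<in> U" for x using that kAB by (simp add: k_def equil_B)
  have kX: "k x = 1" if "x \<in> X" for x using that by (simp add: k_def)
  have k0: "0 \<le> avg k x" and k1: "avg k x \<le> 1" if "x \<in> S" for x
  proof -
    show "0 \<le> avg k x"
      unfolding k_def using that p_nonneg equil_nonneg[OF kAB] by (auto intro!: sum_nonneg)
    have "avg k x \<le> (\<Sum>y\<in>S. p x y * 1)"
      unfolding k_def using that p_nonneg equil_le_one[OF kAB] by (intro sum_mono mult_left_mono) auto
    then show "avg k x \<le> 1" using p_sum[OF that] by simp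
  qed
  have kharm: "k x = avg k x" if "x \<in> S - (X \<union> U)" for x
    using equil_harmonic[OF kAB that] by (simp add: k_def)
  have split: "E k f = (\<Sum>x\<in>X. w x * (1 - avg k x) * f x) - (\<Sum>x\<in>U. w x * avg k x * f x)" for f
  proof -
    have "E k f = (\<Sum>x\<in>X \<union> U. w x * (k x - avg k x) * f x)"
      unfolding dform_green using kAB kharm by (intro sum.mono_neutral_right) auto
    also have "\<dots> = (\<Sum>x\<in>X. w x * (k x - avg k x) * f x) + (\<Sum>x\<in>U. w x * (k x - avg k x) * f x)"
      using kAB fin_sub by (intro sum.union_disjoint) auto
    also have "(\<Sum>x\<in>X. w x * (k x - avg k x) * f x) = (\<Sum>x\<in>X. w x * (1 - avg k x) * f x)"
      by (intro sum.cong) (auto simp: kX)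
    also have "(\<Sum>x\<in>U. w x * (k x - avg k x) * f x) = - (\<Sum>x\<in>U. w x * avg k x * f x)"
      unfolding sum_negf[symmetric] by (intro sum.cong) (auto simp: kU)
    finally show ?thesis by simp
  qed
  have "E h k = 1 * cap X (M j)"
    unfolding h_def using kU kX US by (intro equil_dform_const[OF hAB]) auto
  then have hk: "cap X (M j) = E k h" by (simp add: dform_commute)
  have capXU: "cap X U = (\<Sum>x\<in>X. w x * (1 - avg k x))"
    unfolding k_def by (rule capacity_sum[OF kAB])
  have "E k (\<lambda>_. 1) = 0" by (simp add: dform_def)
  then have tot: "(\<Sum>x\<in>X. w x * (1 - avg k x)) = (\<Sum>x\<in>U. w x * avg k x)"
    using split[of "\<lambda>_. 1"] by simp
  have "E g k = 0"
    unfolding dform_green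
  proof (intro sum.neutral ballI)
    fix x assume "x \<in> S"
    then show "w x * (g x - avg g x) * k x = 0"
      using kU equil_harmonic[OF gAB, of x] gU by (cases "x \<in> U") (auto simp: g_def)
  qed
  then have gk: "(\<Sum>x\<in>X. w x * (1 - avg k x) * g x) = (\<Sum>x\<in>U. w x * avg k x * g x)"
    using split[of g] by (simp add: dform_commute)
  have hX: "h x = 1" if "x \<in> X" for x using that by (simp add: h_def)
  have gle: "1 / real (card I) \<le> g x" if "x \<in> X" for x
  proof -
    have xS: "x \<in> S" using that X by auto
    have "1 = (\<Sum>l\<in>I. equi (M l) (U - M l) x)"
      using valley_equil_sum[OF I M disj xS] by (simp add: U)
    also have "\<dots> \<le> (\<Sum>l\<in>I. g x)"
      using valley[OF that] by (intro sum_mono) (auto simp: g_def)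
    finally show ?thesis using I by (simp add: field_simps card_gt_0_iff)
  qed
  have "cap X U / real (card I) = (\<Sum>x\<in>X. w x * (1 - avg k x) * (1 / real (card I)))"
    by (simp add: capXU sum_divide_distrib)
  also have "\<dots> \<le> (\<Sum>x\<in>X. w x * (1 - avg k x) * g x)"
  proof (intro sum_mono mult_left_mono)
    fix x assume x: "x \<in> X"
    then have "x \<in> S" using kAB by auto
    then show "0 \<le> w x * (1 - avg k x)"
      using k1[of x] w_pos[of x] by simp
  qed (rule gle)
  also have "\<dots> = (\<Sum>x\<in>U. w x * avg k x * g x)" by (rule gk)
  also have "\<dots> \<le> (\<Sum>x\<in>U. w x * avg k x * (1 - h x))"
  proof (intro sum_mono mult_left_mono)
    fix x assume x: "x \<in> U"
    show "g x \<le> 1 - h x"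
    proof (cases "x \<in> M j")
      case True then show ?thesis using hAB by (simp add: g_def h_def equil_B)
    next
      case False then show ?thesis
        using x gAB equil_le_one[OF hAB, of x] US by (auto simp: g_def h_def equil_B)
    qed
    have "x \<in> S" using x US by auto
    then show "0 \<le> w x * avg k x" using k0[of x] w_pos[of x] by simp
  qed
  also have "\<dots> = (\<Sum>x\<in>X. w x * (1 - avg k x)) - (\<Sum>x\<in>U. w x * avg k x * h x)"
    using tot by (simp add: right_diff_distrib sum_subtractf)
  also have "\<dots> = E k h" unfolding split using hX by simp
  finally show ?thesis using I hk by (simp add: field_simps card_gt_0_iff)
qed

end

text \<open>
  A tail bound \<open>R / t\<close> is just not integrable at \<open>0\<close>; cutting at height \<open>(1/2) ^ n\<close> costs a factor \<open>n\<close>.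
\<close>

lemma dyadic_sum_bound:
  fixes f v :: "'s \<Rightarrow> real"
  assumes "finite X" and f: "\<And>x. x \<in> X \<Longrightarrow> f x \<le> 1" and v: "\<And>x. x \<in> X \<Longrightarrow> 0 \<le> v x"
    and R: "\<And>t. 0 < t \<Longrightarrow> t \<le> 1 \<Longrightarrow> (\<Sum>x\<in>{x \<in> X. t \<le> f x}. v x) \<le> R / t"
  shows "(\<Sum>x\<in>X. v x * f x) \<le> (1/2) ^ n * (\<Sum>x\<in>X. v x) + 2 * real n * R"
proof -
  define d where "d k x = (if (1/2) ^ Suc k \<le> f x then (1/2) ^ k else (0::real))" for k x
  have pt: "f x \<le> (1/2) ^ n + (\<Sum>k<n. d k x)" if "x \<in> X" for x
  proof (induction n)
    case 0 then show ?case using f that by simp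
  next
    case (Suc n)
    have "0 \<le> (\<Sum>k<n. d k x)" by (intro sum_nonneg) (auto simp: d_def)
    moreover have "0 \<le> (1/2::real) ^ n" "(1/2::real) ^ Suc n = (1/2) ^ n / 2" by simp_all
    moreover have "d n x = (1/2) ^ n \<or> f x \<le> (1/2) ^ Suc n \<and> d n x = 0" by (auto simp: d_def)
    moreover have "(\<Sum>k<Suc n. d k x) = (\<Sum>k<n. d k x) + d n x" by simp
    ultimately show ?case using Suc by linarith
  qed
  have "(\<Sum>x\<in>X. v x * f x) \<le> (\<Sum>x\<in>X. v x * ((1/2) ^ n + (\<Sum>k<n. d k x)))"
    using pt v by (intro sum_mono mult_left_mono) auto
  also have "\<dots> = (1/2) ^ n * (\<Sum>x\<in>X. v x) + (\<Sum>x\<in>X. \<Sum>k<n. v x * d k x)"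
    by (simp add: distrib_left sum.distrib sum_distrib_left sum_distrib_right mult.commute)
  also have "(\<Sum>x\<in>X. \<Sum>k<n. v x * d k x) = (\<Sum>k<n. \<Sum>x\<in>X. v x * d k x)" by (rule sum.swap)
  also have "\<dots> \<le> (\<Sum>k<n. 2 * R)"
  proof (intro sum_mono)
    fix k :: nat
    have "(\<Sum>x\<in>X. v x * d k x) = (\<Sum>x\<in>{x \<in> X. (1/2) ^ Suc k \<le> f x}. v x * (1/2) ^ k)"
      unfolding d_def using assms(1) by (subst sum.inter_filter) (auto intro!: sum.cong)
    also have "\<dots> = (1/2) ^ k * (\<Sum>x\<in>{x \<in> X. (1/2) ^ Suc k \<le> f x}. v x)"
      by (simp add: sum_distrib_left mult.commute)
    also have "\<dots> \<le> (1/2) ^ k * (R / (1/2) ^ Suc k)"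
      by (intro mult_left_mono R power_le_one) simp_all
    also have "\<dots> = 2 * R" by simp
    finally show "(\<Sum>x\<in>X. v x * d k x) \<le> 2 * R" .
  qed
  finally show ?thesis by simp
qed

text \<open>
  Two chains on the same states whose conductances differ by the factor \<open>\<gamma>\<close> on every edge. The
  diagonal is exempt: holding probabilities do not enter the Dirichlet form.
\<close>

locale chain_pair = reversible_chain S p w + q: reversible_chain S p' w'
  for S :: "'s set" and p w p' w' +
  fixes \<gamma> :: "'s \<times> 's \<Rightarrow> real"
  assumes \<gamma>_pos: "\<And>x y. x \<in> S \<Longrightarrow> y \<in> S \<Longrightarrow> 0 < \<gamma> (x, y)"
    and \<gamma>: "\<And>x y. x \<in> S \<Longrightarrow> y \<in> S \<Longrightarrow> x \<noteq> y \<Longrightarrow> w' x * p' x y = \<gamma> (x, y) * (w x * p x y)"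
begin

abbreviation "cap' A B \<equiv> capacity S p' w' A B"
abbreviation "flow A B \<equiv> flow_weight S p w A B"

lemma dform'_eq:
  "dform S p' w' f g = (\<Sum>x\<in>S. \<Sum>y\<in>S. \<gamma> (x, y) * (w x * p x y) * (f x - f y) * (g x - g y)) / 2"
  unfolding dform_def
proof (intro arg_cong2[of _ _ _ _ "(/)"] sum.cong refl)
  fix x y assume "x \<in> S" "y \<in> S"
  then show "w' x * p' x y * (f x - f y) * (g x - g y) =
      \<gamma> (x, y) * (w x * p x y) * (f x - f y) * (g x - g y)"
    using \<gamma>[of x y] by (cases "x = y") auto
qed

lemma flow_sum_dform:
  assumes AB: "A \<subseteq> S" "B \<subseteq> S" "A \<noteq> {}" "B \<noteq> {}" "A \<inter> B = {}"
  shows "cap A B * (\<Sum>e\<in>S \<times> S. flow A B e * f e) =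
     (\<Sum>x\<in>S. \<Sum>y\<in>S. f (x, y) * (w x * p x y) * (equi A B x - equi A B y)\<^sup>2) / 2"
proof -
  have "cap A B * (\<Sum>e\<in>S \<times> S. flow A B e * f e) =
     (\<Sum>x\<in>S. \<Sum>y\<in>S. cap A B * (flow A B (x, y) * f (x, y)))"
    by (simp add: sum_distrib_left sum.cartesian_product)
  also have "\<dots> = (\<Sum>x\<in>S. \<Sum>y\<in>S. f (x, y) * (w x * p x y) * (equi A B x - equi A B y)\<^sup>2 / 2)"
    using capacity_pos[OF AB] by (intro sum.cong refl) (auto simp: flow_weight_def field_simps)
  finally show ?thesis by (simp add: sum_divide_distrib)
qed

text \<open>
  Dirichlet principle for the second chain with the potential of the first as test function.
\<close>

lemma capacity_upper:
  assumes AB: "A \<subseteq> S" "B \<subseteq> S" "A \<noteq> {}" "B \<noteq> {}" "A \<inter> B = {}"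
  shows "cap' A B \<le> cap A B * (\<Sum>e\<in>S \<times> S. flow A B e * \<gamma> e)"
proof -
  have "cap' A B \<le> dform S p' w' (equi A B) (equi A B)"
    using AB by (intro q.dirichlet_principle) (auto simp: equil_B)
  also have "\<dots> = cap A B * (\<Sum>e\<in>S \<times> S. flow A B e * \<gamma> e)"
    unfolding flow_sum_dform[OF AB] dform'_eq by (simp add: power2_eq_square mult.assoc)
  finally show ?thesis .
qed

text \<open>
  Thomson's principle for the harmonic flow of the first chain: the Dirichlet product of the two
  potentials is the first capacity, and the weighted inequality between arithmetic and geometric mean
  separates it into the two energies.
\<close>

lemma capacity_lower:
  assumes AB: "A \<subseteq> S" "B \<subseteq> S" "A \<noteq> {}" "B \<noteq> {}" "A \<inter> B = {}"
  shows "cap A B \<le> cap' A B * (\<Sum>e\<in>S \<times> S. flow A B e * inverse (\<gamma> e))"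
proof -
  define h where "h = equi A B"
  define h' where "h' = equil S p' A B"
  define Q where "Q = (\<Sum>e\<in>S \<times> S. flow A B e * inverse (\<gamma> e))"
  have AB': "A \<union> B \<noteq> {}" using AB by auto
  have cpos: "0 < cap A B" by (rule capacity_pos[OF AB])
  have h'B: "h' x = 0" if "x \<in> B" for x using that AB q.equil_B by (simp add: h'_def)
  have h'A: "h' x = 1" if "x \<in> A" for x using that by (simp add: h'_def)
  have fg0: "0 \<le> flow A B e * inverse (\<gamma> e)" if "e \<in> S \<times> S" for e
    using that flow_weight_nonneg \<gamma>_pos by (cases e) (auto intro!: mult_nonneg_nonneg simp: less_imp_le)
  have Q0: "0 < Q"
  proof -
    have "Q \<noteq> 0"
    proof
      assume "Q = 0"
      then have "\<forall>e\<in>S \<times> S. flow A B e * inverse (\<gamma> e) = 0"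
        unfolding Q_def using fg0 by (subst (asm) sum_nonneg_eq_0_iff) simp_all
      then have "\<forall>e\<in>S \<times> S. flow A B e = 0" using \<gamma>_pos by force
      then have "(\<Sum>e\<in>S \<times> S. flow A B e) = 0" by (rule sum.neutral)
      then show False using flow_weight_sum[OF AB] by simp
    qed
    moreover have "0 \<le> Q" unfolding Q_def using fg0 by (rule sum_nonneg)
    ultimately show ?thesis by simp
  qed
  have "cap A B = E h h'"
    unfolding h_def using equil_dform_const[OF AB(1,2) AB' AB(5) h'B h'A] by simp
  also have "\<dots> \<le> (\<Sum>x\<in>S. \<Sum>y\<in>S. (inverse (\<gamma> (x,y)) * (w x * p x y) * (h x - h y)\<^sup>2) / Q / 2 +
      Q * (\<gamma> (x,y) * (w x * p x y) * (h' x - h' y) * (h' x - h' y)) / 2) / 2"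
    unfolding dform_def
  proof (intro divide_right_mono sum_mono)
    fix x y assume xy: "x \<in> S" "y \<in> S"
    define c where "c = w x * p x y"
    define a where "a = h x - h y"
    define b where "b = h' x - h' y"
    define g where "g = \<gamma> (x, y)"
    have g: "0 < g" using \<gamma>_pos[OF xy] by (simp add: g_def)
    have c: "0 \<le> c" using w_pos[OF xy(1)] p_nonneg[OF xy] by (simp add: c_def)
    \<comment> \<open>the weight \<open>Q\<close> is the one for which both halves come out equal\<close>
    have "0 \<le> (a - Q * g * b)\<^sup>2 / (Q * g)" using g Q0 by auto
    then have "a * b \<le> a\<^sup>2 / (Q * g) / 2 + Q * g * b\<^sup>2 / 2"
      using g Q0 by (simp add: power2_eq_square field_simps)
    then have "c * (a * b) \<le> c * (a\<^sup>2 / (Q * g) / 2 + Q * g * b\<^sup>2 / 2)"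
      using c by (rule mult_left_mono)
    also have "\<dots> = (inverse g * c * a\<^sup>2) / Q / 2 + Q * (g * c * b * b) / 2"
      using g Q0 by (simp add: power2_eq_square field_simps)
    finally show "w x * p x y * (h x - h y) * (h' x - h' y) \<le>
       (inverse (\<gamma> (x,y)) * (w x * p x y) * (h x - h y)\<^sup>2) / Q / 2 +
        Q * (\<gamma> (x,y) * (w x * p x y) * (h' x - h' y) * (h' x - h' y)) / 2"
      by (simp add: a_def b_def c_def g_def mult.assoc)
  qed auto
  also have "\<dots> = (cap A B * Q) / Q / 2 + Q * dform S p' w' h' h' / 2"
    unfolding Q_def[symmetric] dform'_eq
    by (subst (2) Q_def, subst flow_sum_dform[OF AB])
      (simp add: h_def sum.distrib sum_divide_distrib[symmetric] sum_distrib_left[symmetric] add_divide_distrib)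
  also have "\<dots> = cap A B / 2 + Q * cap' A B / 2"
    using Q0 by (simp add: h'_def capacity_def)
  finally show ?thesis by (simp add: Q_def mult.commute)
qed

lemma capacity_upper_const:
  assumes AB: "A \<subseteq> S" "B \<subseteq> S" "A \<noteq> {}" "B \<noteq> {}" "A \<inter> B = {}"
    and c: "\<And>x y. x \<in> S \<Longrightarrow> y \<in> S \<Longrightarrow> \<gamma> (x, y) \<le> c"
  shows "cap' A B \<le> c * cap A B"
proof -
  have "(\<Sum>e\<in>S \<times> S. flow A B e * \<gamma> e) \<le> (\<Sum>e\<in>S \<times> S. flow A B e * c)"
    using c flow_weight_nonneg by (intro sum_mono mult_left_mono) auto
  also have "\<dots> = c" using flow_weight_sum[OF AB] by (simp add: sum_distrib_right[symmetric])
  finally have "cap A B * (\<Sum>e\<in>S \<times> S. flow A B e * \<gamma> e) \<le> cap A B * c"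
    using capacity_pos[OF AB] by (intro mult_left_mono) auto
  then show ?thesis using capacity_upper[OF AB] by (simp add: mult.commute)
qed

lemma capacity_lower_const:
  assumes AB: "A \<subseteq> S" "B \<subseteq> S" "A \<noteq> {}" "B \<noteq> {}" "A \<inter> B = {}"
    and c: "\<And>x y. x \<in> S \<Longrightarrow> y \<in> S \<Longrightarrow> inverse (\<gamma> (x, y)) \<le> c"
  shows "cap A B \<le> c * cap' A B"
proof -
  have "(\<Sum>e\<in>S \<times> S. flow A B e * inverse (\<gamma> e)) \<le> (\<Sum>e\<in>S \<times> S. flow A B e * c)"
    using c flow_weight_nonneg by (intro sum_mono mult_left_mono) auto
  also have "\<dots> = c" using flow_weight_sum[OF AB] by (simp add: sum_distrib_right[symmetric])
  finally have "cap' A B * (\<Sum>e\<in>S \<times> S. flow A B e * inverse (\<gamma> e)) \<le> cap' A B * c"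
    using q.capacity_pos[OF AB] by (intro mult_left_mono) auto
  then show ?thesis using capacity_lower[OF AB] by (simp add: mult.commute)
qed


text \<open>
  Metastability of the first chain is used only through the two capacity bounds \<open>up\<close> and \<open>low\<close>, which
  change by bounded factors under the passage to the second chain. A superlevel set in a valley
  has capacity to its metastable set at least of the order of its weight, and at most
  \<open>cap' (M i) B / t\<close>, which is smaller by the factor \<open>\<rho>\<close>; the dyadic sum turns this into the bound.
  The valleys with index above \<open>i\<close> are controlled by their weight alone.
\<close>

theorem equil_mass_metastable:
  fixes M V :: "nat \<Rightarrow> 's set" and K i n :: nat and m \<rho> d \<Lambda> \<eta> :: real
  assumes M: "\<And>l. l \<in> {1..K} \<Longrightarrow> M l \<noteq> {} \<and> M l \<subseteq> S" and disj: "disjoint_family_on M {1..K}"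
    and U: "U = (\<Union>l\<in>{1..K}. M l)"
    and m: "0 < m" and \<rho>: "0 \<le> \<rho>"
    and up: "\<And>X. X \<subseteq> S - U \<Longrightarrow> X \<noteq> {} \<Longrightarrow> m * (\<Sum>x\<in>X. w x) \<le> cap X U"
    and low: "\<And>j. j \<in> {1..K} \<Longrightarrow> cap (M j) (U - M j) \<le> \<rho> * m * (\<Sum>x\<in>M j. w x)"
    and V: "disjoint_family_on V {1..K}" "(\<Union>l\<in>{1..K}. V l) = S"
    and MV: "\<And>l. l \<in> {1..K} \<Longrightarrow> M l \<subseteq> V l"
    and valley: "\<And>j l x. j \<in> {1..K} \<Longrightarrow> l \<in> {1..K} - {j} \<Longrightarrow> x \<in> V j - M j \<Longrightarrow>
        x \<notin> U \<and> equi (M l) (U - M l) x \<le> equi (M j) (U - M j) x"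
    and i: "i \<in> {2..K}"
    and nondeg: "\<And>j. j \<in> {i+1..K} \<Longrightarrow> (\<Sum>x\<in>V j. w x) \<le> \<eta> * (\<Sum>x\<in>V i. w x)" and \<eta>: "0 \<le> \<eta>"
    and ww: "\<And>x. x \<in> S \<Longrightarrow> w' x \<le> exp d * w x \<and> w x \<le> exp d * w' x"
    and \<gamma>d: "\<And>x y. x \<in> S \<Longrightarrow> y \<in> S \<Longrightarrow> \<gamma> (x, y) \<le> exp d \<and> inverse (\<gamma> (x, y)) \<le> exp d"
    and \<Lambda>: "(\<Sum>x\<in>S. w' x) \<le> \<Lambda> * (\<Sum>x\<in>V i. w' x)"
  shows "\<bar>(\<Sum>x\<in>S. w' x * equil S p' (M i) (\<Union>j\<in>{1..<i}. M j) x) - (\<Sum>x\<in>V i. w' x)\<bar>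
     \<le> real K * ((1/2) ^ n * \<Lambda> + 2 * real n * real K * exp (4 * d) * \<rho> + exp (2 * d) * \<eta>) * (\<Sum>x\<in>V i. w' x)"
proof -
  define B where "B = (\<Union>j\<in>{1..<i}. M j)"
  define h where "h = equil S p' (M i) B"
  define mass where "mass X = (\<Sum>x\<in>X. w x)" for X
  define mass' where "mass' X = (\<Sum>x\<in>X. w' x)" for X
  define I where "I = {1..K}"
  have iI: "i \<in> I" and K: "1 \<le> K" using i by (auto simp: I_def)
  have Mi: "M l \<noteq> {}" "M l \<subseteq> S" if "l \<in> I" for l using M that by (auto simp: I_def)
  have US: "U \<subseteq> S" using M unfolding U by blast
  have disjM: "M j \<inter> M l = {}" if "j \<in> I" "l \<in> I" "j \<noteq> l" for j l
    using disjoint_family_onD[OF disj] that by (auto simp: I_def)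
  have VS: "V l \<subseteq> S" if "l \<in> I" for l using V(2) that by (auto simp: I_def)
  have finV: "finite (V l)" if "l \<in> I" for l using VS[OF that] by (rule fin_sub)
  have B: "B \<subseteq> U - M i" "B \<noteq> {}" "B \<subseteq> S"
  proof -
    show "B \<subseteq> U - M i"
    proof
      fix x assume "x \<in> B"
      then obtain j where j: "j \<in> {1..<i}" "x \<in> M j" by (auto simp: B_def)
      then have "j \<in> I" "j \<noteq> i" using i by (auto simp: I_def)
      then show "x \<in> U - M i" using j disjM[of j i] iI by (auto simp: U I_def)
    qed
    then show "B \<subseteq> S" using US by auto
    have "M 1 \<subseteq> B" "M 1 \<noteq> {}" using i M[of 1] by (auto simp: B_def)
    then show "B \<noteq> {}" by auto
  qed
  have AB: "M i \<subseteq> S" "B \<subseteq> S" "M i \<noteq> {}" "B \<noteq> {}" "M i \<inter> B = {}" using B Mi[OF iI] by auto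
  have AB1: "M i \<subseteq> S" "B \<subseteq> S" "M i \<union> B \<noteq> {}" "M i \<inter> B = {}" using AB by auto
  have AB2: "B \<subseteq> S" "M i \<subseteq> S" "B \<union> M i \<noteq> {}" "B \<inter> M i = {}" using AB by auto
  have mass'_le: "mass' X \<le> exp d * mass X" and mass_le: "mass X \<le> exp d * mass' X" if "X \<subseteq> S" for X
    unfolding mass_def mass'_def sum_distrib_left using ww that by (auto intro!: sum_mono)
  have mass'_mono: "mass' X \<le> mass' Y" if "X \<subseteq> Y" "Y \<subseteq> S" for X Y
    unfolding mass'_def using that fin_sub[of Y] q.w_pos by (intro sum_mono2) (auto simp: less_imp_le subset_iff)
  have mass'0: "0 \<le> mass' X" if "X \<subseteq> S" for X
    unfolding mass'_def using that q.w_pos by (intro sum_nonneg) (auto simp: less_imp_le subset_iff)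
  define R where "R = real K * exp (4 * d) * \<rho> * mass' (M i)"
  have R0: "0 \<le> R" unfolding R_def using \<rho> mass'0[OF AB(1)] by simp
  have capAB: "cap' (M i) B \<le> exp (2 * d) * \<rho> * m * mass' (M i)"
  proof -
    have "cap' (M i) B \<le> exp d * cap (M i) B"
      using \<gamma>d by (intro capacity_upper_const AB) auto
    also have "cap (M i) B \<le> cap (M i) (U - M i)"
      using AB B US by (intro capacity_mono) auto
    also have "\<dots> \<le> \<rho> * m * mass (M i)" using low iI by (simp add: mass_def I_def)
    also have "\<dots> \<le> \<rho> * m * (exp d * mass' (M i))"
      using mass_le[OF AB(1)] \<rho> m by (intro mult_left_mono) auto
    also have "exp d * (\<rho> * m * (exp d * mass' (M i))) = exp (2 * d) * \<rho> * m * mass' (M i)"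
      by (simp add: exp_double power2_eq_square)
    finally show ?thesis by simp
  qed
  \<comment> \<open>\<open>(A', B')\<close> is chosen such that the potential vanishes on the metastable set of the valley\<close>
  have level: "(\<Sum>x\<in>V j. w' x * equil S p' A' B' x) \<le> (1/2) ^ n * mass' S + 2 * real n * R"
    if j: "j \<in> I" and A'B': "(A', B') = (M i, B) \<or> (A', B') = (B, M i)" and MjB: "M j \<subseteq> B'" for j A' B'
  proof -
    have ab: "A' \<subseteq> S" "B' \<subseteq> S" "A' \<union> B' \<noteq> {}" "A' \<inter> B' = {}"
      and capeq: "cap' A' B' = cap' (M i) B"
      using A'B' AB1 AB2 q.capacity_commute[OF AB1] by auto
    have f0: "equil S p' A' B' x = 0" if "x \<in> M j" for x using that MjB ab by (auto simp: q.equil_B)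
    have sub: "V j - M j \<subseteq> S" using VS[OF j] by auto
    have VU: "V j - M j \<subseteq> S - U"
    proof
      fix x assume x: "x \<in> V j - M j"
      have "\<exists>l. l \<in> {1..K} - {j}"
      proof (cases "j = i")
        case True then show ?thesis using i by (intro exI[of _ 1]) auto
      next
        case False then show ?thesis using i by (intro exI[of _ i]) auto
      qed
      then show "x \<in> S - U" using valley[of j _ x] x j sub by (auto simp: I_def)
    qed
    have "(\<Sum>x\<in>V j. w' x * equil S p' A' B' x) = (\<Sum>x\<in>V j - M j. w' x * equil S p' A' B' x)"
      using f0 finV[OF j] by (intro sum.mono_neutral_right) auto
    also have "\<dots> \<le> (1/2) ^ n * (\<Sum>x\<in>V j - M j. w' x) + 2 * real n * R"
    proof (rule dyadic_sum_bound)
      show "finite (V j - M j)" using finV[OF j] by auto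
      show "equil S p' A' B' x \<le> 1" if "x \<in> V j - M j" for x
        using that sub by (intro q.equil_le_one[OF ab]) auto
      show "0 \<le> w' x" if "x \<in> V j - M j" for x using that sub q.w_pos[of x] by (auto simp: less_imp_le)
      fix t :: real assume t: "0 < t" "t \<le> 1"
      define X where "X = {x \<in> V j - M j. t \<le> equil S p' A' B' x}"
      show "(\<Sum>x\<in>{x \<in> V j - M j. t \<le> equil S p' A' B' x}. w' x) \<le> R / t"
      proof (cases "X = {}")
        case True then show ?thesis using R0 t unfolding X_def[symmetric] by simp
      next
        case False
        have X: "X \<subseteq> S - U" "X \<subseteq> S" using VU by (auto simp: X_def)
        have XM: "X \<inter> M j = {}" by (auto simp: X_def)
        have "m * mass' X \<le> exp d * (m * mass X)"
          using mass'_le[OF X(2)] m by simp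
        also have "m * mass X \<le> cap X U" using up[OF X(1) False] by (simp add: mass_def)
        also have "cap X U \<le> real (card I) * cap X (M j)"
        proof (rule valley_capacity[where M=M])
          show "finite I" "I \<noteq> {}" "disjoint_family_on M I" "j \<in> I" "U = (\<Union>l\<in>I. M l)"
            using disj iI j U by (auto simp: I_def)
          show "equi (M l) (U - M l) x \<le> equi (M j) (U - M j) x" if "x \<in> X" "l \<in> I - {j}" for x l
            using valley[of j l x] that j by (auto simp: X_def I_def)
        qed (use Mi X in auto)
        also have "cap X (M j) \<le> exp d * cap' X (M j)"
          using \<gamma>d by (intro capacity_lower_const X Mi[OF j] False XM) auto
        also have "cap' X (M j) \<le> cap' A' B' / t"
          by (rule q.capacity_level_set[OF ab t X(2) False _ MjB]) (auto simp: X_def)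
        also have "cap' A' B' / t \<le> exp (2 * d) * \<rho> * m * mass' (M i) / t"
          using capAB capeq t by (intro divide_right_mono) auto
        also have "exp d * (real (card I) * (exp d * (exp (2 * d) * \<rho> * m * mass' (M i) / t)))
            = m * (R / t)"
        proof -
          have "exp (4 * d) = exp d * (exp d * exp (2 * d))"
            by (simp add: exp_add[symmetric])
          then show ?thesis by (simp add: R_def I_def)
        qed
        finally have "m * mass' X \<le> m * (R / t)" by (simp add: mult_left_mono)
        then have "mass' X \<le> R / t" using m by (simp only: mult_le_cancel_left_pos)
        then show ?thesis unfolding X_def mass'_def .
      qed
    qed
    also have "(\<Sum>x\<in>V j - M j. w' x) \<le> mass' S"
      using mass'_mono[OF sub] by (simp add: mass'_def)
    finally show ?thesis by simp
  qed
  define \<epsilon> where "\<epsilon> = (1/2) ^ n * \<Lambda> + 2 * real n * real K * exp (4 * d) * \<rho> + exp (2 * d) * \<eta>"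
  have Vi: "mass' (M i) \<le> mass' (V i)" "0 \<le> mass' (V i)"
    using mass'_mono MV[of i] iI VS[OF iI] mass'0 by (auto simp: I_def)
  define core where "core = ((1/2) ^ n * \<Lambda> + 2 * real n * real K * exp (4 * d) * \<rho>) * mass' (V i)"
  have core: "(1/2) ^ n * mass' S + 2 * real n * R \<le> core"
  proof -
    have "(1/2) ^ n * mass' S \<le> (1/2) ^ n * (\<Lambda> * mass' (V i))"
      using \<Lambda> by (intro mult_left_mono) (auto simp: mass'_def)
    moreover have "2 * real n * R \<le> 2 * real n * (real K * exp (4 * d) * \<rho> * mass' (V i))"
      unfolding R_def using Vi \<rho> by (intro mult_left_mono) auto
    ultimately have "(1/2) ^ n * mass' S + 2 * real n * R
      \<le> (1/2) ^ n * (\<Lambda> * mass' (V i)) + 2 * real n * (real K * exp (4 * d) * \<rho> * mass' (V i))"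
      by (rule add_mono)
    then show ?thesis by (simp only: core_def distrib_right mult.assoc)
  qed
  have core0: "0 \<le> (1/2) ^ n * mass' S + 2 * real n * R" using mass'0[of S] R0 by auto
  have \<epsilon>core: "\<epsilon> * mass' (V i) = core + exp (2 * d) * \<eta> * mass' (V i)"
    by (simp only: \<epsilon>_def core_def distrib_right)
  have \<eta>0: "0 \<le> exp (2 * d) * \<eta> * mass' (V i)" using \<eta> Vi by auto
  have e1: "(1/2) ^ n * mass' S + 2 * real n * R \<le> \<epsilon> * mass' (V i)"
    using core \<epsilon>core \<eta>0 by linarith
  have e2: "exp (2 * d) * \<eta> * mass' (V i) \<le> \<epsilon> * mass' (V i)"
    using core core0 \<epsilon>core by linarith
  have h0: "0 \<le> h x" and h1: "h x \<le> 1" if "x \<in> S" for x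
    unfolding h_def using q.equil_nonneg[OF AB1 that] q.equil_le_one[OF AB1 that] by auto
  have other: "(\<Sum>x\<in>V j. w' x * h x) \<le> \<epsilon> * mass' (V i)" if j: "j \<in> I - {i}" for j
  proof (cases "j < i")
    case True
    then have "M j \<subseteq> B" using j by (auto simp: B_def I_def)
    then show ?thesis using level[of j "M i" B] j e1 by (simp add: h_def)
  next
    case False
    then have j': "j \<in> {i+1..K}" using j by (auto simp: I_def)
    have "(\<Sum>x\<in>V j. w' x * h x) \<le> (\<Sum>x\<in>V j. w' x * 1)"
      using j VS h1 q.w_pos by (intro sum_mono mult_left_mono) (auto simp: less_imp_le subset_iff)
    also have "\<dots> = mass' (V j)" by (simp add: mass'_def)
    also have "\<dots> \<le> exp d * mass (V j)" using mass'_le VS j by auto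
    also have "\<dots> \<le> exp d * (\<eta> * mass (V i))"
      using nondeg[OF j'] by (intro mult_left_mono) (auto simp: mass_def)
    also have "\<dots> \<le> exp d * (\<eta> * (exp d * mass' (V i)))"
      using mass_le[OF VS[OF iI]] \<eta> by (intro mult_left_mono) auto
    also have "\<dots> = exp (2 * d) * \<eta> * mass' (V i)" by (simp add: exp_double power2_eq_square)
    finally show ?thesis using e2 by simp
  qed
  have other0: "0 \<le> (\<Sum>x\<in>V j. w' x * h x)" if j: "j \<in> I" for j
    using VS[OF j] h0 q.w_pos by (intro sum_nonneg mult_nonneg_nonneg) (auto simp: less_imp_le subset_iff)
  have own: "(\<Sum>x\<in>V i. w' x * (1 - h x)) \<le> \<epsilon> * mass' (V i)"
  proof -
    have "(\<Sum>x\<in>V i. w' x * (1 - h x)) = (\<Sum>x\<in>V i. w' x * equil S p' B (M i) x)"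
      using VS[OF iI] q.equil_swap[OF AB1] by (intro sum.cong) (auto simp: h_def)
    then show ?thesis using level[of i B "M i"] iI e1 by simp
  qed
  have own0: "0 \<le> (\<Sum>x\<in>V i. w' x * (1 - h x))"
    using VS[OF iI] h1 q.w_pos by (intro sum_nonneg mult_nonneg_nonneg) (auto simp: less_imp_le subset_iff)
  have "(\<Sum>x\<in>S. w' x * h x) = (\<Sum>j\<in>I. \<Sum>x\<in>V j. w' x * h x)"
    unfolding V(2)[symmetric] I_def[symmetric]
    using finV V(1) by (intro sum.UNION_disjoint) (auto simp: I_def disjoint_family_on_def)
  also have "\<dots> = (\<Sum>x\<in>V i. w' x * h x) + (\<Sum>j\<in>I - {i}. \<Sum>x\<in>V j. w' x * h x)"
    using iI by (intro sum.remove) (auto simp: I_def)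
  also have "(\<Sum>x\<in>V i. w' x * h x) = mass' (V i) - (\<Sum>x\<in>V i. w' x * (1 - h x))"
    by (simp add: mass'_def right_diff_distrib sum_subtractf)
  finally have eq: "(\<Sum>x\<in>S. w' x * h x) - mass' (V i) =
      (\<Sum>j\<in>I - {i}. \<Sum>x\<in>V j. w' x * h x) - (\<Sum>x\<in>V i. w' x * (1 - h x))" by simp
  have "(\<Sum>j\<in>I - {i}. \<Sum>x\<in>V j. w' x * h x) \<le> (\<Sum>j\<in>I - {i}. \<epsilon> * mass' (V i))"
    using other by (rule sum_mono)
  also have "\<dots> = real (K - 1) * (\<epsilon> * mass' (V i))" using iI by (simp add: I_def)
  finally have o1: "(\<Sum>j\<in>I - {i}. \<Sum>x\<in>V j. w' x * h x) \<le> real (K - 1) * (\<epsilon> * mass' (V i))" .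
  have o0: "0 \<le> (\<Sum>j\<in>I - {i}. \<Sum>x\<in>V j. w' x * h x)" by (rule sum_nonneg) (use other0 in auto)
  have e0: "0 \<le> \<epsilon> * mass' (V i)" using own own0 by linarith
  have k1: "real (K - 1) * (\<epsilon> * mass' (V i)) \<le> real K * (\<epsilon> * mass' (V i))"
    using e0 by (intro mult_right_mono) auto
  have k2: "1 * (\<epsilon> * mass' (V i)) \<le> real K * (\<epsilon> * mass' (V i))"
    using e0 K by (intro mult_right_mono) auto
  have "\<bar>(\<Sum>x\<in>S. w' x * h x) - mass' (V i)\<bar> \<le> real K * (\<epsilon> * mass' (V i))"
    unfolding eq using o0 o1 own own0 k1 k2 by linarith
  then show ?thesis by (simp add: h_def B_def \<epsilon>_def mass'_def mult.assoc)
qed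

end

section \<open>Return times under the path measure\<close>

context finite_markov_chain
begin

abbreviation "law \<equiv> markov_law S p \<nu>"

lemma space_law: "space law = {w. \<forall>k. w k \<in> S}"
  unfolding markov_law_eq PF.space_lim space_PiM by (auto simp: PiE_iff)

lemma measurable_law_component [measurable]: "(\<lambda>w. w k) \<in> measurable law (count_space S)"
proof -
  have "(\<lambda>w. w k) \<in> measurable (PiM UNIV (\<lambda>_. count_space S)) (count_space S)"
    by (rule measurable_component_singleton) simp
  moreover have "sets law = sets (PiM UNIV (\<lambda>_. count_space S))"
    unfolding markov_law_eq by (rule PF.sets_lim)
  ultimately show ?thesis using measurable_cong_sets by blast
qed

lemma sets_law_component: "{w \<in> space law. w k \<in> A} \<in> sets law"
proof -
  have "(\<lambda>w. w k) -` (A \<inter> S) \<inter> space law \<in> sets law"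
    by (rule measurable_sets[OF measurable_law_component]) auto
  also have "(\<lambda>w. w k) -` (A \<inter> S) \<inter> space law = {w \<in> space law. w k \<in> A}"
    by (auto simp: space_law)
  finally show ?thesis .
qed

lemma pred_law_component [measurable]: "Measurable.pred law (\<lambda>w. w k \<in> A)"
  using sets_law_component[of k A] by (simp add: pred_def)

lemma pred_law_eq [measurable]: "Measurable.pred law (\<lambda>w. w k = x)"
  using pred_law_component[of k "{x}"] by simp

text \<open>
  The Markov property for events that depend on the first \<open>n + 1\<close> coordinates, obtained by splitting
  such an event into cylinders.
\<close>

lemma emeasure_law_prefix_step:
  assumes Q: "\<And>w w'. (\<And>k. k \<le> n \<Longrightarrow> w k = w' k) \<Longrightarrow> Q w \<longleftrightarrow> Q w'" and xy: "x \<in> S" "y \<in> S"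
  shows "emeasure law {w \<in> space law. Q w \<and> w n = x \<and> w (Suc n) = y} =
     ennreal (p x y) * emeasure law {w \<in> space law. Q w \<and> w n = x}"
proof -
  define F where "F = {s \<in> PiE {..n} (\<lambda>_. S). Q s \<and> s n = x}"
  define cyl where "cyl m s = {w \<in> space law. \<forall>k\<le>m. w k = s k}" for m :: nat and s :: "nat \<Rightarrow> 's"
  have finF: "finite F"
    by (rule finite_subset[of _ "PiE {..n} (\<lambda>_. S)"]) (auto simp: F_def finite_S intro!: finite_PiE)
  have cyl_sets: "cyl m s \<in> sets law" for m s unfolding cyl_def by measurable
  have FS: "s k \<in> S" if "s \<in> F" "k \<le> n" for s k using that by (auto simp: F_def PiE_iff)
  have FQ: "Q s" "s n = x" if "s \<in> F" for s using that by (auto simp: F_def)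
  have inF: "restrict w {..n} \<in> F \<longleftrightarrow> Q w \<and> w n = x" if "w \<in> space law" for w
  proof -
    have "Q (restrict w {..n}) \<longleftrightarrow> Q w" by (rule Q) simp
    then show ?thesis using that by (auto simp: F_def space_law)
  qed
  have cyl_iff: "w \<in> cyl n s \<longleftrightarrow> restrict w {..n} = s" if "w \<in> space law" "s \<in> F" for w s
  proof -
    have "s \<in> extensional {..n}" using that by (auto simp: F_def PiE_iff)
    then show ?thesis using that by (auto simp: cyl_def fun_eq_iff restrict_def extensional_def)
  qed
  have disj: "disjoint_family_on (cyl n) F"
    unfolding disjoint_family_on_def
  proof (intro ballI impI)
    fix s s' assume ss: "s \<in> F" "s' \<in> F" "s \<noteq> s'"
    show "cyl n s \<inter> cyl n s' = {}"
    proof (rule ccontr)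
      assume "cyl n s \<inter> cyl n s' \<noteq> {}"
      then obtain w where w: "w \<in> cyl n s" "w \<in> cyl n s'" by auto
      then have "w \<in> space law" by (auto simp: cyl_def)
      then show False using cyl_iff w ss by metis
    qed
  qed
  have un: "{w \<in> space law. Q w \<and> w n = x} = (\<Union>s\<in>F. cyl n s)"
  proof (intro set_eqI iffI)
    fix w assume w: "w \<in> {w \<in> space law. Q w \<and> w n = x}"
    then have "restrict w {..n} \<in> F" "w \<in> cyl n (restrict w {..n})"
      using inF by (auto simp: cyl_def)
    then show "w \<in> (\<Union>s\<in>F. cyl n s)" by blast
  next
    fix w assume "w \<in> (\<Union>s\<in>F. cyl n s)"
    then obtain s where s: "s \<in> F" "w \<in> cyl n s" by auto
    then have "w \<in> space law" by (auto simp: cyl_def)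
    then show "w \<in> {w \<in> space law. Q w \<and> w n = x}" using s cyl_iff inF by fastforce
  qed
  have cyl_Suc: "cyl (Suc n) (s(Suc n := y)) = cyl n s \<inter> {w \<in> space law. w (Suc n) = y}" if "s \<in> F" for s
    unfolding cyl_def by (auto simp: le_Suc_eq)
  have un': "{w \<in> space law. Q w \<and> w n = x \<and> w (Suc n) = y} = (\<Union>s\<in>F. cyl (Suc n) (s(Suc n := y)))"
    using un cyl_Suc by auto
  have disj': "disjoint_family_on (\<lambda>s. cyl (Suc n) (s(Suc n := y))) F"
    using disj cyl_Suc unfolding disjoint_family_on_def by auto
  have em: "emeasure law (cyl (Suc n) (s(Suc n := y))) = ennreal (p x y) * emeasure law (cyl n s)"
    if s: "s \<in> F" for s
  proof -
    have "emeasure law (cyl (Suc n) (s(Suc n := y))) =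
      ennreal (\<nu> (s 0) * (\<Prod>k<Suc n. p ((s(Suc n := y)) k) ((s(Suc n := y)) (Suc k))))"
      unfolding cyl_def using FS[OF s] xy by (subst markov_law_cylinder) (auto simp: le_Suc_eq)
    also have "(\<Prod>k<Suc n. p ((s(Suc n := y)) k) ((s(Suc n := y)) (Suc k))) = (\<Prod>k<n. p (s k) (s (Suc k))) * p x y"
      using FQ[OF s] by simp
    also have "ennreal (\<nu> (s 0) * ((\<Prod>k<n. p (s k) (s (Suc k))) * p x y)) =
       ennreal (p x y * (\<nu> (s 0) * (\<Prod>k<n. p (s k) (s (Suc k)))))" by (simp add: mult_ac)
    also have "\<dots> = ennreal (p x y) * ennreal (\<nu> (s 0) * (\<Prod>k<n. p (s k) (s (Suc k))))"
      using FS[OF s] xy p_nonneg \<nu>_nonneg by (intro ennreal_mult mult_nonneg_nonneg prod_nonneg) auto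
    also have "ennreal (\<nu> (s 0) * (\<Prod>k<n. p (s k) (s (Suc k)))) = emeasure law (cyl n s)"
      unfolding cyl_def using FS[OF s] by (subst markov_law_cylinder) auto
    finally show ?thesis .
  qed
  have "emeasure law (\<Union>s\<in>F. cyl (Suc n) (s(Suc n := y))) = (\<Sum>s\<in>F. emeasure law (cyl (Suc n) (s(Suc n := y))))"
    using finF cyl_sets disj' by (intro sum_emeasure[symmetric]) auto
  also have "\<dots> = (\<Sum>s\<in>F. ennreal (p x y) * emeasure law (cyl n s))" using em by simp
  also have "\<dots> = ennreal (p x y) * emeasure law (\<Union>s\<in>F. cyl n s)"
    using finF cyl_sets disj by (subst sum_distrib_left[symmetric], subst sum_emeasure) auto
  finally show ?thesis unfolding un un' .
qed

lemma emeasure_law_init: "x \<in> S \<Longrightarrow> emeasure law {w \<in> space law. w 0 = x} = ennreal (\<nu> x)"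
  using markov_law_cylinder[of 0 "\<lambda>_. x"] by simp

lemma prob_space_law: "prob_space law"
proof
  have "space law = (\<Union>x\<in>S. {w \<in> space law. w 0 = x})" by (auto simp: space_law)
  then have "emeasure law (space law) = emeasure law (\<Union>x\<in>S. {w \<in> space law. w 0 = x})" by simp
  also have "\<dots> = (\<Sum>x\<in>S. emeasure law {w \<in> space law. w 0 = x})"
    using finite_S by (intro sum_emeasure[symmetric]) (auto simp: disjoint_family_on_def)
  also have "\<dots> = (\<Sum>x\<in>S. ennreal (\<nu> x))" using emeasure_law_init by simp
  also have "\<dots> = 1" using \<nu>_nonneg \<nu>_sum by (subst sum_ennreal) auto
  finally show "emeasure law (space law) = 1" .
qed

text \<open>
  The sub-probability that the chain has stayed in \<open>D\<close> at times \<open>1\<close> to \<open>n - 1\<close> and is at \<open>y\<close> at time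
  \<open>n\<close>. Time \<open>0\<close> is unconstrained, as return times start at \<open>1\<close>.
\<close>

definition occ :: "'s set \<Rightarrow> nat \<Rightarrow> 's \<Rightarrow> real" where
  "occ D n y = measure law {w \<in> space law. (\<forall>k. 1 \<le> k \<and> k < n \<longrightarrow> w k \<in> D) \<and> w n = y}"

interpretation L: prob_space law by (rule prob_space_law)

lemma measure_split_last:
  assumes [measurable]: "Measurable.pred law Q" and B: "B \<subseteq> S"
  shows "measure law {w \<in> space law. Q w \<and> w n \<in> B} = (\<Sum>x\<in>B. measure law {w \<in> space law. Q w \<and> w n = x})"
proof -
  have "{w \<in> space law. Q w \<and> w n \<in> B} = (\<Union>x\<in>B. {w \<in> space law. Q w \<and> w n = x})" by auto
  moreover have "finite B" using finite_S B by (rule rev_finite_subset)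
  ultimately show ?thesis
    by (simp only:) (rule L.finite_measure_finite_Union, auto simp: disjoint_family_on_def)
qed

lemma occ_nonneg: "0 \<le> occ D n y" by (simp add: occ_def)

lemma measure_law_step:
  assumes [measurable]: "Measurable.pred law Q"
    and Q: "\<And>w w'. (\<And>k. k \<le> n \<Longrightarrow> w k = w' k) \<Longrightarrow> Q w \<longleftrightarrow> Q w'" and xy: "x \<in> S" "y \<in> S"
  shows "measure law {w \<in> space law. Q w \<and> w n = x \<and> w (Suc n) = y} =
     p x y * measure law {w \<in> space law. Q w \<and> w n = x}"
  using emeasure_law_prefix_step[OF Q xy] p_nonneg[OF xy]
  by (simp add: measure_def enn2real_mult)

lemma occ_1:
  assumes y: "y \<in> S"
  shows "occ D 1 y = (\<Sum>x\<in>S. \<nu> x * p x y)"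
proof -
  have "occ D 1 y = measure law {w \<in> space law. w 1 = y \<and> w 0 \<in> S}"
    unfolding occ_def by (intro arg_cong[of _ _ "measure law"]) (auto simp: space_law)
  also have "\<dots> = (\<Sum>x\<in>S. measure law {w \<in> space law. w 1 = y \<and> w 0 = x})"
    by (rule measure_split_last) auto
  also have "\<dots> = (\<Sum>x\<in>S. \<nu> x * p x y)"
  proof (intro sum.cong refl)
    fix x assume x: "x \<in> S"
    have "measure law {w \<in> space law. w 1 = y \<and> w 0 = x} =
       measure law {w \<in> space law. True \<and> w 0 = x \<and> w (Suc 0) = y}"
      by (intro arg_cong[of _ _ "measure law"]) auto
    also have "\<dots> = p x y * measure law {w \<in> space law. True \<and> w 0 = x}"
      by (rule measure_law_step) (auto simp: x y)
    also have "measure law {w \<in> space law. True \<and> w 0 = x} = \<nu> x"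
      using emeasure_law_init[OF x] \<nu>_nonneg[OF x] by (simp add: measure_def)
    finally show "measure law {w \<in> space law. w 1 = y \<and> w 0 = x} = \<nu> x * p x y" by simp
  qed
  finally show ?thesis .
qed

lemma occ_Suc:
  assumes D: "D \<subseteq> S" and y: "y \<in> S" and n: "1 \<le> n"
  shows "occ D (Suc n) y = (\<Sum>x\<in>D. occ D n x * p x y)"
proof -
  let ?Q = "\<lambda>w. \<forall>k. 1 \<le> k \<and> k < n \<longrightarrow> w k \<in> D"
  have "occ D (Suc n) y = measure law {w \<in> space law. (?Q w \<and> w (Suc n) = y) \<and> w n \<in> D}"
    unfolding occ_def using n
    by (intro arg_cong[of _ _ "measure law"]) (auto simp: less_Suc_eq)
  also have "\<dots> = (\<Sum>x\<in>D. measure law {w \<in> space law. (?Q w \<and> w (Suc n) = y) \<and> w n = x})"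
    using D by (intro measure_split_last) auto
  also have "\<dots> = (\<Sum>x\<in>D. occ D n x * p x y)"
  proof (intro sum.cong refl)
    fix x assume x: "x \<in> D"
    have "measure law {w \<in> space law. (?Q w \<and> w (Suc n) = y) \<and> w n = x} =
        measure law {w \<in> space law. ?Q w \<and> w n = x \<and> w (Suc n) = y}"
      by (intro arg_cong[of _ _ "measure law"]) auto
    also have "\<dots> = p x y * measure law {w \<in> space law. ?Q w \<and> w n = x}"
      by (rule measure_law_step) (use x D y in auto)
    finally show "measure law {w \<in> space law. (?Q w \<and> w (Suc n) = y) \<and> w n = x} = occ D n x * p x y"
      by (simp add: occ_def mult.commute)
  qed
  finally show ?thesis .
qed

text \<open>
  Pairing the forward vectors with a solution of the Poisson equation telescopes. This identifies
  path probabilities with potentials without any shift of the path measure.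
\<close>

lemma occ_telescope:
  assumes D: "D \<subseteq> S" and u: "\<And>x. x \<in> D \<Longrightarrow> u x = g x + (\<Sum>z\<in>S. p x z * u z)"
  shows "(\<Sum>z\<in>S. occ D 1 z * u z) =
     (\<Sum>n<m. (\<Sum>z\<in>D. occ D (Suc n) z * g z) + (\<Sum>z\<in>S - D. occ D (Suc n) z * u z))
     + (\<Sum>z\<in>S. occ D (Suc m) z * u z)"
proof (induction m)
  case 0 then show ?case by simp
next
  case (Suc m)
  have "(\<Sum>z\<in>S. occ D (Suc m) z * u z) =
     (\<Sum>z\<in>D. occ D (Suc m) z * u z) + (\<Sum>z\<in>S - D. occ D (Suc m) z * u z)"
    using D finite_S by (subst sum.subset_diff[of D S]) auto
  also have "(\<Sum>z\<in>D. occ D (Suc m) z * u z) =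
     (\<Sum>z\<in>D. occ D (Suc m) z * g z) + (\<Sum>x\<in>D. \<Sum>z\<in>S. occ D (Suc m) x * p x z * u z)"
    using u by (simp add: distrib_left sum.distrib sum_distrib_left mult.assoc)
  also have "(\<Sum>x\<in>D. \<Sum>z\<in>S. occ D (Suc m) x * p x z * u z) =
     (\<Sum>z\<in>S. \<Sum>x\<in>D. occ D (Suc m) x * p x z * u z)" by (rule sum.swap)
  also have "\<dots> = (\<Sum>z\<in>S. occ D (Suc (Suc m)) z * u z)"
    by (intro sum.cong refl, subst occ_Suc[OF D]) (auto simp: sum_distrib_right)
  finally show ?case using Suc by (simp add: algebra_simps)
qed

lemma occ_sum1: "(\<Sum>z\<in>S. occ D 1 z * u z) = (\<Sum>x\<in>S. \<nu> x * (\<Sum>z\<in>S. p x z * u z))"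
proof -
  have "(\<Sum>z\<in>S. occ D 1 z * u z) = (\<Sum>z\<in>S. \<Sum>x\<in>S. \<nu> x * p x z * u z)"
    by (intro sum.cong refl, subst occ_1) (auto simp: sum_distrib_right)
  also have "\<dots> = (\<Sum>x\<in>S. \<Sum>z\<in>S. \<nu> x * p x z * u z)" by (rule sum.swap)
  finally show ?thesis by (simp add: sum_distrib_left mult.assoc)
qed

end

lemma return_time_less_iff:
  assumes "A \<inter> B = {}"
  shows "return_time B w < return_time A w \<longleftrightarrow>
     (\<exists>n\<ge>1. (\<forall>k. 1 \<le> k \<and> k < n \<longrightarrow> w k \<notin> A \<union> B) \<and> w n \<in> B)"
proof
  assume lt: "return_time B w < return_time A w"
  let ?E = "\<lambda>A. {enat t |t. 1 \<le> t \<and> w t \<in> A}"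
  have ne: "?E B \<noteq> {}" using lt by (auto simp: return_time_def Inf_enat_def split: if_splits)
  have "return_time B w \<in> ?E B"
    unfolding return_time_def using ne wellorder_InfI[of _ "?E B"] by blast
  then obtain n where n: "return_time B w = enat n" "1 \<le> n" "w n \<in> B" by auto
  have "w k \<notin> A \<union> B" if k: "1 \<le> k" "k < n" for k
  proof
    assume "w k \<in> A \<union> B"
    then consider "w k \<in> A" | "w k \<in> B" by auto
    then show False
    proof cases
      case 1
      then have "return_time A w \<le> enat k" unfolding return_time_def using k by (intro Inf_lower) auto
      then show False using lt n k by (metis enat_ord_simps(2) leD less_trans)
    next
      case 2
      then have "return_time B w \<le> enat k" unfolding return_time_def using k by (intro Inf_lower) auto
      then show False using n k by simp
    qed
  qed
  then show "\<exists>n\<ge>1. (\<forall>k. 1 \<le> k \<and> k < n \<longrightarrow> w k \<notin> A \<union> B) \<and> w n \<in> B" using n by auto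
next
  assume "\<exists>n\<ge>1. (\<forall>k. 1 \<le> k \<and> k < n \<longrightarrow> w k \<notin> A \<union> B) \<and> w n \<in> B"
  then obtain n where n: "1 \<le> n" "\<And>k. 1 \<le> k \<Longrightarrow> k < n \<Longrightarrow> w k \<notin> A \<union> B" "w n \<in> B" by auto
  have "return_time B w \<le> enat n" unfolding return_time_def using n by (intro Inf_lower) auto
  also have "enat n < enat (Suc n)" by simp
  also have "enat (Suc n) \<le> return_time A w"
    unfolding return_time_def
  proof (rule Inf_greatest, clarify)
    fix t assume t: "1 \<le> t" "w t \<in> A"
    then have "\<not> t < n" using n(2)[of t] by auto
    moreover have "t \<noteq> n" using t n assms by auto
    ultimately show "enat (Suc n) \<le> enat t" by simp
  qed
  finally show "return_time B w < return_time A w" .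
qed

lemma less_return_time_iff:
  "enat n < return_time B w \<longleftrightarrow> (\<forall>k. 1 \<le> k \<and> k \<le> n \<longrightarrow> w k \<notin> B)"
proof
  assume lt: "enat n < return_time B w"
  show "\<forall>k. 1 \<le> k \<and> k \<le> n \<longrightarrow> w k \<notin> B"
  proof (intro allI impI notI)
    fix k assume k: "1 \<le> k \<and> k \<le> n" "w k \<in> B"
    then have "return_time B w \<le> enat k" unfolding return_time_def by (intro Inf_lower) auto
    also have "enat k \<le> enat n" using k by simp
    finally show False using lt by simp
  qed
next
  assume a: "\<forall>k. 1 \<le> k \<and> k \<le> n \<longrightarrow> w k \<notin> B"
  have "enat (Suc n) \<le> return_time B w"
    unfolding return_time_def
  proof (rule Inf_greatest, clarify)
    fix t assume "1 \<le> t" "w t \<in> B"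
    then have "\<not> t \<le> n" using a by auto
    then show "enat (Suc n) \<le> enat t" by simp
  qed
  then show "enat n < return_time B w" by (metis Suc_ile_eq)
qed

locale chain_with_law = reversible_chain S p w + finite_markov_chain S p \<nu> for S :: "'s set" and p w \<nu>
begin

interpretation L: prob_space law by (rule prob_space_law)

text \<open>
  The remainder of the telescoping sum is at most a constant times the surviving mass, which is a
  summable sequence because of the same telescoping.
\<close>

lemma mean_hit_occ:
  assumes B: "B \<subseteq> S" "B \<noteq> {}"
  shows "(\<lambda>n. \<Sum>z\<in>S - B. occ (S - B) (Suc n) z) sums (\<Sum>x\<in>S. \<nu> x * avg (mean_hit S p B) x)"
proof -
  let ?C = "S - B" let ?T = "mean_hit S p B"
  define a where "a n = (\<Sum>z\<in>?C. occ ?C (Suc n) z)" for n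
  define T1 where "T1 = (\<Sum>x\<in>S. \<nu> x * avg ?T x)"
  define c where "c = Max (?T ` S)"
  have a0: "0 \<le> a n" for n unfolding a_def by (intro sum_nonneg occ_nonneg)
  have T0: "0 \<le> ?T x" if "x \<in> S" for x using mean_hit_nonneg[OF B that] .
  have Tc: "?T x \<le> c" if "x \<in> S" for x unfolding c_def using that by (intro Max_ge) auto
  define r where "r m = (\<Sum>z\<in>S. occ ?C (Suc m) z * ?T z)" for m
  have tel: "T1 = (\<Sum>n<m. a n) + r m" for m
  proof -
    have "T1 = (\<Sum>z\<in>S. occ ?C 1 z * ?T z)" unfolding T1_def by (rule occ_sum1[symmetric])
    also have "\<dots> = (\<Sum>n<m. (\<Sum>z\<in>?C. occ ?C (Suc n) z * 1) + (\<Sum>z\<in>S - ?C. occ ?C (Suc n) z * ?T z))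
        + (\<Sum>z\<in>S. occ ?C (Suc m) z * ?T z)"
      by (rule occ_telescope) (use mean_hit_eq[OF B] in auto)
    also have "\<dots> = (\<Sum>n<m. a n) + r m"
      unfolding a_def r_def
      by (intro arg_cong2[of _ _ _ _ "(+)"] sum.cong refl) (auto simp: mean_hit_def intro!: sum.neutral)
    finally show ?thesis .
  qed
  have r0: "0 \<le> r m" for m unfolding r_def using T0 occ_nonneg by (intro sum_nonneg mult_nonneg_nonneg) auto
  have rc: "r m \<le> c * a m" for m
  proof -
    have "r m = (\<Sum>z\<in>?C. occ ?C (Suc m) z * ?T z)"
      unfolding r_def by (intro sum.mono_neutral_right) (auto simp: mean_hit_def)
    also have "\<dots> \<le> (\<Sum>z\<in>?C. occ ?C (Suc m) z * c)"
      using Tc occ_nonneg by (intro sum_mono mult_left_mono) auto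
    finally show ?thesis by (simp add: a_def sum_distrib_left mult.commute)
  qed
  have sm: "summable a"
  proof (rule summableI_nonneg_bounded[OF a0])
    show "(\<Sum>n<m. a n) \<le> T1" for m using tel[of m] r0[of m] by simp
  qed
  have "(\<lambda>m. c * a m) \<longlonglongrightarrow> c * 0" by (intro tendsto_intros summable_LIMSEQ_zero[OF sm])
  then have "r \<longlonglongrightarrow> 0"
    by (intro tendsto_sandwich[of "\<lambda>_. 0" r sequentially "\<lambda>m. c * a m"]) (auto simp: r0 rc)
  then have "(\<lambda>m. T1 - r m) \<longlonglongrightarrow> T1 - 0" by (intro tendsto_intros)
  moreover have "(\<lambda>m. T1 - r m) = (\<lambda>m. \<Sum>n<m. a n)" using tel by (auto simp: algebra_simps)
  ultimately show ?thesis unfolding sums_def a_def T1_def by simp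
qed

lemma prob_return_before:
  assumes AB: "A \<subseteq> S" "B \<subseteq> S" "A \<union> B \<noteq> {}" "A \<inter> B = {}"
  shows "measure law {w \<in> space law. return_time B w < return_time A w} = (\<Sum>x\<in>S. \<nu> x * avg (equi B A) x)"
proof -
  let ?C = "S - (A \<union> B)" let ?h = "equi B A"
  define Q where "Q n w = (\<forall>k. 1 \<le> k \<and> k < n \<longrightarrow> w k \<in> ?C)" for n :: nat and w :: "nat \<Rightarrow> 's"
  have Q [measurable]: "Measurable.pred law (Q n)" for n unfolding Q_def by measurable
  define ev where "ev n = {w \<in> space law. Q (Suc n) w \<and> w (Suc n) \<in> B}" for n
  have eq: "{w \<in> space law. return_time B w < return_time A w} = (\<Union>n. ev n)"
  proof (intro set_eqI)
    fix w
    have "(\<exists>n\<ge>1. (\<forall>k. 1 \<le> k \<and> k < n \<longrightarrow> w k \<notin> A \<union> B) \<and> w n \<in> B) \<longleftrightarrow> (\<exists>n. Q (Suc n) w \<and> w (Suc n) \<in> B)"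
      if "w \<in> space law"
      using that unfolding Q_def space_law
      by (auto simp: Suc_le_eq gr0_conv_Suc)
    then show "w \<in> {w \<in> space law. return_time B w < return_time A w} \<longleftrightarrow> w \<in> (\<Union>n. ev n)"
      using return_time_less_iff[OF AB(4), of w] by (auto simp: ev_def)
  qed
  have disj: "disjoint_family ev"
    unfolding disjoint_family_on_def
  proof (intro ballI impI)
    have *: "ev m \<inter> ev n = {}" if "m < n" for m n
    proof -
      have "w (Suc m) \<in> ?C" if "Q (Suc n) w" for w
        using that \<open>m < n\<close> unfolding Q_def by (metis Suc_mono le_add1 plus_1_eq_Suc)
      then show ?thesis by (auto simp: ev_def)
    qed
    fix m n :: nat assume "m \<noteq> n"
    then show "ev m \<inter> ev n = {}"
      using * by (metis inf_commute linorder_neqE_nat)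
  qed
  have ev [measurable]: "ev n \<in> sets law" for n unfolding ev_def by measurable
  have s1: "(\<lambda>n. measure law (ev n)) sums measure law (\<Union>n. ev n)"
    by (rule L.finite_measure_UNION) (use disj in auto)
  define b where "b n = (\<Sum>z\<in>B. occ ?C (Suc n) z)" for n
  have mb: "measure law (ev n) = b n" for n
    unfolding ev_def b_def occ_def using measure_split_last[OF Q AB(2)] by (simp add: Q_def)
  define H1 where "H1 = (\<Sum>x\<in>S. \<nu> x * avg ?h x)"
  define a where "a n = (\<Sum>z\<in>?C. occ ?C (Suc n) z)" for n
  define r where "r m = (\<Sum>z\<in>S. occ ?C (Suc m) z * ?h z)" for m
  have hb: "(\<Sum>z\<in>S - ?C. occ ?C (Suc n) z * ?h z) = b n" for n
  proof -
    have "(\<Sum>z\<in>S - ?C. occ ?C (Suc n) z * ?h z) = (\<Sum>z\<in>B. occ ?C (Suc n) z * ?h z)"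
      using AB by (intro sum.mono_neutral_right) (auto simp: equil_B Int_commute)
    then show ?thesis by (simp add: b_def)
  qed
  have tel: "H1 = (\<Sum>n<m. b n) + r m" for m
  proof -
    have "H1 = (\<Sum>z\<in>S. occ ?C 1 z * ?h z)" unfolding H1_def by (rule occ_sum1[symmetric])
    also have "\<dots> = (\<Sum>n<m. (\<Sum>z\<in>?C. occ ?C (Suc n) z * 0) + (\<Sum>z\<in>S - ?C. occ ?C (Suc n) z * ?h z))
        + (\<Sum>z\<in>S. occ ?C (Suc m) z * ?h z)"
      by (rule occ_telescope) (use equil_harmonic[of B A] AB in auto)
    finally show ?thesis by (simp add: hb r_def)
  qed
  have b0: "0 \<le> b n" for n unfolding b_def by (intro sum_nonneg occ_nonneg)
  have h0: "0 \<le> ?h x \<and> ?h x \<le> 1" if "x \<in> S" for x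
    using equil_nonneg[of B A x] equil_le_one[of B A x] AB that by (auto simp: Un_commute Int_commute)
  have r0: "0 \<le> r m" for m unfolding r_def using h0 occ_nonneg by (intro sum_nonneg mult_nonneg_nonneg) auto
  have rb: "r m \<le> a m + b m" for m
  proof -
    have "r m = (\<Sum>z\<in>?C. occ ?C (Suc m) z * ?h z) + (\<Sum>z\<in>S - ?C. occ ?C (Suc m) z * ?h z)"
      unfolding r_def by (subst sum.subset_diff[of ?C S]) auto
    also have "(\<Sum>z\<in>?C. occ ?C (Suc m) z * ?h z) \<le> (\<Sum>z\<in>?C. occ ?C (Suc m) z * 1)"
      using h0 occ_nonneg by (intro sum_mono mult_left_mono) auto
    finally show ?thesis using hb by (simp add: a_def)
  qed
  have "summable b"
  proof (rule summableI_nonneg_bounded[OF b0])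
    show "(\<Sum>n<m. b n) \<le> H1" for m using tel[of m] r0[of m] by simp
  qed
  then have "b \<longlonglongrightarrow> 0" by (rule summable_LIMSEQ_zero)
  moreover have "a \<longlonglongrightarrow> 0"
  proof -
    have "(\<lambda>n. \<Sum>z\<in>S - (A \<union> B). occ (S - (A \<union> B)) (Suc n) z) sums (\<Sum>x\<in>S. \<nu> x * avg (mean_hit S p (A \<union> B)) x)"
      using AB by (intro mean_hit_occ) auto
    then show ?thesis unfolding a_def using sums_summable summable_LIMSEQ_zero by blast
  qed
  ultimately have "(\<lambda>m. a m + b m) \<longlonglongrightarrow> 0 + 0" by (intro tendsto_intros)
  then have "r \<longlonglongrightarrow> 0"
    by (intro tendsto_sandwich[of "\<lambda>_. 0" r sequentially "\<lambda>m. a m + b m"]) (auto simp: r0 rb)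
  then have "(\<lambda>m. H1 - r m) \<longlonglongrightarrow> H1 - 0" by (intro tendsto_intros)
  moreover have "(\<lambda>m. H1 - r m) = (\<lambda>m. \<Sum>n<m. b n)" using tel by (auto simp: algebra_simps)
  ultimately have "b sums H1" unfolding sums_def by simp
  then have "measure law (\<Union>n. ev n) = H1" using s1 mb sums_unique2 by auto
  then show ?thesis unfolding eq H1_def .
qed

lemma mean_return_time_law:
  assumes B: "B \<subseteq> S" "B \<noteq> {}" and \<nu>B: "\<And>x. x \<in> B \<Longrightarrow> \<nu> x = 0"
  shows "(\<integral>\<^sup>+ w. ennreal_of_enat (return_time B w) \<partial>law) = ennreal (\<Sum>x\<in>S. \<nu> x * mean_hit S p B x)"
proof -
  let ?C = "S - B"
  define T1 where "T1 = (\<Sum>x\<in>S. \<nu> x * avg (mean_hit S p B) x)"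
  define a where "a n = (\<Sum>z\<in>?C. occ ?C (Suc n) z)" for n
  have gt: "{w \<in> space law. enat n < return_time B w} = {w \<in> space law. \<forall>k. 1 \<le> k \<and> k \<le> n \<longrightarrow> w k \<notin> B}" for n
    unfolding less_return_time_iff ..
  have gt_sets: "{w \<in> space law. enat n < return_time B w} \<in> sets law" for n
    unfolding gt by measurable
  have meas: "return_time B \<in> measurable law (count_space UNIV)"
  proof -
    have "return_time B -` {y} \<inter> space law \<in> sets law" for y :: enat
    proof (cases y)
      case (enat n)
      show ?thesis
      proof (cases n)
        case 0
        have "return_time B -` {y} \<inter> space law = space law - {w \<in> space law. enat 0 < return_time B w}"
          using enat 0 by (auto simp: zero_enat_def[symmetric])
        then show ?thesis using gt_sets[of 0] by auto
      next
        case (Suc m)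
        have "return_time B -` {y} \<inter> space law =
           {w \<in> space law. enat m < return_time B w} - {w \<in> space law. enat n < return_time B w}"
        proof (intro set_eqI)
          fix w
          have "return_time B w = enat (Suc m) \<longleftrightarrow>
              enat m < return_time B w \<and> \<not> enat (Suc m) < return_time B w"
            by (cases "return_time B w") auto
          then show "w \<in> return_time B -` {y} \<inter> space law \<longleftrightarrow> w \<in>
             {w \<in> space law. enat m < return_time B w} - {w \<in> space law. enat n < return_time B w}"
            using enat Suc by auto
        qed
        then show ?thesis using gt_sets by auto
      qed
    next
      case infinity
      have "return_time B -` {y} \<inter> space law = (\<Inter>n. {w \<in> space law. enat n < return_time B w})"
      proof (intro set_eqI iffI)
        fix w assume "w \<in> (\<Inter>n. {w \<in> space law. enat n < return_time B w})"
        then have w: "w \<in> space law" "\<And>n. enat n < return_time B w" by auto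
        then have "return_time B w = \<infinity>" by (metis enat.exhaust order_less_irrefl)
        then show "w \<in> return_time B -` {y} \<inter> space law" using w infinity by simp
      qed (use infinity in auto)
      then show ?thesis using gt_sets by auto
    qed
    then show ?thesis by (subst measurable_count_space_eq_countable) auto
  qed
  have m0: "emeasure law {w \<in> space law. enat 0 < return_time B w} = 1"
    unfolding gt using L.emeasure_space_1 by simp
  have mS: "emeasure law {w \<in> space law. enat (Suc n) < return_time B w} = ennreal (a n)" for n
  proof -
    have "{w \<in> space law. enat (Suc n) < return_time B w} =
       {w \<in> space law. (\<forall>k. 1 \<le> k \<and> k < Suc n \<longrightarrow> w k \<in> ?C) \<and> w (Suc n) \<in> ?C}"
      unfolding gt by (auto simp: space_law le_Suc_eq less_Suc_eq_le)
    moreover have "measure law {w \<in> space law. (\<forall>k. 1 \<le> k \<and> k < Suc n \<longrightarrow> w k \<in> ?C) \<and> w (Suc n) \<in> ?C} = a n"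
      unfolding a_def occ_def by (rule measure_split_last) auto
    ultimately show ?thesis by (simp add: L.emeasure_eq_measure)
  qed
  have a: "a sums T1" unfolding a_def T1_def by (rule mean_hit_occ[OF B])
  have a0: "0 \<le> a n" for n unfolding a_def by (intro sum_nonneg occ_nonneg)
  have T10: "0 \<le> T1" using a a0 by (metis sums_le sums_zero)
  have "(\<integral>\<^sup>+ w. ennreal_of_enat (return_time B w) \<partial>law) = (\<Sum>n. emeasure law {w \<in> space law. enat n < return_time B w})"
    by (rule nn_integral_enat_function[OF meas])
  also have "\<dots> = (\<Sum>n. emeasure law {w \<in> space law. enat (Suc n) < return_time B w}) + 1"
    using suminf_offset[of "\<lambda>n. emeasure law {w \<in> space law. enat n < return_time B w}" 1] m0
    by (simp add: add.commute)
  also have "\<dots> = ennreal T1 + 1"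
    unfolding mS using a a0 by (subst suminf_ennreal2) (auto simp: sums_iff)
  also have "\<dots> = ennreal (1 + T1)" using T10 by (simp add: ennreal_plus add.commute)
  also have "1 + T1 = (\<Sum>x\<in>S. \<nu> x * (1 + avg (mean_hit S p B) x))"
    using \<nu>_sum by (simp add: T1_def distrib_left sum.distrib)
  also have "\<dots> = (\<Sum>x\<in>S. \<nu> x * mean_hit S p B x)"
  proof (intro sum.cong refl)
    fix x assume "x \<in> S"
    then show "\<nu> x * (1 + avg (mean_hit S p B) x) = \<nu> x * mean_hit S p B x"
      using \<nu>B[of x] mean_hit_eq[OF B, of x] by (cases "x \<in> B") auto
  qed
  finally show ?thesis .
qed

end

section \<open>Metropolis dynamics on the hypercube\<close>

abbreviation boltzmann :: "real \<Rightarrow> ('s \<Rightarrow> real) \<Rightarrow> 's \<Rightarrow> real" where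
  "boltzmann \<beta> H \<sigma> \<equiv> exp (- \<beta> * H \<sigma>)"

definition metro_equil where
  "metro_equil N \<beta> H A B = equil (spins N) (trans_prob N \<beta> H) A B"

definition metro_cap where
  "metro_cap N \<beta> H A B = capacity (spins N) (trans_prob N \<beta> H) (boltzmann \<beta> H) A B"

definition metro_mass where
  "metro_mass N \<beta> H A B = (\<Sum>\<sigma>\<in>spins N. boltzmann \<beta> H \<sigma> * metro_equil N \<beta> H A B \<sigma>)"

lemma spins_nonempty: "spins N \<noteq> {}"
  by (simp add: spins_def PiE_eq_empty_iff)

lemma card_spins: "card (spins N) = 2 ^ N"
  unfolding spins_def by (subst card_PiE) (auto simp: card_insert_if numeral_2_eq_2)

lemma spins_cases: "\<sigma> \<in> spins N \<Longrightarrow> i \<in> {1..N} \<Longrightarrow> \<sigma> i = 1 \<or> \<sigma> i = -1"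
  unfolding spins_def by (auto simp: PiE_iff)

lemma spins_flip: "\<sigma> \<in> spins N \<Longrightarrow> i \<in> {1..N} \<Longrightarrow> \<sigma>(i := - \<sigma> i) \<in> spins N"
  unfolding spins_def by (auto simp: PiE_iff extensional_def)

lemma neighbour_sym:
  assumes "neighbour N \<sigma> \<eta>"
  shows "neighbour N \<eta> \<sigma>"
proof -
  obtain i where i: "i \<in> {1..N}" "\<eta> = \<sigma>(i := - \<sigma> i)" using assms by (auto simp: neighbour_def)
  then have "\<sigma> = \<eta>(i := - \<eta> i)" by auto
  then show ?thesis unfolding neighbour_def using i by blast
qed

lemma neighbour_spins: "\<sigma> \<in> spins N \<Longrightarrow> neighbour N \<sigma> \<eta> \<Longrightarrow> \<eta> \<in> spins N"
  unfolding neighbour_def using spins_flip by auto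

text \<open>
  If no flip leaves \<open>X\<close>, correcting the spins one at a time leads from a point of \<open>X\<close> to any given
  configuration without leaving \<open>X\<close>.
\<close>

lemma hypercube_exit:
  assumes X: "X \<subseteq> spins N" "X \<noteq> {}" "X \<noteq> spins N"
  shows "\<exists>\<sigma>\<in>X. \<exists>\<eta>\<in>spins N - X. neighbour N \<sigma> \<eta>"
proof (rule ccontr)
  assume no: "\<not> ?thesis"
  have "\<eta> \<in> X" if "\<sigma> \<in> X" "\<eta> \<in> spins N" "card {i \<in> {1..N}. \<sigma> i \<noteq> \<eta> i} = n" for \<sigma> \<eta> n
    using that
  proof (induction n arbitrary: \<sigma>)
    case 0
    then have eq: "\<sigma> i = \<eta> i" if "i \<in> {1..N}" for i using that by auto
    have "\<sigma> \<in> spins N" using 0 X by auto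
    then have "\<sigma> = \<eta>"
      using eq \<open>\<eta> \<in> spins N\<close> unfolding spins_def by (intro PiE_ext) auto
    then show ?case using 0 by simp
  next
    case (Suc n)
    let ?D = "{i \<in> {1..N}. \<sigma> i \<noteq> \<eta> i}"
    have "?D \<noteq> {}" using Suc by (metis card.empty nat.distinct(1))
    then obtain i where i: "i \<in> {1..N}" "\<sigma> i \<noteq> \<eta> i" by auto
    define \<sigma>' where "\<sigma>' = \<sigma>(i := - \<sigma> i)"
    have \<sigma>: "\<sigma> \<in> spins N" using Suc X by auto
    have nb: "neighbour N \<sigma> \<sigma>'" unfolding neighbour_def \<sigma>'_def using i by auto
    have "\<sigma>' \<in> X" using no Suc.prems(1) nb neighbour_spins[OF \<sigma> nb] by auto
    moreover have "{k \<in> {1..N}. \<sigma>' k \<noteq> \<eta> k} = ?D - {i}"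
      using i spins_cases[OF \<sigma> i(1)] spins_cases[OF Suc.prems(2) i(1)] by (auto simp: \<sigma>'_def)
    then have "card {k \<in> {1..N}. \<sigma>' k \<noteq> \<eta> k} = n" using Suc.prems(3) i by simp
    ultimately show ?case using Suc by blast
  qed
  then show False using X by blast
qed

lemma dirac_prob:
  assumes "\<sigma> \<in> spins N"
  shows "\<And>x. x \<in> spins N \<Longrightarrow> 0 \<le> dirac \<sigma> x" "(\<Sum>x\<in>spins N. dirac \<sigma> x) = 1"
    "(\<Sum>x\<in>spins N. dirac \<sigma> x * f x) = f \<sigma>"
proof -
  have d: "dirac \<sigma> x = (if x = \<sigma> then 1 else 0)" for x by (simp add: dirac_def indicator_def)
  show "\<And>x. x \<in> spins N \<Longrightarrow> 0 \<le> dirac \<sigma> x" by (simp add: d)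
  show "(\<Sum>x\<in>spins N. dirac \<sigma> x) = 1" using assms by (simp add: d finite_spins)
  have "(\<Sum>x\<in>spins N. dirac \<sigma> x * f x) = (\<Sum>x\<in>spins N. if x = \<sigma> then f x else 0)"
    by (intro sum.cong) (auto simp: d)
  then show "(\<Sum>x\<in>spins N. dirac \<sigma> x * f x) = f \<sigma>" using assms by (simp add: finite_spins)
qed

context
  fixes N :: nat and \<beta> :: real
  assumes N: "1 \<le> N" and \<beta>: "0 < \<beta>"
begin

text \<open>
  In the Metropolis dynamics the edge weight is the Boltzmann weight of the higher endpoint, which
  exhibits reversibility and is symmetric in the two energies.
\<close>

lemma conductance:
  assumes "\<sigma> \<noteq> \<eta>"
  shows "boltzmann \<beta> H \<sigma> * trans_prob N \<beta> H \<sigma> \<eta> =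
    (if neighbour N \<sigma> \<eta> then exp (- \<beta> * max (H \<sigma>) (H \<eta>)) / real N else 0)"
proof -
  have "- \<beta> * H \<sigma> + - \<beta> * max (H \<eta> - H \<sigma>) 0 = - \<beta> * max (H \<sigma>) (H \<eta>)"
    by (simp add: max_def algebra_simps)
  then have "exp (- \<beta> * H \<sigma>) * exp (- \<beta> * max (H \<eta> - H \<sigma>) 0) = exp (- \<beta> * max (H \<sigma>) (H \<eta>))"
    by (simp add: exp_add[symmetric])
  then show ?thesis using assms by (simp add: trans_prob_def flip_prob_def)
qed

lemma reversible_chain_metropolis:
  "reversible_chain (spins N) (trans_prob N \<beta> H) (boltzmann \<beta> H)"
proof -
  obtain \<sigma>0 where \<sigma>0: "\<sigma>0 \<in> spins N" using spins_nonempty by auto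
  interpret F: finite_markov_chain "spins N" "trans_prob N \<beta> H" "dirac \<sigma>0"
    using N \<beta> \<sigma>0 by (intro finite_markov_chain_trans_prob dirac_prob) auto
  show ?thesis
  proof
    fix X assume X: "X \<subseteq> spins N" "X \<noteq> {}" "X \<noteq> spins N"
    then obtain \<sigma> \<eta> where s: "\<sigma> \<in> X" "\<eta> \<in> spins N - X" "neighbour N \<sigma> \<eta>"
      using hypercube_exit by blast
    have "\<sigma> \<noteq> \<eta>" using s by auto
    then have "0 < trans_prob N \<beta> H \<sigma> \<eta>" using s N by (simp add: trans_prob_def flip_prob_def)
    then show "\<exists>x\<in>X. \<exists>y\<in>spins N - X. 0 < trans_prob N \<beta> H x y" using s by blast
  next
    fix x y
    show "boltzmann \<beta> H x * trans_prob N \<beta> H x y = boltzmann \<beta> H y * trans_prob N \<beta> H y x"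
    proof (cases "x = y")
      case False
      then show ?thesis
        using conductance[of x y H] conductance[of y x H] neighbour_sym[of N x y] neighbour_sym[of N y x]
        by (auto simp: max.commute)
    qed simp
  qed (use F.p_nonneg F.p_sum finite_spins in auto)
qed

lemma chain_pair_metropolis:
  "chain_pair (spins N) (trans_prob N \<beta> H) (boltzmann \<beta> H) (trans_prob N \<beta> H') (boltzmann \<beta> H')
     (\<lambda>(x, y). exp (- \<beta> * (max (H' x) (H' y) - max (H x) (H y))))"
proof -
  interpret a: reversible_chain "spins N" "trans_prob N \<beta> H" "boltzmann \<beta> H"
    by (rule reversible_chain_metropolis)
  interpret b: reversible_chain "spins N" "trans_prob N \<beta> H'" "boltzmann \<beta> H'"
    by (rule reversible_chain_metropolis)
  show ?thesis
  proof
    fix x y :: "nat \<Rightarrow> real" assume "x \<noteq> y"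
    have "exp (- \<beta> * max (H' x) (H' y)) =
      exp (- \<beta> * (max (H' x) (H' y) - max (H x) (H y))) * exp (- \<beta> * max (H x) (H y))"
      by (simp add: exp_add[symmetric] algebra_simps)
    then show "boltzmann \<beta> H' x * trans_prob N \<beta> H' x y =
      (case (x, y) of (x, y) \<Rightarrow> exp (- \<beta> * (max (H' x) (H' y) - max (H x) (H y)))) *
        (boltzmann \<beta> H x * trans_prob N \<beta> H x y)"
      unfolding conductance[OF \<open>x \<noteq> y\<close>] by simp
  qed simp
qed

context
  fixes H :: "(nat \<Rightarrow> real) \<Rightarrow> real"
begin

interpretation ch: reversible_chain "spins N" "trans_prob N \<beta> H" "boltzmann \<beta> H"
  by (rule reversible_chain_metropolis)

lemma prob_before_eq:
  assumes \<nu>: "\<And>\<sigma>. \<sigma> \<in> spins N \<Longrightarrow> 0 \<le> \<nu> \<sigma>" "(\<Sum>\<sigma>\<in>spins N. \<nu> \<sigma>) = 1"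
    and AB: "A \<subseteq> spins N" "B \<subseteq> spins N" "A \<union> B \<noteq> {}" "A \<inter> B = {}"
  shows "prob_before N \<beta> H \<nu> B A = (\<Sum>\<sigma>\<in>spins N. \<nu> \<sigma> * ch.avg (metro_equil N \<beta> H B A) \<sigma>)"
proof -
  interpret F: finite_markov_chain "spins N" "trans_prob N \<beta> H" \<nu>
    using N \<beta> \<nu> by (intro finite_markov_chain_trans_prob) auto
  interpret L: chain_with_law "spins N" "trans_prob N \<beta> H" "boltzmann \<beta> H" \<nu> ..
  show ?thesis
    unfolding prob_before_def chain_law_def metro_equil_def by (rule L.prob_return_before[OF AB])
qed

lemma prob_before_dirac:
  assumes "\<sigma> \<in> spins N"
    and AB: "A \<subseteq> spins N" "B \<subseteq> spins N" "A \<union> B \<noteq> {}" "A \<inter> B = {}"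
  shows "prob_before N \<beta> H (dirac \<sigma>) B A = ch.avg (metro_equil N \<beta> H B A) \<sigma>"
  using prob_before_eq[OF dirac_prob(1,2)[OF assms(1)] AB] dirac_prob(3)[OF assms(1)] by simp

lemma prob_before_dirac_compl:
  assumes "\<sigma> \<in> spins N"
    and AB: "A \<subseteq> spins N" "B \<subseteq> spins N" "A \<union> B \<noteq> {}" "A \<inter> B = {}"
  shows "prob_before N \<beta> H (dirac \<sigma>) B A = 1 - ch.avg (metro_equil N \<beta> H A B) \<sigma>"
proof -
  have "ch.avg (metro_equil N \<beta> H B A) \<sigma> = ch.avg (\<lambda>x. 1 - metro_equil N \<beta> H A B x) \<sigma>"
    unfolding metro_equil_def using ch.equil_swap[OF AB] by (intro sum.cong) auto
  then show ?thesis
    using prob_before_dirac[OF assms] ch.p_sum[OF assms(1)] by (simp add: right_diff_distrib sum_subtractf)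
qed

lemma partition_pos: "0 < (\<Sum>\<sigma>\<in>spins N. boltzmann \<beta> H \<sigma>)"
  using spins_nonempty finite_spins by (intro sum_pos) auto

lemma metro_cap_sum:
  assumes AB: "A \<subseteq> spins N" "B \<subseteq> spins N" "A \<union> B \<noteq> {}" "A \<inter> B = {}"
  shows "metro_cap N \<beta> H A B = (\<Sum>\<sigma>\<in>A. boltzmann \<beta> H \<sigma> * prob_before N \<beta> H (dirac \<sigma>) B A)"
  unfolding metro_cap_def ch.capacity_sum[OF AB]
  using AB prob_before_dirac_compl[OF _ AB] by (intro sum.cong) (auto simp: metro_equil_def)

lemma prob_before_gibbs_cond:
  assumes X: "X \<subseteq> spins N" "X \<noteq> {}" and U: "U \<subseteq> spins N" "X \<inter> U = {}"
  shows "prob_before N \<beta> H (gibbs_cond N \<beta> H X) U X = metro_cap N \<beta> H X U / (\<Sum>\<sigma>\<in>X. boltzmann \<beta> H \<sigma>)"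
proof -
  define Z where "Z = (\<Sum>\<sigma>\<in>spins N. boltzmann \<beta> H \<sigma>)"
  have Z: "0 < Z" unfolding Z_def by (rule partition_pos)
  have finX: "finite X" using X finite_spins by (auto intro: finite_subset)
  have wX: "0 < (\<Sum>\<sigma>\<in>X. boltzmann \<beta> H \<sigma>)" using finX X by (intro sum_pos) auto
  have gc: "gibbs_cond N \<beta> H X \<sigma> = (if \<sigma> \<in> X then boltzmann \<beta> H \<sigma> / (\<Sum>\<sigma>\<in>X. boltzmann \<beta> H \<sigma>) else 0)" for \<sigma>
    using Z unfolding gibbs_cond_def gibbs_mass_def gibbs_def Z_def[symmetric] sum_divide_distrib[symmetric] by simp
  have nn: "0 \<le> gibbs_cond N \<beta> H X \<sigma>" for \<sigma> using wX by (simp add: gc)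
  have sX: "(\<Sum>\<sigma>\<in>spins N. gibbs_cond N \<beta> H X \<sigma> * f \<sigma>) = (\<Sum>\<sigma>\<in>X. boltzmann \<beta> H \<sigma> * f \<sigma>) / (\<Sum>\<sigma>\<in>X. boltzmann \<beta> H \<sigma>)" for f
  proof -
    have "(\<Sum>\<sigma>\<in>spins N. gibbs_cond N \<beta> H X \<sigma> * f \<sigma>) = (\<Sum>\<sigma>\<in>X. gibbs_cond N \<beta> H X \<sigma> * f \<sigma>)"
      using X finite_spins by (intro sum.mono_neutral_right) (auto simp: gc)
    also have "\<dots> = (\<Sum>\<sigma>\<in>X. boltzmann \<beta> H \<sigma> * f \<sigma> / (\<Sum>\<sigma>\<in>X. boltzmann \<beta> H \<sigma>))"
      by (intro sum.cong) (auto simp: gc)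
    finally show ?thesis by (simp add: sum_divide_distrib)
  qed
  have s1: "(\<Sum>\<sigma>\<in>spins N. gibbs_cond N \<beta> H X \<sigma>) = 1" using sX[of "\<lambda>_. 1"] wX by simp
  have XU: "X \<subseteq> spins N" "U \<subseteq> spins N" "X \<union> U \<noteq> {}" "X \<inter> U = {}" using X U by auto
  have "prob_before N \<beta> H (gibbs_cond N \<beta> H X) U X =
     (\<Sum>\<sigma>\<in>X. boltzmann \<beta> H \<sigma> * ch.avg (metro_equil N \<beta> H U X) \<sigma>) / (\<Sum>\<sigma>\<in>X. boltzmann \<beta> H \<sigma>)"
    using prob_before_eq[OF nn s1 XU] sX by simp
  also have "(\<Sum>\<sigma>\<in>X. boltzmann \<beta> H \<sigma> * ch.avg (metro_equil N \<beta> H U X) \<sigma>) = metro_cap N \<beta> H X U"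
    unfolding metro_cap_sum[OF XU] using prob_before_dirac[OF _ XU] X by (intro sum.cong) auto
  finally show ?thesis .
qed

lemma metro_cap_pos:
  assumes "A \<subseteq> spins N" "B \<subseteq> spins N" "A \<noteq> {}" "B \<noteq> {}" "A \<inter> B = {}"
  shows "0 < metro_cap N \<beta> H A B"
  unfolding metro_cap_def by (rule ch.capacity_pos[OF assms])

text \<open>
  The last-exit biased distribution is the normalised charge of the equilibrium potential on \<open>A\<close>, so
  its mean hitting time is the sum in \<open>mean_hit_formula\<close> divided by the capacity.
\<close>

lemma mean_crossover_eq:
  assumes AB: "A \<subseteq> spins N" "B \<subseteq> spins N" "A \<noteq> {}" "B \<noteq> {}" "A \<inter> B = {}"
  shows "mean_crossover N \<beta> H A B = metro_mass N \<beta> H A B / metro_cap N \<beta> H A B"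
proof -
  define Z where "Z = (\<Sum>\<sigma>\<in>spins N. boltzmann \<beta> H \<sigma>)"
  have Z: "0 < Z" unfolding Z_def by (rule partition_pos)
  have AB1: "A \<subseteq> spins N" "B \<subseteq> spins N" "A \<union> B \<noteq> {}" "A \<inter> B = {}" using AB by auto
  have BA1: "B \<subseteq> spins N" "A \<subseteq> spins N" "B \<union> A \<noteq> {}" "B \<inter> A = {}" using AB by auto
  define c where "c = metro_cap N \<beta> H A B"
  define T where "T = mean_hit (spins N) (trans_prob N \<beta> H) B"
  have c: "0 < c" unfolding c_def by (rule metro_cap_pos[OF AB])
  define e where "e \<sigma> = prob_before N \<beta> H (dirac \<sigma>) B A" for \<sigma>
  have e0: "0 \<le> e \<sigma>" for \<sigma> by (simp add: e_def prob_before_def)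
  have ce: "c = (\<Sum>\<sigma>\<in>A. boltzmann \<beta> H \<sigma> * e \<sigma>)" unfolding c_def e_def by (rule metro_cap_sum[OF AB1])
  have le: "last_exit N \<beta> H A B \<sigma> = (if \<sigma> \<in> A then boltzmann \<beta> H \<sigma> * e \<sigma> / c else 0)" for \<sigma>
  proof -
    have "(\<Sum>\<sigma>'\<in>A. gibbs N \<beta> H \<sigma>' * e \<sigma>') = c / Z"
      unfolding ce gibbs_def Z_def[symmetric] sum_divide_distrib by simp
    then show ?thesis
      unfolding last_exit_def e_def[symmetric] gibbs_def Z_def[symmetric] using Z by simp
  qed
  have sA: "(\<Sum>\<sigma>\<in>spins N. last_exit N \<beta> H A B \<sigma> * f \<sigma>) = (\<Sum>\<sigma>\<in>A. boltzmann \<beta> H \<sigma> * e \<sigma> * f \<sigma>) / c" for f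
  proof -
    have "(\<Sum>\<sigma>\<in>spins N. last_exit N \<beta> H A B \<sigma> * f \<sigma>) = (\<Sum>\<sigma>\<in>A. last_exit N \<beta> H A B \<sigma> * f \<sigma>)"
      using AB finite_spins by (intro sum.mono_neutral_right) (auto simp: le)
    also have "\<dots> = (\<Sum>\<sigma>\<in>A. boltzmann \<beta> H \<sigma> * e \<sigma> * f \<sigma> / c)"
      by (intro sum.cong) (auto simp: le)
    finally show ?thesis by (simp add: sum_divide_distrib)
  qed
  have nn: "0 \<le> last_exit N \<beta> H A B \<sigma>" for \<sigma> using c e0 by (simp add: le)
  have s1: "(\<Sum>\<sigma>\<in>spins N. last_exit N \<beta> H A B \<sigma>) = 1" using sA[of "\<lambda>_. 1"] c ce by simp
  interpret F: finite_markov_chain "spins N" "trans_prob N \<beta> H" "last_exit N \<beta> H A B"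
    using N \<beta> nn s1 by (intro finite_markov_chain_trans_prob) auto
  interpret L: chain_with_law "spins N" "trans_prob N \<beta> H" "boltzmann \<beta> H" "last_exit N \<beta> H A B" ..
  have T0: "0 \<le> T \<sigma>" if "\<sigma> \<in> spins N" for \<sigma>
    unfolding T_def using AB that by (intro ch.mean_hit_nonneg) auto
  have "(\<integral>\<^sup>+ w. ennreal_of_enat (return_time B w) \<partial>chain_law N \<beta> H (last_exit N \<beta> H A B)) =
    ennreal (\<Sum>\<sigma>\<in>spins N. last_exit N \<beta> H A B \<sigma> * T \<sigma>)"
    unfolding chain_law_def T_def using AB by (intro L.mean_return_time_law) (auto simp: le)
  moreover have "0 \<le> (\<Sum>\<sigma>\<in>spins N. last_exit N \<beta> H A B \<sigma> * T \<sigma>)"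
    using nn T0 by (intro sum_nonneg) auto
  ultimately have "mean_crossover N \<beta> H A B = (\<Sum>\<sigma>\<in>spins N. last_exit N \<beta> H A B \<sigma> * T \<sigma>)"
    unfolding mean_crossover_def mean_return_time_def by simp
  also have "\<dots> = (\<Sum>\<sigma>\<in>A. boltzmann \<beta> H \<sigma> * e \<sigma> * T \<sigma>) / c" by (rule sA)
  also have "(\<Sum>\<sigma>\<in>A. boltzmann \<beta> H \<sigma> * e \<sigma> * T \<sigma>) =
      (\<Sum>\<sigma>\<in>A. boltzmann \<beta> H \<sigma> * (1 - ch.avg (ch.equi A B) \<sigma>) * T \<sigma>)"
    unfolding e_def using prob_before_dirac_compl[OF _ AB1] AB
    by (intro sum.cong) (auto simp: metro_equil_def)
  also have "\<dots> = metro_mass N \<beta> H A B"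
    unfolding metro_mass_def metro_equil_def T_def using AB by (intro ch.mean_hit_formula) auto
  finally show ?thesis by (simp add: c_def)
qed

lemma metro_mass_pos:
  assumes AB: "A \<subseteq> spins N" "B \<subseteq> spins N" "A \<noteq> {}" "A \<inter> B = {}"
  shows "(\<Sum>\<sigma>\<in>A. boltzmann \<beta> H \<sigma>) \<le> metro_mass N \<beta> H A B"
    and "metro_mass N \<beta> H A B \<le> (\<Sum>\<sigma>\<in>spins N. boltzmann \<beta> H \<sigma>)"
proof -
  have AB1: "A \<subseteq> spins N" "B \<subseteq> spins N" "A \<union> B \<noteq> {}" "A \<inter> B = {}" using AB by auto
  have "(\<Sum>\<sigma>\<in>A. boltzmann \<beta> H \<sigma>) = (\<Sum>\<sigma>\<in>A. boltzmann \<beta> H \<sigma> * metro_equil N \<beta> H A B \<sigma>)"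
    by (intro sum.cong) (auto simp: metro_equil_def equil_def)
  also have "\<dots> \<le> metro_mass N \<beta> H A B"
    unfolding metro_mass_def metro_equil_def
    using AB finite_spins ch.equil_nonneg[OF AB1] by (intro sum_mono2) auto
  finally show "(\<Sum>\<sigma>\<in>A. boltzmann \<beta> H \<sigma>) \<le> metro_mass N \<beta> H A B" .
  show "metro_mass N \<beta> H A B \<le> (\<Sum>\<sigma>\<in>spins N. boltzmann \<beta> H \<sigma>)"
    unfolding metro_mass_def metro_equil_def
    using ch.equil_le_one[OF AB1] by (intro sum_mono) (auto intro: mult_left_le)
qed

text \<open>
  The escape probabilities in the definition of metastability are capacities divided by weights; \<open>m\<close>
  is the minimum in its denominator, positive by irreducibility.
\<close>

lemma metastable_capacities:
  assumes ms: "metastable N \<beta> H \<rho> K M" and K: "2 \<le> K" and U: "U = (\<Union>l\<in>{1..K}. M l)" and \<rho>: "0 \<le> \<rho>"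
  obtains m where "0 < m"
    "\<And>X. X \<subseteq> spins N - U \<Longrightarrow> X \<noteq> {} \<Longrightarrow> m * (\<Sum>x\<in>X. boltzmann \<beta> H x) \<le> metro_cap N \<beta> H X U"
    "\<And>j. j \<in> {1..K} \<Longrightarrow> metro_cap N \<beta> H (M j) (U - M j) \<le> \<rho> * m * (\<Sum>x\<in>M j. boltzmann \<beta> H x)"
proof -
  have M: "\<And>l. l \<in> {1..K} \<Longrightarrow> M l \<noteq> {} \<and> M l \<subseteq> spins N" and disj: "disjoint_family_on M {1..K}"
    and Une: "U \<noteq> spins N"
    using ms unfolding metastable_def U by auto
  have US: "U \<subseteq> spins N" using M unfolding U by blast
  define P where "P = (\<lambda>X. prob_before N \<beta> H (gibbs_cond N \<beta> H X) U X)"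
  define Q where "Q = (\<lambda>j. prob_before N \<beta> H (gibbs_cond N \<beta> H (M j)) (U - M j) (M j))"
  define F where "F = Pow (spins N - U) - {{}}"
  define m where "m = Min (P ` F)"
  have le: "real K * Max (Q ` {1..K}) / m \<le> \<rho>"
    using ms unfolding metastable_def U[symmetric] Let_def P_def Q_def F_def m_def by auto
  have F: "finite F" "F \<noteq> {}" using finite_spins US Une by (auto simp: F_def)
  have Une2: "U \<noteq> {}" using M[of 1] K by (auto simp: U)
  have wpos: "0 < (\<Sum>x\<in>X. boltzmann \<beta> H x)" if "X \<subseteq> spins N" "X \<noteq> {}" for X
    using that finite_spins by (intro sum_pos) (auto intro: finite_subset)
  have P: "P X = metro_cap N \<beta> H X U / (\<Sum>x\<in>X. boltzmann \<beta> H x)" if "X \<in> F" for X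
    unfolding P_def using that US by (intro prob_before_gibbs_cond) (auto simp: F_def)
  have Ppos: "0 < P X" if "X \<in> F" for X
    unfolding P[OF that] using that US Une2
    by (intro divide_pos_pos metro_cap_pos wpos) (auto simp: F_def)
  have m: "0 < m" unfolding m_def using F Ppos by (subst Min_gr_iff) auto
  have 1: "m * (\<Sum>x\<in>X. boltzmann \<beta> H x) \<le> metro_cap N \<beta> H X U" if "X \<subseteq> spins N - U" "X \<noteq> {}" for X
  proof -
    have XF: "X \<in> F" using that by (auto simp: F_def)
    then have "m \<le> P X" unfolding m_def using F by (intro Min_le) auto
    moreover have "0 < (\<Sum>x\<in>X. boltzmann \<beta> H x)" using that by (intro wpos) auto
    ultimately show ?thesis unfolding P[OF XF] by (simp add: pos_le_divide_eq)
  qed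
  have 2: "metro_cap N \<beta> H (M j) (U - M j) \<le> \<rho> * m * (\<Sum>x\<in>M j. boltzmann \<beta> H x)" if j: "j \<in> {1..K}" for j
  proof -
    have wj: "0 < (\<Sum>x\<in>M j. boltzmann \<beta> H x)" using M[OF j] by (intro wpos) auto
    have Qj: "Q j = metro_cap N \<beta> H (M j) (U - M j) / (\<Sum>x\<in>M j. boltzmann \<beta> H x)"
      unfolding Q_def using M[OF j] US by (intro prob_before_gibbs_cond) auto
    have "Q j \<le> Max (Q ` {1..K})" using j by (intro Max_ge) auto
    moreover have "0 \<le> Q j" by (simp add: Q_def prob_before_def)
    ultimately have "1 * Q j \<le> real K * Max (Q ` {1..K})" using K by (intro mult_mono) auto
    also have "\<dots> \<le> \<rho> * m" using le m by (simp add: field_simps)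
    finally show ?thesis unfolding Qj using wj by (simp add: pos_divide_le_eq)
  qed
  show ?thesis using that m 1 2 by blast
qed

lemma valley_dominates:
  assumes M: "\<And>l. l \<in> {1..K} \<Longrightarrow> M l \<noteq> {} \<and> M l \<subseteq> spins N" and U: "U = (\<Union>l\<in>{1..K}. M l)"
    and j: "j \<in> {1..K}" and l: "l \<in> {1..K} - {j}" and x: "x \<in> valley N \<beta> H K M j - M j"
  shows "x \<notin> U" "metro_equil N \<beta> H (M l) (U - M l) x \<le> metro_equil N \<beta> H (M j) (U - M j) x"
proof -
  have xU: "x \<in> spins N - U" using x unfolding valley_def Let_def U[symmetric] by blast
  then show "x \<notin> U" by simp
  have US: "U \<subseteq> spins N" using M unfolding U by blast
  have pb: "prob_before N \<beta> H (dirac x) (M k) (U - M k) = metro_equil N \<beta> H (M k) (U - M k) x"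
    if k: "k \<in> {1..K}" for k
  proof -
    have Mk: "M k \<subseteq> U" using k by (auto simp: U)
    have AB: "U - M k \<subseteq> spins N" "M k \<subseteq> spins N" "(U - M k) \<union> M k \<noteq> {}" "(U - M k) \<inter> M k = {}"
      using M[OF k] US by auto
    have BA: "M k \<subseteq> spins N" "U - M k \<subseteq> spins N" "M k \<union> (U - M k) \<noteq> {}" "M k \<inter> (U - M k) = {}"
      using M[OF k] US by auto
    have "prob_before N \<beta> H (dirac x) (M k) (U - M k) = ch.avg (metro_equil N \<beta> H (M k) (U - M k)) x"
      using xU by (intro prob_before_dirac AB) auto
    also have "\<dots> = metro_equil N \<beta> H (M k) (U - M k) x"
      unfolding metro_equil_def using xU Mk by (intro ch.equil_harmonic[OF BA, symmetric]) auto
    finally show ?thesis .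
  qed
  have "prob_before N \<beta> H (dirac x) (M l) (U - M l) \<le>
      Max ((\<lambda>j. prob_before N \<beta> H (dirac x) (M j) (U - M j)) ` ({1..K} - {j}))"
    using l by (intro Max_ge) auto
  also have "\<dots> \<le> prob_before N \<beta> H (dirac x) (M j) (U - M j)"
    using x unfolding valley_def Let_def U[symmetric] by blast
  finally show "metro_equil N \<beta> H (M l) (U - M l) x \<le> metro_equil N \<beta> H (M j) (U - M j) x"
    using pb l j by auto
qed

end

text \<open>
  A deviation of the energies by at most \<open>D\<close> changes weights and conductances by at most the factor
  \<open>exp (\<beta> * D)\<close>. The a priori bound \<open>R\<close> on the energies compares the total weight with that of the
  valley.
\<close>

lemma metro_mass_metastable:
  assumes ms: "metastable N \<beta> H \<rho> K M" and \<rho>: "0 \<le> \<rho>" and i: "i \<in> {2..K}"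
    and V: "disjoint_family_on V {1..K}" "(\<Union>l\<in>{1..K}. V l) = spins N"
    and MV: "\<And>l. l \<in> {1..K} \<Longrightarrow> M l \<subseteq> V l \<and> V l \<subseteq> valley N \<beta> H K M l"
    and nondeg: "\<And>j. j \<in> {i+1..K} \<Longrightarrow> gibbs_mass N \<beta> H (V j) \<le> \<eta> * gibbs_mass N \<beta> H (V i)" and \<eta>: "0 \<le> \<eta>"
    and D: "\<And>\<sigma>. \<sigma> \<in> spins N \<Longrightarrow> \<bar>H' \<sigma> - H \<sigma>\<bar> \<le> D"
    and R: "\<And>\<sigma>. \<sigma> \<in> spins N \<Longrightarrow> \<bar>H' \<sigma>\<bar> \<le> R"
  shows "\<bar>metro_mass N \<beta> H' (M i) (\<Union>j\<in>{1..<i}. M j) - (\<Sum>\<sigma>\<in>V i. boltzmann \<beta> H' \<sigma>)\<bar>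
     \<le> real K * ((1/2) ^ n * (2 ^ N * exp (2 * \<beta> * R)) + 2 * real n * real K * exp (4 * (\<beta> * D)) * \<rho>
         + exp (2 * (\<beta> * D)) * \<eta>) * (\<Sum>\<sigma>\<in>V i. boltzmann \<beta> H' \<sigma>)"
proof -
  define U where U: "U = (\<Union>l\<in>{1..K}. M l)"
  have K: "2 \<le> K" using i by auto
  have M: "\<And>l. l \<in> {1..K} \<Longrightarrow> M l \<noteq> {} \<and> M l \<subseteq> spins N" and disj: "disjoint_family_on M {1..K}"
    using ms unfolding metastable_def by auto
  obtain m where m: "0 < m"
    "\<And>X. X \<subseteq> spins N - U \<Longrightarrow> X \<noteq> {} \<Longrightarrow> m * (\<Sum>x\<in>X. boltzmann \<beta> H x) \<le> metro_cap N \<beta> H X U"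
    "\<And>j. j \<in> {1..K} \<Longrightarrow> metro_cap N \<beta> H (M j) (U - M j) \<le> \<rho> * m * (\<Sum>x\<in>M j. boltzmann \<beta> H x)"
    using metastable_capacities[OF ms K U \<rho>] by blast
  interpret chain_pair "spins N" "trans_prob N \<beta> H" "boltzmann \<beta> H" "trans_prob N \<beta> H'" "boltzmann \<beta> H'"
     "\<lambda>(x, y). exp (- \<beta> * (max (H' x) (H' y) - max (H x) (H y)))"
    by (rule chain_pair_metropolis)
  define Z where "Z = (\<Sum>\<sigma>\<in>spins N. boltzmann \<beta> H \<sigma>)"
  have Z: "0 < Z" unfolding Z_def by (rule partition_pos)
  have gm: "gibbs_mass N \<beta> H X = (\<Sum>\<sigma>\<in>X. boltzmann \<beta> H \<sigma>) / Z" for X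
    unfolding gibbs_mass_def gibbs_def Z_def[symmetric] sum_divide_distrib ..
  have Vi: "V i \<noteq> {}" "V i \<subseteq> spins N" using M[of i] MV[of i] V(2) i by auto
  have expD: "exp (- \<beta> * a) \<le> exp (\<beta> * D) * exp (- \<beta> * b)" if "\<bar>a - b\<bar> \<le> D" for a b
  proof -
    have "\<beta> * (b - a) \<le> \<beta> * D" using that \<beta> by (intro mult_left_mono) auto
    then show ?thesis by (simp add: exp_add[symmetric] algebra_simps)
  qed
  show ?thesis
    unfolding metro_mass_def metro_equil_def
  proof (rule equil_mass_metastable[where U=U and m=m and \<rho>=\<rho>])
    show "U = (\<Union>l\<in>{1..K}. M l)" by (rule U)
    show "x \<notin> U \<and> equil (spins N) (trans_prob N \<beta> H) (M l) (U - M l) x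
        \<le> equil (spins N) (trans_prob N \<beta> H) (M j) (U - M j) x"
      if "j \<in> {1..K}" "l \<in> {1..K} - {j}" "x \<in> V j - M j" for j l x
      using valley_dominates[OF M U that(1,2), where H=H] that MV[OF that(1)]
      by (auto simp: metro_equil_def)
    show "(\<Sum>x\<in>V j. boltzmann \<beta> H x) \<le> \<eta> * (\<Sum>x\<in>V i. boltzmann \<beta> H x)" if "j \<in> {i+1..K}" for j
      using nondeg[OF that] Z unfolding gm by (simp add: divide_right_mono field_simps)
    show "boltzmann \<beta> H' x \<le> exp (\<beta> * D) * boltzmann \<beta> H x \<and> boltzmann \<beta> H x \<le> exp (\<beta> * D) * boltzmann \<beta> H' x"
      if "x \<in> spins N" for x
      using D[OF that] by (intro conjI expD) (auto simp: abs_minus_commute)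
    show "(case (x, y) of (x, y) \<Rightarrow> exp (- \<beta> * (max (H' x) (H' y) - max (H x) (H y)))) \<le> exp (\<beta> * D) \<and>
       inverse (case (x, y) of (x, y) \<Rightarrow> exp (- \<beta> * (max (H' x) (H' y) - max (H x) (H y)))) \<le> exp (\<beta> * D)"
      if "x \<in> spins N" "y \<in> spins N" for x y
    proof -
      have "\<bar>max (H' x) (H' y) - max (H x) (H y)\<bar> \<le> D"
        using D[OF that(1)] D[OF that(2)] by (auto simp: max_def abs_le_iff)
      then have "\<beta> * \<bar>max (H' x) (H' y) - max (H x) (H y)\<bar> \<le> \<beta> * D" using \<beta> by simp
      then have "\<bar>\<beta> * (max (H' x) (H' y) - max (H x) (H y))\<bar> \<le> \<beta> * D" using \<beta> by (simp add: abs_mult)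
      then show ?thesis by (simp add: exp_minus[symmetric] abs_le_iff)
    qed
    show "(\<Sum>x\<in>spins N. boltzmann \<beta> H' x) \<le> 2 ^ N * exp (2 * \<beta> * R) * (\<Sum>x\<in>V i. boltzmann \<beta> H' x)"
    proof -
      obtain v where v: "v \<in> V i" using Vi by auto
      have b: "- (\<beta> * R) \<le> - \<beta> * H' x \<and> - \<beta> * H' x \<le> \<beta> * R" if "x \<in> spins N" for x
      proof -
        have "\<beta> * \<bar>H' x\<bar> \<le> \<beta> * R" using R[OF that] \<beta> by simp
        then have "\<bar>\<beta> * H' x\<bar> \<le> \<beta> * R" using \<beta> by (simp add: abs_mult)
        then show ?thesis by (simp add: abs_le_iff)
      qed
      have "(\<Sum>x\<in>spins N. boltzmann \<beta> H' x) \<le> (\<Sum>x\<in>spins N. exp (\<beta> * R))"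
        using b by (intro sum_mono) simp
      also have "\<dots> = 2 ^ N * exp (\<beta> * R)" by (simp add: card_spins)
      also have "\<dots> = 2 ^ N * exp (2 * \<beta> * R) * exp (- (\<beta> * R))" by (simp add: exp_add[symmetric])
      also have "exp (- (\<beta> * R)) \<le> boltzmann \<beta> H' v" using b v Vi by auto
      also have "boltzmann \<beta> H' v \<le> (\<Sum>x\<in>V i. boltzmann \<beta> H' x)"
        using v fin_sub[OF Vi(2)] by (intro member_le_sum) auto
      finally show ?thesis by simp
    qed
  qed (use M disj m \<rho> V MV i \<eta> in \<open>auto simp: metro_cap_def\<close>)
qed

end

section \<open>McDiarmid's inequality\<close>

lemma (in prob_space) hoeffding_mgf:
  fixes f :: "'a \<Rightarrow> real"
  assumes [measurable]: "f \<in> borel_measurable M" and ab: "AE x in M. f x \<in> {a..b}" and l: "0 < l"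
  shows "expectation (\<lambda>x. exp (l * (f x - expectation f))) \<le> exp (l\<^sup>2 * (b - a)\<^sup>2 / 8)"
proof -
  interpret I: interval_bounded_random_variable M f a b by unfold_locales (use ab in auto)
  have "(\<integral>\<^sup>+ x. exp (l * (f x - expectation f)) \<partial>M) \<le> ennreal (exp (l\<^sup>2 * (b - a)\<^sup>2 / 8))"
    by (rule I.Hoeffdings_lemma_nn_integral[OF l])
  then show ?thesis
    by (subst integral_eq_nn_integral) (auto intro: enn2real_leI)
qed

lemma (in prob_space) integrable_bounded:
  fixes f :: "'a \<Rightarrow> real"
  assumes "f \<in> borel_measurable M" "AE x in M. \<bar>f x\<bar> \<le> B"
  shows "integrable M f"
  by (rule integrable_const_bound[where B=B]) (use assms in auto)

text \<open>
  Induction over the coordinates: integrating out one coordinate preserves the bounded differences in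
  the others, and Hoeffding's lemma applies to the remaining function of that coordinate, whose values
  lie in an interval of length \<open>c i\<close>.
\<close>

lemma mcdiarmid_mgf:
  fixes f :: "('i \<Rightarrow> 'a) \<Rightarrow> real"
  assumes M: "\<And>i. prob_space (M i)" and "finite I" and l: "0 < l"
    and "f \<in> borel_measurable (PiM I M)"
    and "\<And>x. x \<in> space (PiM I M) \<Longrightarrow> \<bar>f x\<bar> \<le> B"
    and "\<And>i x y. i \<in> I \<Longrightarrow> x \<in> space (PiM I M) \<Longrightarrow> y \<in> space (M i) \<Longrightarrow> \<bar>f x - f (x(i := y))\<bar> \<le> c i"
  shows "(\<integral>x. exp (l * (f x - (\<integral>x. f x \<partial>PiM I M))) \<partial>PiM I M) \<le> exp (l\<^sup>2 * (\<Sum>i\<in>I. (c i)\<^sup>2) / 8)"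
  using assms(2,4-)
proof (induction I arbitrary: f rule: finite_induct)
  case empty
  have sp: "space (PiM {} M) = {\<lambda>_. undefined}" by (rule space_PiM_empty)
  interpret P: prob_space "PiM {} M" by (rule prob_space_PiM[OF M])
  have cnst: "(\<integral>x. g x \<partial>PiM {} M) = g (\<lambda>_. undefined)" for g :: "('i \<Rightarrow> 'a) \<Rightarrow> real"
  proof -
    have "(\<integral>x. g x \<partial>PiM {} M) = (\<integral>x. g (\<lambda>_. undefined) \<partial>PiM {} M)"
      by (intro Bochner_Integration.integral_cong) (auto simp: sp)
    then show ?thesis by (simp add: P.prob_space)
  qed
  show ?case unfolding cnst by simp
next
  case (insert i I)
  note f_meas [measurable] = insert.prems(1)
  have psf: "product_sigma_finite M"
    using M by (simp add: product_sigma_finite_def prob_space_imp_sigma_finite)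
  interpret PI: prob_space "PiM I M" by (rule prob_space_PiM[OF M])
  interpret PJ: prob_space "PiM (insert i I) M" by (rule prob_space_PiM[OF M])
  interpret Mi: prob_space "M i" by (rule M)
  have upd: "x(i := y) \<in> space (PiM (insert i I) M)" if "x \<in> space (PiM I M)" "y \<in> space (M i)" for x y
    using that by (auto simp: space_PiM PiE_iff extensional_def)
  have updm [measurable]: "(\<lambda>(x, y). x(i := y)) \<in> PiM I M \<Otimes>\<^sub>M M i \<rightarrow>\<^sub>M PiM (insert i I) M"
    by (rule measurable_add_dim)
  have fm: "(\<lambda>(x, y). f (x(i := y))) \<in> borel_measurable (PiM I M \<Otimes>\<^sub>M M i)"
    using measurable_compose[OF updm f_meas] by (simp add: case_prod_beta')
  have fym: "(\<lambda>y. f (x(i := y))) \<in> borel_measurable (M i)" if "x \<in> space (PiM I M)" for x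
    using measurable_compose[OF measurable_Pair1'[OF that] fm] by simp
  define g where "g x = (\<integral>y. f (x(i := y)) \<partial>M i)" for x
  have gm [measurable]: "g \<in> borel_measurable (PiM I M)"
    unfolding g_def using fm by (rule sigma_finite_measure.borel_measurable_lebesgue_integral[OF prob_space_imp_sigma_finite[OF M]])
  have fB: "\<bar>f (x(i := y))\<bar> \<le> B" if "x \<in> space (PiM I M)" "y \<in> space (M i)" for x y
    using insert.prems(2)[OF upd[OF that]] .
  have fint: "integrable (M i) (\<lambda>y. f (x(i := y)))" if "x \<in> space (PiM I M)" for x
    using fym[OF that] fB[OF that] by (intro Mi.integrable_bounded[where B=B]) auto
  have gB: "\<bar>g x\<bar> \<le> B" if "x \<in> space (PiM I M)" for x
  proof -
    have "\<bar>g x\<bar> \<le> (\<integral>y. \<bar>f (x(i := y))\<bar> \<partial>M i)"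
      unfolding g_def by (rule integral_abs_bound)
    also have "\<dots> \<le> (\<integral>y. B \<partial>M i)"
      using fint[OF that] fB[OF that] by (intro integral_mono) auto
    finally show ?thesis by (simp add: Mi.prob_space)
  qed
  have gdiff: "\<bar>g x - g (x(j := z))\<bar> \<le> c j" if x: "x \<in> space (PiM I M)" and j: "j \<in> I" and z: "z \<in> space (M j)" for x j z
  proof -
    have ij: "i \<noteq> j" using insert.hyps j by auto
    have x': "x(j := z) \<in> space (PiM I M)" using x j z by (auto simp: space_PiM PiE_iff extensional_def)
    have "\<bar>g x - g (x(j := z))\<bar> = \<bar>\<integral>y. f (x(i := y)) - f ((x(j := z))(i := y)) \<partial>M i\<bar>"
      unfolding g_def using fint[OF x] fint[OF x'] by simp
    also have "\<dots> \<le> (\<integral>y. \<bar>f (x(i := y)) - f ((x(j := z))(i := y))\<bar> \<partial>M i)"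
      by (rule integral_abs_bound)
    also have "\<dots> \<le> (\<integral>y. c j \<partial>M i)"
    proof (intro integral_mono)
      fix y assume y: "y \<in> space (M i)"
      have "(x(j := z))(i := y) = (x(i := y))(j := z)" using ij by (rule fun_upd_twist[symmetric])
      then show "\<bar>f (x(i := y)) - f ((x(j := z))(i := y))\<bar> \<le> c j"
        using insert.prems(3)[OF insertI2[OF j] upd[OF x y] z] by presburger
    qed (use fint[OF x] fint[OF x'] in auto)
    finally show ?thesis by (simp add: Mi.prob_space)
  qed
  have IH: "(\<integral>x. exp (l * (g x - (\<integral>x. g x \<partial>PiM I M))) \<partial>PiM I M) \<le> exp (l\<^sup>2 * (\<Sum>i\<in>I. (c i)\<^sup>2) / 8)"
    by (rule insert.IH[OF gm gB gdiff])
  have fJ: "integrable (PiM (insert i I) M) f"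
    using insert.prems(2) by (intro PJ.integrable_bounded[where B=B]) auto
  define m where "m = (\<integral>x. f x \<partial>PiM (insert i I) M)"
  have mg: "m = (\<integral>x. g x \<partial>PiM I M)"
    unfolding m_def g_def by (rule product_sigma_finite.product_integral_insert[OF psf insert.hyps(1,2) fJ])
  have expB: "\<bar>exp (l * (a - b))\<bar> \<le> exp (l * (B + B))" if "\<bar>a\<bar> \<le> B" "\<bar>b\<bar> \<le> B" for a b
    using that l by auto
  have mB: "\<bar>m\<bar> \<le> B"
  proof -
    have "\<bar>m\<bar> \<le> (\<integral>x. \<bar>f x\<bar> \<partial>PiM (insert i I) M)" unfolding m_def by (rule integral_abs_bound)
    also have "\<dots> \<le> (\<integral>x. B \<partial>PiM (insert i I) M)"
      using fJ insert.prems(2) by (intro integral_mono) auto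
    finally show ?thesis by (simp add: PJ.prob_space)
  qed
  have inner: "(\<integral>y. exp (l * (f (x(i := y)) - m)) \<partial>M i) \<le> exp (l\<^sup>2 * (c i)\<^sup>2 / 8) * exp (l * (g x - m))"
    if x: "x \<in> space (PiM I M)" for x
  proof -
    define a where "a = Inf ((\<lambda>y. f (x(i := y))) ` space (M i))"
    have bdd: "bdd_below ((\<lambda>y. f (x(i := y))) ` space (M i))"
      using fB[OF x] by (intro bdd_belowI2[of _ "-B"]) (auto simp: abs_le_iff minus_le_iff)
    have rng: "f (x(i := y)) \<in> {a..a + c i}" if y: "y \<in> space (M i)" for y
    proof -
      have "a \<le> f (x(i := y))" unfolding a_def using bdd y by (intro cInf_lower) auto
      moreover have "f (x(i := y)) - c i \<le> a" unfolding a_def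
      proof (rule cInf_greatest)
        show "(\<lambda>y. f (x(i := y))) ` space (M i) \<noteq> {}" using Mi.not_empty by auto
        fix v assume "v \<in> (\<lambda>y. f (x(i := y))) ` space (M i)"
        then obtain z where z: "z \<in> space (M i)" "v = f (x(i := z))" by auto
        have "\<bar>f (x(i := y)) - f ((x(i := y))(i := z))\<bar> \<le> c i"
          by (rule insert.prems(3)[OF insertI1 upd[OF x y] z(1)])
        then show "f (x(i := y)) - c i \<le> v" using z by (simp add: abs_le_iff)
      qed
      ultimately show ?thesis by auto
    qed
    have "(\<integral>y. exp (l * (f (x(i := y)) - m)) \<partial>M i) =
       (\<integral>y. exp (l * (f (x(i := y)) - g x)) * exp (l * (g x - m)) \<partial>M i)"
      by (intro Bochner_Integration.integral_cong refl) (simp add: exp_add[symmetric] algebra_simps)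
    also have "\<dots> = (\<integral>y. exp (l * (f (x(i := y)) - g x)) \<partial>M i) * exp (l * (g x - m))" by simp
    also have "(\<integral>y. exp (l * (f (x(i := y)) - g x)) \<partial>M i) \<le> exp (l\<^sup>2 * ((a + c i) - a)\<^sup>2 / 8)"
      unfolding g_def using fym[OF x] rng l by (intro Mi.hoeffding_mgf) auto
    finally show ?thesis by simp
  qed
  have "(\<integral>x. exp (l * (f x - m)) \<partial>PiM (insert i I) M) = (\<integral>x. (\<integral>y. exp (l * (f (x(i := y)) - m)) \<partial>M i) \<partial>PiM I M)"
  proof (rule product_sigma_finite.product_integral_insert[OF psf insert.hyps(1,2)])
    show "integrable (PiM (insert i I) M) (\<lambda>x. exp (l * (f x - m)))"
      by (intro PJ.integrable_bounded[where B="exp (l * (B + B))"] AE_I2 expB insert.prems(2) mB) simp_all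
  qed
  also have "\<dots> \<le> (\<integral>x. exp (l\<^sup>2 * (c i)\<^sup>2 / 8) * exp (l * (g x - m)) \<partial>PiM I M)"
  proof (rule integral_mono)
    have "(\<lambda>(x, y). exp (l * (f (x(i := y)) - m))) \<in> borel_measurable (PiM I M \<Otimes>\<^sub>M M i)"
      using fm by (simp add: case_prod_beta')
    then have me: "(\<lambda>x. \<integral>y. exp (l * (f (x(i := y)) - m)) \<partial>M i) \<in> borel_measurable (PiM I M)"
      by (rule sigma_finite_measure.borel_measurable_lebesgue_integral[OF prob_space_imp_sigma_finite[OF M]])
    have bd: "\<bar>\<integral>y. exp (l * (f (x(i := y)) - m)) \<partial>M i\<bar> \<le> exp (l\<^sup>2 * (c i)\<^sup>2 / 8) * exp (l * (B + B))"
      if x: "x \<in> space (PiM I M)" for x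
    proof -
      have "exp (l * (g x - m)) \<le> exp (l * (B + B))" using expB[OF gB[OF x] mB] by simp
      then have "(\<integral>y. exp (l * (f (x(i := y)) - m)) \<partial>M i) \<le> exp (l\<^sup>2 * (c i)\<^sup>2 / 8) * exp (l * (B + B))"
        using inner[OF x] by (smt (verit) exp_gt_zero mult_left_mono)
      moreover have "0 \<le> (\<integral>y. exp (l * (f (x(i := y)) - m)) \<partial>M i)" by (intro integral_nonneg_AE) auto
      ultimately show ?thesis by simp
    qed
    show "integrable (PiM I M) (\<lambda>x. \<integral>y. exp (l * (f (x(i := y)) - m)) \<partial>M i)"
      using me bd by (intro PI.integrable_bounded) auto
    show "integrable (PiM I M) (\<lambda>x. exp (l\<^sup>2 * (c i)\<^sup>2 / 8) * exp (l * (g x - m)))"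
      by (intro integrable_mult_right PI.integrable_bounded[where B="exp (l * (B + B))"] AE_I2 expB gB mB) simp_all
  qed (rule inner)
  also have "\<dots> = exp (l\<^sup>2 * (c i)\<^sup>2 / 8) * (\<integral>x. exp (l * (g x - m)) \<partial>PiM I M)" by simp
  also have "\<dots> \<le> exp (l\<^sup>2 * (c i)\<^sup>2 / 8) * exp (l\<^sup>2 * (\<Sum>i\<in>I. (c i)\<^sup>2) / 8)"
    using IH by (simp add: mg)
  also have "\<dots> = exp (l\<^sup>2 * (\<Sum>i\<in>insert i I. (c i)\<^sup>2) / 8)"
    using insert.hyps by (simp add: exp_add[symmetric] algebra_simps)
  finally show ?case by (simp add: m_def)
qed

theorem mcdiarmid:
  fixes f :: "('i \<Rightarrow> 'a) \<Rightarrow> real"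
  assumes M: "\<And>i. prob_space (M i)" and I: "finite I"
    and f [measurable]: "f \<in> borel_measurable (PiM I M)"
    and B: "\<And>x. x \<in> space (PiM I M) \<Longrightarrow> \<bar>f x\<bar> \<le> B"
    and c: "\<And>i x y. i \<in> I \<Longrightarrow> x \<in> space (PiM I M) \<Longrightarrow> y \<in> space (M i) \<Longrightarrow> \<bar>f x - f (x(i := y))\<bar> \<le> c i"
    and V: "(\<Sum>i\<in>I. (c i)\<^sup>2) \<le> V" "0 < V" and u: "0 < u"
  shows "measure (PiM I M) {x \<in> space (PiM I M). f x \<ge> (\<integral>x. f x \<partial>PiM I M) + u} \<le> exp (- (2 * u\<^sup>2 / V))"
proof -
  interpret P: prob_space "PiM I M" by (rule prob_space_PiM[OF M])
  define m where "m = (\<integral>x. f x \<partial>PiM I M)"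
  \<comment> \<open>the minimiser of \<open>- l * u + l\<^sup>2 * V / 8\<close>\<close>
  define l where "l = 4 * u / V"
  have l: "0 < l" using u V by (simp add: l_def)
  have int: "integrable (PiM I M) (\<lambda>x. exp (l * (f x - m)))"
  proof (rule P.integrable_bounded[where B="exp (l * (B - m))"])
    show "AE x in PiM I M. \<bar>exp (l * (f x - m))\<bar> \<le> exp (l * (B - m))"
      using B l by (intro AE_I2) (auto simp: abs_le_iff)
  qed simp
  have "measure (PiM I M) {x \<in> space (PiM I M). f x - m \<ge> u} \<le>
     exp (- l * u) * (\<integral>x\<in>space (PiM I M). exp (l * (f x - m)) \<partial>PiM I M)"
    using integrable_mult_indicator[OF sets.top int]
    by (intro P.Chernoff_ineq_ge l) (auto simp: set_integrable_def)
  also have "(\<integral>x\<in>space (PiM I M). exp (l * (f x - m)) \<partial>PiM I M) = (\<integral>x. exp (l * (f x - m)) \<partial>PiM I M)"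
    by (rule set_integral_space[OF int])
  also have "\<dots> \<le> exp (l\<^sup>2 * (\<Sum>i\<in>I. (c i)\<^sup>2) / 8)"
    unfolding m_def by (rule mcdiarmid_mgf[OF M I l f B c])
  also have "\<dots> \<le> exp (l\<^sup>2 * V / 8)" using V by (simp add: mult_left_mono)
  also have "exp (- l * u) * exp (l\<^sup>2 * V / 8) = exp (- (2 * u\<^sup>2 / V))"
    unfolding l_def using V by (simp add: exp_add[symmetric] power2_eq_square field_simps)
  finally have "measure (PiM I M) {x \<in> space (PiM I M). f x - m \<ge> u} \<le> exp (- (2 * u\<^sup>2 / V))" by simp
  moreover have "{x \<in> space (PiM I M). f x - m \<ge> u} = {x \<in> space (PiM I M). f x \<ge> m + u}" by auto
  ultimately show ?thesis by (simp add: m_def)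
qed

section \<open>Independent bounded couplings\<close>

lemma finite_couplings_upto [simp]: "finite (couplings_upto N)"
proof -
  have "couplings_upto N \<subseteq> {1..N} \<times> {1..N}" by (auto simp: couplings_upto_def)
  then show ?thesis by (rule finite_subset) auto
qed

lemma couplings_upto_subset: "couplings_upto N \<subseteq> couplings"
  by (auto simp: couplings_upto_def couplings_def)

lemma card_couplings_upto: "real (card (couplings_upto N)) \<le> (real N)\<^sup>2 / 2"
proof -
  have "card (couplings_upto N) + card (prod.swap ` couplings_upto N) =
      card (couplings_upto N \<union> prod.swap ` couplings_upto N)"
    by (intro card_Un_disjoint[symmetric] finite_imageI finite_couplings_upto) (auto simp: couplings_upto_def)
  also have "\<dots> \<le> card ({1..N} \<times> {1..N})"
    by (intro card_mono) (auto simp: couplings_upto_def)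
  finally have "card (couplings_upto N) + card (couplings_upto N) \<le> N * N"
    by (simp add: card_image)
  then have "real (card (couplings_upto N) + card (couplings_upto N)) \<le> real (N * N)"
    by (rule of_nat_mono)
  then show ?thesis by (simp add: power2_eq_square)
qed

lemma spin_abs: "\<sigma> \<in> spins N \<Longrightarrow> i \<in> {1..N} \<Longrightarrow> \<bar>\<sigma> i\<bar> = 1"
  using spins_cases by fastforce

lemma spin_prod_abs: "\<sigma> \<in> spins N \<Longrightarrow> (i, j) \<in> couplings_upto N \<Longrightarrow> \<bar>\<sigma> i * \<sigma> j\<bar> = 1"
  using spin_abs[of \<sigma> N i] spin_abs[of \<sigma> N j] by (auto simp: couplings_upto_def abs_mult)

lemma hamiltonian_restrict: "hamiltonian N h (restrict c (couplings_upto N)) = hamiltonian N h c"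
  unfolding hamiltonian_def by (intro ext arg_cong2[of _ _ _ _ "(-)"] arg_cong2[of _ _ _ _ "(*)"] sum.cong refl) auto

lemma hamiltonian_diff:
  "hamiltonian N h c \<sigma> - hamiltonian N h b \<sigma> =
     (\<Sum>p\<in>couplings_upto N. - (\<sigma> (fst p) * \<sigma> (snd p) / real N) * (c p - b p))"
  unfolding hamiltonian_def
  by (simp add: case_prod_beta sum_distrib_left sum_subtractf[symmetric] algebra_simps sum_negf[symmetric]
      diff_divide_distrib)

lemma hamiltonian_diff_le:
  assumes \<sigma>: "\<sigma> \<in> spins N"
  shows "\<bar>hamiltonian N h c \<sigma> - hamiltonian N h b \<sigma>\<bar> \<le> (\<Sum>p\<in>couplings_upto N. \<bar>c p - b p\<bar>) / real N"
proof -
  have "\<bar>hamiltonian N h c \<sigma> - hamiltonian N h b \<sigma>\<bar> \<le>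
    (\<Sum>p\<in>couplings_upto N. \<bar>- (\<sigma> (fst p) * \<sigma> (snd p) / real N) * (c p - b p)\<bar>)"
    unfolding hamiltonian_diff by (rule sum_abs)
  also have "\<dots> = (\<Sum>p\<in>couplings_upto N. \<bar>c p - b p\<bar> / real N)"
    using spin_prod_abs[OF \<sigma>] by (intro sum.cong refl) (auto simp: abs_mult)
  finally show ?thesis by (simp add: sum_divide_distrib)
qed

lemma hamiltonian_abs_le:
  assumes \<sigma>: "\<sigma> \<in> spins N" and c: "\<And>p. p \<in> couplings_upto N \<Longrightarrow> \<bar>c p\<bar> \<le> k" and k: "0 \<le> k"
  shows "\<bar>hamiltonian N h c \<sigma>\<bar> \<le> (k + \<bar>h\<bar>) * real N"
proof -
  have "hamiltonian N h (\<lambda>_. 0) \<sigma> = - (h * (\<Sum>i\<in>{1..N}. \<sigma> i))" by (simp add: hamiltonian_def)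
  moreover have "\<bar>\<Sum>i\<in>{1..N}. \<sigma> i\<bar> \<le> real N"
    using sum_abs[of \<sigma> "{1..N}"] spin_abs[OF \<sigma>] by simp
  ultimately have 0: "\<bar>hamiltonian N h (\<lambda>_. 0) \<sigma>\<bar> \<le> \<bar>h\<bar> * real N"
    by (simp add: abs_mult mult_left_mono)
  have "(\<Sum>p\<in>couplings_upto N. \<bar>c p - 0\<bar>) \<le> (\<Sum>p\<in>couplings_upto N. k)"
    using c by (intro sum_mono) auto
  also have "\<dots> \<le> (real N)\<^sup>2 / 2 * k" using mult_right_mono[OF card_couplings_upto[of N] k] by simp
  finally have "(\<Sum>p\<in>couplings_upto N. \<bar>c p - 0\<bar>) / real N \<le> (real N)\<^sup>2 / 2 * k / real N"
    by (rule divide_right_mono) simp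
  also have "\<dots> \<le> k * real N" using k by (simp add: power2_eq_square)
  finally have "\<bar>hamiltonian N h c \<sigma> - hamiltonian N h (\<lambda>_. 0) \<sigma>\<bar> \<le> k * real N"
    using hamiltonian_diff_le[OF \<sigma>, of h c "\<lambda>_. 0"] by simp
  then show ?thesis using 0 by (simp add: distrib_right)
qed

lemma measurable_hamiltonian [measurable]:
  assumes "couplings_upto N \<subseteq> I"
  shows "(\<lambda>c. hamiltonian N h c \<sigma>) \<in> borel_measurable (PiM I (\<lambda>_. borel))"
proof -
  have [measurable]: "(\<lambda>c. c p) \<in> borel_measurable (PiM I (\<lambda>_. borel :: real measure))"
    if "p \<in> couplings_upto N" for p
    using assms that by (intro measurable_component_singleton) auto
  show ?thesis unfolding hamiltonian_def by (simp add: case_prod_beta) measurable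
qed

text \<open>
  A possible conditional law of the couplings. Independence is required for the finitely many couplings
  of each system size.
\<close>

locale disorder = prob_space D for D :: "(nat \<times> nat \<Rightarrow> real) measure" +
  fixes k :: real
  assumes sets_D: "sets D = sets (PiM couplings (\<lambda>_. borel))"
    and k_pos: "0 < k"
    and bounded: "\<And>p. p \<in> couplings \<Longrightarrow> AE c in D. \<bar>c p\<bar> \<le> k"
    and indep: "\<And>N. indep_vars (\<lambda>_. borel) (\<lambda>p c. c p) (couplings_upto N)"
begin

definition mean_J :: "nat \<times> nat \<Rightarrow> real" where "mean_J p = (\<integral>c. c p \<partial>D)"

lemma measurable_coupling [measurable]: "p \<in> couplings \<Longrightarrow> (\<lambda>c. c p) \<in> borel_measurable D"
  unfolding measurable_cong_sets[OF sets_D refl] by (rule measurable_component_singleton)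

lemma measurable_D: "f \<in> borel_measurable (PiM couplings (\<lambda>_. borel)) \<Longrightarrow> f \<in> borel_measurable D"
  unfolding measurable_cong_sets[OF sets_D refl] .

lemma AE_box: "AE c in D. \<forall>p\<in>couplings_upto N. \<bar>c p\<bar> \<le> k"
  using couplings_upto_subset bounded by (intro AE_finite_allI) auto

lemma integrable_coupling: "p \<in> couplings \<Longrightarrow> integrable D (\<lambda>c. c p)"
  by (rule integrable_bounded[OF measurable_coupling bounded])

lemma mean_J_le: "p \<in> couplings \<Longrightarrow> \<bar>mean_J p\<bar> \<le> k"
proof -
  assume p: "p \<in> couplings"
  have "\<bar>mean_J p\<bar> \<le> (\<integral>c. \<bar>c p\<bar> \<partial>D)" unfolding mean_J_def by (rule integral_abs_bound)
  also have "\<dots> \<le> (\<integral>c. k \<partial>D)"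
    using integrable_coupling[OF p] bounded[OF p] by (intro integral_mono_AE) auto
  finally show ?thesis by (simp add: prob_space)
qed

text \<open>
  The Hamiltonian is linear in the couplings, so the annealed model is the model with the mean
  couplings. Statements about arbitrary coupling vectors therefore apply to both models.
\<close>

lemma annealed_ham_eq: "annealed_ham N h D = hamiltonian N h mean_J"
proof
  fix \<sigma>
  have p: "p \<in> couplings" if "p \<in> couplings_upto N" for p using that couplings_upto_subset by auto
  show "annealed_ham N h D \<sigma> = hamiltonian N h mean_J \<sigma>"
    unfolding annealed_ham_def hamiltonian_def
    using integrable_coupling[OF p] by (simp add: case_prod_beta prob_space mean_J_def)
qed

text \<open>
  A functional that is Lipschitz in the energies changes by at most \<open>2 * L * k / N\<close> if one coupling is
  changed within its range; there are at most \<open>N\<^sup>2 / 2\<close> couplings, which gives \<open>2 * (L * k)\<^sup>2\<close> for the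
  sum of the squares in McDiarmid's inequality. As the couplings are bounded only almost surely, the
  inequality is applied after clipping them.
\<close>

lemma functional_concentration:
  fixes F :: "((nat \<Rightarrow> real) \<Rightarrow> real) \<Rightarrow> real"
  assumes N: "2 \<le> N" and L: "0 < L" and u: "0 < u"
    and meas: "(\<lambda>c. F (hamiltonian N h c)) \<in> borel_measurable (PiM (couplings_upto N) (\<lambda>_. borel))"
    and lip: "\<And>H H' d. (\<And>\<sigma>. \<sigma> \<in> spins N \<Longrightarrow> \<bar>H \<sigma> - H' \<sigma>\<bar> \<le> d) \<Longrightarrow> \<bar>F H - F H'\<bar> \<le> L * d"
  shows "prob {c \<in> space D. F (hamiltonian N h c) \<ge> expectation (\<lambda>c. F (hamiltonian N h c)) + u}
     \<le> exp (- (u / (L * k))\<^sup>2)"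
proof -
  let ?I = "couplings_upto N"
  let ?B = "PiM ?I (\<lambda>_. borel :: real measure)"
  define M where "M p = (if p \<in> ?I then distr D borel (\<lambda>c. c p) else return borel (0::real))" for p
  have pI: "p \<in> couplings" if "p \<in> ?I" for p using that couplings_upto_subset by auto
  have M: "prob_space (M p)" for p
    unfolding M_def
    using measurable_coupling[OF pI, of p] by (auto intro!: prob_space_distr prob_space_return)
  have Ine: "?I \<noteq> {}"
  proof -
    have "(1, 2) \<in> ?I" using N by (simp add: couplings_upto_def)
    then show ?thesis by auto
  qed
  have rm: "(\<lambda>c. restrict c ?I) \<in> measurable D ?B"
    using pI by (intro measurable_restrict) auto
  have PM: "distr D ?B (\<lambda>c. restrict c ?I) = PiM ?I M"
  proof -
    have "distr D ?B (\<lambda>c. restrict c ?I) = PiM ?I (\<lambda>p. distr D borel (\<lambda>c. c p))"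
      using indep[of N] pI by (subst (asm) indep_vars_iff_distr_eq_PiM'[OF Ine]) auto
    also have "\<dots> = PiM ?I M" by (intro PiM_cong) (auto simp: M_def)
    finally show ?thesis .
  qed
  define clip where "clip x = (\<lambda>p\<in>?I. max (-k) (min k (x p)))" for x :: "nat \<times> nat \<Rightarrow> real"
  define f where "f x = F (hamiltonian N h (clip x))" for x
  have clipm: "clip \<in> measurable ?B ?B" unfolding clip_def by (intro measurable_restrict) measurable
  have fB: "f \<in> borel_measurable ?B" unfolding f_def using measurable_compose[OF clipm meas] .
  have setsPM: "sets (PiM ?I M) = sets ?B" by (intro sets_PiM_cong) (auto simp: M_def)
  have fm: "f \<in> borel_measurable (PiM ?I M)" using fB measurable_cong_sets[OF setsPM refl] by blast
  have FD: "(\<lambda>c. F (hamiltonian N h c)) \<in> borel_measurable D"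
    using measurable_compose[OF rm meas] by (simp add: hamiltonian_restrict)
  have fD: "(\<lambda>c. f (restrict c ?I)) \<in> borel_measurable D" using measurable_compose[OF rm fB] .
  have clipk: "\<bar>clip x p\<bar> \<le> k" if "p \<in> ?I" for x p using that k_pos by (auto simp: clip_def)
  have clipid: "clip (restrict c ?I) p = c p" if "p \<in> ?I" "\<bar>c p\<bar> \<le> k" for c p
    using that by (auto simp: clip_def abs_le_iff)
  have AEf: "AE c in D. f (restrict c ?I) = F (hamiltonian N h c)"
  proof (rule AE_mp[OF AE_box[of N]], rule AE_I2, rule impI)
    fix c assume c: "\<forall>p\<in>?I. \<bar>c p\<bar> \<le> k"
    have "hamiltonian N h (clip (restrict c ?I)) = hamiltonian N h c"
      unfolding hamiltonian_restrict[of N h c, symmetric]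
    proof (rule arg_cong[of _ _ "hamiltonian N h"], rule ext)
      fix p show "clip (restrict c ?I) p = restrict c ?I p"
        using clipid[of p c] c by (cases "p \<in> ?I") (auto simp: clip_def)
    qed
    then show "f (restrict c ?I) = F (hamiltonian N h c)" by (simp add: f_def)
  qed
  have N0: "0 < real N" using N by simp
  define V where "V = 2 * (L * k)\<^sup>2"
  have V0: "0 < V" using L k_pos by (simp add: V_def)
  define C where "C = \<bar>F (hamiltonian N h (\<lambda>_. 0))\<bar> + L * ((\<Sum>p\<in>?I. k) / real N)"
  have "measure (PiM ?I M) {x \<in> space (PiM ?I M). f x \<ge> (\<integral>x. f x \<partial>PiM ?I M) + u} \<le> exp (- (2 * u\<^sup>2 / V))"
  proof (rule mcdiarmid[OF M _ fm])
    show "\<bar>f x\<bar> \<le> C" for x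
    proof -
      have "\<bar>f x - F (hamiltonian N h (\<lambda>_. 0))\<bar> \<le> L * ((\<Sum>p\<in>?I. k) / real N)"
        unfolding f_def
      proof (rule lip)
        fix \<sigma> assume \<sigma>: "\<sigma> \<in> spins N"
        have "(\<Sum>p\<in>?I. \<bar>clip x p - 0\<bar>) \<le> (\<Sum>p\<in>?I. k)" using clipk by (intro sum_mono) auto
        then show "\<bar>hamiltonian N h (clip x) \<sigma> - hamiltonian N h (\<lambda>_. 0) \<sigma>\<bar> \<le> (\<Sum>p\<in>?I. k) / real N"
          using hamiltonian_diff_le[OF \<sigma>, of h "clip x" "\<lambda>_. 0"] N0
          by (meson divide_right_mono order_trans less_imp_le)
      qed
      then show ?thesis by (simp add: C_def)
    qed
    show "\<bar>f x - f (x(p := y))\<bar> \<le> L * (2 * k / real N)" if p: "p \<in> ?I" for p x y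
      unfolding f_def
    proof (rule lip)
      fix \<sigma> assume \<sigma>: "\<sigma> \<in> spins N"
      have "(\<Sum>q\<in>?I. \<bar>clip x q - clip (x(p := y)) q\<bar>) = (\<Sum>q\<in>?I. if q = p then \<bar>clip x p - clip (x(p := y)) p\<bar> else 0)"
        by (intro sum.cong refl) (auto simp: clip_def)
      also have "\<dots> = \<bar>clip x p - clip (x(p := y)) p\<bar>" using p by simp
      also have "\<dots> \<le> 2 * k" using clipk[OF p, of x] clipk[OF p, of "x(p := y)"] by linarith
      finally have "(\<Sum>q\<in>?I. \<bar>clip x q - clip (x(p := y)) q\<bar>) / real N \<le> 2 * k / real N"
        using N0 by (intro divide_right_mono) auto
      then show "\<bar>hamiltonian N h (clip x) \<sigma> - hamiltonian N h (clip (x(p := y))) \<sigma>\<bar> \<le> 2 * k / real N"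
        using hamiltonian_diff_le[OF \<sigma>, of h "clip x" "clip (x(p := y))"] by linarith
    qed
    have "(\<Sum>p\<in>?I. (L * (2 * k / real N))\<^sup>2) = real (card ?I) * (L * (2 * k / real N))\<^sup>2" by simp
    also have "\<dots> \<le> (real N)\<^sup>2 / 2 * (L * (2 * k / real N))\<^sup>2"
      using card_couplings_upto by (intro mult_right_mono) auto
    also have "\<dots> = V" using N0 by (simp add: V_def power2_eq_square)
    finally show "(\<Sum>p\<in>?I. (L * (2 * k / real N))\<^sup>2) \<le> V" .
  qed (use V0 u in auto)
  also have "2 * u\<^sup>2 / V = (u / (L * k))\<^sup>2" by (simp add: V_def power_divide)
  finally have *: "measure (PiM ?I M) {x \<in> space (PiM ?I M). f x \<ge> (\<integral>x. f x \<partial>PiM ?I M) + u} \<le> exp (- (u / (L * k))\<^sup>2)" .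
  have E: "(\<integral>x. f x \<partial>PiM ?I M) = expectation (\<lambda>c. F (hamiltonian N h c))"
    unfolding PM[symmetric] using fB rm AEf fD FD
    by (subst integral_distr) (auto intro!: integral_cong_AE)
  have "measure (PiM ?I M) {x \<in> space (PiM ?I M). f x \<ge> e} = prob {c \<in> space D. F (hamiltonian N h c) \<ge> e}" for e
  proof -
    have s: "{x \<in> space (PiM ?I M). f x \<ge> e} \<in> sets ?B"
      using fm unfolding setsPM[symmetric] by measurable
    have "measure (PiM ?I M) {x \<in> space (PiM ?I M). f x \<ge> e} =
      prob ((\<lambda>c. restrict c ?I) -` {x \<in> space (PiM ?I M). f x \<ge> e} \<inter> space D)"
      using measure_distr[OF rm s] unfolding PM .
    also have "(\<lambda>c. restrict c ?I) -` {x \<in> space (PiM ?I M). f x \<ge> e} \<inter> space D = {c \<in> space D. f (restrict c ?I) \<ge> e}"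
      using measurable_space[OF rm] sets_eq_imp_space_eq[OF setsPM] by auto
    also have "prob \<dots> = prob {c \<in> space D. F (hamiltonian N h c) \<ge> e}"
      using AEf fD FD by (intro measure_eq_AE) auto
    finally show ?thesis .
  qed
  then show ?thesis using * E by simp
qed

lemma functional_concentration_lower:
  fixes F :: "((nat \<Rightarrow> real) \<Rightarrow> real) \<Rightarrow> real"
  assumes N: "2 \<le> N" and L: "0 < L" and u: "0 < u"
    and meas: "(\<lambda>c. F (hamiltonian N h c)) \<in> borel_measurable (PiM (couplings_upto N) (\<lambda>_. borel))"
    and lip: "\<And>H H' d. (\<And>\<sigma>. \<sigma> \<in> spins N \<Longrightarrow> \<bar>H \<sigma> - H' \<sigma>\<bar> \<le> d) \<Longrightarrow> \<bar>F H - F H'\<bar> \<le> L * d"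
  shows "prob {c \<in> space D. F (hamiltonian N h c) \<le> expectation (\<lambda>c. F (hamiltonian N h c)) - u}
     \<le> exp (- (u / (L * k))\<^sup>2)"
proof -
  have "prob {c \<in> space D. - F (hamiltonian N h c) \<ge> expectation (\<lambda>c. - F (hamiltonian N h c)) + u}
     \<le> exp (- (u / (L * k))\<^sup>2)"
  proof (rule functional_concentration[OF N L u])
    show "(\<lambda>c. - F (hamiltonian N h c)) \<in> borel_measurable (PiM (couplings_upto N) (\<lambda>_. borel))"
      using meas by measurable
    show "\<bar>- F H - - F H'\<bar> \<le> L * d" if "\<And>\<sigma>. \<sigma> \<in> spins N \<Longrightarrow> \<bar>H \<sigma> - H' \<sigma>\<bar> \<le> d" for H H' d
      using lip[OF that] by (simp add: abs_le_iff)
  qed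
  moreover have "{c \<in> space D. - F (hamiltonian N h c) \<ge> expectation (\<lambda>c. - F (hamiltonian N h c)) + u} =
     {c \<in> space D. F (hamiltonian N h c) \<le> expectation (\<lambda>c. F (hamiltonian N h c)) - u}" by auto
  ultimately show ?thesis by simp
qed

end

section \<open>Exponential moments of the energy fluctuations\<close>

text \<open>
  The saddle energy moves with one endpoint up to the difference of the two shifts, which for
  neighbours is much smaller than the shifts themselves.
\<close>

lemma max_shift_le:
  fixes a b x y :: real
  shows "\<bar>(max x y - max a b) - (x - a)\<bar> \<le> \<bar>(y - b) - (x - a)\<bar>"
  by (auto simp: max_def abs_if)

lemma exp_young:
  fixes u v P Q :: real
  assumes "0 < P" "0 < Q" "1 / P + 1 / Q = 1"
  shows "exp (u + v) \<le> exp (P * u) / P + exp (Q * v) / Q"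
proof -
  have "0 < 1 / P" "0 < 1 / Q" using assms by auto
  then have Q1: "1 / Q \<le> 1" "0 \<le> 1 / Q" using assms(3) by linarith+
  have "exp ((1 - 1 / Q) *\<^sub>R (P * u) + (1 / Q) *\<^sub>R (Q * v)) \<le> (1 - 1 / Q) * exp (P * u) + (1 / Q) * exp (Q * v)"
    by (rule convex_onD[OF exp_convex Q1(2,1)]) auto
  moreover have "1 - 1 / Q = 1 / P" using assms by simp
  ultimately show ?thesis using assms by simp
qed

lemma exp_le_quadratic:
  fixes z r :: real
  assumes "\<bar>z\<bar> \<le> r"
  shows "exp z \<le> 1 + z + z\<^sup>2 / 2 + exp r * r ^ 3 / 2"
proof -
  have "norm (exp z - (\<Sum>i\<le>2. z ^ i / fact i)) \<le> exp (norm z) * (norm z ^ Suc 2) / fact 2"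
    by (rule Taylor_exp_field)
  also have "\<dots> = exp \<bar>z\<bar> * \<bar>z\<bar> ^ 3 / 2" by (simp add: numeral_3_eq_3)
  also have "\<dots> \<le> exp r * r ^ 3 / 2"
    using assms by (intro mult_mono power_mono divide_right_mono) simp_all
  finally have "exp z - (\<Sum>i\<le>2. z ^ i / fact i) \<le> exp r * r ^ 3 / 2"
    unfolding real_norm_def by (rule abs_le_D1)
  moreover have "(\<Sum>i\<le>2. z ^ i / fact i) = 1 + z + z\<^sup>2 / 2" by (simp add: numeral_2_eq_2)
  ultimately show ?thesis by linarith
qed

context disorder
begin

lemma AE_dev: "p \<in> couplings \<Longrightarrow> AE c in D. \<bar>c p - mean_J p\<bar> \<le> 2 * k"
  using bounded[of p] mean_J_le[of p] by (auto elim!: eventually_mono)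

lemma expectation_dev: "p \<in> couplings \<Longrightarrow> expectation (\<lambda>c. c p - mean_J p) = 0"
  using integrable_coupling[of p] by (simp add: mean_J_def prob_space)

lemma integrable_exp_dev: "p \<in> couplings \<Longrightarrow> integrable D (\<lambda>c. exp (a * (c p - mean_J p)))"
proof -
  assume p: "p \<in> couplings"
  have "AE c in D. \<bar>exp (a * (c p - mean_J p))\<bar> \<le> exp (\<bar>a\<bar> * (2 * k))"
    using AE_dev[OF p]
  proof eventually_elim
    case (elim c)
    have "a * (c p - mean_J p) \<le> \<bar>a\<bar> * \<bar>c p - mean_J p\<bar>" by (metis abs_ge_self abs_mult)
    also have "\<dots> \<le> \<bar>a\<bar> * (2 * k)" using elim by (intro mult_left_mono) auto
    finally show ?case by simp
  qed
  then show ?thesis using p by (intro integrable_bounded) auto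
qed

lemma mgf_hoeffding1:
  assumes p: "p \<in> couplings"
  shows "expectation (\<lambda>c. exp (a * (c p - mean_J p))) \<le> exp (a\<^sup>2 * k\<^sup>2 / 2)"
proof -
  have AEi: "AE c in D. c p \<in> {-k..k}" "AE c in D. - c p \<in> {-k..k}"
    using bounded[OF p] by (eventually_elim; auto simp: abs_le_iff)+
  have sq: "a\<^sup>2 * (k - - k)\<^sup>2 / 8 = a\<^sup>2 * k\<^sup>2 / 2" by (simp add: power2_eq_square)
  consider "a > 0" | "a = 0" | "a < 0" by linarith
  then show ?thesis
  proof cases
    case 1
    then show ?thesis
      using hoeffding_mgf[OF measurable_coupling[OF p] AEi(1), of a] sq by (simp add: mean_J_def)
  next
    case 2 then show ?thesis by (simp add: prob_space)
  next
    case 3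
    have eq: "(- a) * (- c p - expectation (\<lambda>c. - c p)) = a * (c p - mean_J p)" for c
      by (simp add: mean_J_def algebra_simps)
    have "expectation (\<lambda>c. exp ((- a) * (- c p - expectation (\<lambda>c. - c p)))) \<le> exp ((- a)\<^sup>2 * (k - - k)\<^sup>2 / 8)"
      using 3 p by (intro hoeffding_mgf[OF _ AEi(2)]) auto
    then show ?thesis unfolding eq using sq by simp
  qed
qed

lemma cond_variance_eq: "cond_variance D p = expectation (\<lambda>c. (c p - mean_J p)\<^sup>2)"
  by (simp add: cond_variance_def mean_J_def)

lemma AE_dev_sq: "p \<in> couplings \<Longrightarrow> AE c in D. (c p - mean_J p)\<^sup>2 \<le> (2 * k)\<^sup>2"
proof (erule eventually_mono[OF AE_dev])
  fix c assume "\<bar>c p - mean_J p\<bar> \<le> 2 * k"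
  then show "(c p - mean_J p)\<^sup>2 \<le> (2 * k)\<^sup>2"
    using k_pos by (intro abs_le_square_iff[THEN iffD1]) simp
qed

lemma integrable_dev_sq: "p \<in> couplings \<Longrightarrow> integrable D (\<lambda>c. (c p - mean_J p)\<^sup>2)"
  using AE_dev_sq by (intro integrable_bounded[where B="(2 * k)\<^sup>2"]) auto

lemma cond_variance_bounds:
  assumes p: "p \<in> couplings"
  shows "0 \<le> cond_variance D p" "cond_variance D p \<le> 4 * k\<^sup>2"
proof -
  show "0 \<le> cond_variance D p" by (simp add: cond_variance_def)
  have "cond_variance D p \<le> expectation (\<lambda>c. (2 * k)\<^sup>2)"
    unfolding cond_variance_eq using AE_dev_sq[OF p] integrable_dev_sq[OF p] by (intro integral_mono_AE) auto
  then show "cond_variance D p \<le> 4 * k\<^sup>2" by (simp add: prob_space power_mult_distrib)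
qed

lemma mgf_variance1:
  assumes p: "p \<in> couplings"
  shows "expectation (\<lambda>c. exp (a * (c p - mean_J p))) \<le>
     exp (a\<^sup>2 * cond_variance D p / 2 + 4 * k ^ 3 * \<bar>a\<bar> ^ 3 * exp (2 * k * \<bar>a\<bar>))"
proof -
  define R where "R = 4 * k ^ 3 * \<bar>a\<bar> ^ 3 * exp (2 * k * \<bar>a\<bar>)"
  have "expectation (\<lambda>c. exp (a * (c p - mean_J p))) \<le>
     expectation (\<lambda>c. 1 + a * (c p - mean_J p) + a\<^sup>2 / 2 * (c p - mean_J p)\<^sup>2 + R)"
  proof (rule integral_mono_AE)
    show "integrable D (\<lambda>c. exp (a * (c p - mean_J p)))" by (rule integrable_exp_dev[OF p])
    show "integrable D (\<lambda>c. 1 + a * (c p - mean_J p) + a\<^sup>2 / 2 * (c p - mean_J p)\<^sup>2 + R)"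
      using integrable_coupling[OF p] integrable_dev_sq[OF p] by auto
    show "AE c in D. exp (a * (c p - mean_J p)) \<le> 1 + a * (c p - mean_J p) + a\<^sup>2 / 2 * (c p - mean_J p)\<^sup>2 + R"
      using AE_dev[OF p]
    proof eventually_elim
      case (elim c)
      have "\<bar>a * (c p - mean_J p)\<bar> \<le> \<bar>a\<bar> * (2 * k)" using elim unfolding abs_mult by (intro mult_left_mono) auto
      from exp_le_quadratic[OF this] show ?case
        by (simp add: R_def power_mult_distrib mult_ac)
    qed
  qed
  also have "\<dots> = 1 + a\<^sup>2 / 2 * cond_variance D p + R"
    using integrable_coupling[OF p] integrable_dev_sq[OF p] expectation_dev[OF p]
    by (simp add: prob_space cond_variance_eq)
  also have "\<dots> \<le> exp (a\<^sup>2 * cond_variance D p / 2 + R)"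
    using exp_ge_add_one_self[of "a\<^sup>2 * cond_variance D p / 2 + R"] by (simp add: add.assoc)
  finally show ?thesis by (simp add: R_def)
qed

lemma mgf_product:
  "expectation (\<lambda>c. exp (\<Sum>p\<in>couplings_upto N. a p * (c p - mean_J p))) =
     (\<Prod>p\<in>couplings_upto N. expectation (\<lambda>c. exp (a p * (c p - mean_J p))))"
  "integrable D (\<lambda>c. exp (\<Sum>p\<in>couplings_upto N. a p * (c p - mean_J p)))"
proof -
  have iv: "indep_vars (\<lambda>_. borel) (\<lambda>p c. exp (a p * (c p - mean_J p))) (couplings_upto N)"
    using indep[of N] by (rule indep_vars_compose2) simp
  have int: "integrable D (\<lambda>c. exp (a p * (c p - mean_J p)))" if "p \<in> couplings_upto N" for p
    using that couplings_upto_subset by (intro integrable_exp_dev) auto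
  have eq: "exp (\<Sum>p\<in>couplings_upto N. a p * (c p - mean_J p)) = (\<Prod>p\<in>couplings_upto N. exp (a p * (c p - mean_J p)))" for c
    by (rule exp_sum) simp
  show "expectation (\<lambda>c. exp (\<Sum>p\<in>couplings_upto N. a p * (c p - mean_J p))) =
     (\<Prod>p\<in>couplings_upto N. expectation (\<lambda>c. exp (a p * (c p - mean_J p))))"
    unfolding eq by (rule indep_vars_lebesgue_integral[OF _ iv int]) simp
  show "integrable D (\<lambda>c. exp (\<Sum>p\<in>couplings_upto N. a p * (c p - mean_J p)))"
    unfolding eq by (rule indep_vars_integrable[OF _ iv int]) simp
qed

lemma mgf_hoeffding:
  "expectation (\<lambda>c. exp (\<Sum>p\<in>couplings_upto N. a p * (c p - mean_J p))) \<le>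
     exp (k\<^sup>2 * (\<Sum>p\<in>couplings_upto N. (a p)\<^sup>2) / 2)"
proof -
  have "(\<Prod>p\<in>couplings_upto N. expectation (\<lambda>c. exp (a p * (c p - mean_J p)))) \<le>
      (\<Prod>p\<in>couplings_upto N. exp ((a p)\<^sup>2 * k\<^sup>2 / 2))"
    using couplings_upto_subset[of N] mgf_hoeffding1
    by (intro prod_mono) (auto intro!: integral_nonneg_AE)
  also have "\<dots> = exp (k\<^sup>2 * (\<Sum>p\<in>couplings_upto N. (a p)\<^sup>2) / 2)"
    by (simp add: exp_sum[symmetric] sum_distrib_left sum_divide_distrib mult.commute)
  finally show ?thesis unfolding mgf_product .
qed

text \<open>
  With coefficients of order \<open>1 / N\<close> the cubic remainders of about \<open>N\<^sup>2\<close> couplings sum up to \<open>O (1 / N)\<close>,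
  so the moment is governed by the exact variances; this is where \<open>\<alpha>\<close> comes from.
\<close>

lemma mgf_variance:
  assumes N: "1 \<le> N" and a: "\<And>p. p \<in> couplings_upto N \<Longrightarrow> \<bar>a p\<bar> \<le> r / real N" and r: "0 \<le> r"
  shows "expectation (\<lambda>c. exp (\<Sum>p\<in>couplings_upto N. a p * (c p - mean_J p))) \<le>
     exp ((\<Sum>p\<in>couplings_upto N. (a p)\<^sup>2 * cond_variance D p) / 2 + 2 * k ^ 3 * r ^ 3 * exp (2 * k * r) / real N)"
proof -
  define R where "R = 4 * k ^ 3 * (r / real N) ^ 3 * exp (2 * k * r)"
  have N0: "0 < real N" using N by simp
  have "(\<Prod>p\<in>couplings_upto N. expectation (\<lambda>c. exp (a p * (c p - mean_J p)))) \<le>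
      (\<Prod>p\<in>couplings_upto N. exp ((a p)\<^sup>2 * cond_variance D p / 2 + R))"
  proof (intro prod_mono conjI)
    fix p assume p: "p \<in> couplings_upto N"
    then have pc: "p \<in> couplings" using couplings_upto_subset by auto
    have ar: "\<bar>a p\<bar> \<le> r / real N" using a[OF p] .
    have "r / real N \<le> r / 1" using N r by (intro divide_left_mono) auto
    then have ar1: "\<bar>a p\<bar> \<le> r" using ar by simp
    have "4 * k ^ 3 * \<bar>a p\<bar> ^ 3 * exp (2 * k * \<bar>a p\<bar>) \<le> R"
      unfolding R_def using ar ar1 k_pos by (intro mult_mono power_mono) auto
    then show "expectation (\<lambda>c. exp (a p * (c p - mean_J p))) \<le> exp ((a p)\<^sup>2 * cond_variance D p / 2 + R)"
      using mgf_variance1[OF pc, of "a p"] by (smt (verit) exp_le_cancel_iff)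
  qed (auto intro!: integral_nonneg_AE)
  also have "\<dots> = exp ((\<Sum>p\<in>couplings_upto N. (a p)\<^sup>2 * cond_variance D p) / 2 + real (card (couplings_upto N)) * R)"
    by (simp add: exp_sum[symmetric] sum.distrib sum_divide_distrib)
  also have "real (card (couplings_upto N)) * R \<le> (real N)\<^sup>2 / 2 * R"
    using card_couplings_upto[of N] k_pos r by (intro mult_right_mono) (auto simp: R_def)
  also have "(real N)\<^sup>2 / 2 * R = 2 * k ^ 3 * r ^ 3 * exp (2 * k * r) / real N"
    using N0 unfolding R_def by (simp add: power2_eq_square power3_eq_cube field_simps)
  finally show ?thesis unfolding mgf_product by simp
qed

lemma alpha_bounds:
  assumes N: "1 \<le> N"
  shows "0 \<le> alpha \<beta> D N" "alpha \<beta> D N \<le> \<beta>\<^sup>2 * k\<^sup>2"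
proof -
  have pc: "p \<in> couplings" if "p \<in> couplings_upto N" for p using that couplings_upto_subset by auto
  show "0 \<le> alpha \<beta> D N" unfolding alpha_def
    using cond_variance_bounds(1)[OF pc] by (intro mult_nonneg_nonneg sum_nonneg) auto
  have "(\<Sum>p\<in>couplings_upto N. cond_variance D p) \<le> (\<Sum>p\<in>couplings_upto N. 4 * k\<^sup>2)"
    using cond_variance_bounds(2)[OF pc] by (rule sum_mono)
  also have "\<dots> = real (card (couplings_upto N)) * (4 * k\<^sup>2)" by simp
  also have "\<dots> \<le> (real N)\<^sup>2 / 2 * (4 * k\<^sup>2)" using card_couplings_upto by (intro mult_right_mono) auto
  finally have "alpha \<beta> D N \<le> \<beta>\<^sup>2 / (2 * (real N)\<^sup>2) * ((real N)\<^sup>2 / 2 * (4 * k\<^sup>2))"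
    unfolding alpha_def by (intro mult_left_mono) auto
  also have "\<dots> = \<beta>\<^sup>2 * k\<^sup>2" using N by simp
  finally show "alpha \<beta> D N \<le> \<beta>\<^sup>2 * k\<^sup>2" .
qed

definition vertex_const :: "real \<Rightarrow> real" where
  "vertex_const r = 2 * k ^ 3 * r ^ 3 * exp (2 * k * r)"

lemma vertex_const_nonneg: "0 \<le> r \<Longrightarrow> 0 \<le> vertex_const r"
  using k_pos by (simp add: vertex_const_def)

lemma vertex_mgf:
  assumes N: "1 \<le> N" and \<sigma>: "\<sigma> \<in> spins N"
  shows "expectation (\<lambda>c. exp (s * \<beta> * (hamiltonian N h c \<sigma> - hamiltonian N h mean_J \<sigma>))) \<le>
      exp (s\<^sup>2 * alpha \<beta> D N + vertex_const \<bar>s * \<beta>\<bar> / real N)"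
    and "integrable D (\<lambda>c. exp (s * \<beta> * (hamiltonian N h c \<sigma> - hamiltonian N h mean_J \<sigma>)))"
proof -
  define a where "a p = - (s * \<beta> * (\<sigma> (fst p) * \<sigma> (snd p)) / real N)" for p
  have eq: "s * \<beta> * (hamiltonian N h c \<sigma> - hamiltonian N h mean_J \<sigma>) = (\<Sum>p\<in>couplings_upto N. a p * (c p - mean_J p))" for c
    unfolding hamiltonian_diff sum_distrib_left a_def by (intro sum.cong refl) simp
  have sp: "\<bar>\<sigma> (fst p) * \<sigma> (snd p)\<bar> = 1" if "p \<in> couplings_upto N" for p
    using spin_prod_abs[OF \<sigma>, of "fst p" "snd p"] that by simp
  have abs_a: "\<bar>a p\<bar> = \<bar>s * \<beta>\<bar> / real N" if "p \<in> couplings_upto N" for p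
    using sp[OF that] by (simp add: a_def abs_mult)
  have sq: "(a p)\<^sup>2 = s\<^sup>2 * \<beta>\<^sup>2 / (real N)\<^sup>2" if "p \<in> couplings_upto N" for p
    using abs_a[OF that] by (metis (no_types, lifting) power2_abs power_divide power_mult_distrib)
  have "expectation (\<lambda>c. exp (\<Sum>p\<in>couplings_upto N. a p * (c p - mean_J p))) \<le>
     exp ((\<Sum>p\<in>couplings_upto N. (a p)\<^sup>2 * cond_variance D p) / 2 +
        2 * k ^ 3 * \<bar>s * \<beta>\<bar> ^ 3 * exp (2 * k * \<bar>s * \<beta>\<bar>) / real N)"
    using abs_a by (intro mgf_variance N) auto
  also have "(\<Sum>p\<in>couplings_upto N. (a p)\<^sup>2 * cond_variance D p) / 2 = s\<^sup>2 * alpha \<beta> D N"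
  proof -
    have "(\<Sum>p\<in>couplings_upto N. (a p)\<^sup>2 * cond_variance D p) =
        s\<^sup>2 * \<beta>\<^sup>2 / (real N)\<^sup>2 * (\<Sum>p\<in>couplings_upto N. cond_variance D p)"
      using sq by (simp add: sum_distrib_left)
    then show ?thesis by (simp add: alpha_def)
  qed
  finally show "expectation (\<lambda>c. exp (s * \<beta> * (hamiltonian N h c \<sigma> - hamiltonian N h mean_J \<sigma>))) \<le>
      exp (s\<^sup>2 * alpha \<beta> D N + vertex_const \<bar>s * \<beta>\<bar> / real N)"
    unfolding eq vertex_const_def .
  show "integrable D (\<lambda>c. exp (s * \<beta> * (hamiltonian N h c \<sigma> - hamiltonian N h mean_J \<sigma>)))"
    unfolding eq by (rule mgf_product)
qed

text \<open>
  Flipping one spin affects only the couplings of that spin, fewer than \<open>2 * N\<close> of them, so the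
  difference of the energy shifts of two neighbours is of order \<open>1 / sqrt N\<close>.
\<close>

lemma flip_mgf:
  fixes h :: real
  assumes N: "1 \<le> N" and \<sigma>: "\<sigma> \<in> spins N" and nb: "neighbour N \<sigma> \<eta>"
  defines "X \<equiv> (\<lambda>c. (hamiltonian N h c \<eta> - hamiltonian N h mean_J \<eta>) - (hamiltonian N h c \<sigma> - hamiltonian N h mean_J \<sigma>))"
  shows "expectation (\<lambda>c. exp (s * X c)) \<le> exp (4 * k\<^sup>2 * s\<^sup>2 / real N)"
    and "integrable D (\<lambda>c. exp (s * X c))"
proof -
  obtain i where i: "i \<in> {1..N}" "\<eta> = \<sigma>(i := - \<sigma> i)" using nb by (auto simp: neighbour_def)
  have \<eta>: "\<eta> \<in> spins N" using neighbour_spins[OF \<sigma> nb] .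
  have N0: "0 < real N" using N by simp
  define a where "a p = s * (\<sigma> (fst p) * \<sigma> (snd p) - \<eta> (fst p) * \<eta> (snd p)) / real N" for p
  have eq: "s * X c = (\<Sum>p\<in>couplings_upto N. a p * (c p - mean_J p))" for c
    unfolding X_def hamiltonian_diff sum_subtractf[symmetric] sum_distrib_left a_def
    by (intro sum.cong refl) (simp add: algebra_simps diff_divide_distrib)
  let ?J = "{p \<in> couplings_upto N. fst p = i \<or> snd p = i}"
  have a0: "a p = 0" if "p \<in> couplings_upto N - ?J" for p
    using that by (auto simp: a_def i)
  have aJ: "(a p)\<^sup>2 \<le> 4 * s\<^sup>2 / (real N)\<^sup>2" if "p \<in> ?J" for p
  proof -
    have "\<bar>\<sigma> (fst p) * \<sigma> (snd p)\<bar> = 1" "\<bar>\<eta> (fst p) * \<eta> (snd p)\<bar> = 1"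
      using spin_prod_abs[OF \<sigma>, of "fst p" "snd p"] spin_prod_abs[OF \<eta>, of "fst p" "snd p"] that by auto
    then have "\<bar>\<sigma> (fst p) * \<sigma> (snd p) - \<eta> (fst p) * \<eta> (snd p)\<bar> \<le> 2" by linarith
    then have "(\<sigma> (fst p) * \<sigma> (snd p) - \<eta> (fst p) * \<eta> (snd p))\<^sup>2 \<le> 2\<^sup>2"
      by (subst abs_le_square_iff[symmetric]) simp
    then have "s\<^sup>2 * (\<sigma> (fst p) * \<sigma> (snd p) - \<eta> (fst p) * \<eta> (snd p))\<^sup>2 / (real N)\<^sup>2 \<le> s\<^sup>2 * 2\<^sup>2 / (real N)\<^sup>2"
      by (intro divide_right_mono mult_left_mono) auto
    then show ?thesis by (simp add: a_def power_mult_distrib power_divide mult.commute)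
  qed
  have "card ?J \<le> card ((\<lambda>j. (i, j)) ` {1..N} \<union> (\<lambda>j. (j, i)) ` {1..N})"
    by (intro card_mono) (auto simp: couplings_upto_def)
  also have "\<dots> \<le> card ((\<lambda>j. (i, j)) ` {1..N}) + card ((\<lambda>j. (j, i)) ` {1..N})" by (rule card_Un_le)
  also have "\<dots> \<le> N + N"
    using card_image_le[of "{1..N}" "\<lambda>j. (i, j)"] card_image_le[of "{1..N}" "\<lambda>j. (j, i)"] by simp
  finally have cJ: "real (card ?J) \<le> 2 * real N" by linarith
  have "(\<Sum>p\<in>couplings_upto N. (a p)\<^sup>2) = (\<Sum>p\<in>?J. (a p)\<^sup>2)"
    using a0 by (intro sum.mono_neutral_right) auto
  also have "\<dots> \<le> (\<Sum>p\<in>?J. 4 * s\<^sup>2 / (real N)\<^sup>2)" using aJ by (rule sum_mono)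
  also have "\<dots> = real (card ?J) * (4 * s\<^sup>2 / (real N)\<^sup>2)" by simp
  also have "\<dots> \<le> 2 * real N * (4 * s\<^sup>2 / (real N)\<^sup>2)" using cJ by (intro mult_right_mono) auto
  also have "\<dots> = 8 * s\<^sup>2 / real N" using N0 by (simp add: power2_eq_square)
  finally have "k\<^sup>2 * (\<Sum>p\<in>couplings_upto N. (a p)\<^sup>2) / 2 \<le> k\<^sup>2 * (8 * s\<^sup>2 / real N) / 2"
    by (intro divide_right_mono mult_left_mono) auto
  also have "\<dots> = 4 * k\<^sup>2 * s\<^sup>2 / real N" by simp
  finally have "exp (k\<^sup>2 * (\<Sum>p\<in>couplings_upto N. (a p)\<^sup>2) / 2) \<le> exp (4 * k\<^sup>2 * s\<^sup>2 / real N)" by simp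
  then show "expectation (\<lambda>c. exp (s * X c)) \<le> exp (4 * k\<^sup>2 * s\<^sup>2 / real N)"
    unfolding eq using mgf_hoeffding[where N=N and a=a] by linarith
  show "integrable D (\<lambda>c. exp (s * X c))" unfolding eq by (rule mgf_product)
qed

definition edge_const :: "real \<Rightarrow> real \<Rightarrow> real" where
  "edge_const \<beta> s = s\<^sup>2 * \<beta>\<^sup>2 * k\<^sup>2 + vertex_const (2 * \<bar>s * \<beta>\<bar>) + ln 2 + 16 * k\<^sup>2 * s\<^sup>2 * \<beta>\<^sup>2"

lemma edge_const_nonneg: "0 \<le> edge_const \<beta> s"
  unfolding edge_const_def by (intro add_nonneg_nonneg vertex_const_nonneg) auto

text \<open>
  The saddle energy shift is the shift \<open>\<Delta>\<close> at one endpoint plus a correction bounded by \<open>\<bar>X\<bar>\<close>, with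
  \<open>X\<close> of order \<open>1 / sqrt N\<close>. Young's inequality separates the two. The exponent \<open>P = 1 + 1 / sqrt N\<close> is
  so close to one that the first factor keeps the constant \<open>s\<^sup>2 * \<alpha>\<close>; the conjugate exponent
  \<open>Q = 1 + sqrt N\<close> then scales \<open>X\<close> to order one, and the outer root \<open>1 / Q\<close> leaves \<open>O (1 / sqrt N)\<close>.
\<close>

lemma edge_mgf:
  fixes h :: real
  assumes N: "1 \<le> N" and \<sigma>: "\<sigma> \<in> spins N" and nb: "neighbour N \<sigma> \<eta>"
  defines "m \<equiv> (\<lambda>c. max (hamiltonian N h c \<sigma>) (hamiltonian N h c \<eta>))"
  shows "expectation (\<lambda>c. exp (s * \<beta> * (m c - m mean_J))) \<le> exp (s\<^sup>2 * alpha \<beta> D N + edge_const \<beta> s / sqrt (real N))"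
    and "integrable D (\<lambda>c. exp (s * \<beta> * (m c - m mean_J)))"
proof -
  define r where "r = sqrt (real N)"
  have r1: "1 \<le> r" using N by (simp add: r_def)
  have rr: "r * r = real N" by (simp add: r_def)
  define P where "P = 1 + 1 / r"
  define Q where "Q = 1 + r"
  have PQ: "0 < P" "0 < Q" "1 / P + 1 / Q = 1" "1 \<le> P" "P \<le> 2"
    using r1 by (auto simp: P_def Q_def field_simps)
  define \<Delta> where "\<Delta> c = hamiltonian N h c \<sigma> - hamiltonian N h mean_J \<sigma>" for c
  define X where "X c = (hamiltonian N h c \<eta> - hamiltonian N h mean_J \<eta>) - (hamiltonian N h c \<sigma> - hamiltonian N h mean_J \<sigma>)" for c
  define al where "al = alpha \<beta> D N"
  define t where "t = \<bar>s * \<beta>\<bar>"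
  define A where "A = ((P * s)\<^sup>2 * al + vertex_const \<bar>P * s * \<beta>\<bar> / real N) / P"
  define B where "B = (ln 2 + 4 * k\<^sup>2 * (Q * t)\<^sup>2 / real N) / Q"
  note vm = vertex_mgf[OF N \<sigma>, where s="P * s" and \<beta>=\<beta> and h=h, folded \<Delta>_def]
  note fm1 = flip_mgf[OF N \<sigma> nb, where s="Q * t" and h=h, folded X_def]
  note fm2 = flip_mgf[OF N \<sigma> nb, where s="- (Q * t)" and h=h, folded X_def]
  have i1: "expectation (\<lambda>c. exp (P * s * \<beta> * \<Delta> c)) \<le> exp (P * A)"
    using vm(1) PQ by (simp add: A_def al_def)
  have i2: "expectation (\<lambda>c. exp (Q * t * X c) + exp (- (Q * t) * X c)) \<le> exp (Q * B)"
  proof -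
    have "expectation (\<lambda>c. exp (Q * t * X c) + exp (- (Q * t) * X c)) =
       expectation (\<lambda>c. exp (Q * t * X c)) + expectation (\<lambda>c. exp (- (Q * t) * X c))"
      using fm1(2) fm2(2) by (rule Bochner_Integration.integral_add)
    also have "\<dots> \<le> 2 * exp (4 * k\<^sup>2 * (Q * t)\<^sup>2 / real N)" using fm1(1) fm2(1) by simp
    also have "\<dots> = exp (Q * B)" using PQ by (simp add: B_def exp_add)
    finally show ?thesis .
  qed
  have pt: "exp (s * \<beta> * (m c - m mean_J)) \<le>
     exp (A + B) * (exp (P * s * \<beta> * \<Delta> c) * exp (- P * A) / P +
        (exp (Q * t * X c) + exp (- (Q * t) * X c)) * exp (- Q * B) / Q)" for c
  proof -
    have "\<bar>(m c - m mean_J) - \<Delta> c\<bar> \<le> \<bar>X c\<bar>" unfolding m_def \<Delta>_def X_def by (rule max_shift_le)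
    then have "\<bar>s * \<beta> * ((m c - m mean_J) - \<Delta> c)\<bar> \<le> t * \<bar>X c\<bar>" unfolding t_def abs_mult by (intro mult_left_mono) auto
    then have "s * \<beta> * (m c - m mean_J) \<le> s * \<beta> * \<Delta> c + t * \<bar>X c\<bar>"
      by (simp add: abs_le_iff right_diff_distrib)
    also have "\<dots> = (A + B) + ((s * \<beta> * \<Delta> c - A) + (t * \<bar>X c\<bar> - B))" by simp
    finally have "exp (s * \<beta> * (m c - m mean_J)) \<le> exp (A + B) * exp ((s * \<beta> * \<Delta> c - A) + (t * \<bar>X c\<bar> - B))"
      by (simp only: exp_add[symmetric] exp_le_cancel_iff)
    also have "exp ((s * \<beta> * \<Delta> c - A) + (t * \<bar>X c\<bar> - B)) \<le>
        exp (P * (s * \<beta> * \<Delta> c - A)) / P + exp (Q * (t * \<bar>X c\<bar> - B)) / Q"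
      by (rule exp_young[OF PQ(1-3)])
    also have "exp (P * (s * \<beta> * \<Delta> c - A)) = exp (P * s * \<beta> * \<Delta> c) * exp (- P * A)"
      by (simp add: exp_add[symmetric] algebra_simps)
    also have "exp (Q * (t * \<bar>X c\<bar> - B)) = exp (Q * t * \<bar>X c\<bar>) * exp (- Q * B)"
      by (simp add: exp_add[symmetric] algebra_simps)
    also have "exp (Q * t * \<bar>X c\<bar>) \<le> exp (Q * t * X c) + exp (- (Q * t) * X c)"
      by (cases "0 \<le> X c") auto
    finally show ?thesis using PQ by (simp add: mult_left_mono mult_right_mono divide_right_mono)
  qed
  have mm: "(\<lambda>c. exp (s * \<beta> * (m c - m mean_J))) \<in> borel_measurable D"
    unfolding m_def by (intro measurable_D) (use couplings_upto_subset in measurable)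
  have idom: "integrable D (\<lambda>c. exp (A + B) * (exp (P * s * \<beta> * \<Delta> c) * exp (- P * A) / P +
        (exp (Q * t * X c) + exp (- (Q * t) * X c)) * exp (- Q * B) / Q))"
    using vm(2) fm1(2) fm2(2) by auto
  show int: "integrable D (\<lambda>c. exp (s * \<beta> * (m c - m mean_J)))"
    by (rule Bochner_Integration.integrable_bound[OF idom mm]) (auto intro!: AE_I2 order_trans[OF pt])
  have "expectation (\<lambda>c. exp (s * \<beta> * (m c - m mean_J))) \<le>
     expectation (\<lambda>c. exp (A + B) * (exp (P * s * \<beta> * \<Delta> c) * exp (- P * A) / P +
        (exp (Q * t * X c) + exp (- (Q * t) * X c)) * exp (- Q * B) / Q))"
    by (rule integral_mono[OF int idom pt])
  also have "\<dots> = exp (A + B) * (expectation (\<lambda>c. exp (P * s * \<beta> * \<Delta> c)) * exp (- P * A) / P +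
      expectation (\<lambda>c. exp (Q * t * X c) + exp (- (Q * t) * X c)) * exp (- Q * B) / Q)"
    using vm(2) fm1(2) fm2(2) by simp
  also have "\<dots> \<le> exp (A + B) * (exp (P * A) * exp (- P * A) / P + exp (Q * B) * exp (- Q * B) / Q)"
    using i1 i2 PQ by (intro mult_left_mono add_mono divide_right_mono mult_right_mono) auto
  also have "\<dots> = exp (A + B)" using PQ(3) by (simp add: exp_add[symmetric])
  also have "\<dots> \<le> exp (s\<^sup>2 * al + edge_const \<beta> s / r)"
  proof -
    have N0: "0 < real N" using N by simp
    have al: "0 \<le> al" "al \<le> \<beta>\<^sup>2 * k\<^sup>2" using alpha_bounds[OF N] by (auto simp: al_def)
    have "r * 1 \<le> r * r" using r1 by (intro mult_left_mono) auto
    then have NR: "1 / real N \<le> 1 / r" using r1 rr by (intro divide_left_mono) auto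
    have "\<bar>P * s * \<beta>\<bar> \<le> 2 * t" unfolding t_def abs_mult using PQ by (simp add: mult.assoc mult_right_mono)
    then have vc: "vertex_const \<bar>P * s * \<beta>\<bar> \<le> vertex_const (2 * t)"
      unfolding vertex_const_def using k_pos by (intro mult_mono power_mono) auto
    have v0: "0 \<le> vertex_const (2 * t)" by (intro vertex_const_nonneg) (simp add: t_def)
    have "A = P * s\<^sup>2 * al + vertex_const \<bar>P * s * \<beta>\<bar> / real N / P"
      unfolding A_def using PQ(1) by (simp add: add_divide_distrib power2_eq_square)
    also have "P * s\<^sup>2 * al = s\<^sup>2 * al + s\<^sup>2 * al / r" by (simp add: P_def distrib_right)
    also have "s\<^sup>2 * al / r \<le> s\<^sup>2 * (\<beta>\<^sup>2 * k\<^sup>2) / r"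
      using al r1 by (intro divide_right_mono mult_left_mono) auto
    also have "vertex_const \<bar>P * s * \<beta>\<bar> / real N / P \<le> vertex_const (2 * t) / real N / 1"
      using vc v0 PQ N0 by (intro frac_le divide_right_mono) auto
    also have "vertex_const (2 * t) / real N / 1 \<le> vertex_const (2 * t) / r"
      using mult_left_mono[OF NR v0] by simp
    finally have A: "A \<le> s\<^sup>2 * al + s\<^sup>2 * (\<beta>\<^sup>2 * k\<^sup>2) / r + vertex_const (2 * t) / r" by simp
    have "(Q * t)\<^sup>2 / real N \<le> 4 * t\<^sup>2"
    proof -
      have "Q \<le> 2 * r" using r1 by (simp add: Q_def)
      then have "Q\<^sup>2 \<le> (2 * r)\<^sup>2" using PQ by (intro power_mono) auto
      also have "\<dots> = 4 * real N" using rr by (simp add: power2_eq_square)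
      finally have "Q\<^sup>2 * t\<^sup>2 \<le> 4 * real N * t\<^sup>2" by (intro mult_right_mono) auto
      then show ?thesis using N0 by (simp add: power_mult_distrib field_simps)
    qed
    then have "4 * k\<^sup>2 * ((Q * t)\<^sup>2 / real N) \<le> 4 * k\<^sup>2 * (4 * t\<^sup>2)" by (intro mult_left_mono) auto
    then have "B \<le> (ln 2 + 16 * k\<^sup>2 * t\<^sup>2) / Q"
      unfolding B_def using PQ by (intro divide_right_mono) auto
    also have "\<dots> \<le> (ln 2 + 16 * k\<^sup>2 * t\<^sup>2) / r"
      using r1 by (intro divide_left_mono) (auto simp: Q_def intro!: add_nonneg_nonneg)
    finally have B: "B \<le> (ln 2 + 16 * k\<^sup>2 * t\<^sup>2) / r" .
    have t2: "t\<^sup>2 = s\<^sup>2 * \<beta>\<^sup>2" by (simp add: t_def power_mult_distrib)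
    have "edge_const \<beta> s / r = s\<^sup>2 * (\<beta>\<^sup>2 * k\<^sup>2) / r + vertex_const (2 * t) / r + (ln 2 + 16 * k\<^sup>2 * t\<^sup>2) / r"
      unfolding edge_const_def t2 unfolding t_def by (simp add: add_divide_distrib mult.assoc)
    then have "A + B \<le> s\<^sup>2 * al + edge_const \<beta> s / r" using A B by linarith
    then show ?thesis by simp
  qed
  finally show "expectation (\<lambda>c. exp (s * \<beta> * (m c - m mean_J))) \<le> exp (s\<^sup>2 * alpha \<beta> D N + edge_const \<beta> s / sqrt (real N))"
    by (simp add: al_def r_def)
qed

end

section \<open>Mean and moments of the logarithmic weight of a set\<close>

context
  fixes P :: "'x measure" and N :: nat and Hx :: "'x \<Rightarrow> (nat \<Rightarrow> real) \<Rightarrow> real"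
  assumes Hx: "\<And>\<sigma>. \<sigma> \<in> spins N \<Longrightarrow> (\<lambda>x. Hx x \<sigma>) \<in> borel_measurable P"
begin

lemma measurable_trans_prob:
  assumes "\<sigma> \<in> spins N" "\<eta> \<in> spins N"
  shows "(\<lambda>x. trans_prob N \<beta> (Hx x) \<sigma> \<eta>) \<in> borel_measurable P"
proof -
  have fp: "(\<lambda>x. flip_prob N \<beta> (Hx x) \<sigma> \<eta>) \<in> borel_measurable P"
    if "\<sigma> \<in> spins N" "\<eta> \<in> spins N" for \<sigma> \<eta>
  proof -
    have [measurable]: "(\<lambda>x. Hx x \<sigma>) \<in> borel_measurable P" "(\<lambda>x. Hx x \<eta>) \<in> borel_measurable P"
      using Hx that by auto
    show ?thesis unfolding flip_prob_def by measurable
  qed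
  have "(\<lambda>x. 1 - (\<Sum>\<eta>\<in>spins N - {\<sigma>}. flip_prob N \<beta> (Hx x) \<sigma> \<eta>)) \<in> borel_measurable P"
    using assms by (intro borel_measurable_diff borel_measurable_sum fp) auto
  then show ?thesis unfolding trans_prob_def using fp[OF assms] by auto
qed

lemma measurable_equil:
  assumes A: "A \<subseteq> spins N" and \<sigma>: "\<sigma> \<in> spins N"
  shows "(\<lambda>x. metro_equil N \<beta> (Hx x) A B \<sigma>) \<in> borel_measurable P"
proof -
  let ?C = "spins N - (A \<union> B)"
  have it: "(\<lambda>x. (kill (trans_prob N \<beta> (Hx x)) ?C ^^ n) (\<lambda>y. \<Sum>z\<in>A. trans_prob N \<beta> (Hx x) y z) \<sigma>) \<in> borel_measurable P"
    if "\<sigma> \<in> spins N" for n \<sigma>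
    using that
  proof (induction n arbitrary: \<sigma>)
    case 0
    then show ?case using A by (simp, intro borel_measurable_sum measurable_trans_prob) auto
  next
    case (Suc n)
    have "(kill q ?C ^^ Suc n) f \<sigma> = (\<Sum>y\<in>?C. q \<sigma> y * (kill q ?C ^^ n) f y)" for q f
      by (simp add: kill_def)
    then show ?case
      using Suc by (simp only:) (intro borel_measurable_sum borel_measurable_times measurable_trans_prob, auto)
  qed
  show ?thesis
    unfolding metro_equil_def equil_def green_def
    using it[OF \<sigma>] by (auto intro: borel_measurable_suminf)
qed

lemma measurable_metro_mass:
  assumes A: "A \<subseteq> spins N"
  shows "(\<lambda>x. metro_mass N \<beta> (Hx x) A B) \<in> borel_measurable P"
  unfolding metro_mass_def
  using A by (intro borel_measurable_sum borel_measurable_times measurable_equil)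
    (auto intro!: measurable_compose[OF _ borel_measurable_exp] borel_measurable_times Hx)

lemma measurable_boltzmann_sum:
  assumes A: "A \<subseteq> spins N"
  shows "(\<lambda>x. \<Sum>\<sigma>\<in>A. boltzmann \<beta> (Hx x) \<sigma>) \<in> borel_measurable P"
  using A by (intro borel_measurable_sum)
    (auto intro!: measurable_compose[OF _ borel_measurable_exp] borel_measurable_times Hx)

lemma measurable_metro_cap:
  assumes A: "A \<subseteq> spins N"
  shows "(\<lambda>x. metro_cap N \<beta> (Hx x) A B) \<in> borel_measurable P"
  unfolding metro_cap_def capacity_def dform_def metro_equil_def[symmetric]
  using A by (intro borel_measurable_divide borel_measurable_sum borel_measurable_times borel_measurable_diff
      measurable_equil measurable_trans_prob)
    (auto intro!: measurable_compose[OF _ borel_measurable_exp] borel_measurable_times Hx)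

lemma measurable_mean_crossover:
  assumes "1 \<le> N" "0 < \<beta>" "A \<subseteq> spins N" "B \<subseteq> spins N" "A \<noteq> {}" "B \<noteq> {}" "A \<inter> B = {}"
  shows "(\<lambda>x. mean_crossover N \<beta> (Hx x) A B) \<in> borel_measurable P"
  unfolding mean_crossover_eq[OF assms]
  using assms by (intro borel_measurable_divide measurable_metro_mass measurable_metro_cap)

end

lemma ln_boltzmann_sum_lipschitz:
  assumes X: "X \<subseteq> spins N" "X \<noteq> {}" and \<beta>: "0 < \<beta>"
    and d: "\<And>\<sigma>. \<sigma> \<in> spins N \<Longrightarrow> \<bar>H \<sigma> - H' \<sigma>\<bar> \<le> d"
  shows "\<bar>ln (\<Sum>\<sigma>\<in>X. boltzmann \<beta> H \<sigma>) - ln (\<Sum>\<sigma>\<in>X. boltzmann \<beta> H' \<sigma>)\<bar> \<le> \<beta> * d"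
proof -
  have fin: "finite X" using X finite_spins by (auto intro: finite_subset)
  have pos: "0 < (\<Sum>\<sigma>\<in>X. boltzmann \<beta> H \<sigma>)" for H using fin X by (intro sum_pos) auto
  have *: "ln (\<Sum>\<sigma>\<in>X. boltzmann \<beta> H \<sigma>) \<le> \<beta> * d + ln (\<Sum>\<sigma>\<in>X. boltzmann \<beta> H' \<sigma>)"
    if d: "\<And>\<sigma>. \<sigma> \<in> spins N \<Longrightarrow> H' \<sigma> - H \<sigma> \<le> d" for H H'
  proof -
    have "(\<Sum>\<sigma>\<in>X. boltzmann \<beta> H \<sigma>) \<le> (\<Sum>\<sigma>\<in>X. exp (\<beta> * d) * boltzmann \<beta> H' \<sigma>)"
    proof (rule sum_mono)
      fix \<sigma> assume "\<sigma> \<in> X"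
      then have "\<beta> * (H' \<sigma> - H \<sigma>) \<le> \<beta> * d" using d X \<beta> by (intro mult_left_mono) auto
      then show "boltzmann \<beta> H \<sigma> \<le> exp (\<beta> * d) * boltzmann \<beta> H' \<sigma>"
        by (simp add: exp_add[symmetric] algebra_simps)
    qed
    then have "(\<Sum>\<sigma>\<in>X. boltzmann \<beta> H \<sigma>) \<le> exp (\<beta> * d) * (\<Sum>\<sigma>\<in>X. boltzmann \<beta> H' \<sigma>)"
      by (simp only: sum_distrib_left)
    then have "ln (\<Sum>\<sigma>\<in>X. boltzmann \<beta> H \<sigma>) \<le> ln (exp (\<beta> * d) * (\<Sum>\<sigma>\<in>X. boltzmann \<beta> H' \<sigma>))"
      by (subst ln_le_cancel_iff) (intro pos mult_pos_pos exp_gt_zero)+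
    then show ?thesis using pos[of H'] by (simp add: ln_mult)
  qed
  show ?thesis using *[of H' H] *[of H H'] d by (force simp: abs_le_iff)
qed

text \<open>
  Conductances change by at most \<open>exp (\<beta> * d)\<close>, and the capacity is monotone and homogeneous in them.
\<close>

lemma ln_metro_cap_lipschitz:
  assumes N: "1 \<le> N" and \<beta>: "0 < \<beta>"
    and AB: "A \<subseteq> spins N" "B \<subseteq> spins N" "A \<noteq> {}" "B \<noteq> {}" "A \<inter> B = {}"
    and d: "\<And>\<sigma>. \<sigma> \<in> spins N \<Longrightarrow> \<bar>H \<sigma> - H' \<sigma>\<bar> \<le> d"
  shows "\<bar>ln (metro_cap N \<beta> H A B) - ln (metro_cap N \<beta> H' A B)\<bar> \<le> \<beta> * d"
proof -
  have *: "ln (metro_cap N \<beta> H' A B) \<le> \<beta> * d + ln (metro_cap N \<beta> H A B)"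
    if d: "\<And>\<sigma>. \<sigma> \<in> spins N \<Longrightarrow> \<bar>H \<sigma> - H' \<sigma>\<bar> \<le> d" for H H'
  proof -
    interpret chain_pair "spins N" "trans_prob N \<beta> H" "boltzmann \<beta> H" "trans_prob N \<beta> H'" "boltzmann \<beta> H'"
      "\<lambda>(x, y). exp (- \<beta> * (max (H' x) (H' y) - max (H x) (H y)))"
      by (rule chain_pair_metropolis[OF N \<beta>])
    have "cap' A B \<le> exp (\<beta> * d) * cap A B"
    proof (rule capacity_upper_const[OF AB])
      fix x y assume "x \<in> spins N" "y \<in> spins N"
      then have "max (H x) (H y) - max (H' x) (H' y) \<le> d" using d[of x] d[of y] by (auto simp: max_def abs_le_iff)
      then have "\<beta> * (max (H x) (H y) - max (H' x) (H' y)) \<le> \<beta> * d" using \<beta> by (intro mult_left_mono) auto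
      then show "(case (x, y) of (x, y) \<Rightarrow> exp (- \<beta> * (max (H' x) (H' y) - max (H x) (H y)))) \<le> exp (\<beta> * d)"
        by (simp add: algebra_simps)
    qed
    then have "metro_cap N \<beta> H' A B \<le> exp (\<beta> * d) * metro_cap N \<beta> H A B" by (simp add: metro_cap_def)
    then have "ln (metro_cap N \<beta> H' A B) \<le> ln (exp (\<beta> * d) * metro_cap N \<beta> H A B)"
      using metro_cap_pos[OF N \<beta> AB] by (subst ln_le_cancel_iff) auto
    then show ?thesis using metro_cap_pos[OF N \<beta> AB, of H] by (simp add: ln_mult)
  qed
  have "ln (metro_cap N \<beta> H' A B) \<le> \<beta> * d + ln (metro_cap N \<beta> H A B)" by (rule *) (rule d)
  moreover have "ln (metro_cap N \<beta> H A B) \<le> \<beta> * d + ln (metro_cap N \<beta> H' A B)"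
    by (rule *) (use d in \<open>auto simp: abs_minus_commute\<close>)
  ultimately show ?thesis by (simp add: abs_le_iff)
qed

lemma powr_mean_le:
  fixes \<pi> y :: "'e \<Rightarrow> real"
  assumes "finite E" "\<And>e. e \<in> E \<Longrightarrow> 0 \<le> \<pi> e" "(\<Sum>e\<in>E. \<pi> e) = 1" "\<And>e. e \<in> E \<Longrightarrow> 0 < y e" "1 \<le> s"
  shows "(\<Sum>e\<in>E. \<pi> e * y e) powr s \<le> (\<Sum>e\<in>E. \<pi> e * y e powr s)"
  using convex_on_sum[OF assms(1) _ powr_convex[OF assms(5)] assms(3), of y] assms by fastforce

lemma ln_le_tangent:
  fixes x a :: real
  assumes "0 < x" "0 < a"
  shows "ln x \<le> x / a - 1 + ln a"
  using ln_le_minus_one[of "x / a"] assms by (simp add: ln_div)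

locale disordered_model = disorder D k for D k +
  fixes N :: nat and \<beta> h :: real
  assumes N: "2 \<le> N" and \<beta>: "0 < \<beta>"
begin

abbreviation "Hq c \<equiv> hamiltonian N h c"
abbreviation "\<alpha> \<equiv> alpha \<beta> D N"

definition log_mass where "log_mass X c = ln (\<Sum>\<sigma>\<in>X. boltzmann \<beta> (hamiltonian N h c) \<sigma>)"
definition log_cap where "log_cap A B c = ln (metro_cap N \<beta> (hamiltonian N h c) A B)"

lemma N1: "1 \<le> N" using N by simp

lemma hamiltonian_measurable_upto: "(\<lambda>c. Hq c \<sigma>) \<in> borel_measurable (PiM (couplings_upto N) (\<lambda>_. borel))"
  by (rule measurable_hamiltonian) simp

lemma hamiltonian_measurable_D: "(\<lambda>c. Hq c \<sigma>) \<in> borel_measurable D"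
  by (intro measurable_D measurable_hamiltonian couplings_upto_subset)

lemma log_mass_measurable_upto:
  "X \<subseteq> spins N \<Longrightarrow> log_mass X \<in> borel_measurable (PiM (couplings_upto N) (\<lambda>_. borel))"
  unfolding log_mass_def[abs_def]
  using measurable_boltzmann_sum[OF hamiltonian_measurable_upto, of X] by measurable

lemma log_mass_measurable: "X \<subseteq> spins N \<Longrightarrow> log_mass X \<in> borel_measurable D"
  unfolding log_mass_def[abs_def]
  using measurable_boltzmann_sum[OF hamiltonian_measurable_D, of X] by measurable

lemma log_cap_measurable_upto:
  "A \<subseteq> spins N \<Longrightarrow> log_cap A B \<in> borel_measurable (PiM (couplings_upto N) (\<lambda>_. borel))"
  unfolding log_cap_def[abs_def]
  using measurable_metro_cap[OF hamiltonian_measurable_upto, of A] by measurable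

lemma log_cap_measurable: "A \<subseteq> spins N \<Longrightarrow> log_cap A B \<in> borel_measurable D"
  unfolding log_cap_def[abs_def]
  using measurable_metro_cap[OF hamiltonian_measurable_D, of A] by measurable

lemma AE_ham_dev: "AE c in D. \<forall>\<sigma>\<in>spins N. \<bar>Hq c \<sigma> - Hq mean_J \<sigma>\<bar> \<le> k * real N"
  using AE_box[of N]
proof eventually_elim
  case (elim c)
  show ?case
  proof
    fix \<sigma> assume \<sigma>: "\<sigma> \<in> spins N"
    have "(\<Sum>p\<in>couplings_upto N. \<bar>c p - mean_J p\<bar>) \<le> (\<Sum>p\<in>couplings_upto N. 2 * k)"
    proof (rule sum_mono)
      fix p assume p: "p \<in> couplings_upto N"
      then have "\<bar>mean_J p\<bar> \<le> k" using couplings_upto_subset by (intro mean_J_le) auto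
      then show "\<bar>c p - mean_J p\<bar> \<le> 2 * k" using elim p by (smt (verit, best))
    qed
    also have "\<dots> = real (card (couplings_upto N)) * (2 * k)" by simp
    also have "\<dots> \<le> (real N)\<^sup>2 / 2 * (2 * k)" using card_couplings_upto k_pos by (intro mult_right_mono) auto
    finally have "(\<Sum>p\<in>couplings_upto N. \<bar>c p - mean_J p\<bar>) / real N \<le> (real N)\<^sup>2 / 2 * (2 * k) / real N"
      by (intro divide_right_mono) auto
    also have "\<dots> = k * real N" using N by (simp add: power2_eq_square)
    finally show "\<bar>Hq c \<sigma> - Hq mean_J \<sigma>\<bar> \<le> k * real N" using hamiltonian_diff_le[OF \<sigma>, of h c mean_J] by linarith
  qed
qed

lemma AE_ham_bound: "AE c in D. \<forall>\<sigma>\<in>spins N. \<bar>Hq c \<sigma>\<bar> \<le> (k + \<bar>h\<bar>) * real N"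
  using AE_box[of N]
proof eventually_elim
  case (elim c)
  then show ?case using k_pos by (intro ballI hamiltonian_abs_le) auto
qed

lemma ham_b_bound: "\<sigma> \<in> spins N \<Longrightarrow> \<bar>Hq mean_J \<sigma>\<bar> \<le> (k + \<bar>h\<bar>) * real N"
  using k_pos couplings_upto_subset by (intro hamiltonian_abs_le mean_J_le) auto

lemma AE_log_mass_dev:
  assumes X: "X \<subseteq> spins N" "X \<noteq> {}"
  shows "AE c in D. \<bar>log_mass X c - log_mass X mean_J\<bar> \<le> \<beta> * (k * real N)"
  using AE_ham_dev unfolding log_mass_def
  by eventually_elim (rule ln_boltzmann_sum_lipschitz[OF X \<beta>], auto)

lemma AE_log_cap_dev:
  assumes AB: "A \<subseteq> spins N" "B \<subseteq> spins N" "A \<noteq> {}" "B \<noteq> {}" "A \<inter> B = {}"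
  shows "AE c in D. \<bar>log_cap A B c - log_cap A B mean_J\<bar> \<le> \<beta> * (k * real N)"
  using AE_ham_dev unfolding log_cap_def
  by eventually_elim (rule ln_metro_cap_lipschitz[OF N1 \<beta> AB], auto)

lemma log_mass_integrable:
  assumes X: "X \<subseteq> spins N" "X \<noteq> {}"
  shows "integrable D (log_mass X)"
  by (rule integrable_bounded[where B="\<beta> * (k * real N) + \<bar>log_mass X mean_J\<bar>"])
    (use log_mass_measurable[OF X(1)] AE_log_mass_dev[OF X] in \<open>auto elim!: eventually_mono\<close>)

lemma log_cap_integrable:
  assumes AB: "A \<subseteq> spins N" "B \<subseteq> spins N" "A \<noteq> {}" "B \<noteq> {}" "A \<inter> B = {}"
  shows "integrable D (log_cap A B)"
  by (rule integrable_bounded[where B="\<beta> * (k * real N) + \<bar>log_cap A B mean_J\<bar>"])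
    (use log_cap_measurable[OF AB(1)] AE_log_cap_dev[OF AB] in \<open>auto elim!: eventually_mono\<close>)

lemma expectation_ham: "expectation (\<lambda>c. Hq c \<sigma>) = Hq mean_J \<sigma>"
  using annealed_ham_eq[of N h] by (simp add: annealed_ham_def fun_eq_iff)

lemma ham_integrable: "\<sigma> \<in> spins N \<Longrightarrow> integrable D (\<lambda>c. Hq c \<sigma>)"
  by (rule integrable_bounded[where B="(k + \<bar>h\<bar>) * real N"])
    (use hamiltonian_measurable_D AE_ham_bound in \<open>auto elim!: eventually_mono\<close>)

context
  fixes X :: "(nat \<Rightarrow> real) set"
  assumes X: "X \<subseteq> spins N" "X \<noteq> {}"
begin

definition gibbs_weight where "gibbs_weight \<sigma> = boltzmann \<beta> (Hq mean_J) \<sigma> / (\<Sum>\<sigma>\<in>X. boltzmann \<beta> (Hq mean_J) \<sigma>)"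

lemma finX: "finite X" using X finite_spins by (auto intro: finite_subset)

lemma mass_pos: "0 < (\<Sum>\<sigma>\<in>X. boltzmann \<beta> H \<sigma>)" using finX X by (intro sum_pos) auto

lemma gibbs_weight: "0 \<le> gibbs_weight \<sigma>" "(\<Sum>\<sigma>\<in>X. gibbs_weight \<sigma>) = 1"
  unfolding gibbs_weight_def using mass_pos[of "Hq mean_J"] by (auto simp: sum_divide_distrib[symmetric] intro: less_imp_le)

lemma mass_ratio: "exp (log_mass X c - log_mass X mean_J) = (\<Sum>\<sigma>\<in>X. gibbs_weight \<sigma> * exp (- \<beta> * (Hq c \<sigma> - Hq mean_J \<sigma>)))"
proof -
  have "exp (log_mass X c - log_mass X mean_J) = (\<Sum>\<sigma>\<in>X. boltzmann \<beta> (Hq c) \<sigma>) / (\<Sum>\<sigma>\<in>X. boltzmann \<beta> (Hq mean_J) \<sigma>)"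
    unfolding log_mass_def exp_diff using mass_pos by simp
  also have "\<dots> = (\<Sum>\<sigma>\<in>X. gibbs_weight \<sigma> * exp (- \<beta> * (Hq c \<sigma> - Hq mean_J \<sigma>)))"
    unfolding sum_divide_distrib
  proof (intro sum.cong refl)
    fix \<sigma>
    have "boltzmann \<beta> (Hq c) \<sigma> = boltzmann \<beta> (Hq mean_J) \<sigma> * exp (- \<beta> * (Hq c \<sigma> - Hq mean_J \<sigma>))"
      by (simp add: exp_add[symmetric] algebra_simps)
    then show "boltzmann \<beta> (Hq c) \<sigma> / (\<Sum>\<sigma>\<in>X. boltzmann \<beta> (Hq mean_J) \<sigma>) = gibbs_weight \<sigma> * exp (- \<beta> * (Hq c \<sigma> - Hq mean_J \<sigma>))"
      by (simp add: gibbs_weight_def)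
  qed
  finally show ?thesis .
qed

text \<open>
  The ratio of the weights is an average of \<open>exp (- \<beta> * \<Delta> \<sigma>)\<close> under the annealed Gibbs measure on \<open>X\<close>;
  by convexity the power passes inside the average.
\<close>

lemma mass_moment:
  assumes s: "1 \<le> s"
  shows "integrable D (\<lambda>c. exp (s * (log_mass X c - log_mass X mean_J)))"
    and "expectation (\<lambda>c. exp (s * (log_mass X c - log_mass X mean_J))) \<le> exp (s\<^sup>2 * \<alpha> + vertex_const (s * \<beta>) / real N)"
proof -
  have le: "exp (s * (log_mass X c - log_mass X mean_J)) \<le> (\<Sum>\<sigma>\<in>X. gibbs_weight \<sigma> * exp (- s * \<beta> * (Hq c \<sigma> - Hq mean_J \<sigma>)))" for c
  proof -
    have "exp (s * (log_mass X c - log_mass X mean_J)) = exp (log_mass X c - log_mass X mean_J) powr s"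
      by (simp add: powr_def)
    also have "\<dots> \<le> (\<Sum>\<sigma>\<in>X. gibbs_weight \<sigma> * exp (- \<beta> * (Hq c \<sigma> - Hq mean_J \<sigma>)) powr s)"
      unfolding mass_ratio using finX gibbs_weight s by (intro powr_mean_le) auto
    also have "\<dots> = (\<Sum>\<sigma>\<in>X. gibbs_weight \<sigma> * exp (- s * \<beta> * (Hq c \<sigma> - Hq mean_J \<sigma>)))"
      by (intro sum.cong refl) (simp add: powr_def algebra_simps)
    finally show ?thesis .
  qed
  have iS: "integrable D (\<lambda>c. \<Sum>\<sigma>\<in>X. gibbs_weight \<sigma> * exp (- s * \<beta> * (Hq c \<sigma> - Hq mean_J \<sigma>)))"
    using X vertex_mgf(2)[OF N1, of _ "-s" \<beta> h] by (intro Bochner_Integration.integrable_sum integrable_mult_right) auto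
  show i: "integrable D (\<lambda>c. exp (s * (log_mass X c - log_mass X mean_J)))"
  proof (rule Bochner_Integration.integrable_bound[OF iS])
    show "(\<lambda>c. exp (s * (log_mass X c - log_mass X mean_J))) \<in> borel_measurable D"
      using log_mass_measurable[OF X(1)] by measurable
  qed (auto intro!: AE_I2 order_trans[OF le])
  have "expectation (\<lambda>c. exp (s * (log_mass X c - log_mass X mean_J))) \<le>
      expectation (\<lambda>c. \<Sum>\<sigma>\<in>X. gibbs_weight \<sigma> * exp (- s * \<beta> * (Hq c \<sigma> - Hq mean_J \<sigma>)))"
    by (rule integral_mono[OF i iS le])
  also have "\<dots> = (\<Sum>\<sigma>\<in>X. gibbs_weight \<sigma> * expectation (\<lambda>c. exp (- s * \<beta> * (Hq c \<sigma> - Hq mean_J \<sigma>))))"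
    using X vertex_mgf(2)[OF N1, of _ "-s" \<beta> h] by (subst Bochner_Integration.integral_sum) auto
  also have "\<dots> \<le> (\<Sum>\<sigma>\<in>X. gibbs_weight \<sigma> * exp (s\<^sup>2 * \<alpha> + vertex_const (s * \<beta>) / real N))"
    using vertex_mgf(1)[OF N1, of _ "-s" \<beta> h] X gibbs_weight s \<beta>
    by (intro sum_mono mult_left_mono) (auto simp: abs_mult)
  also have "\<dots> = exp (s\<^sup>2 * \<alpha> + vertex_const (s * \<beta>) / real N)"
    using gibbs_weight by (simp add: sum_distrib_right[symmetric])
  finally show "expectation (\<lambda>c. exp (s * (log_mass X c - log_mass X mean_J))) \<le> exp (s\<^sup>2 * \<alpha> + vertex_const (s * \<beta>) / real N)" .
qed

text \<open>
  The lower bound is Jensen's inequality under the annealed Gibbs measure on \<open>X\<close>, where the energy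
  shifts are centred. For the upper bound the logarithm is replaced by its tangent at the bound of
  \<open>mass_moment\<close>.
\<close>

lemma expectation_log_mass:
  "log_mass X mean_J \<le> expectation (log_mass X)"
  "expectation (log_mass X) \<le> log_mass X mean_J + \<alpha> + vertex_const \<beta> / real N"
proof -
  note int = log_mass_integrable[OF X]
  have le: "(\<Sum>\<sigma>\<in>X. gibbs_weight \<sigma> * (- \<beta> * (Hq c \<sigma> - Hq mean_J \<sigma>))) \<le> log_mass X c - log_mass X mean_J" for c
  proof -
    have "exp (\<Sum>\<sigma>\<in>X. gibbs_weight \<sigma> *\<^sub>R (- \<beta> * (Hq c \<sigma> - Hq mean_J \<sigma>))) \<le> (\<Sum>\<sigma>\<in>X. gibbs_weight \<sigma> * exp (- \<beta> * (Hq c \<sigma> - Hq mean_J \<sigma>)))"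
      using finX X gibbs_weight by (intro convex_on_sum[OF _ _ exp_convex]) auto
    also have "\<dots> = exp (log_mass X c - log_mass X mean_J)" by (rule mass_ratio[symmetric])
    finally show ?thesis by simp
  qed
  have hi: "integrable D (\<lambda>c. Hq c \<sigma>)" if "\<sigma> \<in> X" for \<sigma> using that X by (intro ham_integrable) auto
  have "expectation (\<lambda>c. \<Sum>\<sigma>\<in>X. gibbs_weight \<sigma> * (- \<beta> * (Hq c \<sigma> - Hq mean_J \<sigma>))) \<le> expectation (\<lambda>c. log_mass X c - log_mass X mean_J)"
    using int hi by (intro integral_mono le Bochner_Integration.integrable_sum) auto
  moreover have "expectation (\<lambda>c. \<Sum>\<sigma>\<in>X. gibbs_weight \<sigma> * (- \<beta> * (Hq c \<sigma> - Hq mean_J \<sigma>))) = 0"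
    using hi by (subst Bochner_Integration.integral_sum) (auto simp: expectation_ham prob_space)
  ultimately show "log_mass X mean_J \<le> expectation (log_mass X)"
    using int by (simp add: prob_space)
  \<comment> \<open>tangent of the logarithm at the bound for the first moment\<close>
  define a where "a = exp (1\<^sup>2 * \<alpha> + vertex_const (1 * \<beta>) / real N)"
  have "log_mass X c - log_mass X mean_J \<le> exp (1 * (log_mass X c - log_mass X mean_J)) / a - 1 + ln a" for c
    using ln_le_tangent[of "exp (log_mass X c - log_mass X mean_J)" a] by (simp add: a_def)
  then have "expectation (\<lambda>c. log_mass X c - log_mass X mean_J) \<le>
      expectation (\<lambda>c. exp (1 * (log_mass X c - log_mass X mean_J)) / a - 1 + ln a)"
    using int mass_moment(1)[of 1] by (intro integral_mono) auto
  also have "\<dots> = expectation (\<lambda>c. exp (1 * (log_mass X c - log_mass X mean_J))) / a - 1 + ln a"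
    using mass_moment(1)[of 1] by (simp add: prob_space)
  also have "\<dots> \<le> a / a - 1 + ln a"
    using mass_moment(2)[of 1] by (intro add_mono diff_mono divide_right_mono) (auto simp: a_def)
  finally show "expectation (log_mass X) \<le> log_mass X mean_J + \<alpha> + vertex_const \<beta> / real N"
    using int by (simp add: a_def prob_space)
qed

end

end

section \<open>Mean and moments of the logarithmic capacity\<close>

context disordered_model
begin

context
  fixes A B :: "(nat \<Rightarrow> real) set"
  assumes AB: "A \<subseteq> spins N" "B \<subseteq> spins N" "A \<noteq> {}" "B \<noteq> {}" "A \<inter> B = {}"
begin

definition unit_flow where
  "unit_flow = flow_weight (spins N) (trans_prob N \<beta> (Hq mean_J)) (boltzmann \<beta> (Hq mean_J)) A B"

definition edge_energy :: "(nat \<times> nat \<Rightarrow> real) \<Rightarrow> (nat \<Rightarrow> real) \<times> (nat \<Rightarrow> real) \<Rightarrow> real" where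
  "edge_energy c e = max (Hq c (fst e)) (Hq c (snd e))"

interpretation base: reversible_chain "spins N" "trans_prob N \<beta> (Hq mean_J)" "boltzmann \<beta> (Hq mean_J)"
  by (rule reversible_chain_metropolis[OF N1 \<beta>])

lemma unit_flow_nonneg: "e \<in> spins N \<times> spins N \<Longrightarrow> 0 \<le> unit_flow e"
  unfolding unit_flow_def using base.flow_weight_nonneg by (cases e) auto

lemma unit_flow_sum: "(\<Sum>e\<in>spins N \<times> spins N. unit_flow e) = 1"
  unfolding unit_flow_def by (rule base.flow_weight_sum[OF AB])

lemma unit_flow_zero:
  assumes "e \<in> spins N \<times> spins N" "\<not> neighbour N (fst e) (snd e)"
  shows "unit_flow e = 0"
proof (cases "fst e = snd e")
  case True then show ?thesis by (cases e) (simp add: unit_flow_def flow_weight_def)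
next
  case False
  then have "boltzmann \<beta> (Hq mean_J) (fst e) * trans_prob N \<beta> (Hq mean_J) (fst e) (snd e) = 0"
    using conductance[OF N1 \<beta> False, of "Hq mean_J"] assms by simp
  then show ?thesis by (cases e) (simp add: unit_flow_def flow_weight_def)
qed

text \<open>
  Both ratios of capacities are averages of ratios of conductances under the same distribution
  \<open>unit_flow\<close>, which is determined by the mean couplings alone. Expectations over the couplings can
  therefore be taken edge by edge.
\<close>

lemma cap_ratio:
  "exp (log_cap A B c - log_cap A B mean_J) \<le>
     (\<Sum>e\<in>spins N \<times> spins N. unit_flow e * exp (- \<beta> * (edge_energy c e - edge_energy mean_J e)))"
  "exp (- (log_cap A B c - log_cap A B mean_J)) \<le>
     (\<Sum>e\<in>spins N \<times> spins N. unit_flow e * exp (\<beta> * (edge_energy c e - edge_energy mean_J e)))"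
proof -
  interpret chain_pair "spins N" "trans_prob N \<beta> (Hq mean_J)" "boltzmann \<beta> (Hq mean_J)"
      "trans_prob N \<beta> (Hq c)" "boltzmann \<beta> (Hq c)"
      "\<lambda>(x, y). exp (- \<beta> * (max (Hq c x) (Hq c y) - max (Hq mean_J x) (Hq mean_J y)))"
    by (rule chain_pair_metropolis[OF N1 \<beta>])
  have pos: "0 < metro_cap N \<beta> H A B" for H by (rule metro_cap_pos[OF N1 \<beta> AB])
  have e: "exp (log_cap A B c - log_cap A B mean_J) = metro_cap N \<beta> (Hq c) A B / metro_cap N \<beta> (Hq mean_J) A B"
    "exp (- (log_cap A B c - log_cap A B mean_J)) = metro_cap N \<beta> (Hq mean_J) A B / metro_cap N \<beta> (Hq c) A B"
    unfolding log_cap_def using pos by (simp_all add: exp_diff)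
  have "metro_cap N \<beta> (Hq c) A B \<le> metro_cap N \<beta> (Hq mean_J) A B *
     (\<Sum>e\<in>spins N \<times> spins N. unit_flow e * exp (- \<beta> * (edge_energy c e - edge_energy mean_J e)))"
    using capacity_upper[OF AB]
    by (simp add: metro_cap_def unit_flow_def edge_energy_def case_prod_beta)
  then show "exp (log_cap A B c - log_cap A B mean_J) \<le>
     (\<Sum>e\<in>spins N \<times> spins N. unit_flow e * exp (- \<beta> * (edge_energy c e - edge_energy mean_J e)))"
    unfolding e using pos[of "Hq mean_J"] by (simp add: pos_divide_le_eq mult.commute)
  have "metro_cap N \<beta> (Hq mean_J) A B \<le> metro_cap N \<beta> (Hq c) A B *
     (\<Sum>e\<in>spins N \<times> spins N. unit_flow e * exp (\<beta> * (edge_energy c e - edge_energy mean_J e)))"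
    using capacity_lower[OF AB]
    by (simp add: metro_cap_def unit_flow_def edge_energy_def case_prod_beta exp_minus[symmetric])
  then show "exp (- (log_cap A B c - log_cap A B mean_J)) \<le>
     (\<Sum>e\<in>spins N \<times> spins N. unit_flow e * exp (\<beta> * (edge_energy c e - edge_energy mean_J e)))"
    unfolding e using pos[of "Hq c"] by (simp add: pos_divide_le_eq mult.commute)
qed

lemma unit_flow_moment:
  "integrable D (\<lambda>c. \<Sum>e\<in>spins N \<times> spins N. unit_flow e * exp (s * \<beta> * (edge_energy c e - edge_energy mean_J e)))"
  "expectation (\<lambda>c. \<Sum>e\<in>spins N \<times> spins N. unit_flow e * exp (s * \<beta> * (edge_energy c e - edge_energy mean_J e)))
     \<le> exp (s\<^sup>2 * \<alpha> + edge_const \<beta> s / sqrt (real N))"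
proof -
  have em: "integrable D (\<lambda>c. exp (s * \<beta> * (edge_energy c e - edge_energy mean_J e)))"
    "expectation (\<lambda>c. exp (s * \<beta> * (edge_energy c e - edge_energy mean_J e))) \<le> exp (s\<^sup>2 * \<alpha> + edge_const \<beta> s / sqrt (real N))"
    if "e \<in> spins N \<times> spins N" "neighbour N (fst e) (snd e)" for e
    using edge_mgf[OF N1, of "fst e" "snd e" s \<beta> h] that unfolding edge_energy_def by auto
  have i: "integrable D (\<lambda>c. unit_flow e * exp (s * \<beta> * (edge_energy c e - edge_energy mean_J e)))"
    if "e \<in> spins N \<times> spins N" for e
    using em[OF that] unit_flow_zero[OF that] by (cases "neighbour N (fst e) (snd e)") auto
  show "integrable D (\<lambda>c. \<Sum>e\<in>spins N \<times> spins N. unit_flow e * exp (s * \<beta> * (edge_energy c e - edge_energy mean_J e)))"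
    by (rule Bochner_Integration.integrable_sum[OF i])
  have "expectation (\<lambda>c. \<Sum>e\<in>spins N \<times> spins N. unit_flow e * exp (s * \<beta> * (edge_energy c e - edge_energy mean_J e)))
     = (\<Sum>e\<in>spins N \<times> spins N. unit_flow e * expectation (\<lambda>c. exp (s * \<beta> * (edge_energy c e - edge_energy mean_J e))))"
    by (subst Bochner_Integration.integral_sum[OF i]) auto
  also have "\<dots> \<le> (\<Sum>e\<in>spins N \<times> spins N. unit_flow e * exp (s\<^sup>2 * \<alpha> + edge_const \<beta> s / sqrt (real N)))"
  proof (rule sum_mono)
    fix e assume e: "e \<in> spins N \<times> spins N"
    show "unit_flow e * expectation (\<lambda>c. exp (s * \<beta> * (edge_energy c e - edge_energy mean_J e)))
       \<le> unit_flow e * exp (s\<^sup>2 * \<alpha> + edge_const \<beta> s / sqrt (real N))"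
      using em(2)[OF e] unit_flow_zero[OF e] unit_flow_nonneg[OF e]
      by (cases "neighbour N (fst e) (snd e)") (auto intro: mult_left_mono)
  qed
  also have "\<dots> = exp (s\<^sup>2 * \<alpha> + edge_const \<beta> s / sqrt (real N))"
    using unit_flow_sum by (simp add: sum_distrib_right[symmetric])
  finally show "expectation (\<lambda>c. \<Sum>e\<in>spins N \<times> spins N. unit_flow e * exp (s * \<beta> * (edge_energy c e - edge_energy mean_J e)))
     \<le> exp (s\<^sup>2 * \<alpha> + edge_const \<beta> s / sqrt (real N))" .
qed

lemma cap_moment:
  assumes s: "1 \<le> s"
  shows "integrable D (\<lambda>c. exp (- s * (log_cap A B c - log_cap A B mean_J)))"
    and "expectation (\<lambda>c. exp (- s * (log_cap A B c - log_cap A B mean_J))) \<le> exp (s\<^sup>2 * \<alpha> + edge_const \<beta> s / sqrt (real N))"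
proof -
  have le: "exp (- s * (log_cap A B c - log_cap A B mean_J)) \<le>
      (\<Sum>e\<in>spins N \<times> spins N. unit_flow e * exp (s * \<beta> * (edge_energy c e - edge_energy mean_J e)))" for c
  proof -
    have "exp (- s * (log_cap A B c - log_cap A B mean_J)) = exp (- (log_cap A B c - log_cap A B mean_J)) powr s"
      by (simp add: powr_def algebra_simps)
    also have "\<dots> \<le> (\<Sum>e\<in>spins N \<times> spins N. unit_flow e * exp (\<beta> * (edge_energy c e - edge_energy mean_J e))) powr s"
      using cap_ratio(2) s by (intro powr_mono2) auto
    also have "\<dots> \<le> (\<Sum>e\<in>spins N \<times> spins N. unit_flow e * exp (\<beta> * (edge_energy c e - edge_energy mean_J e)) powr s)"
      using unit_flow_nonneg unit_flow_sum s by (intro powr_mean_le) (auto simp: finite_spins)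
    also have "\<dots> = (\<Sum>e\<in>spins N \<times> spins N. unit_flow e * exp (s * \<beta> * (edge_energy c e - edge_energy mean_J e)))"
      by (intro sum.cong refl) (simp add: powr_def mult.assoc)
    finally show ?thesis .
  qed
  show i: "integrable D (\<lambda>c. exp (- s * (log_cap A B c - log_cap A B mean_J)))"
  proof (rule Bochner_Integration.integrable_bound[OF unit_flow_moment(1)[of s]])
    show "(\<lambda>c. exp (- s * (log_cap A B c - log_cap A B mean_J))) \<in> borel_measurable D"
      using log_cap_measurable[OF AB(1), of B] by measurable
    show "AE c in D. norm (exp (- s * (log_cap A B c - log_cap A B mean_J))) \<le>
       norm (\<Sum>e\<in>spins N \<times> spins N. unit_flow e * exp (s * \<beta> * (edge_energy c e - edge_energy mean_J e)))"
      by (rule AE_I2) (simp only: real_norm_def abs_exp_cancel order_trans[OF le abs_ge_self])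
  qed
  show "expectation (\<lambda>c. exp (- s * (log_cap A B c - log_cap A B mean_J))) \<le> exp (s\<^sup>2 * \<alpha> + edge_const \<beta> s / sqrt (real N))"
    using integral_mono[OF i unit_flow_moment(1)[of s] le] unit_flow_moment(2)[of s] by linarith
qed

lemma expectation_log_cap:
  "\<bar>expectation (log_cap A B) - log_cap A B mean_J\<bar> \<le> \<alpha> + edge_const \<beta> 1 / sqrt (real N)"
proof -
  note int = log_cap_integrable[OF AB]
  define a where "a = exp (\<alpha> + edge_const \<beta> 1 / sqrt (real N))"
  have gen: "expectation g \<le> ln a"
    if g: "integrable D g" and f: "integrable D f" "expectation f \<le> a" and gf: "\<And>c. exp (g c) \<le> f c" for f g
  proof -
    have "g c \<le> f c / a - 1 + ln a" for c
    proof -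
      have "g c \<le> exp (g c) / a - 1 + ln a" using ln_le_tangent[of "exp (g c)" a] by (simp add: a_def)
      also have "\<dots> \<le> f c / a - 1 + ln a" using gf[of c] by (simp add: a_def divide_right_mono)
      finally show ?thesis .
    qed
    then have "expectation g \<le> expectation (\<lambda>c. f c / a - 1 + ln a)"
      using g f by (intro integral_mono) auto
    also have "\<dots> = expectation f / a - 1 + ln a" using f by (simp add: prob_space)
    also have "\<dots> \<le> a / a - 1 + ln a" using f by (intro add_mono diff_mono divide_right_mono) (auto simp: a_def)
    finally show ?thesis by (simp add: a_def)
  qed
  have e1: "edge_const \<beta> (-1) = edge_const \<beta> 1" by (simp add: edge_const_def)
  have "expectation (\<lambda>c. log_cap A B c - log_cap A B mean_J) \<le> ln a"
    by (rule gen[OF _ unit_flow_moment(1)[of "-1"]])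
      (use int unit_flow_moment(2)[of "-1"] cap_ratio(1) in \<open>auto simp: a_def e1\<close>)
  moreover have "expectation (\<lambda>c. - (log_cap A B c - log_cap A B mean_J)) \<le> ln a"
    by (rule gen[OF _ unit_flow_moment(1)[of 1]])
      (use int unit_flow_moment(2)[of 1] cap_ratio(2) in \<open>auto simp: a_def\<close>)
  ultimately show ?thesis using int by (simp add: prob_space a_def abs_le_iff)
qed

end

definition near_annealed :: "real \<Rightarrow> (nat \<times> nat \<Rightarrow> real) set" where
  "near_annealed x = {c \<in> space D. \<forall>\<sigma>\<in>spins N. \<bar>Hq c \<sigma> - Hq mean_J \<sigma>\<bar> \<le> x * sqrt (real N)}"

lemma near_annealed_sets: "near_annealed x \<in> sets D"
  unfolding near_annealed_def
proof (rule sets.sets_Collect_finite_All[OF _ finite_spins])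
  fix \<sigma>
  have [measurable]: "(\<lambda>c. Hq c \<sigma>) \<in> borel_measurable D" by (rule hamiltonian_measurable_D)
  show "{c \<in> space D. \<bar>Hq c \<sigma> - Hq mean_J \<sigma>\<bar> \<le> x * sqrt (real N)} \<in> sets D" by measurable
qed

text \<open>
  A union bound over the \<open>2 ^ N\<close> configurations; each energy is Lipschitz with constant one. For large
  \<open>x\<close> the exponent beats the number of configurations.
\<close>

lemma prob_not_near_annealed:
  assumes x: "0 < x"
  shows "prob (space D - near_annealed x) \<le> 2 ^ N * (2 * exp (- (x\<^sup>2 * real N / k\<^sup>2)))"
proof -
  define up where "up \<sigma> = {c \<in> space D. Hq c \<sigma> \<ge> Hq mean_J \<sigma> + x * sqrt (real N)}" for \<sigma>
  define lo where "lo \<sigma> = {c \<in> space D. Hq c \<sigma> \<le> Hq mean_J \<sigma> - x * sqrt (real N)}" for \<sigma>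
  have [measurable]: "(\<lambda>c. Hq c \<sigma>) \<in> borel_measurable D" for \<sigma> by (rule hamiltonian_measurable_D)
  have m: "up \<sigma> \<in> sets D" "lo \<sigma> \<in> sets D" for \<sigma> unfolding up_def lo_def by measurable
  have u0: "0 < x * sqrt (real N)" using x N by simp
  have e: "(x * sqrt (real N) / (1 * k))\<^sup>2 = x\<^sup>2 * real N / k\<^sup>2"
    by (simp add: power_divide power_mult_distrib)
  have "prob (up \<sigma>) \<le> exp (- (x\<^sup>2 * real N / k\<^sup>2))" if "\<sigma> \<in> spins N" for \<sigma>
    using functional_concentration[OF N zero_less_one u0, of "\<lambda>H. H \<sigma>" h] that hamiltonian_measurable_upto
    unfolding e up_def by (auto simp: expectation_ham)
  moreover have "prob (lo \<sigma>) \<le> exp (- (x\<^sup>2 * real N / k\<^sup>2))" if "\<sigma> \<in> spins N" for \<sigma>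
    using functional_concentration_lower[OF N zero_less_one u0, of "\<lambda>H. H \<sigma>" h] that hamiltonian_measurable_upto
    unfolding e lo_def by (auto simp: expectation_ham)
  ultimately have one: "prob (up \<sigma> \<union> lo \<sigma>) \<le> 2 * exp (- (x\<^sup>2 * real N / k\<^sup>2))" if "\<sigma> \<in> spins N" for \<sigma>
    using measure_Un_le[OF m(1)[of \<sigma>] m(2)[of \<sigma>]] that by fastforce
  have "space D - near_annealed x \<subseteq> (\<Union>\<sigma>\<in>spins N. up \<sigma> \<union> lo \<sigma>)"
    unfolding near_annealed_def up_def lo_def by (auto simp: abs_le_iff not_le)
  then have "prob (space D - near_annealed x) \<le> prob (\<Union>\<sigma>\<in>spins N. up \<sigma> \<union> lo \<sigma>)"
    using m finite_spins by (intro finite_measure_mono sets.finite_UN) auto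
  also have "\<dots> \<le> (\<Sum>\<sigma>\<in>spins N. prob (up \<sigma> \<union> lo \<sigma>))"
    using m finite_spins by (intro measure_UNION_le) auto
  also have "\<dots> \<le> (\<Sum>\<sigma>\<in>spins N. 2 * exp (- (x\<^sup>2 * real N / k\<^sup>2)))" using one by (rule sum_mono)
  also have "\<dots> = 2 ^ N * (2 * exp (- (x\<^sup>2 * real N / k\<^sup>2)))" by (simp add: card_spins)
  finally show ?thesis .
qed

lemma log_mass_tails:
  assumes X: "X \<subseteq> spins N" "X \<noteq> {}" and u: "0 < u"
  shows "prob {c \<in> space D. log_mass X c \<ge> expectation (log_mass X) + u} \<le> exp (- (u / (\<beta> * k))\<^sup>2)"
    and "prob {c \<in> space D. log_mass X c \<le> expectation (log_mass X) - u} \<le> exp (- (u / (\<beta> * k))\<^sup>2)"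
  using functional_concentration[OF N \<beta> u, of "\<lambda>H. ln (\<Sum>\<sigma>\<in>X. boltzmann \<beta> H \<sigma>)" h]
    functional_concentration_lower[OF N \<beta> u, of "\<lambda>H. ln (\<Sum>\<sigma>\<in>X. boltzmann \<beta> H \<sigma>)" h]
    log_mass_measurable_upto[OF X(1)] ln_boltzmann_sum_lipschitz[OF X \<beta>]
  unfolding log_mass_def[abs_def] by auto

lemma log_cap_tails:
  assumes AB: "A \<subseteq> spins N" "B \<subseteq> spins N" "A \<noteq> {}" "B \<noteq> {}" "A \<inter> B = {}" and u: "0 < u"
  shows "prob {c \<in> space D. log_cap A B c \<ge> expectation (log_cap A B) + u} \<le> exp (- (u / (\<beta> * k))\<^sup>2)"
    and "prob {c \<in> space D. log_cap A B c \<le> expectation (log_cap A B) - u} \<le> exp (- (u / (\<beta> * k))\<^sup>2)"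
  using functional_concentration[OF N \<beta> u, of "\<lambda>H. ln (metro_cap N \<beta> H A B)" h]
    functional_concentration_lower[OF N \<beta> u, of "\<lambda>H. ln (metro_cap N \<beta> H A B)" h]
    log_cap_measurable_upto[OF AB(1), of B] ln_metro_cap_lipschitz[OF N1 \<beta> AB]
  unfolding log_cap_def[abs_def] by auto

end

section \<open>The crossover time for a fixed law of the couplings\<close>

lemma exp_minus_le_inverse_sqrt:
  assumes "1 \<le> N"
  shows "exp (- real N) \<le> 1 / sqrt (real N)"
proof -
  have s1: "1 \<le> sqrt (real N)" using assms by simp
  then have "sqrt (real N) * 1 \<le> sqrt (real N) * sqrt (real N)" by (intro mult_left_mono) auto
  then have "sqrt (real N) \<le> real N" by simp
  also have "\<dots> \<le> exp (real N)" using exp_ge_add_one_self[of "real N"] by linarith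
  finally show ?thesis using s1 by (simp add: exp_minus field_simps)
qed

text \<open>
  The hypotheses on the annealed model for one value of \<open>N\<close>. The errors that have to vanish are kept
  as parameters \<open>\<rho>\<close> (metastability) and \<open>\<eta>\<close> (non-degeneracy).
\<close>

locale metastable_model = disordered_model D k N \<beta> h for D k N \<beta> h +
  fixes K i :: nat and \<rho> \<eta> :: real and M V :: "nat \<Rightarrow> (nat \<Rightarrow> real) set"
  assumes ms: "metastable N \<beta> (hamiltonian N h mean_J) \<rho> K M" and \<rho>: "0 \<le> \<rho>" and \<eta>: "0 \<le> \<eta>"
    and i: "i \<in> {2..K}"
    and V: "disjoint_family_on V {1..K}" "(\<Union>l\<in>{1..K}. V l) = spins N"
    and MV: "\<And>l. l \<in> {1..K} \<Longrightarrow> M l \<subseteq> V l \<and> V l \<subseteq> valley N \<beta> (hamiltonian N h mean_J) K M l"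
    and nondeg: "\<And>j. j \<in> {i+1..K} \<Longrightarrow>
      gibbs_mass N \<beta> (hamiltonian N h mean_J) (V j) \<le> \<eta> * gibbs_mass N \<beta> (hamiltonian N h mean_J) (V i)"
begin

abbreviation "AA \<equiv> M i"
abbreviation "BB \<equiv> \<Union>j\<in>{1..<i}. M j"
abbreviation "VV \<equiv> V i"
abbreviation "T c \<equiv> mean_crossover N \<beta> (Hq c) AA BB"
abbreviation "LW \<equiv> log_mass VV"
abbreviation "LC \<equiv> log_cap AA BB"
abbreviation "RR \<equiv> (k + \<bar>h\<bar>) * real N"
abbreviation "rN \<equiv> sqrt (real N)"

lemma AB: "AA \<subseteq> spins N" "BB \<subseteq> spins N" "AA \<noteq> {}" "BB \<noteq> {}" "AA \<inter> BB = {}"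
proof -
  have M: "\<And>l. l \<in> {1..K} \<Longrightarrow> M l \<noteq> {} \<and> M l \<subseteq> spins N" and disj: "disjoint_family_on M {1..K}"
    using ms unfolding metastable_def by auto
  show "AA \<subseteq> spins N" "AA \<noteq> {}" using M[of i] i by auto
  show "BB \<subseteq> spins N"
  proof
    fix x assume "x \<in> BB"
    then obtain j where "j \<in> {1..<i}" "x \<in> M j" by auto
    then show "x \<in> spins N" using M[of j] i by auto
  qed
  have "M 1 \<noteq> {}" "M 1 \<subseteq> BB" using M[of 1] i by auto
  then show "BB \<noteq> {}" by auto
  have "AA \<inter> M j = {}" if "j \<in> {1..<i}" for j
    using disjoint_family_onD[OF disj, of i j] that i by auto
  then show "AA \<inter> BB = {}" by blast
qed

lemma VV: "VV \<subseteq> spins N" "VV \<noteq> {}" "AA \<subseteq> VV"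
  using V(2) MV[of i] AB i by auto

definition correction where "correction c = ln (metro_mass N \<beta> (Hq c) AA BB) - LW c"

lemma mass_VV_pos: "0 < (\<Sum>\<sigma>\<in>VV. boltzmann \<beta> H \<sigma>)"
  using mass_pos[OF VV(1,2)] .

lemma metro_mass_AB_pos: "0 < metro_mass N \<beta> H AA BB"
  using metro_mass_pos(1)[OF N1 \<beta> AB(1,2,3,5), of H] mass_pos[OF AB(1,3), of H] by linarith

lemma T_pos: "0 < T c"
  unfolding mean_crossover_eq[OF N1 \<beta> AB] using metro_mass_AB_pos metro_cap_pos[OF N1 \<beta> AB]
  by (intro divide_pos_pos)

lemma ln_T: "ln (T c) = LW c - LC c + correction c"
proof -
  have "0 < metro_mass N \<beta> (Hq c) AA BB" "0 < metro_cap N \<beta> (Hq c) AA BB"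
    using metro_mass_AB_pos metro_cap_pos[OF N1 \<beta> AB] by blast+
  then show ?thesis
    unfolding mean_crossover_eq[OF N1 \<beta> AB] correction_def log_cap_def by (simp add: ln_div)
qed

lemma T_measurable: "T \<in> borel_measurable D"
  by (rule measurable_mean_crossover[OF hamiltonian_measurable_D N1 \<beta> AB])

lemma correction_measurable: "correction \<in> borel_measurable D"
proof -
  have [measurable]: "(\<lambda>c. metro_mass N \<beta> (Hq c) AA BB) \<in> borel_measurable D" "LW \<in> borel_measurable D"
    using measurable_metro_mass[OF hamiltonian_measurable_D AB(1)] log_mass_measurable[OF VV(1)] by auto
  show ?thesis unfolding correction_def[abs_def] by measurable
qed

text \<open>
  The relative error in \<open>metro_mass_metastable\<close> for deviations up to \<open>x * sqrt N\<close> and \<open>n\<close> dyadic scales.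
\<close>

definition valley_error :: "nat \<Rightarrow> real \<Rightarrow> real" where
  "valley_error n x = real K * ((1/2) ^ n * (2 ^ N * exp (2 * \<beta> * RR)) + 2 * real n * real K * exp (4 * (\<beta> * (x * rN))) * \<rho>
         + exp (2 * (\<beta> * (x * rN))) * \<eta>)"

text \<open>
  The correction is the logarithm of the numerator of the crossover time relative to the weight of the
  valley; it is small whenever the energies are near the annealed ones.
\<close>

lemma correction_small:
  assumes dev: "\<And>\<sigma>. \<sigma> \<in> spins N \<Longrightarrow> \<bar>Hq c \<sigma> - Hq mean_J \<sigma>\<bar> \<le> x * rN"
    and R: "\<And>\<sigma>. \<sigma> \<in> spins N \<Longrightarrow> \<bar>Hq c \<sigma>\<bar> \<le> RR" and valley_error: "valley_error n x \<le> e" "e \<le> 1/2"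
  shows "\<bar>correction c\<bar> \<le> 2 * e"
proof -
  define m where "m = metro_mass N \<beta> (Hq c) AA BB"
  define v where "v = (\<Sum>\<sigma>\<in>VV. boltzmann \<beta> (Hq c) \<sigma>)"
  have pos: "0 < m" "0 < v" unfolding m_def v_def using metro_mass_AB_pos mass_VV_pos by auto
  have "\<bar>m - v\<bar> \<le> valley_error n x * v"
    unfolding m_def v_def valley_error_def
    by (rule metro_mass_metastable[OF N1 \<beta> ms \<rho> i V MV nondeg \<eta> dev R])
  also have "\<dots> \<le> e * v" using valley_error pos by (intro mult_right_mono) auto
  finally have mv: "\<bar>m - v\<bar> \<le> e * v" .
  then have e0: "0 \<le> e" using pos by (smt (verit) zero_le_mult_iff)
  have r: "1 - e \<le> m / v" "m / v \<le> 1 + e"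
  proof -
    have "v - e * v \<le> m" "m \<le> v + e * v" using mv by (auto simp: abs_le_iff)
    then show "1 - e \<le> m / v" "m / v \<le> 1 + e"
      using pos by (simp_all add: pos_le_divide_eq pos_divide_le_eq left_diff_distrib distrib_right)
  qed
  have c: "correction c = ln (m / v)" unfolding correction_def log_mass_def m_def[symmetric] v_def[symmetric] using pos by (simp add: ln_div)
  have "ln (m / v) \<le> m / v - 1" using pos by (intro ln_le_minus_one) auto
  then have up: "ln (m / v) \<le> e" using r by simp
  have "- e - 2 * e\<^sup>2 \<le> ln (1 - e)" using e0 valley_error by (intro ln_one_minus_pos_lower_bound) auto
  moreover have "2 * e\<^sup>2 \<le> e" using mult_left_mono[of e "1/2" "2 * e"] valley_error e0 by (simp add: power2_eq_square)
  moreover have "ln (1 - e) \<le> ln (m / v)" using r valley_error pos by (subst ln_le_cancel_iff) auto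
  ultimately show ?thesis using up e0 unfolding c by (simp add: abs_le_iff)
qed

text \<open>
  This bound holds for all couplings within their range. It is used on the exceptional event, whose
  probability can be made to decay at any exponential rate.
\<close>

lemma correction_crude:
  assumes R: "\<And>\<sigma>. \<sigma> \<in> spins N \<Longrightarrow> \<bar>Hq c \<sigma>\<bar> \<le> RR"
  shows "\<bar>correction c\<bar> \<le> (ln 2 + 2 * \<beta> * (k + \<bar>h\<bar>)) * real N"
proof -
  let ?w = "boltzmann \<beta> (Hq c)"
  have lohi: "exp (- (\<beta> * RR)) \<le> ?w \<sigma>" "?w \<sigma> \<le> exp (\<beta> * RR)" if "\<sigma> \<in> spins N" for \<sigma>
  proof -
    have "\<bar>\<beta> * Hq c \<sigma>\<bar> \<le> \<beta> * RR" unfolding abs_mult using R[OF that] \<beta> by simp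
    then show "exp (- (\<beta> * RR)) \<le> ?w \<sigma>" "?w \<sigma> \<le> exp (\<beta> * RR)" by (simp_all add: abs_le_iff)
  qed
  have tot: "(\<Sum>\<sigma>\<in>spins N. ?w \<sigma>) \<le> 2 ^ N * exp (\<beta> * RR)"
  proof -
    have "(\<Sum>\<sigma>\<in>spins N. ?w \<sigma>) \<le> (\<Sum>\<sigma>\<in>spins N. exp (\<beta> * RR))" using lohi by (intro sum_mono) auto
    then show ?thesis by (simp add: card_spins)
  qed
  have lnX: "- (\<beta> * RR) \<le> ln Y \<and> ln Y \<le> real N * ln 2 + \<beta> * RR"
    if Y: "(\<Sum>\<sigma>\<in>X. ?w \<sigma>) \<le> Y" "Y \<le> (\<Sum>\<sigma>\<in>spins N. ?w \<sigma>)" and X: "X \<subseteq> spins N" "X \<noteq> {}" for X Y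
  proof -
    obtain v where v: "v \<in> X" using X by auto
    have "exp (- (\<beta> * RR)) \<le> ?w v" using v X by (intro lohi) auto
    also have "\<dots> \<le> (\<Sum>\<sigma>\<in>X. ?w \<sigma>)" using v finX[OF X] by (intro member_le_sum) auto
    finally have 1: "exp (- (\<beta> * RR)) \<le> Y" using Y by simp
    then have Y0: "0 < Y" by (rule less_le_trans[OF exp_gt_zero])
    have "ln (exp (- (\<beta> * RR))) \<le> ln Y" using 1 Y0 by (subst ln_le_cancel_iff) auto
    moreover have "ln Y \<le> ln (2 ^ N * exp (\<beta> * RR))" using Y tot Y0 by (subst ln_le_cancel_iff) auto
    moreover have "ln (2 ^ N * exp (\<beta> * RR)) = real N * ln 2 + \<beta> * RR" by (simp add: ln_mult ln_realpow)
    ultimately show ?thesis by simp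
  qed
  have 1: "- (\<beta> * RR) \<le> LW c \<and> LW c \<le> real N * ln 2 + \<beta> * RR"
    unfolding log_mass_def
    by (rule lnX[OF order_refl _ VV(1,2)]) (intro sum_mono2[OF finite_spins VV(1)], simp)
  have 2: "- (\<beta> * RR) \<le> ln (metro_mass N \<beta> (Hq c) AA BB) \<and> ln (metro_mass N \<beta> (Hq c) AA BB) \<le> real N * ln 2 + \<beta> * RR"
    using metro_mass_pos[OF N1 \<beta> AB(1,2,3,5), of "Hq c"] AB by (intro lnX[of AA]) auto
  have "\<bar>correction c\<bar> \<le> real N * ln 2 + 2 * (\<beta> * RR)" unfolding correction_def using 1 2 by (simp add: abs_le_iff)
  then show ?thesis by (simp add: algebra_simps)
qed

definition correction_rate :: real where "correction_rate = ln 2 + 2 * \<beta> * (k + \<bar>h\<bar>)"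
definition log_error_const :: real where "log_error_const = vertex_const \<beta> + edge_const \<beta> 1 + 2"
definition log_ratio_rate :: real where "log_ratio_rate = 2 * \<beta> * k + 2 * correction_rate"

lemma correction_rate_pos: "0 < correction_rate"
  unfolding correction_rate_def using \<beta> k_pos by (intro add_pos_nonneg) auto

lemma log_ratio_rate_pos: "0 < log_ratio_rate" unfolding log_ratio_rate_def using correction_rate_pos \<beta> k_pos by (intro add_pos_pos) auto

lemma rN1: "1 \<le> rN" using N by simp

lemma inv_N_le: "y / real N \<le> y / rN" if "0 \<le> y"
proof -
  have "rN * 1 \<le> rN * rN" using rN1 by (intro mult_left_mono) auto
  then show ?thesis using rN1 that by (intro divide_left_mono) auto
qed

lemma expectation_LW: "LW mean_J \<le> expectation LW" "expectation LW \<le> LW mean_J + \<alpha> + vertex_const \<beta> / rN"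
  using expectation_log_mass[OF VV(1,2)] inv_N_le[OF vertex_const_nonneg, of \<beta>] \<beta> by auto

lemma expectation_LC: "\<bar>expectation LC - LC mean_J\<bar> \<le> \<alpha> + edge_const \<beta> 1 / rN"
  by (rule expectation_log_cap[OF AB])

lemma log_error_const_nonneg: "0 \<le> log_error_const" unfolding log_error_const_def using vertex_const_nonneg[of \<beta>] edge_const_nonneg[of \<beta> 1] \<beta> by simp

lemma alpha_nonneg: "0 \<le> \<alpha>" by (rule alpha_bounds(1)[OF N1])

context
  fixes n :: nat and x :: real
  assumes x: "0 < x" and valley_error: "valley_error n x \<le> 1 / (2 * rN)"
begin

lemma correction_b: "\<bar>correction mean_J\<bar> \<le> 1 / rN"
proof -
  have "\<bar>correction mean_J\<bar> \<le> 2 * (1 / (2 * rN))"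
    by (rule correction_small[OF _ _ valley_error]) (use x rN1 ham_b_bound in auto)
  then show ?thesis by simp
qed

lemma AE_correction: "AE c in D. \<bar>correction c\<bar> \<le> correction_rate * real N \<and> (c \<in> near_annealed x \<longrightarrow> \<bar>correction c\<bar> \<le> 1 / rN)"
  using AE_ham_bound
proof eventually_elim
  case (elim c)
  have "\<bar>correction c\<bar> \<le> 2 * (1 / (2 * rN))" if "c \<in> near_annealed x"
    by (rule correction_small[OF _ _ valley_error]) (use elim that rN1 in \<open>auto simp: near_annealed_def\<close>)
  then show ?case using correction_crude[of c] elim by (auto simp: correction_rate_def)
qed

text \<open>
  Off the four tail events and the exceptional event, the logarithm of the ratio differs from the
  difference of the mean logarithms by less than \<open>2 * u = t - log_error_const / sqrt N\<close>, and the last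
  term absorbs the errors of the means and the two corrections.
\<close>

theorem crossover_ratio_concentration:
  assumes u: "0 < (t - log_error_const / rN) / 2"
  shows "1 - 4 * exp (- ((t - log_error_const / rN) / 2 / (\<beta> * k))\<^sup>2) - 2 ^ N * (2 * exp (- (x\<^sup>2 * real N / k\<^sup>2)))
    \<le> prob {c \<in> space D. exp (- t - \<alpha>) \<le> T c / T mean_J \<and> T c / T mean_J \<le> exp (t + 2 * \<alpha>)}"
proof -
  define u where "u = (t - log_error_const / rN) / 2"
  have u0: "0 < u" using assms by (simp add: u_def)
  define tail where "tail = exp (- (u / (\<beta> * k))\<^sup>2)"
  let ?S = "{c \<in> space D. exp (- t - \<alpha>) \<le> T c / T mean_J \<and> T c / T mean_J \<le> exp (t + 2 * \<alpha>)}"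
  define W1 where "W1 = {c \<in> space D. LW c \<ge> expectation LW + u}"
  define W2 where "W2 = {c \<in> space D. LW c \<le> expectation LW - u}"
  define L1 where "L1 = {c \<in> space D. LC c \<ge> expectation LC + u}"
  define L2 where "L2 = {c \<in> space D. LC c \<le> expectation LC - u}"
  have [measurable]: "LW \<in> borel_measurable D" "LC \<in> borel_measurable D" "T \<in> borel_measurable D" "near_annealed x \<in> sets D"
    using log_mass_measurable[OF VV(1)] log_cap_measurable[OF AB(1)] T_measurable near_annealed_sets by auto
  have sets: "W1 \<in> sets D" "W2 \<in> sets D" "L1 \<in> sets D" "L2 \<in> sets D" "space D - near_annealed x \<in> sets D"
    unfolding W1_def W2_def L1_def L2_def by measurable
  have S: "?S \<in> sets D" by measurable
  define bad where "bad = W1 \<union> W2 \<union> L1 \<union> L2 \<union> (space D - near_annealed x)"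
  have AEbad: "AE c in D. c \<in> space D - ?S \<longrightarrow> c \<in> bad"
    using AE_correction
  proof eventually_elim
    case (elim c)
    show ?case
    proof (rule impI, rule ccontr)
      assume c: "c \<in> space D - ?S" and nb: "c \<notin> bad"
      then have g: "c \<in> near_annealed x" and cs: "c \<in> space D" by (auto simp: bad_def)
      have cc: "\<bar>correction c\<bar> \<le> 1 / rN" using elim g by simp
      have dW: "\<bar>LW c - expectation LW\<bar> < u" and dL: "\<bar>LC c - expectation LC\<bar> < u"
        using nb cs by (auto simp: bad_def W1_def W2_def L1_def L2_def abs_if)
      define log_ratio where "log_ratio = ln (T c) - ln (T mean_J)"
      have ratio: "T c / T mean_J = exp log_ratio" using T_pos by (simp add: log_ratio_def exp_diff)
      have log_ratio: "log_ratio = (LW c - LW mean_J) - (LC c - LC mean_J) + (correction c - correction mean_J)" unfolding log_ratio_def ln_T by simp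
      have C1s: "log_error_const / rN = vertex_const \<beta> / rN + edge_const \<beta> 1 / rN + 2 / rN"
        by (simp add: log_error_const_def add_divide_distrib)
      have v0: "0 \<le> vertex_const \<beta> / rN" using vertex_const_nonneg[of \<beta>] \<beta> by simp
      have e0: "0 \<le> edge_const \<beta> 1 / rN" using edge_const_nonneg[of \<beta> 1] by simp
      have 2: "2 / rN = 1 / rN + 1 / rN" by simp
      have tu: "t = 2 * u + log_error_const / rN"
      proof -
        define z where "z = log_error_const / rN"
        have "u = (t - z) / 2" by (simp add: u_def z_def)
        then have "t = 2 * u + z" by (simp add: field_simps)
        then show ?thesis by (simp add: z_def)
      qed
      have "log_ratio \<le> t + 2 * \<alpha>"
        unfolding log_ratio tu C1s 2 using dW dL cc correction_b expectation_LW(2) expectation_LC by linarith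
      moreover have "- t - \<alpha> \<le> log_ratio"
        unfolding log_ratio tu C1s 2 using dW dL cc correction_b expectation_LW(1) expectation_LC v0 by linarith
      ultimately have "exp (- t - \<alpha>) \<le> T c / T mean_J" "T c / T mean_J \<le> exp (t + 2 * \<alpha>)"
        unfolding ratio by auto
      then show False using c cs by blast
    qed
  qed
  have "prob (space D - ?S) \<le> prob bad"
    by (rule finite_measure_mono_AE) (use AEbad sets in \<open>auto simp: bad_def\<close>)
  also have "\<dots> \<le> prob W1 + prob W2 + prob L1 + prob L2 + prob (space D - near_annealed x)"
  proof -
    have "prob bad \<le> prob (W1 \<union> W2 \<union> L1 \<union> L2) + prob (space D - near_annealed x)"
      unfolding bad_def using sets by (intro measure_Un_le) auto
    moreover have "prob (W1 \<union> W2 \<union> L1 \<union> L2) \<le> prob (W1 \<union> W2 \<union> L1) + prob L2"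
      using sets by (intro measure_Un_le) auto
    moreover have "prob (W1 \<union> W2 \<union> L1) \<le> prob (W1 \<union> W2) + prob L1"
      using sets by (intro measure_Un_le) auto
    moreover have "prob (W1 \<union> W2) \<le> prob W1 + prob W2"
      using sets by (intro measure_Un_le) auto
    ultimately show ?thesis by linarith
  qed
  also have "\<dots> \<le> tail + tail + tail + tail + 2 ^ N * (2 * exp (- (x\<^sup>2 * real N / k\<^sup>2)))"
    unfolding W1_def W2_def L1_def L2_def tail_def
    by (intro add_mono log_mass_tails[OF VV(1,2) u0] log_cap_tails[OF AB u0] prob_not_near_annealed x)
  finally have "prob (space D - ?S) \<le> 4 * tail + 2 ^ N * (2 * exp (- (x\<^sup>2 * real N / k\<^sup>2)))" by simp
  then show ?thesis using prob_compl[OF S] by (simp add: tail_def u_def)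
qed

end

text \<open>
  Large enough for the probability of the exceptional event to beat the number of configurations, the
  crude bounds \<open>correction_rate\<close> and \<open>q * log_ratio_rate\<close>, and one more factor \<open>exp (- N)\<close>.
\<close>

definition deviation_radius :: "real \<Rightarrow> real" where
  "deviation_radius q = k * sqrt (2 * ln 2 + q * log_ratio_rate + correction_rate + 1)"

lemma deviation_radius_pos: "0 \<le> q \<Longrightarrow> 0 < deviation_radius q"
  unfolding deviation_radius_def using k_pos correction_rate_pos log_ratio_rate_pos by (intro mult_pos_pos real_sqrt_gt_zero) (auto intro!: add_nonneg_pos)

lemma prob_not_near_annealed_radius:
  assumes q: "0 \<le> q"
  shows "prob (space D - near_annealed (deviation_radius q)) \<le> exp (- ((q * log_ratio_rate + correction_rate + 1) * real N))"
proof -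
  have a0: "0 \<le> 2 * ln 2 + q * log_ratio_rate + correction_rate + 1" using q correction_rate_pos log_ratio_rate_pos by (intro add_nonneg_nonneg) auto
  have r2: "(deviation_radius q)\<^sup>2 / k\<^sup>2 = 2 * ln 2 + q * log_ratio_rate + correction_rate + 1"
    using k_pos a0 by (simp add: deviation_radius_def power_mult_distrib)
  have two: "(2::real) \<le> 2 ^ N" using power_increasing[OF N1, of "2::real"] by simp
  have "prob (space D - near_annealed (deviation_radius q)) \<le> 2 ^ N * (2 * exp (- ((deviation_radius q)\<^sup>2 * real N / k\<^sup>2)))"
    by (rule prob_not_near_annealed[OF deviation_radius_pos[OF q]])
  also have "\<dots> \<le> 2 ^ N * (2 ^ N * exp (- ((deviation_radius q)\<^sup>2 * real N / k\<^sup>2)))"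
    using two by (intro mult_left_mono mult_right_mono) auto
  finally have "prob (space D - near_annealed (deviation_radius q)) \<le> 2 ^ N * (2 ^ N * exp (- ((deviation_radius q)\<^sup>2 * real N / k\<^sup>2)))" .
  also have "(deviation_radius q)\<^sup>2 * real N / k\<^sup>2 = (2 * ln 2 + q * log_ratio_rate + correction_rate + 1) * real N"
    unfolding r2[symmetric] by simp
  also have "(2::real) ^ N = exp (real N * ln 2)" by (simp add: exp_of_nat_mult)
  also have "exp (real N * ln 2) * (exp (real N * ln 2) * exp (- ((2 * ln 2 + q * log_ratio_rate + correction_rate + 1) * real N))) =
     exp (- ((q * log_ratio_rate + correction_rate + 1) * real N))"
    unfolding exp_add[symmetric] by (simp add: algebra_simps)
  finally show ?thesis .
qed

definition moment_error_const :: "real \<Rightarrow> real" where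
  "moment_error_const q = 2 * q + (vertex_const (2 * q * \<beta>) + edge_const \<beta> (2 * q)) / 2 + 1"

definition crossover_const :: "real \<Rightarrow> real" where
  "crossover_const q = log_error_const + 1 + moment_error_const q * exp (moment_error_const q)"

context
  fixes n :: nat and q :: real
  assumes q: "1 \<le> q" and valley_error: "valley_error n (deviation_radius q) \<le> 1 / (2 * rN)"
begin

lemma deviation_radius_q_pos: "0 < deviation_radius q" using deviation_radius_pos q by simp

definition log_ratio where "log_ratio c = ln (T c) - ln (T mean_J)"

lemma log_ratio: "log_ratio c = (LW c - LW mean_J) - (LC c - LC mean_J) + (correction c - correction mean_J)"
  unfolding log_ratio_def ln_T by simp

lemma log_ratio_measurable: "log_ratio \<in> borel_measurable D"
  unfolding log_ratio_def[abs_def] using T_measurable by measurable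

lemma correction_b_crude: "\<bar>correction mean_J\<bar> \<le> correction_rate * real N"
  using correction_crude[of mean_J] ham_b_bound by (simp add: correction_rate_def)

lemma AE_log_ratio: "AE c in D. \<bar>log_ratio c\<bar> \<le> log_ratio_rate * real N"
  using AE_correction[OF deviation_radius_q_pos valley_error] AE_log_mass_dev[OF VV(1,2)] AE_log_cap_dev[OF AB]
proof eventually_elim
  case (elim c)
  have "log_ratio_rate * real N = \<beta> * (k * real N) + \<beta> * (k * real N) + correction_rate * real N + correction_rate * real N"
    by (simp add: log_ratio_rate_def algebra_simps)
  then show ?case unfolding log_ratio using elim correction_b_crude by linarith
qed

lemma log_ratio_integrable: "integrable D log_ratio"
  by (rule integrable_bounded[OF log_ratio_measurable AE_log_ratio])

lemma exp_log_ratio_integrable: "integrable D (\<lambda>c. exp (q * log_ratio c))"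
proof (rule integrable_bounded[where B="exp (q * (log_ratio_rate * real N))"])
  show "AE c in D. \<bar>exp (q * log_ratio c)\<bar> \<le> exp (q * (log_ratio_rate * real N))"
    using AE_log_ratio by eventually_elim (use q in \<open>auto simp: abs_le_iff intro!: mult_left_mono\<close>)
qed (use log_ratio_measurable in measurable)

lemma moment_ratio:
  "(\<integral>c. T c powr q \<partial>D) powr (1 / q) / T mean_J = (expectation (\<lambda>c. exp (q * log_ratio c))) powr (1 / q)"
proof -
  define tb where "tb = T mean_J"
  define e where "e = expectation (\<lambda>c. exp (q * log_ratio c))"
  have tb: "0 < tb" unfolding tb_def by (rule T_pos)
  have e: "0 \<le> e" unfolding e_def by (intro integral_nonneg_AE) auto
  have "T c powr q = tb powr q * exp (q * log_ratio c)" for c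
  proof -
    have "T c powr q = exp (q * ln (T c))" using T_pos[of c] by (simp add: powr_def)
    also have "\<dots> = exp (q * ln tb) * exp (q * log_ratio c)"
      unfolding exp_add[symmetric] log_ratio_def tb_def by (simp only: distrib_left[symmetric]) simp
    finally show ?thesis using tb by (simp add: powr_def)
  qed
  then have "(\<integral>c. T c powr q \<partial>D) = tb powr q * e" by (simp add: e_def)
  then have "(\<integral>c. T c powr q \<partial>D) powr (1 / q) = (tb powr q) powr (1 / q) * e powr (1 / q)"
    using e by (simp only: powr_mult powr_ge_zero)
  moreover have "(tb powr q) powr (1 / q) = tb" using tb q unfolding powr_powr by simp
  ultimately show ?thesis using tb unfolding e_def[symmetric] tb_def[symmetric] by simp
qed

lemma expectation_correction: "- (2 / rN) \<le> expectation correction"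
proof -
  have p: "prob (space D - near_annealed (deviation_radius q)) \<le> exp (- ((q * log_ratio_rate + correction_rate + 1) * real N))"
    using q by (intro prob_not_near_annealed_radius) auto
  let ?ind = "\<lambda>c. indicator (space D - near_annealed (deviation_radius q)) c :: real"
  have gs: "space D - near_annealed (deviation_radius q) \<in> sets D" using near_annealed_sets by auto
  have ii: "integrable D ?ind" using gs by (simp add: integrable_indicator_iff emeasure_eq_measure)
  have ci: "integrable D correction"
    using AE_correction[OF deviation_radius_q_pos valley_error] correction_measurable
    by (intro integrable_bounded[where B="correction_rate * real N"]) (auto elim!: eventually_mono)
  have "expectation (\<lambda>c. - (1 / rN) - correction_rate * real N * ?ind c) \<le> expectation correction"
  proof (rule integral_mono_AE)
    show "AE c in D. - (1 / rN) - correction_rate * real N * ?ind c \<le> correction c"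
      using AE_correction[OF deviation_radius_q_pos valley_error] AE_space
    proof eventually_elim
      case (elim c)
      have r0: "0 \<le> 1 / rN" by simp
      show ?case
      proof (cases "c \<in> near_annealed (deviation_radius q)")
        case True
        then show ?thesis using elim by (simp add: abs_le_iff)
      next
        case False
        then have "?ind c = 1" using elim by simp
        then show ?thesis using elim r0 by (simp only: mult_1_right) linarith
      qed
    qed
  qed (use ii ci in auto)
  moreover have "expectation (\<lambda>c. - (1 / rN) - correction_rate * real N * ?ind c) = - (1 / rN) - correction_rate * real N * prob (space D - near_annealed (deviation_radius q))"
    using ii gs by (simp add: prob_space)
  moreover have "correction_rate * real N * prob (space D - near_annealed (deviation_radius q)) \<le> 1 / rN"
  proof -
    have "correction_rate * real N * prob (space D - near_annealed (deviation_radius q)) \<le> correction_rate * real N * exp (- ((q * log_ratio_rate + correction_rate + 1) * real N))"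
      using p correction_rate_pos by (intro mult_left_mono) auto
    also have "\<dots> \<le> exp (correction_rate * real N) * exp (- ((q * log_ratio_rate + correction_rate + 1) * real N))"
    proof (rule mult_right_mono)
      show "correction_rate * real N \<le> exp (correction_rate * real N)" using exp_ge_add_one_self[of "correction_rate * real N"] by linarith
    qed simp
    also have "\<dots> = exp (- (q * log_ratio_rate * real N)) * exp (- real N)"
      unfolding exp_add[symmetric] by (simp add: algebra_simps)
    also have "\<dots> \<le> 1 * exp (- real N)" using q log_ratio_rate_pos by (intro mult_right_mono) auto
    also have "\<dots> \<le> 1 / rN" using exp_minus_le_inverse_sqrt[OF N1] by simp
    finally show ?thesis .
  qed
  ultimately show ?thesis by simp
qed

text \<open>
  Jensen's inequality: the \<open>L\<^sup>q\<close> norm is at least the exponential of the mean logarithm. The exceptional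
  event contributes to the latter at most its probability times the crude bound.
\<close>

lemma moment_lower: "exp (- \<alpha>) * (1 - (log_error_const + 1) / rN) \<le> (expectation (\<lambda>c. exp (q * log_ratio c))) powr (1 / q)"
proof -
  define a where "a = expectation log_ratio"
  have ci: "integrable D correction"
    using AE_correction[OF deviation_radius_q_pos valley_error] correction_measurable
    by (intro integrable_bounded[where B="correction_rate * real N"]) (auto elim!: eventually_mono)
  have "a = (expectation LW - LW mean_J) - (expectation LC - LC mean_J) + (expectation correction - correction mean_J)"
    unfolding a_def log_ratio[abs_def] using log_mass_integrable[OF VV(1,2)] log_cap_integrable[OF AB] ci
    by (simp add: prob_space)
  moreover have "(log_error_const + 1) / rN = vertex_const \<beta> / rN + edge_const \<beta> 1 / rN + 2 / rN + 1 / rN"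
    by (simp add: log_error_const_def add_divide_distrib)
  moreover have "0 \<le> vertex_const \<beta> / rN" using vertex_const_nonneg[of \<beta>] \<beta> by simp
  ultimately have a: "- \<alpha> - (log_error_const + 1) / rN \<le> a"
    using expectation_LW(1) expectation_LC expectation_correction correction_b[OF deviation_radius_q_pos valley_error] by linarith
  have "expectation (\<lambda>c. exp (q * a) * (1 + q * (log_ratio c - a))) \<le> expectation (\<lambda>c. exp (q * log_ratio c))"
  proof (rule integral_mono)
    show "exp (q * a) * (1 + q * (log_ratio c - a)) \<le> exp (q * log_ratio c)" for c
    proof -
      have "exp (q * a) * (1 + q * (log_ratio c - a)) \<le> exp (q * a) * exp (q * (log_ratio c - a))"
        by (intro mult_left_mono exp_ge_add_one_self) auto
      then show ?thesis by (simp add: exp_add[symmetric] algebra_simps)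
    qed
  qed (use log_ratio_integrable exp_log_ratio_integrable in auto)
  moreover have "expectation (\<lambda>c. exp (q * a) * (1 + q * (log_ratio c - a))) = exp (q * a)"
    using log_ratio_integrable by (simp add: prob_space a_def)
  ultimately have "exp (q * a) \<le> expectation (\<lambda>c. exp (q * log_ratio c))" by simp
  then have "exp (q * a) powr (1 / q) \<le> (expectation (\<lambda>c. exp (q * log_ratio c))) powr (1 / q)"
    using q by (intro powr_mono2) auto
  moreover have "exp (q * a) powr (1 / q) = exp a" using q by (simp add: powr_def)
  moreover have "exp (- \<alpha>) * (1 - (log_error_const + 1) / rN) \<le> exp (- \<alpha>) * exp (- ((log_error_const + 1) / rN))"
    using exp_ge_add_one_self[of "- ((log_error_const + 1) / rN)"] by (intro mult_left_mono) auto
  moreover have "exp (- \<alpha>) * exp (- ((log_error_const + 1) / rN)) \<le> exp a"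
    using a by (simp add: exp_add[symmetric])
  ultimately show ?thesis by linarith
qed

lemma moment_error_const_ge: "1 \<le> moment_error_const q"
  unfolding moment_error_const_def using q vertex_const_nonneg[of "2 * q * \<beta>"] edge_const_nonneg[of \<beta> "2 * q"] \<beta> by simp

text \<open>
  On the typical event the Cauchy-Schwarz inequality, in the form of \<open>exp_young\<close> with both exponents
  two and both moments normalised by \<open>a\<close> and \<open>a'\<close>, separates weight and capacity. On the exceptional
  event the crude bound is compensated by the small probability.
\<close>

lemma moment_upper: "(expectation (\<lambda>c. exp (q * log_ratio c))) powr (1 / q) \<le> exp (4 * q * \<alpha>) * (1 + moment_error_const q * exp (moment_error_const q) / rN)"
proof -
  define vc where "vc = vertex_const (2 * q * \<beta>)"
  define ec where "ec = edge_const \<beta> (2 * q)"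
  define a where "a = ((2 * q)\<^sup>2 * \<alpha> + vc / real N) / 2"
  define a' where "a' = ((2 * q)\<^sup>2 * \<alpha> + ec / rN) / 2"
  have q2: "1 \<le> 2 * q" using q by simp
  note mm = mass_moment[OF VV(1,2) q2]
  note cm = cap_moment[OF AB q2]
  have half: "2 * (z / 2) = z" for z :: real by simp
  have mW: "expectation (\<lambda>c. exp (2 * q * (LW c - LW mean_J))) \<le> exp (2 * a)"
    using mm(2) unfolding a_def half vc_def .
  have cC: "expectation (\<lambda>c. exp (- (2 * q) * (LC c - LC mean_J))) \<le> exp (2 * a')"
    using cm(2) unfolding a'_def half ec_def .
  let ?ind = "\<lambda>c. indicator (space D - near_annealed (deviation_radius q)) c :: real"
  have gs: "space D - near_annealed (deviation_radius q) \<in> sets D" using near_annealed_sets by auto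
  have ii: "integrable D ?ind" using gs by (simp add: integrable_indicator_iff emeasure_eq_measure)
  define f where "f c = exp (2 * q / rN + a + a') * (exp (2 * q * (LW c - LW mean_J)) * exp (- (2 * a)) / 2 +
      exp (- (2 * q) * (LC c - LC mean_J)) * exp (- (2 * a')) / 2) + exp (q * (log_ratio_rate * real N)) * ?ind c" for c
  have fi: "integrable D f" unfolding f_def[abs_def] using mm(1) cm(1) ii by auto
  have "expectation (\<lambda>c. exp (q * log_ratio c)) \<le> expectation f"
  proof (rule integral_mono_AE[OF exp_log_ratio_integrable fi])
    show "AE c in D. exp (q * log_ratio c) \<le> f c"
      using AE_correction[OF deviation_radius_q_pos valley_error] AE_log_ratio AE_space
    proof eventually_elim
      case (elim c)
      define Y where "Y = exp (2 * q / rN + a + a') * (exp (2 * q * (LW c - LW mean_J)) * exp (- (2 * a)) / 2 +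
         exp (- (2 * q) * (LC c - LC mean_J)) * exp (- (2 * a')) / 2)"
      have fY: "f c = Y + exp (q * (log_ratio_rate * real N)) * ?ind c" unfolding f_def Y_def ..
      have Y0: "0 \<le> Y" unfolding Y_def by (intro mult_nonneg_nonneg add_nonneg_nonneg) auto
      show ?case
      proof (cases "c \<in> near_annealed (deviation_radius q)")
        case True
        define U where "U = q * (LW c - LW mean_J)"
        define W where "W = - q * (LC c - LC mean_J)"
        have "correction c - correction mean_J \<le> 2 / rN" using elim True correction_b[OF deviation_radius_q_pos valley_error] by (simp add: abs_le_iff)
        then have "q * (correction c - correction mean_J) \<le> q * (2 / rN)" using q by (intro mult_left_mono) auto
        moreover have "q * log_ratio c = U + W + q * (correction c - correction mean_J)" unfolding log_ratio U_def W_def by (simp add: algebra_simps)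
        moreover have "q * (2 / rN) = 2 * q / rN" by simp
        ultimately have "q * log_ratio c \<le> (2 * q / rN + a + a') + ((U - a) + (W - a'))" by linarith
        then have "exp (q * log_ratio c) \<le> exp (2 * q / rN + a + a') * exp ((U - a) + (W - a'))"
          by (simp only: exp_add[symmetric] exp_le_cancel_iff)
        also have "\<dots> \<le> exp (2 * q / rN + a + a') * (exp (2 * (U - a)) / 2 + exp (2 * (W - a')) / 2)"
          by (intro mult_left_mono exp_young) auto
        also have "exp (2 * (U - a)) = exp (2 * q * (LW c - LW mean_J)) * exp (- (2 * a))"
          by (simp add: U_def exp_add[symmetric] algebra_simps)
        also have "exp (2 * (W - a')) = exp (- (2 * q) * (LC c - LC mean_J)) * exp (- (2 * a'))"
          by (simp add: W_def exp_add[symmetric] algebra_simps)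
        finally have "exp (q * log_ratio c) \<le> Y" by (simp add: Y_def)
        then show ?thesis using True by (simp add: fY)
      next
        case False
        have "exp (q * log_ratio c) \<le> exp (q * (log_ratio_rate * real N))"
          using elim q by (auto simp: abs_le_iff intro!: mult_left_mono)
        moreover have "?ind c = 1" using False elim by simp
        ultimately show ?thesis unfolding fY using Y0 by (simp only: mult_1_right)
      qed
    qed
  qed
  also have "expectation f = exp (2 * q / rN + a + a') * (expectation (\<lambda>c. exp (2 * q * (LW c - LW mean_J))) * exp (- (2 * a)) / 2 +
      expectation (\<lambda>c. exp (- (2 * q) * (LC c - LC mean_J))) * exp (- (2 * a')) / 2) + exp (q * (log_ratio_rate * real N)) * prob (space D - near_annealed (deviation_radius q))"
    unfolding f_def using mm(1) cm(1) ii gs by simp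
  also have "\<dots> \<le> exp (2 * q / rN + a + a') * (exp (2 * a) * exp (- (2 * a)) / 2 + exp (2 * a') * exp (- (2 * a')) / 2)
      + exp (q * (log_ratio_rate * real N)) * exp (- ((q * log_ratio_rate + correction_rate + 1) * real N))"
    using mW cC prob_not_near_annealed_radius[of q] q
    by (intro add_mono mult_left_mono divide_right_mono mult_right_mono) auto
  also have "\<dots> = exp (2 * q / rN + a + a') + exp (- (correction_rate * real N)) * exp (- real N)"
    unfolding exp_add[symmetric] by (simp add: algebra_simps)
  also have "\<dots> \<le> exp (2 * q / rN + a + a') + 1 * (1 / rN)"
    using correction_rate_pos exp_minus_le_inverse_sqrt[OF N1] by (intro add_left_mono mult_mono) auto
  also have "\<dots> \<le> exp (2 * q / rN + a + a') + exp (2 * q / rN + a + a') * (1 / rN)"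
  proof -
    have "0 \<le> 2 * q / rN + a + a'"
      using q alpha_nonneg vertex_const_nonneg[of "2 * q * \<beta>"] edge_const_nonneg[of \<beta> "2 * q"] \<beta>
      by (auto simp: a_def a'_def vc_def ec_def)
    then have "1 \<le> exp (2 * q / rN + a + a')" by simp
    then have "1 * (1 / rN) \<le> exp (2 * q / rN + a + a') * (1 / rN)" by (intro mult_right_mono) auto
    then show ?thesis by simp
  qed
  also have "\<dots> = exp (2 * q / rN + a + a') * (1 + 1 / rN)" by (simp add: distrib_left)
  also have "\<dots> \<le> exp (2 * q / rN + a + a') * exp (1 / rN)" by (intro mult_left_mono exp_ge_add_one_self) auto
  also have "\<dots> \<le> exp (4 * q\<^sup>2 * \<alpha> + moment_error_const q / rN)"
  proof -
    have v0: "0 \<le> vc" unfolding vc_def using q \<beta> by (intro vertex_const_nonneg) auto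
    have "moment_error_const q / rN = 2 * q / rN + vc / rN / 2 + ec / rN / 2 + 1 / rN"
      by (simp add: moment_error_const_def vc_def ec_def add_divide_distrib)
    moreover have "a + a' = 4 * q\<^sup>2 * \<alpha> + vc / real N / 2 + ec / rN / 2"
      by (simp add: a_def a'_def power_mult_distrib add_divide_distrib)
    moreover have "z1 + a + a' + z2 \<le> z3 + y"
      if "y = z1 + z4 / 2 + z5 / 2 + z2" "a + a' = z3 + z6 / 2 + z5 / 2" "z6 \<le> z4" for y z1 z2 z3 z4 z5 z6 :: real
      using that by linarith
    ultimately have "2 * q / rN + a + a' + 1 / rN \<le> 4 * q\<^sup>2 * \<alpha> + moment_error_const q / rN"
      using inv_N_le[OF v0] by blast
    then show ?thesis by (simp add: exp_add[symmetric])
  qed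
  finally have E: "expectation (\<lambda>c. exp (q * log_ratio c)) \<le> exp (4 * q\<^sup>2 * \<alpha> + moment_error_const q / rN)" .
  have "(expectation (\<lambda>c. exp (q * log_ratio c))) powr (1 / q) \<le> exp (4 * q\<^sup>2 * \<alpha> + moment_error_const q / rN) powr (1 / q)"
    using E q by (intro powr_mono2) (auto intro: integral_nonneg_AE)
  also have "\<dots> = exp (4 * q * \<alpha> + moment_error_const q / rN / q)"
    using q by (simp add: powr_def field_simps power2_eq_square)
  also have "\<dots> \<le> exp (4 * q * \<alpha>) * exp (moment_error_const q / rN)"
  proof -
    have "moment_error_const q / rN / q \<le> moment_error_const q / rN / 1" using q moment_error_const_ge by (intro divide_left_mono) auto
    then show ?thesis by (simp add: exp_add[symmetric])
  qed
  also have "\<dots> \<le> exp (4 * q * \<alpha>) * (1 + moment_error_const q * exp (moment_error_const q) / rN)"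
  proof (rule mult_left_mono)
    define y where "y = moment_error_const q / rN"
    have y: "0 \<le> y" "y \<le> moment_error_const q" using moment_error_const_ge rN1 by (auto simp: y_def divide_le_eq mult_le_cancel_left1)
    have "1 - y \<le> exp (- y)" using exp_ge_add_one_self[of "- y"] by simp
    then have "exp y * (1 - y) \<le> exp y * exp (- y)" by (intro mult_left_mono) auto
    then have "exp y \<le> 1 + y * exp y" by (simp add: exp_add[symmetric] algebra_simps)
    also have "y * exp y \<le> y * exp (moment_error_const q)" using y by (intro mult_left_mono) auto
    finally show "exp (moment_error_const q / rN) \<le> 1 + moment_error_const q * exp (moment_error_const q) / rN" by (simp add: y_def)
  qed simp
  finally show ?thesis .
qed

theorem crossover_moment_bounds:
  "exp (- \<alpha>) * (1 - crossover_const q / rN) \<le> (\<integral>c. T c powr q \<partial>D) powr (1 / q) / T mean_J"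
  "(\<integral>c. T c powr q \<partial>D) powr (1 / q) / T mean_J \<le> exp (4 * q * \<alpha>) * (1 + crossover_const q / rN)"
proof -
  have moment_error_const: "0 \<le> moment_error_const q * exp (moment_error_const q)" using moment_error_const_ge by simp
  have "exp (- \<alpha>) * (1 - crossover_const q / rN) \<le> exp (- \<alpha>) * (1 - (log_error_const + 1) / rN)"
    using moment_error_const by (intro mult_left_mono diff_left_mono divide_right_mono) (auto simp: crossover_const_def)
  then show "exp (- \<alpha>) * (1 - crossover_const q / rN) \<le> (\<integral>c. T c powr q \<partial>D) powr (1 / q) / T mean_J"
    unfolding moment_ratio using moment_lower by linarith
  have "exp (4 * q * \<alpha>) * (1 + moment_error_const q * exp (moment_error_const q) / rN) \<le> exp (4 * q * \<alpha>) * (1 + crossover_const q / rN)"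
    using log_error_const_nonneg by (intro mult_left_mono add_left_mono divide_right_mono) (auto simp: crossover_const_def)
  then show "(\<integral>c. T c powr q \<partial>D) powr (1 / q) / T mean_J \<le> exp (4 * q * \<alpha>) * (1 + crossover_const q / rN)"
    unfolding moment_ratio using moment_upper by linarith
qed

end

end

section \<open>Conditional laws of the couplings\<close>

text \<open>
  A countable generator, so that the almost sure identities for each generating event can be combined.
\<close>

lemma borel_eq_sigma_rat_atMost:
  "sets (borel :: real measure) = sigma_sets UNIV (insert UNIV (range (\<lambda>r. {..real_of_rat r})))"
proof -
  let ?E = "insert UNIV (range (\<lambda>r. {..real_of_rat r}))"
  let ?S = "sigma UNIV ?E"
  have sS: "sets ?S = sigma_sets UNIV ?E" by (rule sets_measure_of) auto
  have spS: "space ?S = UNIV" by (rule space_measure_of) auto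
  have atMost: "{..x} \<in> sets ?S" for x :: real
  proof -
    have eq: "{..x} = (\<Inter>r\<in>{r. x < real_of_rat r}. {..real_of_rat r})"
    proof (intro set_eqI iffI)
      fix y assume y: "y \<in> (\<Inter>r\<in>{r. x < real_of_rat r}. {..real_of_rat r})"
      show "y \<in> {..x}"
      proof (rule ccontr)
        assume "y \<notin> {..x}"
        then obtain r where "x < of_rat r" "of_rat r < y" using of_rat_dense[of x y] by auto
        then show False using y by force
      qed
    qed auto
    have "{..real_of_rat r} \<in> sets ?S" for r unfolding sS by (intro sigma_sets.Basic) auto
    then show ?thesis unfolding eq
      using spS by (intro sets.countable_INT'') (auto simp: countable_Collect)
  qed
  have "sigma_sets UNIV (range atMost) \<subseteq> sets ?S"
    using sets.sigma_sets_subset[of "range atMost" ?S] atMost spS by auto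
  moreover have "sets (borel :: real measure) = sigma_sets UNIV (range atMost)"
    unfolding borel_eq_atMost by (rule sets_measure_of) auto
  moreover have "sigma_sets UNIV ?E \<subseteq> sets (borel :: real measure)"
    using sets.sigma_sets_subset[of ?E "borel :: real measure"] by (auto simp: image_subset_iff)
  ultimately show ?thesis using sS by auto
qed

context
  fixes M G :: "'a measure" and J :: "nat \<times> nat \<Rightarrow> 'a \<Rightarrow> real"
    and \<kappa> :: "'a \<Rightarrow> (nat \<times> nat \<Rightarrow> real) measure" and kJ :: real
  assumes M: "prob_space M" and G: "subalgebra M G"
    and J [measurable]: "\<And>p. p \<in> couplings \<Longrightarrow> J p \<in> borel_measurable M"
    and ci: "cond_indep_given M G couplings J"
    and kJ: "0 < kJ" and Jb: "\<And>p. p \<in> couplings \<Longrightarrow> AE \<omega> in M. \<bar>J p \<omega>\<bar> \<le> kJ"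
    and rcd: "regular_cond_dist M G couplings J \<kappa>"
begin

abbreviation "PB \<equiv> PiM couplings (\<lambda>_. borel :: real measure)"

lemma kernel_measurable: "\<kappa> \<in> measurable G (prob_algebra PB)"
  using rcd by (simp add: regular_cond_dist_def)

lemma kernel_prob:
  assumes "\<omega> \<in> space M"
  shows "prob_space (\<kappa> \<omega>)" "sets (\<kappa> \<omega>) = sets PB"
proof -
  have "\<omega> \<in> space G" using assms G by (simp add: subalgebra_def)
  then have "\<kappa> \<omega> \<in> space (prob_algebra PB)" by (rule measurable_space[OF kernel_measurable])
  then show "prob_space (\<kappa> \<omega>)" "sets (\<kappa> \<omega>) = sets PB" by (auto simp: space_prob_algebra)
qed

lemma kernel_cylinder:
  assumes F: "finite F" "F \<subseteq> couplings" and A: "\<And>p. p \<in> F \<Longrightarrow> A p \<in> sets borel"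
  shows "AE \<omega> in M. measure (\<kappa> \<omega>) {c \<in> space PB. \<forall>p\<in>F. c p \<in> A p} =
     real_cond_exp M G (indicator {\<xi> \<in> space M. \<forall>p\<in>F. J p \<xi> \<in> A p}) \<omega>"
proof -
  have "{c \<in> space PB. \<forall>p\<in>F. c p \<in> A p} \<in> sets PB"
  proof (rule sets.sets_Collect_finite_All[OF _ F(1)])
    fix p assume p: "p \<in> F"
    then have "(\<lambda>c. c p) -` A p \<inter> space PB \<in> sets PB"
      using F A by (intro measurable_sets[OF measurable_component_singleton]) auto
    also have "(\<lambda>c. c p) -` A p \<inter> space PB = {c \<in> space PB. c p \<in> A p}" by auto
    finally show "{c \<in> space PB. c p \<in> A p} \<in> sets PB" .
  qed
  then have "AE \<omega> in M. measure (\<kappa> \<omega>) {c \<in> space PB. \<forall>p\<in>F. c p \<in> A p} =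
     real_cond_exp M G (indicator {\<xi> \<in> space M. (\<lambda>p\<in>couplings. J p \<xi>) \<in> {c \<in> space PB. \<forall>p\<in>F. c p \<in> A p}}) \<omega>"
    using rcd unfolding regular_cond_dist_def by blast
  moreover have "{\<xi> \<in> space M. (\<lambda>p\<in>couplings. J p \<xi>) \<in> {c \<in> space PB. \<forall>p\<in>F. c p \<in> A p}} =
     {\<xi> \<in> space M. \<forall>p\<in>F. J p \<xi> \<in> A p}"
    using F by (auto simp: space_PiM subset_iff)
  ultimately show ?thesis by simp
qed

lemma kernel_factorizes:
  assumes F: "finite F" "F \<subseteq> couplings" and A: "\<And>p. p \<in> F \<Longrightarrow> A p \<in> sets borel"
  shows "AE \<omega> in M. measure (\<kappa> \<omega>) {c \<in> space PB. \<forall>p\<in>F. c p \<in> A p} =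
     (\<Prod>p\<in>F. measure (\<kappa> \<omega>) {c \<in> space PB. c p \<in> A p})"
proof -
  have 1: "AE \<omega> in M. real_cond_exp M G (indicator {\<xi> \<in> space M. \<forall>p\<in>F. J p \<xi> \<in> A p}) \<omega> =
         (\<Prod>p\<in>F. real_cond_exp M G (indicator {\<xi> \<in> space M. J p \<xi> \<in> A p}) \<omega>)"
    using ci F A by (simp add: cond_indep_given_def)
  have "AE \<omega> in M. measure (\<kappa> \<omega>) {c \<in> space PB. c p \<in> A p} =
      real_cond_exp M G (indicator {\<xi> \<in> space M. J p \<xi> \<in> A p}) \<omega>" if "p \<in> F" for p
    using kernel_cylinder[of "{p}" A] that F A by auto
  then have 2: "AE \<omega> in M. \<forall>p\<in>F. measure (\<kappa> \<omega>) {c \<in> space PB. c p \<in> A p} =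
      real_cond_exp M G (indicator {\<xi> \<in> space M. J p \<xi> \<in> A p}) \<omega>"
    by (intro AE_finite_allI F) auto
  have 3: "AE \<omega> in M. measure (\<kappa> \<omega>) {c \<in> space PB. \<forall>p\<in>F. c p \<in> A p} =
     real_cond_exp M G (indicator {\<xi> \<in> space M. \<forall>p\<in>F. J p \<xi> \<in> A p}) \<omega>"
    by (rule kernel_cylinder[OF F A])
  from 1 2 3 show ?thesis by eventually_elim simp
qed

lemma kernel_bounded:
  assumes p: "p \<in> couplings"
  shows "AE \<omega> in M. AE c in \<kappa> \<omega>. \<bar>c p\<bar> \<le> kJ"
proof -
  interpret prob_space M by (rule M)
  interpret S: finite_measure_subalgebra M G
    by (simp add: finite_measure_subalgebra_def finite_measure_subalgebra_axioms_def G finite_measure_axioms)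
  let ?A = "\<lambda>_. {-kJ..kJ}"
  let ?ind = "indicator {\<xi> \<in> space M. \<forall>p\<in>{p}. J p \<xi> \<in> ?A p} :: 'a \<Rightarrow> real"
  have m: "{\<xi> \<in> space M. J p \<xi> \<in> {-kJ..kJ}} \<in> sets M"
    using J[OF p] by measurable
  have "AE \<omega> in M. real_cond_exp M G ?ind \<omega> = real_cond_exp M G (\<lambda>_. 1) \<omega>"
  proof (rule S.real_cond_exp_cong)
    show "AE \<omega> in M. ?ind \<omega> = 1"
      using Jb[OF p] AE_space by eventually_elim (auto simp: abs_le_iff indicator_def)
    show "?ind \<in> borel_measurable M" using m by simp
  qed auto
  moreover have "AE \<omega> in M. real_cond_exp M G (\<lambda>_. 1) \<omega> = (1::real)"
    by (rule S.real_cond_exp_F_meas) auto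
  moreover have "AE \<omega> in M. measure (\<kappa> \<omega>) {c \<in> space PB. \<forall>p\<in>{p}. c p \<in> ?A p} = real_cond_exp M G ?ind \<omega>"
    using p by (intro kernel_cylinder) auto
  ultimately show ?thesis
    using AE_space
  proof eventually_elim
    case (elim \<omega>)
    interpret k: prob_space "\<kappa> \<omega>" by (rule kernel_prob(1)) fact
    have sp: "space (\<kappa> \<omega>) = space PB" using kernel_prob(2)[OF \<open>\<omega> \<in> space M\<close>] by (rule sets_eq_imp_space_eq)
    have "measure (\<kappa> \<omega>) {c \<in> space PB. c p \<in> {-kJ..kJ}} = 1" using elim by simp
    then have "AE c in \<kappa> \<omega>. c \<in> {c \<in> space PB. c p \<in> {-kJ..kJ}}" by (rule k.AE_prob_1)
    then show ?case by eventually_elim auto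
  qed
qed

text \<open>
  The factorisation of the conditional probabilities holds outside a null set that depends on the
  event. For rational half-lines and finitely many couplings there are countably many events, and they
  determine independence.
\<close>

theorem kernel_disorder: "AE \<omega> in M. disorder (\<kappa> \<omega>) kJ"
proof -
  define E where "E = insert UNIV (range (\<lambda>r. {..real_of_rat r}))"
  have E_borel: "e \<in> sets borel" if "e \<in> E" for e using that by (auto simp: E_def)
  have cE: "countable E" by (auto simp: E_def)
  have "AE \<omega> in M. \<forall>A\<in>PiE (couplings_upto N) (\<lambda>_. E).
      measure (\<kappa> \<omega>) {c \<in> space PB. \<forall>p\<in>couplings_upto N. c p \<in> A p} =
     (\<Prod>p\<in>couplings_upto N. measure (\<kappa> \<omega>) {c \<in> space PB. c p \<in> A p})" for N
  proof (rule AE_ball_countable')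
    show "countable (PiE (couplings_upto N) (\<lambda>_. E))" using cE by (intro countable_PiE) auto
    fix A assume "A \<in> PiE (couplings_upto N) (\<lambda>_. E)"
    then show "AE \<omega> in M. measure (\<kappa> \<omega>) {c \<in> space PB. \<forall>p\<in>couplings_upto N. c p \<in> A p} =
     (\<Prod>p\<in>couplings_upto N. measure (\<kappa> \<omega>) {c \<in> space PB. c p \<in> A p})"
      using couplings_upto_subset by (intro kernel_factorizes E_borel) (auto simp: PiE_iff)
  qed
  then have 1: "AE \<omega> in M. \<forall>N. \<forall>A\<in>PiE (couplings_upto N) (\<lambda>_. E).
      measure (\<kappa> \<omega>) {c \<in> space PB. \<forall>p\<in>couplings_upto N. c p \<in> A p} =
     (\<Prod>p\<in>couplings_upto N. measure (\<kappa> \<omega>) {c \<in> space PB. c p \<in> A p})"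
    by (simp add: AE_all_countable)
  have 2: "AE \<omega> in M. \<forall>p\<in>couplings. AE c in \<kappa> \<omega>. \<bar>c p\<bar> \<le> kJ"
    by (rule AE_ball_countable') (use kernel_bounded in auto)
  from 1 2 AE_space[of M] show ?thesis
  proof eventually_elim
    case (elim \<omega>)
    interpret k: prob_space "\<kappa> \<omega>" by (rule kernel_prob(1)) fact
    have st: "sets (\<kappa> \<omega>) = sets PB" by (rule kernel_prob(2)) fact
    have sp: "space (\<kappa> \<omega>) = space PB" using st by (rule sets_eq_imp_space_eq)
    show ?case
    proof
      show "sets (\<kappa> \<omega>) = sets PB" by (rule st)
      show "0 < kJ" by (rule kJ)
      show "AE c in \<kappa> \<omega>. \<bar>c p\<bar> \<le> kJ" if "p \<in> couplings" for p using elim(2) that by auto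
      fix N
      have comp: "(\<lambda>c. c p) \<in> borel_measurable (\<kappa> \<omega>)" if "p \<in> couplings_upto N" for p
        unfolding measurable_cong_sets[OF st refl] using that couplings_upto_subset
        by (intro measurable_component_singleton) auto
      show "k.indep_vars (\<lambda>_. borel) (\<lambda>p c. c p) (couplings_upto N)"
      proof (cases "couplings_upto N = {}")
        case True
        then show ?thesis by (simp add: k.indep_vars_def k.indep_sets_def)
      next
        case False
        have "\<forall>A\<in>(\<Pi> i\<in>couplings_upto N. E). k.prob (\<Inter>j\<in>couplings_upto N. (\<lambda>c. c j) -` A j \<inter> space (\<kappa> \<omega>)) =
           (\<Prod>j\<in>couplings_upto N. k.prob ((\<lambda>c. c j) -` A j \<inter> space (\<kappa> \<omega>)))"
        proof
          fix A assume A: "A \<in> (\<Pi> i\<in>couplings_upto N. E)"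
          then have "restrict A (couplings_upto N) \<in> PiE (couplings_upto N) (\<lambda>_. E)" by auto
          from elim(1)[rule_format, OF this]
          have "k.prob {c \<in> space PB. \<forall>p\<in>couplings_upto N. c p \<in> A p} =
            (\<Prod>p\<in>couplings_upto N. k.prob {c \<in> space PB. c p \<in> A p})"
            by (simp cong: prod.cong)
          moreover have "(\<Inter>j\<in>couplings_upto N. (\<lambda>c. c j) -` A j \<inter> space (\<kappa> \<omega>)) =
              {c \<in> space PB. \<forall>p\<in>couplings_upto N. c p \<in> A p}"
            using False by (auto simp: sp)
          moreover have "(\<lambda>c. c j) -` A j \<inter> space (\<kappa> \<omega>) = {c \<in> space PB. c j \<in> A j}" for j
            by (auto simp: sp)
          ultimately show "k.prob (\<Inter>j\<in>couplings_upto N. (\<lambda>c. c j) -` A j \<inter> space (\<kappa> \<omega>)) =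
           (\<Prod>j\<in>couplings_upto N. k.prob ((\<lambda>c. c j) -` A j \<inter> space (\<kappa> \<omega>)))" by simp
        qed
        moreover have "Int_stable E"
        proof (rule Int_stableI)
          fix a b assume "a \<in> E" "b \<in> E"
          moreover have "{..real_of_rat r} \<inter> {..real_of_rat s} = {..real_of_rat (min r s)}" for r s
            by (auto simp: min_def of_rat_less_eq)
          ultimately show "a \<inter> b \<in> E" by (auto simp: E_def)
        qed
        ultimately show ?thesis
          using comp False borel_eq_sigma_rat_atMost
          by (subst k.indep_vars_finite[where E="\<lambda>_. E"]) (auto simp: E_def)
      qed
    qed
  qed
qed

lemma kernel_integral_measurable:
  fixes f :: "(nat \<times> nat \<Rightarrow> real) \<Rightarrow> real"
  assumes "f \<in> borel_measurable PB"
  shows "(\<lambda>\<omega>. \<integral>c. f c \<partial>\<kappa> \<omega>) \<in> borel_measurable M"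
proof -
  have "(\<lambda>D. \<integral>c. f c \<partial>D) \<in> borel_measurable (subprob_algebra PB)"
    using assms by (rule integral_measurable_subprob_algebra)
  from measurable_compose[OF measurable_prob_algebraD[OF kernel_measurable] this]
  have "(\<lambda>\<omega>. \<integral>c. f c \<partial>\<kappa> \<omega>) \<in> borel_measurable G" .
  then show ?thesis using G by (rule measurable_from_subalg[rotated])
qed

lemma annealed_measurable: "(\<lambda>\<omega>. annealed_ham N h (\<kappa> \<omega>) \<sigma>) \<in> borel_measurable M"
  unfolding annealed_ham_def by (intro kernel_integral_measurable measurable_hamiltonian couplings_upto_subset)

text \<open>
  The integrand depends on \<open>\<omega>\<close> through the mean, so measurability comes from the joint version for
  kernels, which is applied to the nonnegative integral.
\<close>

lemma cond_variance_measurable: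
  assumes p: "p \<in> couplings"
  shows "(\<lambda>\<omega>. cond_variance (\<kappa> \<omega>) p) \<in> borel_measurable M"
proof -
  have [measurable]: "(\<lambda>c. c p) \<in> borel_measurable PB" using p by (rule measurable_component_singleton)
  have K: "\<kappa> \<in> measurable G (subprob_algebra PB)" by (rule measurable_prob_algebraD[OF kernel_measurable])
  have m: "(\<lambda>\<omega>. \<integral>c. c p \<partial>\<kappa> \<omega>) \<in> borel_measurable G"
    using measurable_compose[OF K integral_measurable_subprob_algebra[of "\<lambda>c. c p"]] by simp
  have "(\<lambda>(\<omega>, c). ennreal ((c p - (\<integral>c'. c' p \<partial>\<kappa> \<omega>))\<^sup>2)) \<in> borel_measurable (G \<Otimes>\<^sub>M PB)"
    using m by measurable
  then have "(\<lambda>\<omega>. \<integral>\<^sup>+c. ennreal ((c p - (\<integral>c'. c' p \<partial>\<kappa> \<omega>))\<^sup>2) \<partial>\<kappa> \<omega>) \<in> borel_measurable G"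
    by (rule nn_integral_measurable_subprob_algebra2[OF _ K])
  then have "(\<lambda>\<omega>. enn2real (\<integral>\<^sup>+c. ennreal ((c p - (\<integral>c'. c' p \<partial>\<kappa> \<omega>))\<^sup>2) \<partial>\<kappa> \<omega>)) \<in> borel_measurable G"
    by measurable
  moreover have "cond_variance (\<kappa> \<omega>) p = enn2real (\<integral>\<^sup>+c. ennreal ((c p - (\<integral>c'. c' p \<partial>\<kappa> \<omega>))\<^sup>2) \<partial>\<kappa> \<omega>)"
    if "\<omega> \<in> space G" for \<omega>
  proof -
    have \<omega>: "\<omega> \<in> space M" using that G by (simp add: subalgebra_def)
    have [measurable]: "(\<lambda>c. c p) \<in> borel_measurable (\<kappa> \<omega>)"
      unfolding measurable_cong_sets[OF kernel_prob(2)[OF \<omega>] refl] using p by (rule measurable_component_singleton)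
    show ?thesis unfolding cond_variance_def by (rule integral_eq_nn_integral) auto
  qed
  ultimately have "(\<lambda>\<omega>. cond_variance (\<kappa> \<omega>) p) \<in> borel_measurable G"
    by (subst measurable_cong) auto
  then show ?thesis using G by (rule measurable_from_subalg[rotated])
qed

lemma alpha_measurable: "(\<lambda>\<omega>. alpha \<beta> (\<kappa> \<omega>) N) \<in> borel_measurable M"
  unfolding alpha_def using couplings_upto_subset
  by (intro borel_measurable_times borel_measurable_sum cond_variance_measurable) auto

end

section \<open>The limit of large systems\<close>

lemma subexponential_decay:
  fixes a k :: real
  assumes "0 < k"
  shows "(\<lambda>N. real N * sqrt (real N) * exp (a * sqrt (real N) - k * real N)) \<longlonglongrightarrow> 0"
    and "(\<lambda>N. sqrt (real N) * exp (a * sqrt (real N) - k * real N)) \<longlonglongrightarrow> 0"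
proof -
  define c where "c = \<bar>a\<bar> + 1"
  have c: "0 < c" "a \<le> c" by (auto simp: c_def)
  have le: "exp (a * sqrt (real N) - k * real N) \<le> exp (c * sqrt (real N) - k * real N)" for N
    using c by (simp add: mult_right_mono)
  have 1: "(\<lambda>N. real N * sqrt (real N) * exp (c * sqrt (real N) - k * real N)) \<longlonglongrightarrow> 0"
    using assms c(1) by real_asymp
  have 2: "(\<lambda>N. sqrt (real N) * exp (c * sqrt (real N) - k * real N)) \<longlonglongrightarrow> 0"
    using assms c(1) by real_asymp
  show "(\<lambda>N. real N * sqrt (real N) * exp (a * sqrt (real N) - k * real N)) \<longlonglongrightarrow> 0"
    by (rule tendsto_sandwich[OF _ _ tendsto_const 1]) (auto intro!: always_eventually mult_left_mono le)
  show "(\<lambda>N. sqrt (real N) * exp (a * sqrt (real N) - k * real N)) \<longlonglongrightarrow> 0"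
    by (rule tendsto_sandwich[OF _ _ tendsto_const 2]) (auto intro!: always_eventually mult_left_mono le)
qed

text \<open>
  The number \<open>m * N\<close> of dyadic scales is linear in \<open>N\<close>: enough for the cut-off to beat the ratio of the
  total weight to the weight of the valley, while the factor \<open>m * N\<close> is harmless against
  \<open>exp (- k1 * N)\<close>. The deviations of order \<open>sqrt N\<close> cost only \<open>exp (O (sqrt N))\<close>.
\<close>

lemma error_eventually_small:
  fixes \<beta> R x k1 k2 :: real and K :: nat
  assumes k1: "0 < k1" and k2: "0 < k2"
  obtains m :: nat where "\<forall>\<^sub>F N in sequentially.
    real K * ((1/2) ^ (m * N) * (2 ^ N * exp (2 * \<beta> * (R * real N)))
      + 2 * real (m * N) * real K * exp (4 * (\<beta> * (x * sqrt (real N)))) * exp (- k1 * real N)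
      + exp (2 * (\<beta> * (x * sqrt (real N)))) * exp (- k2 * real N)) \<le> 1 / (2 * sqrt (real N))"
proof -
  define m where "m = nat \<lceil>(ln 2 + \<bar>2 * \<beta> * R\<bar> + 1) / ln 2\<rceil>"
  have m: "ln 2 + 2 * \<beta> * R + 1 \<le> real m * ln 2"
  proof -
    have "(ln 2 + \<bar>2 * \<beta> * R\<bar> + 1) / ln 2 \<le> real m" unfolding m_def by linarith
    then have "ln 2 + \<bar>2 * \<beta> * R\<bar> + 1 \<le> real m * ln 2" by (simp add: pos_divide_le_eq)
    then show ?thesis by linarith
  qed
  define a where "a = 4 * \<beta> * x"
  define c where "c = 2 * \<beta> * x"
  define f where "f N = real K * (exp (- real N) + 2 * (real m * real N) * real K * exp (a * sqrt (real N) - k1 * real N)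
      + exp (c * sqrt (real N) - k2 * real N))" for N :: nat
  have le: "real K * ((1/2) ^ (m * N) * (2 ^ N * exp (2 * \<beta> * (R * real N)))
      + 2 * real (m * N) * real K * exp (4 * (\<beta> * (x * sqrt (real N)))) * exp (- k1 * real N)
      + exp (2 * (\<beta> * (x * sqrt (real N)))) * exp (- k2 * real N)) \<le> f N" for N
    unfolding f_def
  proof (intro mult_left_mono add_mono)
    have h: "((1/2::real)) ^ (m * N) = exp (- (real m * real N * ln 2))"
      by (simp add: power_one_over exp_minus exp_of_nat_mult[symmetric] inverse_eq_divide
          exp_of_nat_mult[of "m * N" "ln 2", simplified])
    have t: "(2::real) ^ N = exp (real N * ln 2)" by (simp add: exp_of_nat_mult)
    have "(1/2) ^ (m * N) * (2 ^ N * exp (2 * \<beta> * (R * real N))) =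
       exp (- (real m * real N * ln 2) + (real N * ln 2 + 2 * \<beta> * (R * real N)))"
      unfolding h t exp_add ..
    also have "\<dots> \<le> exp (- real N)"
    proof -
      have "(ln 2 + 2 * \<beta> * R + 1) * real N \<le> real m * ln 2 * real N" using m by (intro mult_right_mono) auto
      then show ?thesis by (simp add: algebra_simps)
    qed
    finally show "(1/2) ^ (m * N) * (2 ^ N * exp (2 * \<beta> * (R * real N))) \<le> exp (- real N)" .
  qed (auto simp: a_def c_def exp_diff exp_minus field_simps)
  have "(\<lambda>N. f N * (2 * sqrt (real N))) \<longlonglongrightarrow> 0"
  proof -
    have "(\<lambda>N. 2 * real K * (sqrt (real N) * exp (0 * sqrt (real N) - 1 * real N)
        + 2 * real m * real K * (real N * sqrt (real N) * exp (a * sqrt (real N) - k1 * real N))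
        + sqrt (real N) * exp (c * sqrt (real N) - k2 * real N))) \<longlonglongrightarrow> 2 * real K * (0 + 2 * real m * real K * 0 + 0)"
      by (intro tendsto_mult tendsto_add tendsto_const subexponential_decay k1 k2 zero_less_one)
    moreover have "f N * (2 * sqrt (real N)) = 2 * real K * (sqrt (real N) * exp (0 * sqrt (real N) - 1 * real N)
        + 2 * real m * real K * (real N * sqrt (real N) * exp (a * sqrt (real N) - k1 * real N))
        + sqrt (real N) * exp (c * sqrt (real N) - k2 * real N))" for N
      unfolding f_def by (simp add: algebra_simps)
    ultimately show ?thesis by (simp only: mult_zero_right add.right_neutral)
  qed
  then have "\<forall>\<^sub>F N in sequentially. f N * (2 * sqrt (real N)) < 1" by (rule order_tendstoD) simp
  then have "\<forall>\<^sub>F N in sequentially. f N \<le> 1 / (2 * sqrt (real N))"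
    using eventually_gt_at_top[of 0] by eventually_elim (simp add: field_simps)
  then have "\<forall>\<^sub>F N in sequentially. real K * ((1/2) ^ (m * N) * (2 ^ N * exp (2 * \<beta> * (R * real N)))
      + 2 * real (m * N) * real K * exp (4 * (\<beta> * (x * sqrt (real N)))) * exp (- k1 * real N)
      + exp (2 * (\<beta> * (x * sqrt (real N)))) * exp (- k2 * real N)) \<le> 1 / (2 * sqrt (real N))"
    by eventually_elim (rule order_trans[OF le])
  then show ?thesis by (rule that)
qed

lemma concentration_bound_tendsto:
  fixes t C \<beta> k :: real
  assumes "\<beta> \<noteq> 0" "k \<noteq> 0"
  shows "(\<lambda>N. 1 - 4 * exp (- ((t - C / sqrt (real N)) / 2 / (\<beta> * k))\<^sup>2)
      - 2 ^ N * (2 * exp (- ((2 * k)\<^sup>2 * real N / k\<^sup>2)))) \<longlonglongrightarrow> 1 - 4 * exp (- (t\<^sup>2 / (2 * \<beta> * k)\<^sup>2))"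
proof -
  have "(\<lambda>N. C / sqrt (real N)) \<longlonglongrightarrow> 0" by real_asymp
  then have h: "(\<lambda>N. t - C / sqrt (real N)) \<longlonglongrightarrow> t - 0" by (intro tendsto_diff tendsto_const)
  have "(\<lambda>N. 1 - 4 * exp (- ((t - C / sqrt (real N)) / 2 / (\<beta> * k))\<^sup>2)) \<longlonglongrightarrow>
      1 - 4 * exp (- ((t - 0) / 2 / (\<beta> * k))\<^sup>2)"
    by (intro tendsto_diff tendsto_mult tendsto_const tendsto_exp tendsto_minus tendsto_power tendsto_divide h)
      (use assms in auto)
  moreover have "(\<lambda>N. 2 ^ N * (2 * exp (- ((2 * k)\<^sup>2 * real N / k\<^sup>2)))) \<longlonglongrightarrow> 0"
  proof -
    have two: "2 ^ N \<le> exp (real N)" for N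
    proof -
      have "(2::real) \<le> exp 1" using exp_ge_add_one_self[of 1] by simp
      then have "(2::real) ^ N \<le> exp 1 ^ N" by (intro power_mono) auto
      then show ?thesis by (simp add: exp_of_nat_mult[symmetric])
    qed
    have le: "2 ^ N * (2 * exp (- (4 * real N))) \<le> exp (real N) * (2 * exp (- (4 * real N)))" for N
      by (intro mult_right_mono two) auto
    have "(\<lambda>N. exp (real N) * (2 * exp (- (4 * real N)))) \<longlonglongrightarrow> 0" by real_asymp
    then have "(\<lambda>N::nat. 2 ^ N * (2 * exp (- (4 * real N)))) \<longlonglongrightarrow> (0::real)"
      by (rule tendsto_sandwich[OF _ _ tendsto_const, rotated 2]) (auto intro!: always_eventually two)
    then show ?thesis using assms by (simp add: power_mult_distrib)
  qed
  ultimately have "(\<lambda>N. 1 - 4 * exp (- ((t - C / sqrt (real N)) / 2 / (\<beta> * k))\<^sup>2)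
      - 2 ^ N * (2 * exp (- ((2 * k)\<^sup>2 * real N / k\<^sup>2)))) \<longlonglongrightarrow> 1 - 4 * exp (- ((t - 0) / 2 / (\<beta> * k))\<^sup>2) - 0"
    by (rule tendsto_diff)
  moreover have "((t - 0) / 2 / (\<beta> * k))\<^sup>2 = t\<^sup>2 / (2 * \<beta> * k)\<^sup>2" by (simp add: power_divide power_mult_distrib)
  ultimately show ?thesis by simp
qed

text \<open>
  The first two events are dropped because the metastable sets are measurable only for \<open>N \<ge> 2\<close>.
\<close>

lemma liminf_event_tail: "liminf_event E = (\<Union>n. \<Inter>N\<in>{n + 2..}. E N)"
proof (intro set_eqI iffI)
  fix \<omega> assume "\<omega> \<in> liminf_event E"
  then obtain n where "\<forall>N\<ge>n. \<omega> \<in> E N" by (auto simp: liminf_event_def)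
  then show "\<omega> \<in> (\<Union>n. \<Inter>N\<in>{n + 2..}. E N)" by (intro UN_I[of n]) auto
next
  fix \<omega> assume "\<omega> \<in> (\<Union>n. \<Inter>N\<in>{n + 2..}. E N)"
  then show "\<omega> \<in> liminf_event E" unfolding liminf_event_def by blast
qed

lemma liminf_event_iff: "\<omega> \<in> liminf_event E \<longleftrightarrow> (\<forall>\<^sub>F N in sequentially. \<omega> \<in> E N)"
  by (auto simp: liminf_event_def eventually_sequentially)

text \<open>
  For almost every \<open>\<omega>\<close> and all large \<open>N\<close> the conditional law of the couplings is a
  \<open>metastable_model\<close>, with error constants that depend only on \<open>kJ\<close>, \<open>\<beta>\<close>, \<open>h\<close> and \<open>q\<close>. For \<open>t = 0\<close> the
  bound in the first claim is negative. The event of the second claim is split according to the finitely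
  many values of the two sets, on each of which the crossover times are measurable functions of \<open>\<omega>\<close>.
\<close>

theorem theorem2p12:
  fixes M G :: "'a measure"
    and J :: "nat \<times> nat \<Rightarrow> 'a \<Rightarrow> real"
    and \<kappa> :: "'a \<Rightarrow> (nat \<times> nat \<Rightarrow> real) measure"
    and kJ \<beta> h k1 k2 :: real
    and K i :: nat
    and \<M> \<S> :: "nat \<Rightarrow> nat \<Rightarrow> 'a \<Rightarrow> (nat \<Rightarrow> real) set"
    and \<A> \<B> :: "nat \<Rightarrow> 'a \<Rightarrow> (nat \<Rightarrow> real) set"
    and HA :: "nat \<Rightarrow> 'a \<Rightarrow> (nat \<Rightarrow> real) \<Rightarrow> real"
    and meta :: "nat \<Rightarrow> 'a set"
    and \<Omega> :: "real \<Rightarrow> real \<Rightarrow> nat \<Rightarrow> 'a set"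
  assumes "prob_space M" and "subalgebra M G"
    and "\<And>p. p \<in> couplings \<Longrightarrow> J p \<in> borel_measurable M"
    and "cond_indep_given M G couplings J"
    and "0 < kJ" and "\<And>p. p \<in> couplings \<Longrightarrow> AE \<omega> in M. \<bar>J p \<omega>\<bar> \<le> kJ"
    and "regular_cond_dist M G couplings J \<kappa>"
    and "0 < \<beta>" and "2 \<le> K" and "0 < k1"
    and HA_def: "\<And>N \<omega>. HA N \<omega> = annealed_ham N h (\<kappa> \<omega>)"
    and meta_def: "\<And>N. meta N = meta_event M \<kappa> \<beta> h K k1 N"
    and meta_as: "measure M (liminf_event meta) = 1"
    \<comment> \<open>the metastable sets fixed on the event \<open>meta N\<close>\<close>
    and "\<And>N \<omega>. 2 \<le> N \<Longrightarrow> \<omega> \<in> meta N \<Longrightarrow>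
           metastable N \<beta> (HA N \<omega>) (exp (- k1 * real N)) K (\<lambda>l. \<M> N l \<omega>)"
    and "\<And>N \<omega> l. 2 \<le> N \<Longrightarrow> \<omega> \<in> meta N \<Longrightarrow> 1 \<le> l \<Longrightarrow> l < K \<Longrightarrow>
           gibbs_mass N \<beta> (HA N \<omega>) (\<M> N (Suc l) \<omega>) \<le> gibbs_mass N \<beta> (HA N \<omega>) (\<M> N l \<omega>)"
    and "\<And>N l X. 2 \<le> N \<Longrightarrow> l \<in> {1..K} \<Longrightarrow> {\<omega> \<in> meta N. \<M> N l \<omega> = X} \<in> sets G"
    \<comment> \<open>the metastable partition\<close>
    and "\<And>N \<omega>. 2 \<le> N \<Longrightarrow> \<omega> \<in> meta N \<Longrightarrow>
           disjoint_family_on (\<lambda>l. \<S> N l \<omega>) {1..K} \<and> (\<Union>l\<in>{1..K}. \<S> N l \<omega>) = spins N"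
    and "\<And>N \<omega> l. 2 \<le> N \<Longrightarrow> \<omega> \<in> meta N \<Longrightarrow> l \<in> {1..K} \<Longrightarrow>
           \<M> N l \<omega> \<subseteq> \<S> N l \<omega> \<and> \<S> N l \<omega> \<subseteq> valley N \<beta> (HA N \<omega>) K (\<lambda>l. \<M> N l \<omega>) l"
    and "\<And>N l X. 2 \<le> N \<Longrightarrow> l \<in> {1..K} \<Longrightarrow> {\<omega> \<in> meta N. \<S> N l \<omega> = X} \<in> sets G"
    \<comment> \<open>non-degeneracy\<close>
    and "i \<in> {2..K}" and "0 < k2"
    and "AE \<omega> in M. \<forall>N\<ge>2. \<omega> \<in> meta N \<longrightarrow> (\<forall>j\<in>{i+1..K}.
           gibbs_mass N \<beta> (HA N \<omega>) (\<S> N j \<omega>)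
             \<le> exp (- k2 * real N) * gibbs_mass N \<beta> (HA N \<omega>) (\<S> N i \<omega>))"
    and A_def: "\<And>N \<omega>. \<A> N \<omega> = \<M> N i \<omega>"
    and B_def: "\<And>N \<omega>. \<B> N \<omega> = (\<Union>j\<in>{1..<i}. \<M> N j \<omega>)"
    and Omega_def: "\<And>q c N. \<Omega> q c N = {\<omega> \<in> meta N.
           let r = (\<integral>x. mean_crossover N \<beta> (hamiltonian N h x) (\<A> N \<omega>) (\<B> N \<omega>) powr q \<partial>\<kappa> \<omega>)
                     powr (1 / q)
                   / mean_crossover N \<beta> (HA N \<omega>) (\<A> N \<omega>) (\<B> N \<omega>)
           in exp (- alpha \<beta> (\<kappa> \<omega>) N) * (1 - c / sqrt (real N)) \<le> r
            \<and> r \<le> exp (4 * q * alpha \<beta> (\<kappa> \<omega>) N) * (1 + c / sqrt (real N))}"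
  shows "(\<forall>t::nat. AE \<omega> in M.
            liminf (\<lambda>N. ereal (measure (\<kappa> \<omega>) {x \<in> space (\<kappa> \<omega>).
              let r = mean_crossover N \<beta> (hamiltonian N h x) (\<A> N \<omega>) (\<B> N \<omega>)
                      / mean_crossover N \<beta> (HA N \<omega>) (\<A> N \<omega>) (\<B> N \<omega>)
              in exp (- real t - alpha \<beta> (\<kappa> \<omega>) N) \<le> r
               \<and> r \<le> exp (real t + 2 * alpha \<beta> (\<kappa> \<omega>) N)}))
            \<ge> ereal (1 - 4 * exp (- ((real t)\<^sup>2 / (2 * \<beta> * kJ)\<^sup>2))))
       \<and> (\<forall>q\<ge>1. \<exists>c1>0. measure M (liminf_event (\<Omega> q c1)) = 1)"
proof -
  interpret prob_space M by fact
  note kernel = assms(1-7)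
  note ms = assms(14) and M_sets = assms(16) and part = assms(17) and MV = assms(18)
  note i = \<open>i \<in> {2..K}\<close> and \<beta> = \<open>0 < \<beta>\<close> and kJ = \<open>0 < kJ\<close>
  have kJ0: "kJ \<noteq> 0" and \<beta>0: "\<beta> \<noteq> 0" using kJ \<beta> by auto
  have kd: "AE \<omega> in M. disorder (\<kappa> \<omega>) kJ" by (rule kernel_disorder[OF kernel])
  have am: "(\<lambda>\<omega>. annealed_ham N h (\<kappa> \<omega>) \<sigma>) \<in> borel_measurable M" for N \<sigma>
    by (rule annealed_measurable[OF kernel])
  have alm: "(\<lambda>\<omega>. alpha \<beta> (\<kappa> \<omega>) N) \<in> borel_measurable M" for N by (rule alpha_measurable[OF kernel])
  have kim: "(\<lambda>\<omega>. \<integral>c. f c \<partial>\<kappa> \<omega>) \<in> borel_measurable M"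
    if "f \<in> borel_measurable (PiM couplings (\<lambda>_. borel))" for f :: "(nat \<times> nat \<Rightarrow> real) \<Rightarrow> real"
    by (rule kernel_integral_measurable[OF kernel that])
  \<comment> \<open>almost surely, from some size on, the conditional law is a disordered metastable model\<close>
  define model where "model \<omega> N \<longleftrightarrow> metastable_model (\<kappa> \<omega>) kJ N \<beta> h K i (exp (- k1 * real N)) (exp (- k2 * real N))
      (\<lambda>l. \<M> N l \<omega>) (\<lambda>l. \<S> N l \<omega>)" for \<omega> N
  have "AE \<omega> in M. \<omega> \<in> liminf_event meta" by (rule AE_prob_1[OF meta_as])
  then have ev: "AE \<omega> in M. \<forall>\<^sub>F N in sequentially. model \<omega> N \<and> \<omega> \<in> meta N \<and> HA N \<omega> = hamiltonian N h (disorder.mean_J (\<kappa> \<omega>))"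
    using kd assms(22)
  proof eventually_elim
    case (elim \<omega>)
    interpret d: disorder "\<kappa> \<omega>" kJ by (rule elim)
    from elim(1) have "\<forall>\<^sub>F N in sequentially. \<omega> \<in> meta N" by (simp add: liminf_event_iff)
    then show ?case
      using eventually_ge_at_top[of 2]
    proof eventually_elim
      case N: (elim N)
      have H: "HA N \<omega> = hamiltonian N h d.mean_J" by (simp add: HA_def d.annealed_ham_eq)
      have "model \<omega> N" unfolding model_def
      proof
        show "2 \<le> N" "0 < \<beta>" by fact+
        show "metastable N \<beta> (hamiltonian N h d.mean_J) (exp (- k1 * real N)) K (\<lambda>l. \<M> N l \<omega>)"
          using ms[OF N(2,1)] by (simp add: H)
        show "\<M> N l \<omega> \<subseteq> \<S> N l \<omega> \<and> \<S> N l \<omega> \<subseteq> valley N \<beta> (hamiltonian N h d.mean_J) K (\<lambda>l. \<M> N l \<omega>) l"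
          if "l \<in> {1..K}" for l using MV[OF N(2,1) that] by (simp add: H)
        show "gibbs_mass N \<beta> (hamiltonian N h d.mean_J) (\<S> N j \<omega>) \<le> exp (- k2 * real N) * gibbs_mass N \<beta> (hamiltonian N h d.mean_J) (\<S> N i \<omega>)"
          if "j \<in> {i+1..K}" for j using elim(3)[rule_format, OF N(2,1) that] by (simp add: H)
      qed (use i part[OF N(2,1)] in auto)
      then show ?case using H N by simp
    qed
  qed
  have part1: "AE \<omega> in M. liminf (\<lambda>N. ereal (measure (\<kappa> \<omega>) {x \<in> space (\<kappa> \<omega>).
              let r = mean_crossover N \<beta> (hamiltonian N h x) (\<A> N \<omega>) (\<B> N \<omega>)
                      / mean_crossover N \<beta> (HA N \<omega>) (\<A> N \<omega>) (\<B> N \<omega>)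
              in exp (- real t - alpha \<beta> (\<kappa> \<omega>) N) \<le> r
               \<and> r \<le> exp (real t + 2 * alpha \<beta> (\<kappa> \<omega>) N)}))
            \<ge> ereal (1 - 4 * exp (- ((real t)\<^sup>2 / (2 * \<beta> * kJ)\<^sup>2)))" for t :: nat
  proof (cases "t = 0")
    case True
    show ?thesis
      by (rule AE_I2, rule Liminf_bounded) (simp add: True zero_ereal_def[symmetric] order_trans[of _ 0])
  next
    case False
    define C where "C = metastable_model.log_error_const kJ \<beta>"
    \<comment> \<open>then \<open>x\<^sup>2 / kJ\<^sup>2 = 4\<close> exceeds the rate \<open>ln 2\<close> at which configurations multiply\<close>
    define x where "x = 2 * kJ"
    obtain m where m: "\<forall>\<^sub>F N in sequentially.
      real K * ((1/2) ^ (m * N) * (2 ^ N * exp (2 * \<beta> * ((kJ + \<bar>h\<bar>) * real N)))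
      + 2 * real (m * N) * real K * exp (4 * (\<beta> * (x * sqrt (real N)))) * exp (- k1 * real N)
      + exp (2 * (\<beta> * (x * sqrt (real N)))) * exp (- k2 * real N)) \<le> 1 / (2 * sqrt (real N))"
      by (rule error_eventually_small[OF \<open>0 < k1\<close> \<open>0 < k2\<close>])
    have "(\<lambda>N. real t - C / sqrt (real N)) \<longlonglongrightarrow> real t - 0"
      by (intro tendsto_diff tendsto_const) real_asymp
    then have u: "\<forall>\<^sub>F N in sequentially. 0 < real t - C / sqrt (real N)"
      by (rule order_tendstoD) (use False in simp)
    show ?thesis
      using ev
    proof eventually_elim
      case (elim \<omega>)
      let ?g = "\<lambda>N. 1 - 4 * exp (- ((real t - C / sqrt (real N)) / 2 / (\<beta> * kJ))\<^sup>2)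
         - 2 ^ N * (2 * exp (- ((2 * kJ)\<^sup>2 * real N / kJ\<^sup>2)))"
      let ?f = "\<lambda>N. measure (\<kappa> \<omega>) {x \<in> space (\<kappa> \<omega>).
              let r = mean_crossover N \<beta> (hamiltonian N h x) (\<A> N \<omega>) (\<B> N \<omega>)
                      / mean_crossover N \<beta> (HA N \<omega>) (\<A> N \<omega>) (\<B> N \<omega>)
              in exp (- real t - alpha \<beta> (\<kappa> \<omega>) N) \<le> r
               \<and> r \<le> exp (real t + 2 * alpha \<beta> (\<kappa> \<omega>) N)}"
      have "\<forall>\<^sub>F N in sequentially. ?g N \<le> ?f N"
        using elim m u
      proof eventually_elim
        case N: (elim N)
        interpret mm: metastable_model "\<kappa> \<omega>" kJ N \<beta> h K i "exp (- k1 * real N)" "exp (- k2 * real N)"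
            "\<lambda>l. \<M> N l \<omega>" "\<lambda>l. \<S> N l \<omega>"
          using N(1) by (simp add: model_def)
        have "mm.valley_error (m * N) x \<le> 1 / (2 * sqrt (real N))" unfolding mm.valley_error_def by (rule N(2))
        from mm.crossover_ratio_concentration[OF _ this, of "real t"] N(1,3) kJ
        show ?case by (simp add: A_def B_def C_def x_def Let_def)
      qed
      then have "liminf (\<lambda>N. ereal (?g N)) \<le> liminf (\<lambda>N. ereal (?f N))"
        by (intro Liminf_mono) (auto elim!: eventually_mono)
      moreover have "(\<lambda>N. ereal (?g N)) \<longlonglongrightarrow> ereal (1 - 4 * exp (- ((real t)\<^sup>2 / (2 * \<beta> * kJ)\<^sup>2)))"
        by (intro tendsto_ereal concentration_bound_tendsto kJ0 \<beta>0)
      then have "liminf (\<lambda>N. ereal (?g N)) = ereal (1 - 4 * exp (- ((real t)\<^sup>2 / (2 * \<beta> * kJ)\<^sup>2)))"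
        by (rule lim_imp_Liminf[OF sequentially_bot])
      ultimately show ?case by simp
    qed
  qed
  have part2: "\<exists>c1>0. measure M (liminf_event (\<Omega> q c1)) = 1" if q: "1 \<le> q" for q :: real
  proof -
    define c1 where "c1 = metastable_model.crossover_const kJ \<beta> q"
    define x where "x = metastable_model.deviation_radius kJ \<beta> h q"
    obtain m where m: "\<forall>\<^sub>F N in sequentially.
      real K * ((1/2) ^ (m * N) * (2 ^ N * exp (2 * \<beta> * ((kJ + \<bar>h\<bar>) * real N)))
      + 2 * real (m * N) * real K * exp (4 * (\<beta> * (x * sqrt (real N)))) * exp (- k1 * real N)
      + exp (2 * (\<beta> * (x * sqrt (real N)))) * exp (- k2 * real N)) \<le> 1 / (2 * sqrt (real N))"
      by (rule error_eventually_small[OF \<open>0 < k1\<close> \<open>0 < k2\<close>])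
    have ae: "AE \<omega> in M. 0 < c1 \<and> \<omega> \<in> liminf_event (\<Omega> q c1)"
      using ev
    proof eventually_elim
      case (elim \<omega>)
      have "\<forall>\<^sub>F N in sequentially. 0 < c1 \<and> \<omega> \<in> \<Omega> q c1 N"
        using elim m
      proof eventually_elim
        case N: (elim N)
        interpret mm: metastable_model "\<kappa> \<omega>" kJ N \<beta> h K i "exp (- k1 * real N)" "exp (- k2 * real N)"
            "\<lambda>l. \<M> N l \<omega>" "\<lambda>l. \<S> N l \<omega>"
          using N(1) by (simp add: model_def)
        have e: "mm.valley_error (m * N) (mm.deviation_radius q) \<le> 1 / (2 * sqrt (real N))"
          unfolding mm.valley_error_def using N(2) by (simp add: x_def)
        have "0 \<le> mm.moment_error_const q * exp (mm.moment_error_const q)" using mm.moment_error_const_ge[OF q e] by simp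
        then have "0 < c1" using mm.log_error_const_nonneg by (simp add: c1_def mm.crossover_const_def)
        then show ?case
          unfolding Omega_def Let_def
          using mm.crossover_moment_bounds[OF q e] N(1) by (simp add: A_def B_def c1_def)
      qed
      moreover from this obtain N where "0 < c1" by (auto simp: eventually_sequentially)
      ultimately show ?case by (auto simp: liminf_event_iff elim!: eventually_mono)
    qed
    have c1: "0 < c1"
    proof (rule ccontr)
      assume "\<not> 0 < c1"
      then have "AE \<omega> in M. False" using ae by simp
      then show False by simp
    qed
    have Om: "\<Omega> q c1 N \<in> sets M" if N: "2 \<le> N" for N
    proof -
      define admissible where "admissible = {XY. fst XY \<subseteq> spins N \<and> snd XY \<subseteq> spins N \<and> fst XY \<noteq> {} \<and> snd XY \<noteq> {} \<and> fst XY \<inter> snd XY = {}}"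
      have finite_admissible: "finite admissible"
        by (rule finite_subset[of _ "Pow (spins N) \<times> Pow (spins N)"]) (auto simp: admissible_def finite_spins)
      define ok where "ok XY \<omega> \<longleftrightarrow> (let r = (\<integral>x. mean_crossover N \<beta> (hamiltonian N h x) (fst XY) (snd XY) powr q \<partial>\<kappa> \<omega>)
                     powr (1 / q)
                   / mean_crossover N \<beta> (HA N \<omega>) (fst XY) (snd XY)
           in exp (- alpha \<beta> (\<kappa> \<omega>) N) * (1 - c1 / sqrt (real N)) \<le> r
            \<and> r \<le> exp (4 * q * alpha \<beta> (\<kappa> \<omega>) N) * (1 + c1 / sqrt (real N)))" for XY \<omega>
      define fixed_sets where "fixed_sets XY = {\<omega> \<in> meta N. \<M> N i \<omega> = fst XY \<and> (\<Union>j\<in>{1..<i}. \<M> N j \<omega>) = snd XY}" for XY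
      have sub: "\<omega> \<in> space M" if "\<omega> \<in> meta N" for \<omega> using that by (simp add: meta_def meta_event_def)
      have valid: "(\<M> N i \<omega>, \<Union>j\<in>{1..<i}. \<M> N j \<omega>) \<in> admissible" "\<And>l. l \<in> {1..K} \<Longrightarrow> \<M> N l \<omega> \<subseteq> spins N"
        if "\<omega> \<in> meta N" for \<omega>
      proof -
        have Ml: "\<And>l. l \<in> {1..K} \<Longrightarrow> \<M> N l \<omega> \<noteq> {} \<and> \<M> N l \<omega> \<subseteq> spins N"
          and dj: "disjoint_family_on (\<lambda>l. \<M> N l \<omega>) {1..K}"
          using ms[OF N that] unfolding metastable_def by auto
        show "\<And>l. l \<in> {1..K} \<Longrightarrow> \<M> N l \<omega> \<subseteq> spins N" using Ml by blast
        have *: "\<M> N j \<omega> \<subseteq> spins N \<and> \<M> N i \<omega> \<inter> \<M> N j \<omega> = {}" if "j \<in> {1..<i}" for j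
          using disjoint_family_onD[OF dj, of i j] Ml[of j] that i by auto
        have 1: "\<M> N 1 \<omega> \<noteq> {}" "1 \<in> {1..<i}" using Ml[of 1] i by auto
        have "(\<Union>j\<in>{1..<i}. \<M> N j \<omega>) \<subseteq> spins N" by (rule UN_least) (use * in blast)
        moreover have "(\<Union>j\<in>{1..<i}. \<M> N j \<omega>) \<noteq> {}" using 1 by (metis UN_upper bot.extremum_uniqueI)
        moreover have "\<M> N i \<omega> \<inter> (\<Union>j\<in>{1..<i}. \<M> N j \<omega>) = {}"
          unfolding Int_UN_distrib using * by (simp only: UN_simps SUP_bot_conv) blast
        moreover have "\<M> N i \<omega> \<noteq> {}" "\<M> N i \<omega> \<subseteq> spins N" using Ml[of i] i by auto
        ultimately show "(\<M> N i \<omega>, \<Union>j\<in>{1..<i}. \<M> N j \<omega>) \<in> admissible"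
          unfolding admissible_def fst_conv snd_conv mem_Collect_eq by (intro conjI)
      qed
      have fixed_sets: "fixed_sets XY \<in> sets M" for XY
      proof -
        define F where "F = {f \<in> PiE {1..K} (\<lambda>_. Pow (spins N)). f i = fst XY \<and> (\<Union>j\<in>{1..<i}. f j) = snd XY}"
        have "finite F"
          by (rule finite_subset[of _ "PiE {1..K} (\<lambda>_. Pow (spins N))"]) (auto simp: F_def finite_spins intro!: finite_PiE)
        have "fixed_sets XY = (\<Union>f\<in>F. \<Inter>l\<in>{1..K}. {\<omega> \<in> meta N. \<M> N l \<omega> = f l})"
        proof (intro set_eqI iffI)
          fix \<omega> assume w: "\<omega> \<in> fixed_sets XY"
          define f where "f = (\<lambda>l\<in>{1..K}. \<M> N l \<omega>)"
          have f: "f l = \<M> N l \<omega>" if "l \<in> {1..K}" for l using that by (simp add: f_def)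
          have wm: "\<omega> \<in> meta N" using w by (simp add: fixed_sets_def)
          have "f \<in> PiE {1..K} (\<lambda>_. Pow (spins N))" unfolding f_def using valid(2)[OF wm] by auto
          moreover have "f i = fst XY" using w i f by (simp add: fixed_sets_def)
          moreover have "(\<Union>j\<in>{1..<i}. f j) = (\<Union>j\<in>{1..<i}. \<M> N j \<omega>)"
            by (intro SUP_cong refl f) (use i in auto)
          ultimately have "f \<in> F" using w by (simp add: F_def fixed_sets_def)
          moreover have "\<omega> \<in> (\<Inter>l\<in>{1..K}. {\<omega> \<in> meta N. \<M> N l \<omega> = f l})" using wm f by auto
          ultimately show "\<omega> \<in> (\<Union>f\<in>F. \<Inter>l\<in>{1..K}. {\<omega> \<in> meta N. \<M> N l \<omega> = f l})" by blast
        next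
          fix \<omega> assume "\<omega> \<in> (\<Union>f\<in>F. \<Inter>l\<in>{1..K}. {\<omega> \<in> meta N. \<M> N l \<omega> = f l})"
          then obtain f where f: "f \<in> F" "\<And>l. l \<in> {1..K} \<Longrightarrow> \<omega> \<in> meta N \<and> \<M> N l \<omega> = f l" by blast
          have "(\<Union>j\<in>{1..<i}. \<M> N j \<omega>) = (\<Union>j\<in>{1..<i}. f j)"
            by (intro SUP_cong refl) (use f(2) i in auto)
          then show "\<omega> \<in> fixed_sets XY" using f(1) f(2)[of i] i by (simp add: F_def fixed_sets_def)
        qed
        moreover have "{\<omega> \<in> meta N. \<M> N l \<omega> = f l} \<in> sets M" if "l \<in> {1..K}" for l f
          using M_sets[OF N that] \<open>subalgebra M G\<close> by (auto simp: subalgebra_def)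
        ultimately show ?thesis
          using \<open>finite F\<close> i by (auto intro!: sets.finite_UN sets.finite_INT)
      qed
      have okm: "{\<omega> \<in> space M. ok XY \<omega>} \<in> sets M" if "XY \<in> admissible" for XY
      proof -
        have XY: "fst XY \<subseteq> spins N" "snd XY \<subseteq> spins N" "fst XY \<noteq> {}" "snd XY \<noteq> {}" "fst XY \<inter> snd XY = {}"
          using that by (auto simp: admissible_def)
        have N1: "1 \<le> N" using N by simp
        have "(\<lambda>\<omega>. mean_crossover N \<beta> (HA N \<omega>) (fst XY) (snd XY)) \<in> borel_measurable M"
          unfolding HA_def by (rule measurable_mean_crossover[OF am N1 \<beta> XY])
        have "(\<lambda>x. mean_crossover N \<beta> (hamiltonian N h x) (fst XY) (snd XY)) \<in> borel_measurable (PiM couplings (\<lambda>_. borel))"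
          by (rule measurable_mean_crossover[OF measurable_hamiltonian[OF couplings_upto_subset] N1 \<beta> XY])
        then have "(\<lambda>\<omega>. \<integral>x. mean_crossover N \<beta> (hamiltonian N h x) (fst XY) (snd XY) powr q \<partial>\<kappa> \<omega>) \<in> borel_measurable M"
          by (intro kim) measurable
        have "(\<lambda>\<omega>. alpha \<beta> (\<kappa> \<omega>) N) \<in> borel_measurable M" by (rule alm)
        define m where "m \<omega> = (\<integral>x. mean_crossover N \<beta> (hamiltonian N h x) (fst XY) (snd XY) powr q \<partial>\<kappa> \<omega>)" for \<omega>
        define d where "d \<omega> = mean_crossover N \<beta> (HA N \<omega>) (fst XY) (snd XY)" for \<omega>
        define al where "al \<omega> = alpha \<beta> (\<kappa> \<omega>) N" for \<omega>
        have [measurable]: "m \<in> borel_measurable M" "d \<in> borel_measurable M" "al \<in> borel_measurable M"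
          unfolding m_def d_def al_def by fact+
        show ?thesis
          unfolding ok_def Let_def m_def[symmetric] d_def[symmetric] al_def[symmetric] by measurable
      qed
      have "\<Omega> q c1 N = (\<Union>XY\<in>admissible. fixed_sets XY \<inter> {\<omega> \<in> space M. ok XY \<omega>})"
      proof (intro set_eqI iffI)
        fix \<omega> assume w: "\<omega> \<in> \<Omega> q c1 N"
        define XY where "XY = (\<M> N i \<omega>, \<Union>j\<in>{1..<i}. \<M> N j \<omega>)"
        have wm: "\<omega> \<in> meta N" using w by (simp add: Omega_def)
        have "XY \<in> admissible" unfolding XY_def by (rule valid(1)[OF wm])
        moreover have "ok XY \<omega>" using w by (simp add: Omega_def ok_def XY_def A_def B_def)
        moreover have "\<omega> \<in> fixed_sets XY" using wm by (simp add: fixed_sets_def XY_def)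
        ultimately show "\<omega> \<in> (\<Union>XY\<in>admissible. fixed_sets XY \<inter> {\<omega> \<in> space M. ok XY \<omega>})" using sub[OF wm] by blast
      next
        fix \<omega> assume "\<omega> \<in> (\<Union>XY\<in>admissible. fixed_sets XY \<inter> {\<omega> \<in> space M. ok XY \<omega>})"
        then show "\<omega> \<in> \<Omega> q c1 N" by (auto simp: Omega_def ok_def fixed_sets_def A_def B_def)
      qed
      then show ?thesis using finite_admissible fixed_sets okm by (auto intro!: sets.finite_UN sets.Int)
    qed
    have "liminf_event (\<Omega> q c1) \<in> sets M"
      unfolding liminf_event_tail using Om by (intro sets.countable_UN sets.countable_INT') auto
    then have "measure M (liminf_event (\<Omega> q c1)) = 1"
      using ae by (subst prob_eq_1) auto
    then show ?thesis using c1 by blast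
  qed
  show ?thesis using part1 part2 by blast
qed

end
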